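(* Let $\Omega$ be a smooth bounded domain in $\mathbb{R}^N$ and let $c \in C^\infty(\overline{\Omega},\mathbb{R}^N)$. Let $\lambda^*$ be the critical parameter and $u^*$ the extremal solution associated with the family of problems $$(S)_\lambda \qquad -\Delta u + c(x)\cdot\nabla u = \frac{\lambda}{(1-u)^2} \ \text{ in } \Omega, \qquad u = 0 \ \text{ on } \partial\Omega.$$ If $1 \le N \le 7$, then the extremal solution $u^*$ of $(S)_{\lambda^*}$ is smooth.
   Context: A smooth solution of $(S)_\lambda$ is a function $u\in C^\infty(\overline{\Omega})$ with $0\le u<1$ on $\overline\Omega$ satisfying the equation and boundary condition classically. A smooth solution $u$ of $(S)_\lambda$ is minimal if every other solution $v$ of $(S)_\lambda$ satisfies $u\le v$ a.e. in $\Omega$. It is known that there is a critical parameter $\lambda^*\in(0,\infty)$ such that for every $0<\lambda<\lambda^*$ there exists a smooth minimal solution $u_\lambda$ of $(S)_\lambda$, while for $\lambda>\lambda^*$ there are no smooth solutions of $(S)_\lambda$. Moreover, each $u_\lambda$ is semi-stable: the principal eigenvalue of the linearized operator $-\Delta + c(x)\cdot\nabla - \frac{2\lambda}{(1-u_\lambda)^3}$ in $H_0^1(\Omega)$ (zero Dirichlet boundary condition) is nonnegative. For each $x$ the map $\lambda\mapsto u_\lambda(x)$ is increasing on $(0,\lambda^* )$, and the extremal solution is defined by $$u^*(x) := \lim_{\lambda\nearrow\lambda^*} u_\lambda(x).$$ That $u^*$ is smooth means that $u^*$ is a smooth solution of $(S)_{\lambda^*}$, i.e. $u^*\in C^\infty(\overline{\Omega})$,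 $0\le u^*<1$ on $\overline\Omega$, and $u^*$ satisfies classically $-\Delta u^* + c(x)\cdot\nabla u^* = \frac{\lambda^*}{(1-u^* )^2}$ in $\Omega$ and $u^*=0$ on $\partial\Omega$ (equivalently, by elliptic regularity, $\sup_\Omega u^*<1$). *)

theory Defs
  imports "HOL-Analysis.Analysis"
begin

section \<open>Smooth functions\<close>

text \<open>Functions on a domain or on its closure are represented by total functions on
  \<^typ>\<open>real^'n\<close>. All derivatives below are taken at points of an open set, so values outside
  the set concerned are irrelevant.\<close>

definition partial_deriv ::
  "'n::finite \<Rightarrow> (real^'n \<Rightarrow> 'b::real_normed_vector) \<Rightarrow> real^'n \<Rightarrow> 'b"
  where "partial_deriv i f x = frechet_derivative f (at x) (axis i 1)"

fun iter_partial_deriv ::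
  "'n::finite list \<Rightarrow> (real^'n \<Rightarrow> 'b::real_normed_vector) \<Rightarrow> real^'n \<Rightarrow> 'b"
  where
    "iter_partial_deriv [] f = f"
  | "iter_partial_deriv (i # is) f = partial_deriv i (iter_partial_deriv is f)"

text \<open>\<open>C\<^sup>\<infinity>(S)\<close> for open \<open>S\<close>. Differentiability of all iterated partial derivatives makes
  them continuous, so this is the usual notion.\<close>

definition smooth_on ::
  "(real^'n::finite) set \<Rightarrow> (real^'n \<Rightarrow> 'b::real_normed_vector) \<Rightarrow> bool"
  where "smooth_on S f \<longleftrightarrow> (\<forall>is. \<forall>x\<in>S. iter_partial_deriv is f differentiable (at x))"

text \<open>\<open>C\<^sup>\<infinity>\<close> on the closure of an open set \<open>S\<close>: all derivatives of \<open>f\<close> on \<open>S\<close> extend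
  continuously to the closure, and \<open>f\<close> itself has the extended values on the boundary.\<close>

definition smooth_on_closure ::
  "(real^'n::finite) set \<Rightarrow> (real^'n \<Rightarrow> 'b::real_normed_vector) \<Rightarrow> bool"
  where "smooth_on_closure S f \<longleftrightarrow>
    smooth_on S f \<and> continuous_on (closure S) f \<and>
    (\<forall>is. \<exists>g. continuous_on (closure S) g \<and> (\<forall>x\<in>S. g x = iter_partial_deriv is f x))"

definition gradient :: "(real^'n::finite \<Rightarrow> real) \<Rightarrow> real^'n \<Rightarrow> real^'n"
  where "gradient u x = (\<chi> i. partial_deriv i u x)"

definition laplacian :: "(real^'n::finite \<Rightarrow> real) \<Rightarrow> real^'n \<Rightarrow> real"
  where "laplacian u x = (\<Sum>i\<in>UNIV. partial_deriv i (partial_deriv i u) x)"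


section \<open>Smooth bounded domains\<close>

text \<open>The boundary is locally straightened by smooth diffeomorphisms \<open>\<psi>\<close>, with the set lying
  on one side of it.\<close>

definition smooth_boundary :: "(real^'n::finite) set \<Rightarrow> bool"
  where "smooth_boundary \<Omega> \<longleftrightarrow>
    (\<forall>p\<in>frontier \<Omega>. \<exists>U V \<psi> \<phi> k. open U \<and> p \<in> U \<and> open V \<and>
       homeomorphism U V \<psi> \<phi> \<and> smooth_on U \<psi> \<and> smooth_on V (\<phi> :: real^'n \<Rightarrow> real^'n) \<and>
       \<psi> ` (U \<inter> \<Omega>) = {y \<in> V. y $ (k::'n) > 0} \<and>
       \<psi> ` (U \<inter> frontier \<Omega>) = {y \<in> V. y $ k = 0})"

definition smooth_bounded_domain :: "(real^'n::finite) set \<Rightarrow> bool"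
  where "smooth_bounded_domain \<Omega> \<longleftrightarrow>
    open \<Omega> \<and> connected \<Omega> \<and> \<Omega> \<noteq> {} \<and> bounded \<Omega> \<and> smooth_boundary \<Omega>"


section \<open>The boundary value problem\<close>

definition smooth_solution ::
  "(real^'n::finite) set \<Rightarrow> (real^'n \<Rightarrow> real^'n) \<Rightarrow> real \<Rightarrow> (real^'n \<Rightarrow> real) \<Rightarrow> bool"
  where "smooth_solution \<Omega> c lam u \<longleftrightarrow>
    smooth_on_closure \<Omega> u \<and>
    (\<forall>x\<in>closure \<Omega>. 0 \<le> u x \<and> u x < 1) \<and>
    (\<forall>x\<in>\<Omega>. - laplacian u x + c x \<bullet> gradient u x = lam / (1 - u x)\<^sup>2) \<and>
    (\<forall>x\<in>frontier \<Omega>. u x = 0)"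

definition minimal_solution ::
  "(real^'n::finite) set \<Rightarrow> (real^'n \<Rightarrow> real^'n) \<Rightarrow> real \<Rightarrow> (real^'n \<Rightarrow> real) \<Rightarrow> bool"
  where "minimal_solution \<Omega> c lam u \<longleftrightarrow>
    smooth_solution \<Omega> c lam u \<and>
    (\<forall>v. smooth_solution \<Omega> c lam v \<longrightarrow> (AE x in lebesgue_on \<Omega>. u x \<le> v x))"

definition critical_parameter ::
  "(real^'n::finite) set \<Rightarrow> (real^'n \<Rightarrow> real^'n) \<Rightarrow> real \<Rightarrow> bool"
  where "critical_parameter \<Omega> c lamstar \<longleftrightarrow>
    0 < lamstar \<and>
    (\<forall>lam. 0 < lam \<and> lam < lamstar \<longrightarrow> (\<exists>u. minimal_solution \<Omega> c lam u)) \<and>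
    (\<forall>lam>lamstar. \<not> (\<exists>u. smooth_solution \<Omega> c lam u))"

definition extremal_solution ::
  "(real^'n::finite) set \<Rightarrow> (real^'n \<Rightarrow> real^'n) \<Rightarrow> real \<Rightarrow> (real^'n \<Rightarrow> real) \<Rightarrow> bool"
  where "extremal_solution \<Omega> c lamstar w \<longleftrightarrow>
    (\<exists>u. (\<forall>lam. 0 < lam \<and> lam < lamstar \<longrightarrow> minimal_solution \<Omega> c lam (u lam)) \<and>
         (\<forall>x\<in>closure \<Omega>. ((\<lambda>lam. u lam x) \<longlongrightarrow> w x) (at_left lamstar)))"

text \<open>The critical parameter is unique, and minimal and extremal solutions are unique as
  functions on the closure of the domain.\<close>

lemma critical_parameter_unique:
  assumes "critical_parameter \<Omega> c a" "critical_parameter \<Omega> c b"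
  shows "a = b"
proof -
  have "\<not> a' < b'" if "critical_parameter \<Omega> c a'" "critical_parameter \<Omega> c b'" for a' b'
  proof
    assume "a' < b'"
    then obtain l where "a' < l" "l < b'" using dense by blast
    with that show False
      unfolding critical_parameter_def minimal_solution_def by (meson less_trans)
  qed
  with assms show ?thesis by (meson linorder_neqE)
qed

lemma minimal_solution_unique:
  assumes "open \<Omega>" "minimal_solution \<Omega> c lam u" "minimal_solution \<Omega> c lam v" "x \<in> closure \<Omega>"
  shows "u x = v x"
proof -
  have cont: "continuous_on (closure \<Omega>) u" "continuous_on (closure \<Omega>) v"
    using assms
    by (auto simp: minimal_solution_def smooth_solution_def smooth_on_closure_def)
  define W where "W = {y\<in>\<Omega>. u y \<noteq> v y}"
  have contd: "continuous_on \<Omega> (\<lambda>y. u y - v y)"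
    using cont closure_subset by (intro continuous_intros) (auto intro: continuous_on_subset)
  have "open (\<Omega> \<inter> (\<lambda>y. u y - v y) -` (- {0}))"
    using continuous_open_preimage[OF contd assms(1)] by blast
  also have "\<Omega> \<inter> (\<lambda>y. u y - v y) -` (- {0}) = W" by (auto simp: W_def)
  finally have "open W" .
  have "AE y in lebesgue_on \<Omega>. u y \<le> v y" "AE y in lebesgue_on \<Omega>. v y \<le> u y"
    using assms by (auto simp: minimal_solution_def)
  then have "AE y in lebesgue_on \<Omega>. u y = v y" by eventually_elim auto
  then have "AE y in lebesgue. y \<in> \<Omega> \<longrightarrow> u y = v y"
    using assms(1) by (simp add: AE_restrict_space_iff)
  then have "AE y in lebesgue. y \<notin> W" by eventually_elim (auto simp: W_def)
  then have "negligible W"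
    using \<open>open W\<close> by (simp add: negligible_iff_null_sets AE_iff_null_sets)
  then have "W = {}" using \<open>open W\<close> open_not_negligible by blast
  then have "u y - v y = 0" if "y \<in> \<Omega>" for y
    using that by (auto simp: W_def)
  moreover have "continuous_on (closure \<Omega>) (\<lambda>y. u y - v y)"
    using cont by (intro continuous_intros)
  ultimately have "u x - v x = 0"
    using continuous_constant_on_closure[where f = "\<lambda>y. u y - v y" and a = 0] assms(4)
    by blast
  then show ?thesis by simp
qed

lemma extremal_solution_unique:
  assumes "open \<Omega>" "0 < lamstar" "extremal_solution \<Omega> c lamstar w" "extremal_solution \<Omega> c lamstar w'"
    and "x \<in> closure \<Omega>"
  shows "w x = w' x"
proof -
  obtain u where u: "\<And>lam. 0 < lam \<Longrightarrow> lam < lamstar \<Longrightarrow> minimal_solution \<Omega> c lam (u lam)"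
      "((\<lambda>lam. u lam x) \<longlongrightarrow> w x) (at_left lamstar)"
    using assms(3,5) unfolding extremal_solution_def by blast
  obtain v where v: "\<And>lam. 0 < lam \<Longrightarrow> lam < lamstar \<Longrightarrow> minimal_solution \<Omega> c lam (v lam)"
      "((\<lambda>lam. v lam x) \<longlongrightarrow> w' x) (at_left lamstar)"
    using assms(4,5) unfolding extremal_solution_def by blast
  have "eventually (\<lambda>lam. lam \<in> {0<..<lamstar}) (at_left lamstar)"
    using assms(2) by (intro eventually_at_left_real)
  then have "eventually (\<lambda>lam. u lam x = v lam x) (at_left lamstar)"
  proof eventually_elim
    case (elim lam)
    then have "minimal_solution \<Omega> c lam (u lam)" "minimal_solution \<Omega> c lam (v lam)"
      using u(1) v(1) by auto
    then show ?case using minimal_solution_unique assms(1,5) by blast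
  qed
  then have "((\<lambda>lam. v lam x) \<longlongrightarrow> w x) (at_left lamstar)"
    using u(2) by (simp cong: tendsto_cong)
  then show ?thesis using v(2) tendsto_unique trivial_limit_at_left_real by blast
qed

end

(* Semi-stability enters through the difference phi of two minimal solutions: monotonicity in
   lambda makes phi positive, and convexity of the nonlinearity gives
   -Lap phi + c.grad phi >= 2 lambda phi / (1-u)^3 for the smaller solution u. With
   Q = max 0 (1/(1-u) - 2), integrating the divergence of Q^8 grad phi / phi minus a multiple of
   the field 16 (Q^9/9 + Q^8/2 + 4 Q^7/7) grad u bounds the integral of Q^11, uniformly in
   lambda. A mean value inequality for z = (max 0 (u - 1/2))^3 shows that a small gap
   delta = 1 - max u forces the integral of Q^11 over a ball of radius of order delta^(3/2) to be
   at least of order delta^(-11 + 3N/2); for N <= 7 the exponent is negative, so u_lambda stays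
   away from 1 uniformly.

   A smooth solution at lambda-star is obtained without Sobolev or Schauder theory. Finite
   difference schemes are solved by monotone iteration below given supersolutions; a discrete
   version of the reflection argument for interior gradient estimates bounds all difference
   quotients, so that a cluster point is a smooth solution. Near a straightened piece of the
   boundary, the square root of the distance to the boundary is a barrier for tangential
   derivatives, the equation gives the normal ones, and an induction bounds all derivatives.
   Minimality identifies the solution so obtained with u-star. *)
theory Submission
  imports Defs
begin

text \<open>The drift makes the operator non-self-adjoint, so there is no quadratic form to test
  with; a positive supersolution of the linearised problem replaces it and everything becomes a
  pointwise inequality under the integral. With Q^(2s) in place of Q^8 and P = 1/(1-u), completing
  the square costs s^2 Q^(2s-2) P^4 |grad u|^2. Removing this by a field G grad u, G about s^2
  Q^(2s+1)/(2s+1), leaves lambda (s^2/(2s+1) - 2) Q^(2s+3) at top order. This is negative for s < 2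
  + sqrt 6; s = 4 gives 16/9 < 2, with room for the factor 10/9 that pays for the drift. A ball of
  radius delta^(3/2) then needs 3N/2 < 2s + 3 = 11, that is N <= 7. Truncation at u = 1/2 gives
  every field compact support in the domain, so no boundary integrals occur. At lambda-star no
  solution for a larger parameter is available as supersolution. The schemes therefore use
  parameters increasing to lambda-star, each lying below the minimal solution for the next
  parameter; the difference of the two parameters pays for the discretisation error.\<close>

abbreviation step :: "real^'n => real => 'n => real^'n" where "step x h i \<equiv> x + h *\<^sub>R axis i 1"

abbreviation "pd \<equiv> partial_deriv"
abbreviation "Dd \<equiv> iter_partial_deriv"

section \<open>Calculus of iterated partial derivatives\<close>

lemma pd_eqI: "(f has_derivative f') (at x) ==> pd i f x = f' (axis i 1)"
  unfolding partial_deriv_def using frechet_derivative_at by metis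

lemma has_derivative_pd:
  fixes f :: "real^'n => 'b::real_normed_vector"
  assumes "f differentiable (at x)"
  shows "(f has_derivative (%v. \<Sum>i\<in>UNIV. (v $ i) *\<^sub>R pd i f x)) (at x)"
proof -
  have d: "(f has_derivative frechet_derivative f (at x)) (at x)"
    using assms frechet_derivative_works by blast
  interpret bounded_linear "frechet_derivative f (at x)"
    using d by (rule has_derivative_bounded_linear)
  have "frechet_derivative f (at x) v = (\<Sum>i\<in>UNIV. (v $ i) *\<^sub>R pd i f x)" for v
  proof -
    have "v = (\<Sum>i\<in>UNIV. (v $ i) *\<^sub>R axis i 1)"
      by (simp add: basis_expansion flip: scalar_mult_eq_scaleR)
    then have "frechet_derivative f (at x) v
        = frechet_derivative f (at x) (\<Sum>i\<in>UNIV. (v $ i) *\<^sub>R axis i 1)" by simp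
    also have "... = (\<Sum>i\<in>UNIV. (v $ i) *\<^sub>R pd i f x)"
      by (simp add: sum scaleR partial_deriv_def)
    finally show ?thesis .
  qed
  then have "frechet_derivative f (at x) = (%v. \<Sum>i\<in>UNIV. (v $ i) *\<^sub>R pd i f x)" by blast
  with d show ?thesis by simp
qed

lemma has_derivative_pd_real:
  fixes f :: "real^'n => real"
  assumes "f differentiable (at x)"
  shows "(f has_derivative (%v. \<Sum>i\<in>UNIV. v $ i * pd i f x)) (at x)"
  using has_derivative_pd[OF assms] by simp

lemma has_derivative_cong_open:
  assumes "open S" "x \<in> S" "!!y. y \<in> S ==> f y = g y"
  shows "(f has_derivative f') (at x) \<longleftrightarrow> (g has_derivative f') (at x)"
  using assms has_derivative_transform_within_open by (smt (verit, best))

lemma pd_cong: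
  assumes "open S" "x \<in> S" "!!y. y \<in> S ==> f y = g y"
  shows "pd i f x = pd i g x"
  unfolding partial_deriv_def frechet_derivative_def
  using has_derivative_cong_open[OF assms] by simp

lemma differentiable_cong_open:
  assumes "open S" "x \<in> S" "!!y. y \<in> S ==> f y = g y"
  shows "f differentiable (at x) \<longleftrightarrow> g differentiable (at x)"
  unfolding differentiable_def using has_derivative_cong_open[of S x f g] assms by blast

lemma Dd_cong:
  assumes "open S" "!!y. y \<in> S ==> f y = g y" "x \<in> S"
  shows "Dd is f x = Dd is g x"
  using assms(3)
proof (induction "is" arbitrary: x)
  case (Cons i "is")
  show ?case using pd_cong[OF assms(1) Cons(2), of "Dd is f" "Dd is g"] Cons(1) by simp
qed (use assms in auto)

lemma Dd_append: "Dd (is @ js) f = Dd is (Dd js f)"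
  by (induction "is") auto

lemma Dd_snoc: "Dd (is @ [i]) f = Dd is (pd i f)"
  by (simp add: Dd_append)

lemma smooth_on_subset: "smooth_on S f ==> T \<subseteq> S ==> smooth_on T f"
  unfolding smooth_on_def by blast

lemma smooth_on_Dd: "smooth_on S f ==> smooth_on S (Dd is f)"
  unfolding smooth_on_def by (metis Dd_append)

lemma smooth_on_pd: "smooth_on S f ==> smooth_on S (pd i f)"
  using smooth_on_Dd[of S f "[i]"] by simp

lemma smooth_on_differentiable: "smooth_on S f ==> x \<in> S ==> f differentiable (at x)"
  unfolding smooth_on_def by (metis iter_partial_deriv.simps(1))

lemma smooth_on_continuous_on: "smooth_on S f ==> continuous_on S f"
  by (meson continuous_at_imp_continuous_on differentiable_imp_continuous_within
      smooth_on_differentiable)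

text \<open>A finite order gives the closure properties an induction parameter: derivatives of
  products and composites are again sums of such functions, with one order less to account
  for.\<close>

definition Ck :: "nat => (real^'n::finite) set => (real^'n => 'b::real_normed_vector) => bool"
  where "Ck n S f \<longleftrightarrow> (\<forall>is. length is <= n --> (\<forall>x\<in>S. Dd is f differentiable (at x)))"

lemma smooth_on_Ck: "smooth_on S f \<longleftrightarrow> (\<forall>n. Ck n S f)"
  unfolding smooth_on_def Ck_def by blast

lemma Ck_0: "Ck 0 S f \<longleftrightarrow> (\<forall>x\<in>S. f differentiable (at x))"
  unfolding Ck_def by simp

lemma Ck_Suc: "Ck (Suc n) S f \<longleftrightarrow> (\<forall>x\<in>S. f differentiable (at x)) & (\<forall>i. Ck n S (pd i f))"
proof
  assume L: "Ck (Suc n) S f"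
  have "Dd is (pd i f) differentiable (at x)" if "length is <= n" "x \<in> S" for "is" i x
    using L that unfolding Ck_def by (metis Dd_snoc length_append_singleton Suc_le_mono)
  moreover have "f differentiable (at x)" if "x \<in> S" for x
    using L that unfolding Ck_def by (metis iter_partial_deriv.simps(1) le0 list.size(3))
  ultimately show "(\<forall>x\<in>S. f differentiable (at x)) & (\<forall>i. Ck n S (pd i f))"
    unfolding Ck_def by blast
next
  assume R: "(\<forall>x\<in>S. f differentiable (at x)) & (\<forall>i. Ck n S (pd i f))"
  have "Dd is f differentiable (at x)" if "length is <= Suc n" "x \<in> S" for "is" x
  proof (cases "is" rule: rev_cases)
    case Nil then show ?thesis using R that by simp
  next
    case (snoc js i)
    then show ?thesis using R that unfolding Ck_def by (auto simp: Dd_snoc)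
  qed
  then show "Ck (Suc n) S f" unfolding Ck_def by blast
qed

lemma Ck_cong:
  assumes "open S" "!!y. y \<in> S ==> f y = g y"
  shows "Ck n S f \<longleftrightarrow> Ck n S g"
proof -
  have "Dd is f differentiable (at x) \<longleftrightarrow> Dd is g differentiable (at x)" if "x \<in> S" for "is" x
    using differentiable_cong_open[OF assms(1) that, of "Dd is f" "Dd is g"] Dd_cong[of S f g _ "is"] assms by blast
  then show ?thesis unfolding Ck_def by blast
qed

lemma Ck_differentiable: "Ck n S f ==> x \<in> S ==> f differentiable (at x)"
  unfolding Ck_def by (metis iter_partial_deriv.simps(1) le0 list.size(3))

lemma Ck_mono: "Ck n S f ==> m <= n ==> Ck m S f"
  unfolding Ck_def by auto

lemma Ck_SucD: "Ck (Suc n) S f ==> Ck n S f"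
  by (rule Ck_mono) auto

text \<open>The differentiation rules hold only at points of the open set, so the step accepts any
  formula \<open>g i\<close> that agrees with the partial derivatives there.\<close>

lemma Ck_SucI:
  assumes "open S" "!!x. x \<in> S ==> f differentiable (at x)"
    and "!!i x. x \<in> S ==> pd i f x = g i x" "!!i. Ck n S (g i)"
  shows "Ck (Suc n) S f"
proof -
  have "Ck n S (pd i f)" for i using Ck_cong[of S "pd i f" "g i" n] assms by blast
  then show ?thesis using assms(2) unfolding Ck_Suc by blast
qed

section \<open>Rules for first partial derivatives\<close>

lemma pd_const [simp]: "pd i (%x. c) x = 0"
  by (rule pd_eqI[where f' = "%_. 0"]) simp

lemma pd_add:
  assumes "f differentiable (at x)" "g differentiable (at x)"
  shows "pd i (%y. f y + g y) x = pd i f x + pd i g x"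
proof -
  obtain f' g' where d: "(f has_derivative f') (at x)" "(g has_derivative g') (at x)"
    using assms unfolding differentiable_def by blast
  show ?thesis using pd_eqI[OF d(1)] pd_eqI[OF d(2)] pd_eqI[OF has_derivative_add[OF d]] by simp
qed

lemma pd_diff:
  assumes "f differentiable (at x)" "g differentiable (at x)"
  shows "pd i (%y. f y - g y) x = pd i f x - pd i g x"
proof -
  obtain f' g' where d: "(f has_derivative f') (at x)" "(g has_derivative g') (at x)"
    using assms unfolding differentiable_def by blast
  show ?thesis using pd_eqI[OF d(1)] pd_eqI[OF d(2)] pd_eqI[OF has_derivative_diff[OF d]] by simp
qed

lemma pd_minus:
  assumes "f differentiable (at x)"
  shows "pd i (%y. - f y) x = - pd i f x"
proof -
  obtain f' where d: "(f has_derivative f') (at x)" using assms unfolding differentiable_def by blast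
  show ?thesis using pd_eqI[OF d] pd_eqI[OF has_derivative_minus[OF d]] by simp
qed

lemma pd_sum:
  assumes "finite I" "!!j. j \<in> I ==> f j differentiable (at x)"
  shows "pd i (%y. \<Sum>j\<in>I. f j y) x = (\<Sum>j\<in>I. pd i (f j) x)"
  using assms
proof (induction I rule: finite_induct)
  case (insert a I)
  have "(%y. \<Sum>j\<in>I. f j y) differentiable (at x)"
    using insert by (intro differentiable_sum) auto
  then show ?case using insert pd_add[of "f a" x "%y. \<Sum>j\<in>I. f j y"] by auto
qed simp

lemma pd_mult:
  fixes f g :: "real^'n => real"
  assumes "f differentiable (at x)" "g differentiable (at x)"
  shows "pd i (%y. f y * g y) x = pd i f x * g x + f x * pd i g x"
proof -
  obtain f' g' where d: "(f has_derivative f') (at x)" "(g has_derivative g') (at x)"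
    using assms unfolding differentiable_def by blast
  show ?thesis using pd_eqI[OF d(1)] pd_eqI[OF d(2)] pd_eqI[OF has_derivative_mult[OF d]]
    by (simp add: algebra_simps)
qed

lemma pd_cmult:
  fixes f :: "real^'n => real"
  assumes "f differentiable (at x)"
  shows "pd i (%y. k * f y) x = k * pd i f x"
  using pd_mult[of "%_. k" x f i] assms by simp

lemma pd_compose_real:
  fixes f :: "real^'n => real" and g :: "real => real"
  assumes "f differentiable (at x)" "(g has_real_derivative g') (at (f x))"
  shows "pd i (%y. g (f y)) x = g' * pd i f x" "(%y. g (f y)) differentiable (at x)"
proof -
  obtain f' where d: "(f has_derivative f') (at x)" using assms unfolding differentiable_def by blast
  have h: "((%y. g (f y)) has_derivative (%v. g' * f' v)) (at x)"
    using has_derivative_compose[OF d, of g "%v. g' * v"] assms(2)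
    by (simp add: has_field_derivative_def)
  show "pd i (%y. g (f y)) x = g' * pd i f x" using pd_eqI[OF d] pd_eqI[OF h] by simp
  show "(%y. g (f y)) differentiable (at x)" using h differentiable_def by blast
qed

lemma pd_component:
  fixes f :: "real^'n => real^'m"
  assumes "f differentiable (at x)"
  shows "pd i (%y. f y $ l) x = pd i f x $ l" "(%y. f y $ l) differentiable (at x)"
proof -
  obtain f' where d: "(f has_derivative f') (at x)" using assms unfolding differentiable_def by blast
  have h: "((%y. f y $ l) has_derivative (%v. f' v $ l)) (at x)"
    using bounded_linear.has_derivative[OF bounded_linear_vec_nth d] .
  show "pd i (%y. f y $ l) x = pd i f x $ l" using pd_eqI[OF d] pd_eqI[OF h] by simp
  show "(%y. f y $ l) differentiable (at x)" using h differentiable_def by blast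
qed

lemma Dd_component:
  fixes f :: "real^'n => real^'m"
  assumes "open S" "smooth_on S f" "x \<in> S"
  shows "Dd is (%y. f y $ l) x = Dd is f x $ l"
  using assms(3)
proof (induction "is" arbitrary: x)
  case (Cons i "is")
  have "Dd (i # is) (%y. f y $ l) x = pd i (%y. Dd is f y $ l) x"
    using pd_cong[OF assms(1) Cons(2) Cons(1)] by simp
  then show ?case
    using pd_component(1)[OF smooth_on_differentiable[OF smooth_on_Dd[OF assms(2)] Cons(2)]] by simp
qed simp

lemma smooth_on_component:
  fixes f :: "real^'n => real^'m"
  assumes "open S" "smooth_on S f"
  shows "smooth_on S (%y. f y $ l)"
  unfolding smooth_on_def
proof (intro allI ballI)
  fix "is" x assume x: "x \<in> S"
  show "Dd is (%y. f y $ l) differentiable (at x)"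
    using differentiable_cong_open[OF assms(1) x, of "Dd is (%y. f y $ l)" "%y. Dd is f y $ l"]
      Dd_component[OF assms] pd_component(2)[OF smooth_on_differentiable[OF smooth_on_Dd[OF assms(2)] x]]
    by blast
qed

lemma Ck_const: "Ck n S (%x. c)"
proof (induction n arbitrary: c)
  case (Suc n)
  have "pd i (%x::real^'a. c) = (%x. 0)" for i by (rule ext) simp
  then show ?case using Suc by (simp add: Ck_Suc)
qed (simp add: Ck_0)

lemma Ck_add:
  assumes "open S" "Ck n S f" "Ck n S g" shows "Ck n S (%x. f x + g x)"
  using assms(2,3)
proof (induction n arbitrary: f g)
  case (Suc n)
  show ?case
    by (rule Ck_SucI[OF assms(1), where g = "%i x. pd i f x + pd i g x"])
      (use Suc in \<open>auto simp: Ck_Suc intro!: pd_add\<close>)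
qed (auto simp: Ck_0)

lemma Ck_mult:
  fixes f g :: "real^'n => real"
  assumes "open S" "Ck n S f" "Ck n S g" shows "Ck n S (%x. f x * g x)"
  using assms(2,3)
proof (induction n arbitrary: f g)
  case (Suc n)
  show ?case
    by (rule Ck_SucI[OF assms(1), where g = "%i x. pd i f x * g x + f x * pd i g x"])
      (use Suc Ck_SucD[OF Suc(2)] Ck_SucD[OF Suc(3)] in
        \<open>auto simp: Ck_Suc intro!: pd_mult Ck_add[OF assms(1)]\<close>)
qed (auto simp: Ck_0)

lemma Ck_sum:
  assumes "open S" "finite I" "!!j. j \<in> I ==> Ck n S (f j)"
  shows "Ck n S (%x. \<Sum>j\<in>I. f j x)"
  using assms(2,3) by (induction I rule: finite_induct) (auto intro: Ck_const Ck_add[OF assms(1)])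

text \<open>The derivatives of the outer function are listed by \<open>g\<close>, and
  \<open>m\<close> is left general because differentiating \<open>g m (f x)\<close> leads to
  \<open>g (Suc m)\<close>. They are needed only at values of \<open>f\<close>, which admits outer
  functions with singularities.\<close>

lemma Ck_compose_real:
  fixes f :: "real^'n => real" and g :: "nat => real => real"
  assumes "open S" "Ck n S f"
    and "!!m x. x \<in> S ==> (g m has_real_derivative g (Suc m) (f x)) (at (f x))"
  shows "Ck n S (%x. g m (f x))"
  using assms(2)
proof (induction n arbitrary: m)
  case 0
  then show ?case using assms(3) pd_compose_real(2)[of f _ "g m"] unfolding Ck_0 by blast
next
  case (Suc n)
  show ?case
  proof (rule Ck_SucI[OF assms(1)])
    show "pd i (%x. g m (f x)) x = g (Suc m) (f x) * pd i f x" if "x \<in> S" for i x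
      using pd_compose_real(1) Ck_differentiable[OF Suc(2)] assms(3) that by blast
    show "(%x. g m (f x)) differentiable at x" if "x \<in> S" for x
      using pd_compose_real(2) Ck_differentiable[OF Suc(2)] assms(3) that by blast
    show "Ck n S (%x. g (Suc m) (f x) * pd i f x)" for i
      using Suc(1)[OF Ck_SucD[OF Suc(2)]] Suc(2) by (intro Ck_mult[OF assms(1)]) (auto simp: Ck_Suc)
  qed
qed

text \<open>The derivative of \<open>1 / f\<close> is a polynomial in \<open>1 / f\<close> and the
  derivatives of \<open>f\<close>, so the induction closes without listing higher derivatives of the
  reciprocal.\<close>

lemma Ck_inverse:
  fixes f :: "real^'n => real"
  assumes "open S" "Ck n S f" "!!x. x \<in> S ==> f x ~= 0"
  shows "Ck n S (%x. 1 / f x)"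
  using assms(2)
proof (induction n)
  case 0
  then show ?case using assms(3) by (auto simp: Ck_0)
next
  case (Suc n)
  have d: "((%t. 1 / t) has_real_derivative - (1 / f x) * (1 / f x)) (at (f x))" if "x \<in> S" for x
    using assms(3)[OF that] by (auto intro!: derivative_eq_intros)
  show ?case
  proof (rule Ck_SucI[OF assms(1)])
    show "pd i (%x. 1 / f x) x = (-1) * ((1 / f x) * (1 / f x) * pd i f x)" if "x \<in> S" for i x
      using pd_compose_real(1)[of f x "%t. 1 / t", OF _ d[OF that], of i] Ck_differentiable[OF Suc(2)] that by simp
    show "(%x. 1 / f x) differentiable at x" if "x \<in> S" for x
      using pd_compose_real(2)[of f x "%t. 1 / t", OF _ d[OF that]] Ck_differentiable[OF Suc(2)] that by blast
    show "Ck n S (%x. (-1) * ((1 / f x) * (1 / f x) * pd i f x))" for i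
      using Suc(1)[OF Ck_SucD[OF Suc(2)]] Suc(2)
      by (intro Ck_mult[OF assms(1)] Ck_const) (auto simp: Ck_Suc)
  qed
qed

lemma pd_compose:
  fixes f :: "real^'m => real" and g :: "real^'n => real^'m"
  assumes "g differentiable (at x)" "f differentiable (at (g x))"
  shows "pd i (%y. f (g y)) x = (\<Sum>l\<in>UNIV. pd l f (g x) * pd i (%y. g y $ l) x)"
    "(%y. f (g y)) differentiable (at x)"
proof -
  obtain g' where d: "(g has_derivative g') (at x)" using assms unfolding differentiable_def by blast
  have h: "((%y. f (g y)) has_derivative (%v. \<Sum>l\<in>UNIV. g' v $ l * pd l f (g x))) (at x)"
    using has_derivative_compose[OF d has_derivative_pd_real[OF assms(2)]] .
  show "pd i (%y. f (g y)) x = (\<Sum>l\<in>UNIV. pd l f (g x) * pd i (%y. g y $ l) x)"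
    using pd_eqI[OF h, of i] pd_eqI[OF d, of i] pd_component(1)[OF assms(1), of i]
    by (simp add: mult.commute)
  show "(%y. f (g y)) differentiable (at x)" using h differentiable_def by blast
qed

lemma Ck_compose:
  fixes f :: "real^'m => real" and g :: "real^'n => real^'m"
  assumes "open S" "smooth_on S g" "!!x. x \<in> S ==> g x \<in> T" "Ck n T f"
  shows "Ck n S (%x. f (g x))"
  using assms(4)
proof (induction n arbitrary: f)
  case 0
  then show ?case
    using assms(3) pd_compose(2)[of g _ f] smooth_on_differentiable[OF assms(2)] unfolding Ck_0 by blast
next
  case (Suc n)
  note dg = smooth_on_differentiable[OF assms(2)]
  note df = Ck_differentiable[OF Suc(2) assms(3)]
  show ?case
  proof (rule Ck_SucI[OF assms(1)])
    show "pd i (%y. f (g y)) x = (\<Sum>l\<in>UNIV. pd l f (g x) * pd i (%y. g y $ l) x)"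
      if "x \<in> S" for i x
      using pd_compose(1) dg df that by blast
    show "(%y. f (g y)) differentiable (at x)" if "x \<in> S" for x
      using pd_compose(2) dg df that by blast
    show "Ck n S (%x. \<Sum>l\<in>UNIV. pd l f (g x) * pd i (%y. g y $ l) x)" for i
      using Suc smooth_on_pd[OF smooth_on_component[OF assms(1,2)]]
      by (intro Ck_sum[OF assms(1)] Ck_mult[OF assms(1)]) (auto simp: Ck_Suc smooth_on_Ck)
  qed
qed

section \<open>Closure properties of smooth functions\<close>

lemma smooth_on_const: "smooth_on S (%x. c)"
  by (simp add: smooth_on_Ck Ck_const)

lemma smooth_on_add: "open S ==> smooth_on S f ==> smooth_on S g ==> smooth_on S (%x. f x + g x)"
  by (simp add: smooth_on_Ck Ck_add)

lemma smooth_on_mult: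
  fixes f g :: "real^'n => real"
  shows "open S ==> smooth_on S f ==> smooth_on S g ==> smooth_on S (%x. f x * g x)"
  by (simp add: smooth_on_Ck Ck_mult)

lemma smooth_on_cmult:
  fixes f :: "real^'n => real"
  shows "open S ==> smooth_on S f ==> smooth_on S (%x. c * f x)"
  using smooth_on_mult[OF _ smooth_on_const] .

lemma smooth_on_diff:
  fixes f g :: "real^'n => real"
  assumes "open S" "smooth_on S f" "smooth_on S g" shows "smooth_on S (%x. f x - g x)"
  using smooth_on_add[OF assms(1,2) smooth_on_cmult[OF assms(1,3), of "-1"]] by simp

lemma smooth_on_sum:
  "open S ==> finite I ==> (!!j. j \<in> I ==> smooth_on S (f j)) ==> smooth_on S (%x. \<Sum>j\<in>I. f j x)"
  by (simp add: smooth_on_Ck Ck_sum)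

lemma smooth_on_inverse:
  fixes f :: "real^'n => real"
  shows "open S ==> smooth_on S f ==> (!!x. x \<in> S ==> f x ~= 0) ==> smooth_on S (%x. 1 / f x)"
  by (simp add: smooth_on_Ck Ck_inverse)

lemma smooth_on_compose:
  fixes f :: "real^'m => real" and g :: "real^'n => real^'m"
  shows "open S ==> smooth_on S g ==> (!!x. x \<in> S ==> g x \<in> T) ==> smooth_on T f
    ==> smooth_on S (%x. f (g x))"
  unfolding smooth_on_Ck using Ck_compose[of S g T] by (simp add: smooth_on_Ck)

lemma smooth_on_cong:
  "open S ==> (!!y. y \<in> S ==> f y = g y) ==> smooth_on S f \<longleftrightarrow> smooth_on S g"
  unfolding smooth_on_Ck using Ck_cong by blast

lemma smooth_on_component_id: "smooth_on S (%x::real^'n. x $ i)"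
proof -
  have "Ck n UNIV (%x::real^'n. x $ i)" for n
  proof (cases n)
    case 0 then show ?thesis by (simp add: Ck_0 bounded_linear_imp_differentiable bounded_linear_vec_nth)
  next
    case (Suc m)
    have "pd j (%x::real^'n. x $ i) x = axis j 1 $ i" for j x
      by (rule pd_eqI) (rule bounded_linear_imp_has_derivative[OF bounded_linear_vec_nth])
    then show ?thesis unfolding Suc
      by (intro Ck_SucI[where g = "%j x. axis j 1 $ i"])
        (auto simp: Ck_const bounded_linear_imp_differentiable bounded_linear_vec_nth)
  qed
  then show ?thesis unfolding smooth_on_Ck by (meson Ck_def subset_UNIV subsetD)
qed

section \<open>Restriction to lines, and bounds for iterated derivatives\<close>

lemma line_deriv:
  fixes f :: "real^'n => real"
  assumes "f differentiable (at (step x t i))"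
  shows "((%s. f (step x s i)) has_real_derivative pd i f (step x t i)) (at t)"
proof -
  obtain f' where d: "(f has_derivative f') (at (step x t i))"
    using assms unfolding differentiable_def by blast
  have l: "((%s. step x s i) has_derivative (%s. s *\<^sub>R axis i 1)) (at t)"
    by (auto intro!: derivative_eq_intros)
  have "((%s. f (step x s i)) has_derivative (%s. f' (s *\<^sub>R axis i 1))) (at t)"
    using has_derivative_compose[OF l, of f f'] d by simp
  moreover have "f' (s *\<^sub>R axis i 1) = pd i f (step x t i) * s" for s
    using linear_scale[OF has_derivative_linear[OF d]] pd_eqI[OF d] by simp
  ultimately show ?thesis by (simp add: has_field_derivative_def)
qed

lemma line_MVT:
  fixes f :: "real^'n => real"
  assumes "0 < h" "!!t. 0 <= t ==> t <= h ==> f differentiable (at (step x t i))"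
  obtains t where "0 < t" "t < h" "f (step x h i) - f x = h * pd i f (step x t i)"
  using MVT2[of 0 h "%t. f (step x t i)" "%t. pd i f (step x t i)"]
    line_deriv[of f x _ i] assms by auto

lemma Dd_add:
  assumes "open S" "smooth_on S f" "smooth_on S g" "x \<in> S"
  shows "Dd is (%y. f y + g y) x = Dd is f x + Dd is g x"
  using assms(4)
proof (induction "is" arbitrary: x)
  case (Cons i "is")
  show ?case
    using pd_cong[OF assms(1) Cons(2) Cons(1)]
      pd_add[OF smooth_on_differentiable[OF smooth_on_Dd[OF assms(2)] Cons(2)]
        smooth_on_differentiable[OF smooth_on_Dd[OF assms(3)] Cons(2)]] by simp
qed simp

lemma Dd_cmult:
  fixes f :: "real^'n => real"
  assumes "open S" "smooth_on S f" "x \<in> S"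
  shows "Dd is (%y. c * f y) x = c * Dd is f x"
  using assms(3)
proof (induction "is" arbitrary: x)
  case (Cons i "is")
  show ?case
    using pd_cong[OF assms(1) Cons(2) Cons(1)]
      pd_cmult[OF smooth_on_differentiable[OF smooth_on_Dd[OF assms(2)] Cons(2)]] by simp
qed simp

lemma Dd_diff:
  fixes f :: "real^'n => real"
  assumes "open S" "smooth_on S f" "smooth_on S g" "x \<in> S"
  shows "Dd is (%y. f y - g y) x = Dd is f x - Dd is g x"
  using Dd_add[OF assms(1,2) smooth_on_cmult[OF assms(1,3), of "-1"] assms(4)]
    Dd_cmult[OF assms(1,3,4), of "is" "-1"] by simp

lemma Dd_sum:
  assumes "open S" "finite I" "!!j. j \<in> I ==> smooth_on S (f j)" "x \<in> S"
  shows "Dd is (%y. \<Sum>j\<in>I. f j y) x = (\<Sum>j\<in>I. Dd is (f j) x)"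
  using assms(2,3)
proof (induction I rule: finite_induct)
  case empty
  have "Dd is (%y. \<Sum>j\<in>{}. f j y) = (%y. 0)" for "is" by (induction "is") (auto intro!: ext)
  then show ?case by simp
next
  case (insert a I)
  have "Dd is (%y. f a y + (\<Sum>j\<in>I. f j y)) x = Dd is (f a) x + Dd is (%y. \<Sum>j\<in>I. f j y) x"
    using insert by (intro Dd_add[OF assms(1) _ _ assms(4)] smooth_on_sum[OF assms(1)]) auto
  then show ?case using insert by simp
qed

text \<open>Leibniz rule: each derivative doubles the number of products, whence
  \<open>2 ^ m\<close>.\<close>

lemma Dd_mult_bound:
  fixes f g :: "real^'n => real"
  assumes "open S" "x \<in> S" "smooth_on S f" "smooth_on S g"
    and "!!is. length is <= m ==> \<bar>Dd is f x\<bar> <= A" "!!is. length is <= m ==> \<bar>Dd is g x\<bar> <= B"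
    and "length is <= m"
  shows "\<bar>Dd is (%y. f y * g y) x\<bar> <= 2 ^ m * A * B"
  using assms(3-)
proof (induction m arbitrary: f g "is")
  case 0
  have "\<bar>f x\<bar> <= A" "\<bar>g x\<bar> <= B" using 0(3)[of "[]"] 0(4)[of "[]"] by auto
  then have "\<bar>f x\<bar> * \<bar>g x\<bar> <= A * B" by (intro mult_mono) auto
  then show ?case using 0 by (simp add: abs_mult)
next
  case (Suc m)
  have AB: "\<bar>f x\<bar> <= A" "\<bar>g x\<bar> <= B" using Suc(4)[of "[]"] Suc(5)[of "[]"] by auto
  then have AB0: "0 <= A * B" by (meson abs_ge_zero mult_nonneg_nonneg order_trans)
  show ?case
  proof (cases "is" rule: rev_cases)
    case Nil
    have "\<bar>f x\<bar> * \<bar>g x\<bar> <= A * B" using AB by (intro mult_mono) auto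
    moreover have "1 * (A * B) <= 2 ^ Suc m * (A * B)"
      by (rule mult_right_mono) (use AB0 one_le_power[of "2::real" "Suc m"] in auto)
    ultimately show ?thesis using Nil by (simp add: abs_mult)
  next
    case (snoc js i)
    have js: "length js <= m" using Suc(6) snoc by simp
    have df: "smooth_on S (pd i f)" and dg: "smooth_on S (pd i g)"
      using Suc(2,3) smooth_on_pd by auto
    have "Dd is (%y. f y * g y) x = Dd js (pd i (%y. f y * g y)) x"
      by (simp add: snoc Dd_snoc)
    also have "... = Dd js (%y. pd i f y * g y + f y * pd i g y) x"
      using pd_mult smooth_on_differentiable Suc(2,3) assms(2) by (intro Dd_cong[OF assms(1)]) blast+
    also have "... = Dd js (%y. pd i f y * g y) x + Dd js (%y. f y * pd i g y) x"
      by (intro Dd_add[OF assms(1) _ _ assms(2)] smooth_on_mult[OF assms(1)] df dg Suc(2,3))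
    finally have eq: "Dd is (%y. f y * g y) x
        = Dd js (%y. pd i f y * g y) x + Dd js (%y. f y * pd i g y) x" .
    have "\<bar>Dd js (%y. pd i f y * g y) x\<bar> <= 2 ^ m * A * B"
      using Suc(4)[of "_ @ [i]"] Suc(5) by (intro Suc(1)[OF df Suc(3) _ _ js]) (auto simp: Dd_snoc)
    moreover have "\<bar>Dd js (%y. f y * pd i g y) x\<bar> <= 2 ^ m * A * B"
      using Suc(5)[of "_ @ [i]"] Suc(4) by (intro Suc(1)[OF Suc(2) dg _ _ js]) (auto simp: Dd_snoc)
    ultimately show ?thesis unfolding eq by simp
  qed
qed

text \<open>Once the product in which all derivatives fall on \<open>f\<close> is subtracted, the
  others carry fewer than \<open>length js\<close> derivatives of \<open>f\<close>. For empty
  \<open>js\<close> nothing bounds \<open>B\<close> from below, hence the assumption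
  \<open>0 <= B\<close>.\<close>

lemma Dd_commutator_bound:
  fixes a f :: "real^'n => real"
  assumes "open S" "x \<in> S" "smooth_on S a" "smooth_on S f"
    and "!!is. length is <= length js ==> \<bar>Dd is a x\<bar> <= A"
    and "!!is. length is < length js ==> \<bar>Dd is f x\<bar> <= B" and "0 <= B"
  shows "\<bar>Dd js (%y. a y * f y) x - a x * Dd js f x\<bar> <= 2 ^ length js * A * B"
  using assms(3-)
proof (induction js arbitrary: a f rule: rev_induct)
  case Nil
  have "0 <= A" using Nil(3)[of "[]"] by auto
  then show ?case using Nil by simp
next
  case (snoc i js)
  have da: "smooth_on S (pd i a)" and df: "smooth_on S (pd i f)"
    using snoc(2,3) smooth_on_pd by auto
  have "Dd (js @ [i]) (%y. a y * f y) x = Dd js (%y. pd i a y * f y + a y * pd i f y) x"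
    unfolding Dd_snoc
    using pd_mult smooth_on_differentiable snoc(2,3) assms(2) by (intro Dd_cong[OF assms(1)]) blast+
  also have "... = Dd js (%y. pd i a y * f y) x + Dd js (%y. a y * pd i f y) x"
    by (intro Dd_add[OF assms(1) _ _ assms(2)] smooth_on_mult[OF assms(1)] da df snoc(2,3))
  finally have eq: "Dd (js @ [i]) (%y. a y * f y) x
      = Dd js (%y. pd i a y * f y) x + Dd js (%y. a y * pd i f y) x" .
  have "\<bar>Dd js (%y. pd i a y * f y) x\<bar> <= 2 ^ length js * A * B"
    using snoc(4)[of "_ @ [i]"] snoc(5) by (intro Dd_mult_bound[OF assms(1,2) da snoc(3)]) (auto simp: Dd_snoc)
  moreover have "\<bar>Dd js (%y. a y * pd i f y) x - a x * Dd js (pd i f) x\<bar> <= 2 ^ length js * A * B"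
    using snoc(5)[of "_ @ [i]"] snoc(4) by (intro snoc(1)[OF snoc(2) df _ _ snoc(6)]) (auto simp: Dd_snoc)
  ultimately show ?case unfolding eq by (simp add: Dd_snoc)
qed

text \<open>An interior estimate whose right-hand side contains the estimated quantity itself,
  multiplied by the radius, is closed on a small ball by means of a weighted supremum. The resulting
  bound is independent of \<open>bd\<close>, which only makes that supremum finite.\<close>

lemma absorb:
  fixes D :: "'a::real_normed_vector => real"
  assumes R: "0 < R" and C0: "0 <= C0" "0 <= M" "0 <= K" "0 <= K'"
    and bdd: "!!z. z \<in> ball x0 R ==> 0 <= D z & D z <= bd"
    and step: "!!x \<rho> B. 0 < \<rho> ==> cball x \<rho> \<subseteq> ball x0 R ==> 0 <= B ==> (!!z. z \<in> cball x \<rho> ==> D z <= B)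
      ==> D x <= C0 * (M / \<rho> + \<rho> * (K + K' * B))"
    and small: "C0 * K' * R <= 1 / 2"
  shows "D x0 <= 4 * C0 * M / R + C0 * K * R"
proof -
  \<comment> \<open>The weight vanishes on the sphere; on a ball reaching halfway to the sphere it
    loses at most a factor 2.\<close>
  define E where "E z = (R - dist x0 z) * D z" for z
  define A where "A = Sup (E ` ball x0 R)"
  have ne: "x0 \<in> ball x0 R" using R by simp
  have bd: "0 <= bd" using bdd[OF ne] by linarith
  have "E z <= R * bd" if "z \<in> ball x0 R" for z
    unfolding E_def using bdd[OF that] that R by (intro mult_mono) auto
  then have bA: "bdd_above (E ` ball x0 R)" by (intro bdd_aboveI) auto
  have EA: "E z <= A" if "z \<in> ball x0 R" for z
    unfolding A_def using bA that by (intro cSup_upper) auto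
  have "0 <= E x0" unfolding E_def using bdd[OF ne] R by auto
  then have A0: "0 <= A" using EA[OF ne] by linarith
  have main: "E x <= 2 * C0 * M + C0 * K * R\<^sup>2 / 2 + A / 2" if x: "x \<in> ball x0 R" for x
  proof -
    define s where "s = R - dist x0 x"
    have s: "0 < s" "s <= R" using x by (auto simp: s_def)
    have near: "s / 2 <= R - dist x0 z" if "z \<in> cball x (s/2)" for z
    proof -
      have "dist x0 z <= dist x0 x + dist x z" by (rule dist_triangle)
      then show ?thesis using that by (simp add: s_def)
    qed
    have sub: "cball x (s/2) \<subseteq> ball x0 R" using near s by fastforce
    have "D z <= 2 * A / s" if z: "z \<in> cball x (s/2)" for z
    proof -
      have "z \<in> ball x0 R" using sub z by blast
      then have "E z <= A" "0 <= D z" using EA bdd by auto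
      moreover have "s / 2 * D z <= E z"
        unfolding E_def using near[OF z] \<open>0 <= D z\<close> by (intro mult_right_mono)
      ultimately show ?thesis using s by (simp add: field_simps)
    qed
    \<comment> \<open>The term with \<open>M\<close> picks up \<open>2 / s\<close>, which the weight
      cancels, and the supremum term \<open>2 * A / s\<close> comes with the factor
      \<open>s / 2\<close>; after multiplication by the weight only \<open>C0 * K' * s * A\<close>
      has to be absorbed.\<close>
    then have "D x <= C0 * (M / (s/2) + (s/2) * (K + K' * (2 * A / s)))"
      using s sub A0 by (intro step) auto
    then have "s * D x <= s * (C0 * (M / (s/2) + (s/2) * (K + K' * (2 * A / s))))"
      using s by (intro mult_left_mono) auto
    also have "... = 2 * C0 * M + C0 * K * (s * s) / 2 + C0 * K' * s * A"
      using s by (simp add: field_simps)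
    also have "... <= 2 * C0 * M + C0 * K * (R * R) / 2 + (1/2) * A"
    proof -
      have "C0 * K * (s * s) <= C0 * K * (R * R)"
        using s C0 by (intro mult_left_mono mult_mono) auto
      moreover have "C0 * K' * s <= C0 * K' * R" using s C0 by (intro mult_left_mono) auto
      then have "C0 * K' * s * A <= (1/2) * A"
        using small A0 by (intro mult_right_mono) auto
      ultimately show ?thesis by linarith
    qed
    finally show ?thesis by (simp add: E_def s_def power2_eq_square)
  qed
  have "A <= 2 * C0 * M + C0 * K * R\<^sup>2 / 2 + A / 2"
    unfolding A_def using ne main by (intro cSup_least) (auto simp: A_def[symmetric])
  then have "R * D x0 <= 4 * C0 * M + C0 * K * R\<^sup>2"
    using EA[OF ne] by (simp add: E_def)
  then show ?thesis using R by (simp add: field_simps power2_eq_square)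
qed

section \<open>A gradient estimate for the discrete Laplacian\<close>

lemma finite_int_cube: "finite {k::int^'n. \<forall>j. \<bar>k $ j\<bar> <= m}"
proof (rule finite_imageD)
  have "vec_nth ` {k::int^'n. \<forall>j. \<bar>k $ j\<bar> <= m} \<subseteq> (UNIV :: 'n set) \<rightarrow>\<^sub>E {-m..m}"
    by (auto simp: PiE_def abs_le_iff minus_le_iff) 
  then show "finite (vec_nth ` {k::int^'n. \<forall>j. \<bar>k $ j\<bar> <= m})"
    by (rule finite_subset) (auto intro: finite_PiE)
  show "inj_on vec_nth {k::int^'n. \<forall>j. \<bar>k $ j\<bar> <= m}"
    by (auto simp: inj_on_def vec_eq_iff)
qed

definition zlap :: "(int^'n => real) => int^'n => real"
  where "zlap F k = (\<Sum>j\<in>UNIV. F (k + axis j 1) + F (k - axis j 1) - 2 * F k)"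

text \<open>Reflection in the hyperplane midway between \<open>0\<close> and \<open>axis i 1\<close>
  exchanges these points, so the first difference is a value of the odd function
  \<open>\<phi>\<close>. On the half cube \<open>S\<close> the discrete maximum principle compares
  it with \<open>\<psi>\<close>, which dominates it on the outer faces and is concave enough in the
  direction \<open>i\<close>.\<close>

lemma discrete_gradient_one_sided:
  fixes F :: "int^'n => real" and m :: nat and M N :: real
  assumes m: "0 < m" and M0: "0 < M" and N0: "0 <= N"
    and M: "!!k. (!!j. \<bar>k $ j\<bar> <= int m) ==> \<bar>F k\<bar> <= M"
    and N: "!!k. (!!j. \<bar>k $ j\<bar> <= int m) ==> \<bar>zlap F k\<bar> <= N"
  shows "F (axis i 1) - F 0 <= 8 * CARD('n) * M / m + 2 * m * N"
proof -
  define \<sigma> where "\<sigma> k = (\<chi> j. if j = i then 1 - k $ i else k $ j)" for k :: "int^'n"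
  define \<phi> where "\<phi> k = F k - F (\<sigma> k)" for k
  \<comment> \<open>With this coefficient \<open>a * q\<close> alone reaches \<open>2 * M\<close> on
    the lateral faces.\<close>
  define a where "a = 2 * M / m\<^sup>2"
  define d where "d = real CARD('n)"
  \<comment> \<open>The concave part has to outweigh \<open>a * q\<close> and the two values of
    \<open>zlap F\<close>, even with the factor 3/2 that is all the layer next to the hyperplane
    allows. That \<open>e\<close> is at least \<open>4 * a\<close> gives \<open>2 * M\<close> on the
    face opposite the hyperplane.\<close>
  define e where "e = 4 * d * a + 2 * N"
  define q where "q k = (\<Sum>j\<in>UNIV - {i}. (of_int (k $ j))\<^sup>2 :: real)" for k :: "int^'n"
  \<comment> \<open>The half shift makes the reflection act as change of sign of
    \<open>t\<close>.\<close>
  define t where "t k = real_of_int (k $ i) - 1 / 2" for k :: "int^'n"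
  define \<psi> where "\<psi> k = a * q k + e * (t k * (2 * m - t k))" for k
  define S where "S = {k::int^'n. (\<forall>j. \<bar>k $ j\<bar> <= int m) & 1 <= k $ i}"
  have a0: "0 < a" using M0 m by (simp add: a_def)
  have d1: "1 <= d" unfolding d_def using finite_UNIV_card_ge_0[where 'a='n] by (simp add: Suc_leI)
  have e0: "4 * a <= e" using d1 a0 N0 mult_right_mono[of 1 d a] unfolding e_def by linarith
  have finS: "finite S" unfolding S_def by (rule finite_subset[OF _ finite_int_cube[of "int m"]]) auto
  have q0: "0 <= q k" for k unfolding q_def by (intro sum_nonneg) auto
  have tS: "1 / 2 <= t k" "t k <= m" if "k \<in> S" for k
  proof -
    have "\<bar>k $ i\<bar> <= int m" "1 <= k $ i" using that unfolding S_def by blast+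
    then have "1 <= k $ i" "k $ i <= int m" by linarith+
    then have "1 <= real_of_int (k $ i)" "real_of_int (k $ i) <= real m" by linarith+
    then show "1 / 2 <= t k" "t k <= m" by (auto simp: t_def)
  qed
  have ax: "\<sigma> (axis i 1) = 0" by (auto simp: \<sigma>_def vec_eq_iff axis_def)
  have \<sigma>S: "\<bar>\<sigma> k $ j\<bar> <= int m" if "k \<in> S" for k j
  proof -
    have "\<bar>k $ i\<bar> <= int m" "\<bar>k $ j\<bar> <= int m" "1 <= k $ i" using that unfolding S_def by blast+
    then show ?thesis by (auto simp: \<sigma>_def)
  qed
  have \<phi>M: "\<phi> k <= 2 * M" if "k \<in> S" for k
  proof -
    have "\<bar>F k\<bar> <= M" using that by (intro M) (auto simp: S_def)
    moreover have "\<bar>F (\<sigma> k)\<bar> <= M"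
      by (rule M[OF \<sigma>S[OF that]])
    ultimately show ?thesis by (simp add: \<phi>_def)
  qed
  have q_other: "q (k + axis j c) = q k + 2 * of_int c * of_int (k $ j) + (of_int c)\<^sup>2" if "j ~= i" for k j c
  proof -
    have "q (k + axis j c) = (of_int ((k + axis j c) $ j))\<^sup>2
        + (\<Sum>l\<in>UNIV - {i} - {j}. (of_int ((k + axis j c) $ l))\<^sup>2)"
      unfolding q_def using that by (subst sum.remove[of _ j]) auto
    also have "(\<Sum>l\<in>UNIV - {i} - {j}. (of_int ((k + axis j c) $ l))\<^sup>2 :: real)
        = (\<Sum>l\<in>UNIV - {i} - {j}. (of_int (k $ l))\<^sup>2)"
      by (intro sum.cong) (auto simp: axis_def)
    finally have "q (k + axis j c) = (of_int (k $ j) + of_int c)\<^sup>2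
        + (\<Sum>l\<in>UNIV - {i} - {j}. (of_int (k $ l))\<^sup>2)" by simp
    moreover have "q k = (of_int (k $ j))\<^sup>2 + (\<Sum>l\<in>UNIV - {i} - {j}. (of_int (k $ l))\<^sup>2)"
      unfolding q_def using that by (subst sum.remove[of _ j]) auto
    ultimately show ?thesis by (simp add: power2_eq_square algebra_simps)
  qed
  have q_i: "q (k + axis i c) = q k" for k c
    unfolding q_def by (intro sum.cong) (auto simp: axis_def)
  have t_other: "t (k + axis j c) = t k" if "j ~= i" for k j c using that by (simp add: t_def axis_def)
  have t_i: "t (k + axis i c) = t k + of_int c" for k c by (simp add: t_def axis_def)
  have ax_minus: "k - axis j 1 = k + axis j (-1)" for k :: "int^'n" and j
    by (auto simp: vec_eq_iff axis_def)
  have le: "\<phi> k <= \<psi> k" if "k \<in> S" for k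
  proof (rule ccontr)
    assume neg: "\<not> ?thesis"
    obtain k0 where k0: "k0 \<in> S" "!!l. l \<in> S ==> \<phi> l - \<psi> l <= \<phi> k0 - \<psi> k0"
    proof -
      have "Max ((%l. \<phi> l - \<psi> l) ` S) \<in> (%l. \<phi> l - \<psi> l) ` S"
        using finS \<open>k \<in> S\<close> by (intro Max_in) auto
      moreover have "\<phi> l - \<psi> l <= Max ((%l. \<phi> l - \<psi> l) ` S)" if "l \<in> S" for l
        using finS that by (intro Max_ge) auto
      ultimately show ?thesis using that by fastforce
    qed
    have pos: "\<psi> k0 < \<phi> k0" using k0(2)[OF that] neg by linarith
    \<comment> \<open>The barrier is at least \<open>2 * M\<close> on the outer faces, so a positive
      maximum of \<open>\<phi> - \<psi>\<close> lies off them.\<close>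
    have int: "\<bar>k0 $ j\<bar> < int m" for j
    proof (rule ccontr)
      assume "\<not> ?thesis"
      then have kj: "\<bar>k0 $ j\<bar> = int m" using k0(1) by (auto simp: S_def intro: antisym)
      have "2 * M <= \<psi> k0"
      proof (cases "j = i")
        case True
        have "k0 $ i = int m" using kj k0(1) True by (auto simp: S_def)
        then have t: "t k0 = m - 1/2" by (simp add: t_def)
        have m1: "1 <= real m" using m by linarith
        have "(real m)\<^sup>2 / 2 <= t k0 * (2 * m - t k0)"
          unfolding t power2_eq_square using m1 mult_mono[of 1 "real m" 1 "real m"] by (simp add: algebra_simps)
        then have "4 * a * ((real m)\<^sup>2 / 2) <= e * (t k0 * (2 * m - t k0))"
          using e0 a0 by (intro mult_mono) auto
        moreover have "4 * a * ((real m)\<^sup>2 / 2) = 4 * M" using m by (simp add: a_def)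
        moreover have "0 <= a * q k0" using a0 q0 by simp
        ultimately show ?thesis unfolding \<psi>_def using M0 by linarith
      next
        case False
        have "(of_int (k0 $ j))\<^sup>2 <= q k0"
          unfolding q_def using False by (intro member_le_sum) auto
        moreover have "(of_int (k0 $ j))\<^sup>2 = (real m)\<^sup>2"
          by (metis kj of_int_abs of_int_of_nat_eq power2_abs)
        ultimately have "a * (real m)\<^sup>2 <= a * q k0" using a0 by simp
        moreover have "a * (real m)\<^sup>2 = 2 * M" using m by (simp add: a_def)
        moreover have "0 <= e * (t k0 * (2 * m - t k0))"
          using tS[OF k0(1)] e0 a0 by (intro mult_nonneg_nonneg) auto
        ultimately show ?thesis by (simp add: \<psi>_def)
      qed
      then show False using pos \<phi>M[OF k0(1)] by linarith
    qed
    have up: "\<phi> l <= \<phi> k0 + \<psi> l - \<psi> k0" if "l \<in> S" for l using k0(2)[OF that] by linarith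
    have inS: "k0 + axis j c \<in> S" if "\<bar>c\<bar> <= 1" "j = i ==> 1 <= k0 $ i + c" for j c
    proof -
      have "\<bar>k0 $ l + (if l = j then c else 0)\<bar> <= int m" for l using int[of l] that(1) by auto
      then show ?thesis using k0(1) that by (auto simp: S_def axis_def)
    qed
    have oth: "\<phi> (k0 + axis j 1) + \<phi> (k0 - axis j 1) - 2 * \<phi> k0 <= 2 * a" if "j ~= i" for j
      using up[OF inS[of 1 j]] up[OF inS[of "-1" j]] that
      unfolding ax_minus \<psi>_def q_other[OF that] t_other[OF that] by (simp add: algebra_simps)
    have self: "\<phi> (k0 + axis i 1) + \<phi> (k0 - axis i 1) - 2 * \<phi> k0 <= - (3/2) * e"
    proof (cases "k0 $ i = 1")
      case True
      \<comment> \<open>In the first layer the lower neighbour lies outside \<open>S\<close>, but it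
        is the mirror image of \<open>k0\<close> and contributes \<open>- \<phi> k0\<close>.\<close>
      have "\<sigma> (k0 - axis i 1) = k0" "\<sigma> k0 = k0 - axis i 1"
        using True by (auto simp: \<sigma>_def vec_eq_iff axis_def)
      then have "\<phi> (k0 - axis i 1) = - \<phi> k0" by (simp add: \<phi>_def)
      moreover have "\<phi> (k0 + axis i 1) <= \<phi> k0 + \<psi> (k0 + axis i 1) - \<psi> k0"
        using True by (intro up inS) auto
      moreover have "0 <= a * q k0" using a0 q0 by simp
      moreover have t: "t k0 = 1/2" using True by (simp add: t_def)
      ultimately show ?thesis using pos
        unfolding \<psi>_def q_i t_i t by (simp add: algebra_simps)
    next
      case False
      have "1 <= k0 $ i" using k0(1) by (simp add: S_def)
      then have "2 <= k0 $ i" using False by linarith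
      then have "\<phi> (k0 + axis i 1) <= \<phi> k0 + \<psi> (k0 + axis i 1) - \<psi> k0"
        "\<phi> (k0 + axis i (-1)) <= \<phi> k0 + \<psi> (k0 + axis i (-1)) - \<psi> k0"
        by (auto intro!: up inS)
      then have "\<phi> (k0 + axis i 1) + \<phi> (k0 - axis i 1) - 2 * \<phi> k0 <= - 2 * e"
        unfolding \<psi>_def q_i t_i ax_minus by (simp add: algebra_simps)
      then show ?thesis using e0 a0 by linarith
    qed
    have "zlap \<phi> k0 = (\<Sum>j\<in>UNIV - {i}. \<phi> (k0 + axis j 1) + \<phi> (k0 - axis j 1) - 2 * \<phi> k0)
        + (\<phi> (k0 + axis i 1) + \<phi> (k0 - axis i 1) - 2 * \<phi> k0)"
      unfolding zlap_def by (subst sum.remove[of _ i]) auto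
    also have "... <= (\<Sum>j\<in>UNIV - {i}. 2 * a) + (- (3/2) * e)"
      using oth self by (intro add_mono sum_mono) auto
    also have "(\<Sum>j\<in>UNIV - {i}. 2 * a) = (d - 1) * (2 * a)"
      using d1 by (simp add: d_def card_Diff_singleton of_nat_diff)
    finally have 1: "zlap \<phi> k0 <= (d - 1) * (2 * a) - (3/2) * e" by simp
    have "zlap \<phi> k0 = zlap F k0 - zlap F (\<sigma> k0)"
    proof -
      have refl: "\<phi> (k0 + axis j 1) + \<phi> (k0 - axis j 1) - 2 * \<phi> k0
          = (F (k0 + axis j 1) + F (k0 - axis j 1) - 2 * F k0)
            - (F (\<sigma> k0 + axis j 1) + F (\<sigma> k0 - axis j 1) - 2 * F (\<sigma> k0))" for j
      proof (cases "j = i")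
        case True
        have "\<sigma> (k0 + axis i 1) = \<sigma> k0 - axis i 1" "\<sigma> (k0 - axis i 1) = \<sigma> k0 + axis i 1"
          by (auto simp: \<sigma>_def vec_eq_iff axis_def)
        then show ?thesis using True by (simp add: \<phi>_def)
      next
        case False
        have "\<sigma> (k0 + axis j 1) = \<sigma> k0 + axis j 1" "\<sigma> (k0 - axis j 1) = \<sigma> k0 - axis j 1"
          using False by (auto simp: \<sigma>_def vec_eq_iff axis_def)
        then show ?thesis by (simp add: \<phi>_def)
      qed
      show ?thesis unfolding zlap_def refl by (simp only: sum_subtractf)
    qed
    moreover have "\<bar>zlap F k0\<bar> <= N" using k0(1) by (intro N) (auto simp: S_def)
    moreover have "\<bar>zlap F (\<sigma> k0)\<bar> <= N"
      by (rule N[OF \<sigma>S[OF k0(1)]])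
    ultimately have "- 2 * N <= (d - 1) * (2 * a) - (3/2) * e" using 1 by linarith
    moreover have "0 < d * a" using d1 a0 by simp
    ultimately show False using a0 N0 unfolding e_def by (simp add: algebra_simps)
  qed
  have "axis i 1 \<in> S" using m by (auto simp: S_def axis_def)
  from le[OF this] have "F (axis i 1) - F 0 <= \<psi> (axis i 1)" by (simp add: \<phi>_def ax)
  also have "\<psi> (axis i 1) = e * (1/2 * (2 * m - 1/2))"
  proof -
    have "q (axis i 1) = 0" unfolding q_def by (intro sum.neutral) (auto simp: axis_def)
    then show ?thesis by (simp add: \<psi>_def t_def axis_def)
  qed
  also have "... <= e * m" using e0 a0 by (intro mult_left_mono) auto
  also have "... = 8 * CARD('n) * M / m + 2 * m * N"
    using m by (simp add: e_def a_def d_def field_simps power2_eq_square)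
  finally show ?thesis .
qed

lemma discrete_gradient:
  fixes F :: "int^'n => real" and m :: nat and M N :: real
  assumes "0 < m" "0 < M" "0 <= N"
    and M: "!!k. (!!j. \<bar>k $ j\<bar> <= int m) ==> \<bar>F k\<bar> <= M"
    and N: "!!k. (!!j. \<bar>k $ j\<bar> <= int m) ==> \<bar>zlap F k\<bar> <= N"
  shows "\<bar>F (axis i 1) - F 0\<bar> <= 8 * CARD('n) * M / m + 2 * m * N"
proof -
  have "zlap (%k. - F k) k = - zlap F k" for k
    unfolding zlap_def sum_negf[symmetric] by (intro sum.cong) auto
  then have "- F (axis i 1) - - F 0 <= 8 * CARD('n) * M / m + 2 * m * N"
    using assms by (intro discrete_gradient_one_sided) auto
  moreover have "F (axis i 1) - F 0 <= 8 * CARD('n) * M / m + 2 * m * N"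
    using assms by (intro discrete_gradient_one_sided) auto
  ultimately show ?thesis by linarith
qed

section \<open>Difference quotients\<close>

definition dq :: "real => 'n => (real^'n => real) => real^'n => real"
  where "dq h i f x = (f (step x h i) - f x) / h"

fun dqs :: "real => 'n list => (real^'n => real) => real^'n => real"
  where "dqs h [] f = f" | "dqs h (i # is) f = dq h i (dqs h is f)"

definition dlap :: "real => (real^'n => real) => real^'n => real"
  where "dlap h f x
    = (\<Sum>j\<in>UNIV. f (step x h j) + f (x - h *\<^sub>R axis j 1) - 2 * f x) / h\<^sup>2"

text \<open>Sampling \<open>f\<close> on the lattice of width \<open>h\<close> through
  \<open>x\<close> reduces this to \<open>discrete_gradient\<close>, with \<open>zlap\<close> equal
  to \<open>h\<^sup>2\<close> times \<open>dlap\<close>.\<close>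

lemma dlap_gradient:
  fixes f :: "real^'n => real"
  assumes h: "0 < h" "real CARD('n) * h <= \<rho>" and M0: "0 < M" "0 <= G"
    and M: "!!z. z \<in> cball x \<rho> ==> \<bar>f z\<bar> <= M"
    and G: "!!z. z \<in> cball x \<rho> ==> \<bar>dlap h f z\<bar> <= G"
  shows "\<bar>dq h i f x\<bar> <= 16 * (CARD('n))\<^sup>2 * (M / \<rho> + \<rho> * G)"
proof -
  define d where "d = real CARD('n)"
  \<comment> \<open>The largest cube that fits into the ball, Euclidean norms on it being at most
    \<open>d * m * h\<close>. Since \<open>m\<close> is at least 1, rounding down costs at most a
    factor 2.\<close>
  define m where "m = nat \<lfloor>\<rho> / (d * h)\<rfloor>"
  define p where "p k = x + h *\<^sub>R (\<chi> j. real_of_int (k $ j))" for k :: "int^'n"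
  have d1: "1 <= d" unfolding d_def using finite_UNIV_card_ge_0[where 'a='n] by (simp add: Suc_leI)
  have dh: "0 < d * h" using d1 h by simp
  have q1: "1 <= \<rho> / (d * h)" using h dh by (simp add: d_def)
  have fl: "real m = of_int \<lfloor>\<rho> / (d * h)\<rfloor>" unfolding m_def using q1 by simp
  have m_le: "real m <= \<rho> / (d * h)" using fl by linarith
  have m1: "1 <= real m" using fl q1 by (simp add: le_floor_iff)
  have m_ge: "\<rho> / (2 * (d * h)) <= real m"
  proof -
    have "\<rho> / (d * h) <= real m + 1" using fl by linarith
    also have "... <= 2 * real m" using m1 by simp
    finally show ?thesis using dh by (simp add: field_simps)
  qed
  have \<rho>: "0 < \<rho>" using h dh unfolding d_def by linarith
  have ball: "p k \<in> cball x \<rho>" if "!!j. \<bar>k $ j\<bar> <= int m" for k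
  proof -
    have "norm (\<chi> j. real_of_int (k $ j)) <= (\<Sum>j\<in>UNIV. \<bar>real_of_int (k $ j)\<bar>)"
      using norm_le_l1_cart[of "\<chi> j. real_of_int (k $ j)"] by simp
    also have "... <= (\<Sum>j\<in>(UNIV::'n set). real m)"
      using that by (intro sum_mono) (metis of_int_abs of_int_le_iff of_int_of_nat_eq)
    also have "... = d * m" by (simp add: d_def)
    finally have "h * norm (\<chi> j. real_of_int (k $ j)) <= h * (d * m)"
      using h by (intro mult_left_mono) auto
    also have "... <= \<rho>" using m_le dh by (simp add: field_simps)
    finally show ?thesis using h by (simp add: p_def dist_norm)
  qed
  have p_ax: "p (k + axis j 1) = p k + h *\<^sub>R axis j 1" "p (k - axis j 1) = p k - h *\<^sub>R axis j 1" for k j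
    by (auto simp: p_def vec_eq_iff axis_def algebra_simps)
  have zl: "zlap (%k. f (p k)) k = h\<^sup>2 * dlap h f (p k)" for k
    unfolding zlap_def dlap_def p_ax using h by simp
  have "\<bar>f (p (axis i 1)) - f (p 0)\<bar> <= 8 * CARD('n) * M / m + 2 * m * (h\<^sup>2 * G)"
  proof (rule discrete_gradient)
    show "0 < m" using m1 by linarith
    show "\<bar>f (p k)\<bar> <= M" if "!!j. \<bar>k $ j\<bar> <= int m" for k using M ball[OF that] by blast
    show "\<bar>zlap (%k. f (p k)) k\<bar> <= h\<^sup>2 * G" if "!!j. \<bar>k $ j\<bar> <= int m" for k
      unfolding zl abs_mult using G ball[OF that] h by (intro mult_mono) auto
  qed (use M0 in auto)
  moreover have "p (axis i 1) = step x h i" "p 0 = x"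
    by (auto simp: p_def vec_eq_iff axis_def)
  ultimately have "\<bar>dq h i f x\<bar> <= (8 * d * M / m + 2 * m * (h\<^sup>2 * G)) / h"
    unfolding dq_def abs_divide using h by (simp add: d_def divide_right_mono)
  also have "... = 8 * d * M / (m * h) + 2 * (m * h) * G"
    using h m1 by (simp add: field_simps power2_eq_square)
  also have "... <= 16 * d\<^sup>2 * M / \<rho> + 16 * d\<^sup>2 * (\<rho> * G)"
  proof (rule add_mono)
    have mh: "\<rho> / (2 * d) <= m * h" using m_ge h d1 by (simp add: field_simps)
    have "0 < \<rho> / (2 * d)" using \<rho> d1 by simp
    then have "8 * d * M / (m * h) <= 8 * d * M / (\<rho> / (2 * d))"
      using mh d1 M0 m1 h by (intro divide_left_mono mult_pos_pos) auto
    then show "8 * d * M / (m * h) <= 16 * d\<^sup>2 * M / \<rho>"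
      by (simp add: power2_eq_square mult_ac)
    have "m * h <= \<rho> / d" using m_le h d1 by (simp add: field_simps)
    also have "... <= \<rho>" using d1 \<rho> by (simp add: field_simps)
    finally have mh2: "m * h <= \<rho>" .
    have "1 <= d\<^sup>2" using d1 by (simp add: one_le_power)
    then have "1 * \<rho> <= d\<^sup>2 * \<rho>" using \<rho> by (intro mult_right_mono) auto
    then have "2 * (m * h) <= 16 * d\<^sup>2 * \<rho>" using mh2 \<rho> unfolding mult.assoc by linarith
    then show "2 * (m * h) * G <= 16 * d\<^sup>2 * (\<rho> * G)"
      using M0(2) mult_right_mono[of "2 * (m * h)" "16 * d\<^sup>2 * \<rho>" G] by simp
  qed
  finally show ?thesis by (simp add: d_def algebra_simps)
qed

section \<open>Algebra of iterated difference quotients\<close>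

lemma dqs_snoc: "dqs h (is @ [i]) f = dqs h is (dq h i f)"
  by (induction "is") auto

lemma dq_add: "dq h i (%y. f y + g y) x = dq h i f x + dq h i g x"
  by (simp add: dq_def field_simps add_divide_distrib diff_divide_distrib)

lemma dq_cmult: "dq h i (%y. k * f y) x = k * dq h i f x"
  by (simp add: dq_def algebra_simps)

lemma dq_const: "dq h i (%y. k) x = 0"
  by (simp add: dq_def)

lemma dqs_add: "dqs h is (%y. f y + g y) = (%x. dqs h is f x + dqs h is g x)"
  by (induction "is") (auto intro!: ext simp: dq_add)

lemma dqs_cmult: "dqs h is (%y. k * f y) = (%x. k * dqs h is f x)"
  by (induction "is") (auto intro!: ext simp: dq_cmult)

lemma dqs_0: "dqs h is (%y. 0) = (%x. 0)"
  by (induction "is") (auto intro!: ext simp: dq_const)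

lemma dqs_sum: "finite I ==> dqs h is (%y. \<Sum>j\<in>I. f j y) = (%x. \<Sum>j\<in>I. dqs h is (f j) x)"
  by (induction I rule: finite_induct) (auto simp: dqs_add dqs_0)

lemma dqs_shift: "dqs h is (%y. f (y + v)) x = dqs h is f (x + v)"
  by (induction "is" arbitrary: x) (auto simp: dq_def algebra_simps)

lemma dq_dlap: "dlap h (dq h i f) x = dq h i (dlap h f) x"
proof -
  have "dlap h (dq h i f) x = (\<Sum>j\<in>UNIV.
      ((f (step x h i + h *\<^sub>R axis j 1) + f (x + h *\<^sub>R axis i 1 - h *\<^sub>R axis j 1) - 2 * f (step x h i))
      - (f (step x h j) + f (x - h *\<^sub>R axis j 1) - 2 * f x)) / h) / h\<^sup>2"
    unfolding dlap_def dq_def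
    by (intro arg_cong2[where f = "(/)"] sum.cong)
      (auto simp: algebra_simps add_divide_distrib diff_divide_distrib)
  also have "... = dq h i (dlap h f) x"
    unfolding dlap_def dq_def sum_divide_distrib[symmetric] sum_subtractf
    by (simp add: diff_divide_distrib mult.commute)
  finally show ?thesis .
qed

lemma dqs_dlap: "dlap h (dqs h is f) = dqs h is (dlap h f)"
proof (induction "is")
  case (Cons i "is")
  have "dlap h (dqs h (i # is) f) = dq h i (dlap h (dqs h is f))" by (rule ext) (simp add: dq_dlap)
  then show ?case using Cons by simp
qed simp

lemma cball_step:
  fixes x :: "real^'n"
  assumes "0 <= h" "z \<in> cball (step x h i) (real m * h)"
  shows "z \<in> cball x (real (Suc m) * h)"
proof -
  have "dist x z <= dist x (step x h i) + dist (step x h i) z" by (rule dist_triangle)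
  then show ?thesis using assms by (simp add: dist_norm algebra_simps)
qed

lemma cball_mono_step:
  fixes x :: "real^'n"
  assumes "0 <= h" "z \<in> cball x (real m * h)"
  shows "z \<in> cball x (real (Suc m) * h)"
  using assms by (simp add: algebra_simps)

lemma dqs_cong:
  assumes "0 <= h" "!!z. z \<in> cball x (real (length is) * h) ==> f z = g z"
  shows "dqs h is f x = dqs h is g x"
  using assms(2)
proof (induction "is" arbitrary: x)
  case (Cons i "is")
  have "dqs h is f x = dqs h is g x"
    by (intro Cons(1) Cons(2)) (simp only: length_Cons cball_mono_step[OF assms(1)])
  moreover have "dqs h is f (step x h i) = dqs h is g (step x h i)"
    by (intro Cons(1) Cons(2)) (simp only: length_Cons cball_step[OF assms(1)])
  ultimately show ?case by (simp add: dq_def)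
qed simp

lemma dq_mult: "dq h i (%y. f y * g y) = (%x. dq h i f x * g x + f (step x h i) * dq h i g x)"
proof
  fix x show "dq h i (%y. f y * g y) x = dq h i f x * g x + f (step x h i) * dq h i g x"
    by (cases "h = 0") (auto simp: dq_def field_simps)
qed

text \<open>The discrete product rule evaluates one factor at a shifted point; \<open>m\<close>
  quotients therefore need the bounds on a ball of \<open>m\<close> mesh widths.\<close>

lemma dqs_mult_bound:
  fixes f g :: "real^'n => real"
  assumes "0 <= h"
    and "!!js z. length js <= m ==> z \<in> cball x (real m * h) ==> \<bar>dqs h js f z\<bar> <= A"
    and "!!js z. length js <= m ==> z \<in> cball x (real m * h) ==> \<bar>dqs h js g z\<bar> <= B"
    and "length is <= m"
  shows "\<bar>dqs h is (%y. f y * g y) x\<bar> <= 2 ^ m * A * B"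
  using assms(2-)
proof (induction m arbitrary: f g x "is")
  case 0
  have "\<bar>f x\<bar> <= A" "\<bar>g x\<bar> <= B" using 0(1)[of "[]" x] 0(2)[of "[]" x] by auto
  then have "\<bar>f x\<bar> * \<bar>g x\<bar> <= A * B" by (intro mult_mono) auto
  then show ?case using 0 by (simp add: abs_mult)
next
  case (Suc m)
  have xin: "x \<in> cball x (real (Suc m) * h)" using assms(1) by simp
  have AB: "\<bar>f x\<bar> <= A" "\<bar>g x\<bar> <= B" using Suc(2)[of "[]" x] Suc(3)[of "[]" x] xin by auto
  then have AB0: "0 <= A * B" by (meson abs_ge_zero mult_nonneg_nonneg order_trans)
  show ?case
  proof (cases "is" rule: rev_cases)
    case Nil
    have "\<bar>f x\<bar> * \<bar>g x\<bar> <= A * B" using AB by (intro mult_mono) auto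
    moreover have "1 * (A * B) <= 2 ^ Suc m * (A * B)"
      by (rule mult_right_mono) (use AB0 one_le_power[of "2::real" "Suc m"] in auto)
    ultimately show ?thesis using Nil by (simp add: abs_mult)
  next
    case (snoc js i)
    have js: "length js <= m" using Suc(4) snoc by simp
    have eq: "dqs h is (%y. f y * g y) x
        = dqs h js (%y. dq h i f y * g y) x + dqs h js (%y. f (step y h i) * dq h i g y) x"
      by (simp add: snoc dqs_snoc dq_mult dqs_add)
    have "\<bar>dqs h js (%y. dq h i f y * g y) x\<bar> <= 2 ^ m * A * B"
    proof (rule Suc(1)[OF _ _ js])
      fix ks :: "'n list" and z assume ks: "length ks <= m" "z \<in> cball x (real m * h)"
      show "\<bar>dqs h ks (dq h i f) z\<bar> <= A" "\<bar>dqs h ks g z\<bar> <= B"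
        using Suc(2)[of "ks @ [i]" z] Suc(3)[of ks z] ks cball_mono_step[OF assms(1) ks(2)]
        by (auto simp: dqs_snoc)
    qed
    moreover have "\<bar>dqs h js (%y. f (step y h i) * dq h i g y) x\<bar> <= 2 ^ m * A * B"
    proof (rule Suc(1)[OF _ _ js])
      fix ks :: "'n list" and z assume ks: "length ks <= m" "z \<in> cball x (real m * h)"
      have "step z h i \<in> cball (step x h i) (real m * h)" using ks by (simp add: dist_norm)
      then have "step z h i \<in> cball x (real (Suc m) * h)" by (rule cball_step[OF assms(1)])
      then show "\<bar>dqs h ks (%y. f (step y h i)) z\<bar> <= A"
        unfolding dqs_shift using ks by (intro Suc(2)) auto
      show "\<bar>dqs h ks (dq h i g) z\<bar> <= B"
        using Suc(3)[of "ks @ [i]" z] ks cball_mono_step[OF assms(1) ks(2)] by (auto simp: dqs_snoc)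
    qed
    ultimately show ?thesis unfolding eq by simp
  qed
qed

lemma dq_inverse:
  assumes "h ~= 0" "u x < 1" "u (step x h i) < 1"
  shows "dq h i (%y. 1 / (1 - u y)) x
    = 1 / (1 - u x) * (1 / (1 - u (step x h i))) * dq h i u x"
  using assms by (simp add: dq_def field_simps)

text \<open>One quotient turns the reciprocal into a product of two reciprocals, one of them
  shifted, and a quotient of \<open>u\<close>. Each order thus uses at most \<open>2 * m + 1\<close>
  further mesh widths, which \<open>2 * m * m\<close> accommodates. The bound is chosen before
  \<open>u\<close>, \<open>x\<close> and \<open>h\<close>.\<close>

lemma dqs_inverse_bound:
  fixes A K :: real
  shows "\<exists>C. \<forall>u x h. 0 < h --> (\<forall>z\<in>cball x (real (2 * m * m) * h). u z < 1 & \<bar>1 / (1 - u z)\<bar> <= A) -->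
    (\<forall>js. \<forall>z\<in>cball x (real (2 * m * m) * h). length js <= m --> \<bar>dqs h js u z\<bar> <= K) -->
    (\<forall>js. length (js :: 'n::finite list) <= m --> \<bar>dqs h js (%y. 1 / (1 - u y)) x\<bar> <= C)"
proof (induction m)
  case 0
  show ?case by (intro exI[of _ A]) auto
next
  case (Suc m)
  define r where "r = real (2 * m * m)"
  define r' where "r' = real (2 * Suc m * Suc m)"
  have rr: "r + 2 * real m + 1 <= r'" "0 <= r" by (auto simp: r_def r'_def)
  obtain C where C: "!!u x h js. 0 < h ==>
    (!!z. z\<in>cball x (r * h) ==> u z < 1 & \<bar>1 / (1 - u z)\<bar> <= A) ==>
    (!!js z. z\<in>cball x (r * h) ==> length (js :: 'n list) <= m ==> \<bar>dqs h js u z\<bar> <= K) ==>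
    length (js :: 'n list) <= m ==> \<bar>dqs h js (%y. 1 / (1 - u y)) x\<bar> <= C"
    using Suc unfolding r_def by metis
  show ?case unfolding r'_def[symmetric]
  proof (intro exI[of _ "max A (2 ^ m * (2 ^ m * C * C) * K)"] allI impI)
    fix u :: "real^'n => real" and x and h :: real and js :: "'n list"
    assume h: "0 < h" and u: "\<forall>z\<in>cball x (r' * h). u z < 1 & \<bar>1 / (1 - u z)\<bar> <= A"
      and d: "\<forall>js. \<forall>z\<in>cball x (r' * h). length (js :: 'n list) <= Suc m --> \<bar>dqs h js u z\<bar> <= K"
      and js: "length js <= Suc m"
    define P where "P y = 1 / (1 - u y)" for y
    have sub: "w \<in> cball x (r' * h)" if "dist x z <= (2 * real m + 1) * h" "w \<in> cball z (r * h)" for w z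
    proof -
      have "dist x w <= dist x z + dist z w" by (rule dist_triangle)
      also have "... <= (2 * real m + 1) * h + r * h" using that by (intro add_mono) auto
      also have "... <= r' * h" using rr h mult_right_mono[of "r + 2 * real m + 1" r' h] by (simp add: algebra_simps)
      finally show ?thesis by simp
    qed
    have CP: "\<bar>dqs h ks P z\<bar> <= C"
      if "dist x z <= (2 * real m + 1) * h" "length ks <= m" for ks z
      unfolding P_def
    proof (rule C[OF h _ _ that(2)])
      show "u w < 1 & \<bar>1 / (1 - u w)\<bar> <= A" if "w \<in> cball z (r * h)" for w
        using sub[OF \<open>dist x z <= _\<close> that] u by blast
      show "\<bar>dqs h js u w\<bar> <= K" if "w \<in> cball z (r * h)" "length js <= m" for w js
        using sub[OF \<open>dist x z <= _\<close> that(1)] d that by auto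
    qed
    have u': "u z < 1" "\<bar>1 / (1 - u z)\<bar> <= A" and d': "length ls <= Suc m ==> \<bar>dqs h ls u z\<bar> <= K"
      if "dist x z <= (2 * real m + 1) * h" for z ls
      using sub[OF that, of z] rr h u d by auto
    show "\<bar>dqs h js (%y. 1 / (1 - u y)) x\<bar> <= max A (2 ^ m * (2 ^ m * C * C) * K)"
    proof (cases js rule: rev_cases)
      case Nil
      have "\<bar>1 / (1 - u x)\<bar> <= A" using u'(2)[of x] h by simp
      then show ?thesis using Nil by simp
    next
      case (snoc ks i)
      have ks: "length ks <= m" using js snoc by simp
      have near: "dist x z <= (2 * real m + 1) * h" "dist x (step z h i) <= (2 * real m + 1) * h"
        if "z \<in> cball x (2 * real m * h)" for z
      proof -
        show "dist x z <= (2 * real m + 1) * h" using that h by (simp add: algebra_simps)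
        have "step z h i \<in> cball (step x h i) (real (2 * m) * h)" using that by (simp add: dist_norm)
        then have "step z h i \<in> cball x (real (Suc (2 * m)) * h)"
          using cball_step[of h "step z h i" x i "2 * m"] h by simp
        then show "dist x (step z h i) <= (2 * real m + 1) * h" by (simp add: add.commute)
      qed
      have "dqs h js P x = dqs h ks (dq h i P) x" by (simp add: snoc dqs_snoc)
      also have "... = dqs h ks (%y. (P y * P (step y h i)) * dq h i u y) x"
      proof (rule dqs_cong)
        fix z assume "z \<in> cball x (real (length ks) * h)"
        then have z: "z \<in> cball x (2 * real m * h)"
          using ks h by (auto intro: order_trans[OF _ mult_right_mono])
        show "dq h i P z = (P z * P (step z h i)) * dq h i u z"
          unfolding P_def using h near[OF z] u'(1) by (intro dq_inverse) auto
      qed (use h in auto)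
      finally have eq: "dqs h js P x = dqs h ks (%y. (P y * P (step y h i)) * dq h i u y) x" .
      have "\<bar>dqs h ks (%y. (P y * P (step y h i)) * dq h i u y) x\<bar> <= 2 ^ m * (2 ^ m * C * C) * K"
      proof (rule dqs_mult_bound[OF _ _ _ ks])
        fix ls :: "'n list" and z assume ls: "length ls <= m" "z \<in> cball x (real m * h)"
        have z2: "z \<in> cball x (2 * real m * h)"
          using ls h by (auto intro: order_trans[OF _ mult_right_mono])
        have "\<bar>dqs h (ls @ [i]) u z\<bar> <= K" using d'[OF near(1)[OF z2], of "ls @ [i]"] ls by simp
        then show "\<bar>dqs h ls (dq h i u) z\<bar> <= K" by (simp add: dqs_snoc)
        have w: "w \<in> cball x (2 * real m * h)" if "w \<in> cball z (real m * h)" for w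
          using that ls dist_triangle[of x w z] by simp
        show "\<bar>dqs h ls (%y. P y * P (step y h i)) z\<bar> <= 2 ^ m * C * C"
        proof (rule dqs_mult_bound[OF _ _ _ ls(1)])
          fix ks :: "'n list" and w assume *: "length ks <= m" "w \<in> cball z (real m * h)"
          show "\<bar>dqs h ks P w\<bar> <= C" "\<bar>dqs h ks (%y. P (step y h i)) w\<bar> <= C"
            unfolding dqs_shift using CP near[OF w[OF *(2)]] *(1) by auto
        qed (use h in auto)
      qed (use h in auto)
      then show ?thesis unfolding P_def[symmetric] eq by simp
    qed
  qed
qed

text \<open>Interior estimates uniform in the mesh: \<open>C\<close> and \<open>h0\<close> are fixed
  before \<open>u\<close>, \<open>lam\<close> and the coefficients. The induction over the order
  shrinks the ball; the sum of all quotients of the next order satisfies the hypothesis of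
  \<open>absorb\<close>, because the equation contains that order only linearly, through the
  drift.\<close>

lemma discrete_regularity:
  fixes A :: "nat => real" and d0 L R :: real
  assumes d0: "0 < d0" and R: "0 < R"
  shows "\<exists>C h0. 0 < h0 & (\<forall>h u lam c (x0::real^'n). 0 < h & h < h0 & \<bar>lam\<bar> <= L &
    (\<forall>x\<in>ball x0 R. 0 <= u x & u x <= 1 - d0 &
      dlap h u x = (\<Sum>i\<in>UNIV. c i x * dq h i u x) - lam / (1 - u x)\<^sup>2) &
    (\<forall>is i. \<forall>x\<in>ball x0 R. length is <= k --> \<bar>dqs h is (c i) x\<bar> <= A (length is)) -->
    (\<forall>is. length is <= k --> \<bar>dqs h is u x0\<bar> <= C))"
  using R
proof (induction k arbitrary: R)
  case 0
  show ?case
  proof (intro exI[of _ 1] conjI allI impI)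
    fix h lam :: real and u and c :: "'n => real^'n => real" and x0 :: "real^'n" and "is" :: "'n list"
    assume *: "0 < h & h < 1 & \<bar>lam\<bar> <= L &
      (\<forall>x\<in>ball x0 R. 0 <= u x & u x <= 1 - d0 &
        dlap h u x = (\<Sum>i\<in>UNIV. c i x * dq h i u x) - lam / (1 - u x)\<^sup>2) &
      (\<forall>is i. \<forall>x\<in>ball x0 R. length is <= 0 --> \<bar>dqs h is (c i) x\<bar> <= A (length is))" "length is <= 0"
    have "x0 \<in> ball x0 R" using 0 by simp
    then have "0 <= u x0 & u x0 <= 1 - d0" using * by blast
    then show "\<bar>dqs h is u x0\<bar> <= 1" using * d0 by auto
  qed simp
next
  case (Suc k)
  obtain C1 h1 where h1: "0 < h1" and IH0: "\<forall>h u lam c (x0::real^'n). 0 < h & h < h1 & \<bar>lam\<bar> <= L &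
    (\<forall>x\<in>ball x0 (R/2). 0 <= u x & u x <= 1 - d0 &
      dlap h u x = (\<Sum>i\<in>UNIV. c i x * dq h i u x) - lam / (1 - u x)\<^sup>2) &
    (\<forall>is i. \<forall>x\<in>ball x0 (R/2). length is <= k --> \<bar>dqs h is (c i) x\<bar> <= A (length is)) -->
    (\<forall>is. length is <= k --> \<bar>dqs h is u x0\<bar> <= C1)"
    using Suc.IH[of "R/2"] Suc.prems by auto
  have IH: "\<bar>dqs h is u x0\<bar> <= C1" if "0 < h" "h < h1" "\<bar>lam\<bar> <= L"
    "!!x. x\<in>ball x0 (R/2) ==> 0 <= u x & u x <= 1 - d0 &
      dlap h u x = (\<Sum>i\<in>UNIV. c i x * dq h i u x) - lam / (1 - u x)\<^sup>2"
    "!!is i x. x\<in>ball x0 (R/2) ==> length is <= k ==> \<bar>dqs h is (c i) x\<bar> <= A (length is)"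
    "length is <= k" for h lam u c and x0 :: "real^'n" and "is"
    using IH0[rule_format, of h lam x0 u c "is"] that by blast
  define C where "C = max C1 1"
  define d where "d = real CARD('n)"
  obtain CP where CP: "!!u x h js. 0 < h ==>
    (!!z. z\<in>cball x (real (2 * k * k) * h) ==> u z < 1 & \<bar>1 / (1 - u z)\<bar> <= 1 / d0) ==>
    (!!js z. z\<in>cball x (real (2 * k * k) * h) ==> length (js :: 'n list) <= k ==> \<bar>dqs h js u z\<bar> <= C) ==>
    length (js :: 'n list) <= k ==> \<bar>dqs h js (%y. 1 / (1 - u y)) x\<bar> <= CP"
    using dqs_inverse_bound[of k "1 / d0" C, where 'n='n] by metis
  define Ak where "Ak = (\<Sum>j\<le>k. \<bar>A j\<bar>)"
  \<comment> \<open>\<open>K\<close> and \<open>K'\<close> split the bound for \<open>dlap\<close>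
    of a quotient of order \<open>k\<close>: \<open>K'\<close> is the coefficient of the quotients
    of order \<open>k + 1\<close> in the drift.\<close>
  define K where "K = d * (2^k * Ak * C) + \<bar>L\<bar> * (2^k * CP * CP)"
  define K' where "K' = d * (2^k * Ak)"
  define J where "J = {js :: 'n list. length js = Suc k}"
  \<comment> \<open>The two summands stem from the gradient estimate and from the trivial bound on
    balls of few mesh widths.\<close>
  define G where "G = card J * (32 * d\<^sup>2 + 4 * (d + k))"
  \<comment> \<open>Room, in mesh widths, for the nested product rules behind the quotients of the
    nonlinearity.\<close>
  define q where "q = real (2 * k * k) + 2 * real k + 2"
  \<comment> \<open>The second entry is the smallness condition of \<open>absorb\<close>.\<close>
  define R' where "R' = min (R / 4) (1 / (2 * (G * K' + 1)))"
  define h0 where "h0 = min h1 (R / (4 * q))"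
  have R0: "0 < R" using Suc.prems .
  have d1: "1 <= d" unfolding d_def using finite_UNIV_card_ge_0[where 'a='n] by (simp add: Suc_leI)
  have finJ: "finite J" unfolding J_def using finite_lists_length_eq[of "UNIV :: 'n set" "Suc k"] by simp
  have C1: "1 <= C" by (simp add: C_def)
  have Ak: "0 <= Ak" "!!j. j <= k ==> A j <= Ak"
    unfolding Ak_def by (auto intro!: sum_nonneg member_le_sum[of _ "{..k}" "%j. \<bar>A j\<bar>", THEN order_trans[OF abs_ge_self]])
  have CP2: "0 <= 2^k * CP * CP" by (simp add: mult.assoc)
  have K: "0 <= K" "0 <= K'" using d1 Ak C1 CP2 by (auto simp: K_def K'_def intro!: add_nonneg_nonneg)
  have G: "0 <= G" using d1 by (simp add: G_def)
  have q: "0 < q" by (simp add: q_def add_nonneg_pos)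
  have GK: "0 < 2 * (G * K' + 1)" using G K by (simp add: add_nonneg_pos)
  have R': "0 < R'" "R' <= R / 4" "G * K' * R' <= 1 / 2"
  proof -
    show "0 < R'" "R' <= R / 4" using R0 GK by (auto simp: R'_def)
    have "G * K' * R' <= G * K' * (1 / (2 * (G * K' + 1)))"
      using G K by (intro mult_left_mono) (auto simp: R'_def)
    also have "... <= 1 / 2" using G K GK by (simp add: field_simps)
    finally show "G * K' * R' <= 1 / 2" .
  qed
  have h0: "0 < h0" using h1 R0 q by (simp add: h0_def)
  show ?case
  proof (rule exI[of _ "max C (4 * G * C / R' + G * K * R')"], rule exI[of _ h0], intro conjI allI impI h0)
    fix h lam :: real and u and c and x0 :: "real^'n" and "is" :: "'n list"
    assume *: "0 < h & h < h0 & \<bar>lam\<bar> <= L &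
      (\<forall>x\<in>ball x0 R. 0 <= u x & u x <= 1 - d0 &
        dlap h u x = (\<Sum>i\<in>UNIV. c i x * dq h i u x) - lam / (1 - u x)\<^sup>2) &
      (\<forall>is i. \<forall>x\<in>ball x0 R. length is <= Suc k --> \<bar>dqs h is (c i) x\<bar> <= A (length is))"
    assume len: "length is <= Suc k"
    have h: "0 < h" "h < h1" "q * h <= R / 4" "\<bar>lam\<bar> <= L"
      using * q by (auto simp: h0_def field_simps)
    have eq: "0 <= u x" "u x <= 1 - d0" "dlap h u x = (\<Sum>i\<in>UNIV. c i x * dq h i u x) - lam / (1 - u x)\<^sup>2"
      "length is <= Suc k ==> \<bar>dqs h is (c i) x\<bar> <= A (length is)" if "x \<in> ball x0 R" for x i "is"
      using * that by blast+
    have low: "\<bar>dqs h is u x\<bar> <= C" if "x \<in> ball x0 (R/2)" "length is <= k" for x "is"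
    proof -
      have "z \<in> ball x0 R" if "z \<in> ball x (R/2)" for z
        using that \<open>x \<in> ball x0 (R/2)\<close> dist_triangle[of x0 z x] by simp
      then have "\<bar>dqs h is u x\<bar> <= C1"
        using eq that(2) h by (intro IH[of h lam x u c]) auto
      then show ?thesis by (simp add: C_def)
    qed
    have inR2: "z \<in> ball x0 (R/2)" if "x \<in> ball x0 R'" "dist x z <= q * h" for x z
      using that R' h dist_triangle[of x0 z x] by simp
    define D where "D x = (\<Sum>js\<in>J. \<bar>dqs h js u x\<bar>)" for x
    have D_ge: "\<bar>dqs h js u x\<bar> <= D x" if "length js = Suc k" for js x
      unfolding D_def using finJ that by (intro member_le_sum) (auto simp: J_def)
    have D_le: "D x <= card J * b" if le: "!!i js. length js = k ==> \<bar>dq h i (dqs h js u) x\<bar> <= b" for x and b :: real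
    proof -
      have "\<bar>dqs h js u x\<bar> <= b" if "js \<in> J" for js
        using that le by (cases js) (auto simp: J_def)
      then show ?thesis unfolding D_def using sum_bounded_above[of J "%js. \<bar>dqs h js u x\<bar>" b] by simp
    qed
    \<comment> \<open>Not uniform in \<open>h\<close>; it makes the supremum in
      \<open>absorb\<close> finite and serves for radii comparable to \<open>h\<close>.\<close>
    have triv: "\<bar>dq h i (dqs h js u) x\<bar> <= 2 * C / h" if "length js = k" "x \<in> ball x0 R'" for i js x
    proof -
      have "1 <= q" by (simp add: q_def)
      then have "h <= q * h" using h by simp
      then have "\<bar>dqs h js u (step x h i)\<bar> <= C" "\<bar>dqs h js u x\<bar> <= C"
        using that h by (auto intro!: low inR2[OF that(2)] simp: dist_norm)
      then have "\<bar>dqs h js u (step x h i) - dqs h js u x\<bar> <= 2 * C" by linarith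
      then show ?thesis unfolding dq_def abs_divide using h by (simp add: divide_right_mono)
    qed
    \<comment> \<open>Quotients commute with \<open>dlap\<close>, so the equation itself can be
      differenced; the nonlinearity then involves quotients of order at most \<open>k\<close>,
      already bounded by \<open>C\<close>.\<close>
    have rhs: "\<bar>dlap h (dqs h js u) z\<bar> <= K + K' * B"
      if js: "length js = k" and z: "z \<in> ball x0 R'" and B: "0 <= B" "!!w. w \<in> cball z (real k * h) ==> D w <= B"
      for js z B
    proof -
      have inz: "w \<in> ball x0 (R/2)" "w \<in> ball x0 R" if "dist z w <= (real (2 * k * k) + 2 * real k) * h" for w
      proof -
        have "dist z w <= q * h" using that h by (simp add: q_def algebra_simps)
        then show "w \<in> ball x0 (R/2)" by (rule inR2[OF z])
        then show "w \<in> ball x0 R" using R0 by simp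
      qed
      have inz1: "w \<in> ball x0 (R/2)" "w \<in> ball x0 R" if "w \<in> cball z (real k * h)" for w
      proof -
        have "real k * h <= (real (2 * k * k) + 2 * real k) * h" using h by (intro mult_right_mono) auto
        then have "dist z w <= (real (2 * k * k) + 2 * real k) * h" using that by (simp del: of_nat_mult)
        then show "w \<in> ball x0 (R/2)" "w \<in> ball x0 R" using inz by blast+
      qed
      define P where "P y = 1 / (1 - u y)" for y
      have "dlap h (dqs h js u) z = dqs h js (%x. (\<Sum>i\<in>UNIV. c i x * dq h i u x) + (- lam) * (P x * P x)) z"
        unfolding dqs_dlap
      proof (rule dqs_cong)
        fix w assume "w \<in> cball z (real (length js) * h)"
        then have "w \<in> ball x0 R" using inz1 js by simp
        then show "dlap h u w = (\<Sum>i\<in>UNIV. c i w * dq h i u w) + (- lam) * (P w * P w)"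
          using eq(3) by (simp add: P_def power2_eq_square)
      qed (use h in auto)
      also have "... = (\<Sum>i\<in>UNIV. dqs h js (%x. c i x * dq h i u x) z) + (- lam) * dqs h js (%x. P x * P x) z"
        by (simp only: dqs_add dqs_cmult dqs_sum[OF finite])
      finally have eq1: "dlap h (dqs h js u) z = ..." .
      have "\<bar>dqs h js (%x. c i x * dq h i u x) z\<bar> <= 2 ^ k * Ak * (C + B)" for i
      proof (rule dqs_mult_bound)
        fix ls :: "'n list" and w assume ls: "length ls <= k" "w \<in> cball z (real k * h)"
        show "\<bar>dqs h ls (c i) w\<bar> <= Ak"
          using eq(4)[OF inz1(2)[OF ls(2)], of ls i] Ak(2)[OF ls(1)] ls(1) by simp
        have "\<bar>dqs h (ls @ [i]) u w\<bar> <= C + B"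
        proof (cases "length ls = k")
          case True
          then show ?thesis using D_ge[of "ls @ [i]" w] B(2)[OF ls(2)] C1 by simp
        next
          case False
          then have "\<bar>dqs h (ls @ [i]) u w\<bar> <= C" using ls by (intro low inz1) auto
          then show ?thesis using B by simp
        qed
        then show "\<bar>dqs h ls (dq h i u) w\<bar> <= C + B" by (simp add: dqs_snoc)
      qed (use h js in auto)
      then have "\<bar>\<Sum>i\<in>UNIV. dqs h js (%x. c i x * dq h i u x) z\<bar> <= d * (2 ^ k * Ak * (C + B))"
        using sum_bounded_above[of "UNIV :: 'n set" "%i. \<bar>dqs h js (%x. c i x * dq h i u x) z\<bar>"]
        by (intro order_trans[OF sum_abs]) (simp add: d_def)
      moreover have "\<bar>dqs h js (%x. P x * P x) z\<bar> <= 2 ^ k * CP * CP"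
      proof (rule dqs_mult_bound)
        fix ls :: "'n list" and w assume ls: "length ls <= k" "w \<in> cball z (real k * h)"
        have v: "v \<in> ball x0 (R/2)" "v \<in> ball x0 R" if "v \<in> cball w (real (2 * k * k) * h)" for v
        proof -
          have "dist z v <= real k * h + real (2 * k * k) * h"
            using that ls dist_triangle[of z v w] by simp
          also have "... <= (real (2 * k * k) + 2 * real k) * h" using h by (simp add: algebra_simps)
          finally show "v \<in> ball x0 (R/2)" "v \<in> ball x0 R" using inz by blast+
        qed
        show "\<bar>dqs h ls P w\<bar> <= CP" unfolding P_def
        proof (rule CP[OF h(1) _ _ ls(1)])
          fix v' assume "v' \<in> cball w (real (2 * k * k) * h)"
          then have "u v' <= 1 - d0" using eq(2) v(2) by blast
          then show "u v' < 1 & \<bar>1 / (1 - u v')\<bar> <= 1 / d0"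
            using d0 by (auto intro: frac_le)
        qed (use v low in auto)
        then show "\<bar>dqs h ls P w\<bar> <= CP" .
      qed (use h js in auto)
      then have "\<bar>(- lam) * dqs h js (%x. P x * P x) z\<bar> <= \<bar>L\<bar> * (2 ^ k * CP * CP)"
        unfolding abs_mult using h(4) CP2 by (intro mult_mono) auto
      ultimately have "\<bar>dlap h (dqs h js u) z\<bar> <= d * (2 ^ k * Ak * (C + B)) + \<bar>L\<bar> * (2 ^ k * CP * CP)"
        unfolding eq1 by linarith
      then show ?thesis by (simp add: K_def K'_def algebra_simps)
    qed
    have "D x0 <= 4 * G * C / R' + G * K * R'"
    proof (rule absorb[where D = D and bd = "card J * (2 * C / h)" and K' = K'])
      show "0 <= D z & D z <= card J * (2 * C / h)" if "z \<in> ball x0 R'" for z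
        using D_le[OF triv[OF _ that]] by (simp add: D_def sum_nonneg)
      fix x and \<rho> B :: real
      assume \<rho>: "0 < \<rho>" "cball x \<rho> \<subseteq> ball x0 R'" and B: "0 <= B" "!!z. z \<in> cball x \<rho> ==> D z <= B"
      have "x \<in> cball x \<rho>" using \<rho>(1) by simp
      then have x: "x \<in> ball x0 R'" using \<rho>(2) by blast
      define T where "T = C / \<rho> + \<rho> * (K + K' * B)"
      have T: "C / \<rho> <= T" "\<rho> * (K + K' * B) <= T" "0 <= T"
        using \<rho> K B C1 by (auto simp: T_def)
      have "\<bar>dq h i (dqs h js u) x\<bar> <= (32 * d\<^sup>2 + 4 * (d + k)) * T" if js: "length js = k" for i js
      \<comment> \<open>A ball too small for the lattice estimate has radius below a multiple of
        \<open>h\<close>, and then the trivial bound \<open>2 * C / h\<close> is at most a multiple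
        of \<open>C / \<rho>\<close>.\<close>
      proof (cases "2 * (d + k) * h <= \<rho>")
        case True
        have dk: "d * h <= \<rho> / 2" "real k * h <= \<rho> / 2"
        proof -
          have "0 <= d * h" "0 <= real k * h" using d1 h by auto
          moreover have "2 * (d + k) * h = 2 * (d * h) + 2 * (real k * h)" by (simp add: algebra_simps)
          ultimately show "d * h <= \<rho> / 2" "real k * h <= \<rho> / 2" using True by linarith+
        qed
        have "\<bar>dq h i (dqs h js u) x\<bar> <= 16 * (CARD('n))\<^sup>2 * (C / (\<rho> / 2) + (\<rho> / 2) * (K + K' * B))"
        proof (rule dlap_gradient)
          fix z assume z: "z \<in> cball x (\<rho> / 2)"
          then have zR: "z \<in> ball x0 R'" using \<rho> by (auto simp: subset_iff)
          show "\<bar>dqs h js u z\<bar> <= C" using low[OF inR2[OF zR]] js q h by simp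
          show "\<bar>dlap h (dqs h js u) z\<bar> <= K + K' * B"
          proof (rule rhs[OF js zR B(1)])
            fix w assume "w \<in> cball z (real k * h)"
            then show "D w <= B" using z dk dist_triangle[of x w z] by (intro B) simp
          qed
        qed (use h dk C1 K B in \<open>auto simp: d_def\<close>)
        also have "... <= 32 * d\<^sup>2 * T"
        proof -
          have "C / (\<rho> / 2) + (\<rho> / 2) * (K + K' * B) <= 2 * T"
          proof -
            have "C / (\<rho> / 2) = 2 * (C / \<rho>)" "(\<rho> / 2) * (K + K' * B) = \<rho> * (K + K' * B) / 2" by auto
            moreover have "0 <= \<rho> * (K + K' * B)" using \<rho> K B by auto
            moreover have "X + Y <= 2 * (a + b)" if "X = 2 * a" "Y = b / 2" "0 <= b" for X Y a b :: real
              using that by simp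
            ultimately show ?thesis unfolding T_def by blast
          qed
          then have "16 * d\<^sup>2 * (C / (\<rho> / 2) + (\<rho> / 2) * (K + K' * B)) <= 16 * d\<^sup>2 * (2 * T)"
            by (intro mult_left_mono) auto
          then show ?thesis by (simp add: d_def)
        qed
        also have "... <= (32 * d\<^sup>2 + 4 * (d + k)) * T" using T d1 by (intro mult_right_mono) auto
        finally show ?thesis .
      next
        case False
        have "\<bar>dq h i (dqs h js u) x\<bar> <= 2 * C / h" using triv js x by blast
        also have "... <= 4 * (d + k) * (C / \<rho>)"
        proof -
          have "C * \<rho> <= C * (2 * (d + k) * h)" using False C1 by (intro mult_left_mono) auto
          then show ?thesis using h \<rho> by (simp add: field_simps)
        qed
        also have "... <= 4 * (d + k) * T" using T d1 by (intro mult_left_mono) auto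
        also have "... <= (32 * d\<^sup>2 + 4 * (d + k)) * T" using T by (intro mult_right_mono) auto
        finally show ?thesis .
      qed
      from D_le[OF this] show "D x <= G * (C / \<rho> + \<rho> * (K + K' * B))"
        by (simp add: G_def T_def mult.assoc)
    qed (use R' G C1 K in auto)
    moreover have "x0 \<in> ball x0 (R/2)" using R0 by simp
    ultimately show "\<bar>dqs h is u x0\<bar> <= max C (4 * G * C / R' + G * K * R')"
      using len low[of x0 "is"] D_ge[of "is" x0] by (cases "length is = Suc k") auto
  qed
qed

section \<open>Difference quotients of smooth functions\<close>

lemma line_deriv_dqs:
  fixes f :: "real^'n => real"
  assumes "0 < h" "!!z. z \<in> cball (step x t i) (real (length is) * h) ==> f differentiable (at z)"
  shows "((%s. dqs h is f (step x s i)) has_real_derivative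
    dqs h is (pd i f) (step x t i)) (at t)"
  using assms(2)
proof (induction "is" arbitrary: x)
  case Nil
  then show ?case using line_deriv[of f x t i] by simp
next
  case (Cons j "is")
  have comm: "step x h j + s *\<^sub>R axis i 1 = step x s i + h *\<^sub>R axis j 1" for s
    by simp
  have 1: "((%s. dqs h is f (step x s i)) has_real_derivative
      dqs h is (pd i f) (step x t i)) (at t)"
    by (intro Cons(1) Cons(2)) (simp only: length_Cons cball_mono_step less_imp_le[OF assms(1)])
  have "((%s. dqs h is f (step x h j + s *\<^sub>R axis i 1)) has_real_derivative
      dqs h is (pd i f) (step x h j + t *\<^sub>R axis i 1)) (at t)"
    unfolding comm
    by (intro Cons(1)[of "step x h j", unfolded comm] Cons(2))
      (simp only: length_Cons cball_step less_imp_le[OF assms(1)])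
  then have 2: "((%s. dqs h is f (step x s i + h *\<^sub>R axis j 1)) has_real_derivative
      dqs h is (pd i f) (step x t i + h *\<^sub>R axis j 1)) (at t)"
    unfolding comm .
  show ?case unfolding dqs.simps dq_def
    by (intro DERIV_cdivide DERIV_diff 1 2)
qed

text \<open>Each application of the mean value theorem trades the outermost quotient for a
  derivative in the innermost place, hence \<open>rev\<close>.\<close>

lemma dqs_MVT:
  fixes f :: "real^'n => real"
  assumes h: "0 < h" and S: "smooth_on S f" "cball x (real (length is) * h) \<subseteq> S"
  shows "\<exists>z\<in>cball x (real (length is) * h). dqs h is f x = Dd (rev is) f z"
  using S
proof (induction "is" arbitrary: f x)
  case (Cons i "is")
  have sub: "z \<in> cball x (real (length (i # is)) * h)"
    if "0 <= t" "t <= h" "z \<in> cball (step x t i) (real (length is) * h)" for t z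
  proof -
    have "dist x z <= dist x (step x t i) + dist (step x t i) z" by (rule dist_triangle)
    then show ?thesis using that by (simp add: dist_norm algebra_simps)
  qed
  have "\<exists>t. 0 < t & t < h & dqs h is f (step x h i) - dqs h is f (step x 0 i)
      = (h - 0) * dqs h is (pd i f) (step x t i)"
    using sub smooth_on_differentiable[OF Cons(2)] Cons(3)
    by (intro MVT2 h line_deriv_dqs) (auto simp del: mem_cball)
  then obtain t where t: "0 < t" "t < h"
    "dqs h is f (step x h i) - dqs h is f x = h * dqs h is (pd i f) (step x t i)" by auto
  have e: "dqs h (i # is) f x = dqs h is (pd i f) (step x t i)"
    using t h by (simp add: dq_def)
  have "cball (step x t i) (real (length is) * h) \<subseteq> S"
    using sub[of t] Cons(3) t by (auto simp del: mem_cball)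
  from Cons(1)[OF smooth_on_pd[OF Cons(2)] this] obtain z where
    "z \<in> cball (step x t i) (real (length is) * h)" "dqs h is (pd i f) (step x t i) = Dd (rev is) (pd i f) z"
    by blast
  then show ?case using e sub[of t z] t by (intro bexI[of _ z]) (simp_all add: Dd_snoc)
qed (use h in auto)

lemma dqs_smooth_bound:
  fixes f :: "real^'n => real"
  assumes "0 < h" "smooth_on S f" "cball x (real (length is) * h) \<subseteq> S"
    and "!!js z. length js = length is ==> z \<in> cball x (real (length is) * h) ==> \<bar>Dd js f z\<bar> <= A"
  shows "\<bar>dqs h is f x\<bar> <= A"
  using dqs_MVT[OF assms(1-3)] assms(4)[of "rev is"] by auto

lemma dqs_limit:
  fixes f :: "real^'n => real"
  assumes S: "open S" "x \<in> S" and f: "smooth_on S f"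
  shows "((%h. dqs h is f x) \<longlongrightarrow> Dd (rev is) f x) (at_right 0)"
proof (rule tendstoI)
  fix \<epsilon> :: real assume \<epsilon>: "0 < \<epsilon>"
  define g where "g = Dd (rev is) f"
  have "open (S \<inter> g -` ball (g x) \<epsilon>)" unfolding g_def
    by (rule continuous_open_preimage[OF smooth_on_continuous_on[OF smooth_on_Dd[OF f]] S(1) open_ball])
  then obtain d where d: "0 < d" "ball x d \<subseteq> S \<inter> g -` ball (g x) \<epsilon>"
    using S(2) \<epsilon> by (elim openE[of _ x]) auto
  have "0 < d / (real (length is) + 1)" using d(1) by (simp add: add_nonneg_pos)
  then have "\<forall>\<^sub>F h in at_right 0. h \<in> {0<..<d / (real (length is) + 1)}" by (rule eventually_at_right_real)
  then show "\<forall>\<^sub>F h in at_right 0. dist (dqs h is f x) (Dd (rev is) f x) < \<epsilon>"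
  proof eventually_elim
    case (elim h)
    then have "(real (length is) + 1) * h < d" by (simp add: pos_less_divide_eq add_nonneg_pos mult.commute)
    then have sub: "cball x (real (length is) * h) \<subseteq> ball x d" using elim by (auto simp: distrib_right)
    have "cball x (real (length is) * h) \<subseteq> S" using sub d(2) by blast
    with elim obtain z where "z \<in> cball x (real (length is) * h)" "dqs h is f x = g z"
      using dqs_MVT[OF _ f, of h x "is"] unfolding g_def by auto
    moreover from this have "g z \<in> ball (g x) \<epsilon>" using sub d(2) by blast
    ultimately show ?case by (simp add: g_def dist_commute)
  qed
qed

text \<open>Difference quotients in two directions commute exactly, and the limit transfers this to
  derivatives.\<close>

lemma pd_commute:
  fixes f :: "real^'n => real"
  assumes S: "open S" "x \<in> S" and f: "smooth_on S f"
  shows "pd i (pd j f) x = pd j (pd i f) x"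
proof -
  have "dqs h [i, j] f x = dqs h [j, i] f x" for h
    by (simp add: dq_def add_ac diff_divide_distrib)
  then show ?thesis
    using tendsto_unique[OF _ dqs_limit[OF S f, of "[i, j]"]] dqs_limit[OF S f, of "[j, i]"] by simp
qed

lemma Dd_pd:
  fixes f :: "real^'n => real"
  assumes "open S" "smooth_on S f" "x \<in> S"
  shows "Dd is (pd i f) x = pd i (Dd is f) x"
  using assms(3)
proof (induction "is" arbitrary: x)
  case (Cons j "is")
  have "Dd (j # is) (pd i f) x = pd j (pd i (Dd is f)) x"
    using pd_cong[OF assms(1) Cons(2) Cons(1)] by simp
  then show ?case using pd_commute[OF assms(1) Cons(2) smooth_on_Dd[OF assms(2)]] by simp
qed simp

lemma Dd_perm:
  fixes f :: "real^'n => real"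
  assumes "open S" "smooth_on S f" "mset is = mset js" "x \<in> S"
  shows "Dd is f x = Dd js f x"
  using assms(3,4)
proof (induction "is" arbitrary: js x)
  case (Cons i "is")
  then obtain a b where js: "js = a @ i # b"
    by (metis list.set_intros(1) mset_eq_setD split_list)
  have ab: "mset is = mset (a @ b)" using Cons(2) js by simp
  have "Dd (i # is) f x = pd i (Dd (a @ b) f) x"
    using pd_cong[OF assms(1) Cons(3) Cons(1)[OF ab]] by simp
  also have "... = pd i (Dd a (Dd b f)) x" by (simp add: Dd_append)
  also have "... = Dd a (pd i (Dd b f)) x"
    using Dd_pd[OF assms(1) smooth_on_Dd[OF assms(2)] Cons(3)] by simp
  finally show ?case by (simp add: js Dd_append)
qed simp

lemma dq_consistent:
  fixes f :: "real^'n => real"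
  assumes h: "0 < h" and f: "smooth_on S f" and sub: "cball x h \<subseteq> S"
    and K: "!!z. z \<in> cball x h ==> \<bar>pd i (pd i f) z\<bar> <= K"
  shows "\<bar>dq h i f x - pd i f x\<bar> <= h * K"
proof -
  have inb: "step x t i \<in> cball x h" if "0 <= t" "t <= h" for t
    using that by (simp add: dist_norm)
  obtain t where t: "0 < t" "t < h" "f (step x h i) - f x = h * pd i f (step x t i)"
  proof (rule line_MVT[OF h, of f x i])
    show "f differentiable (at (step x t i))" if "0 <= t" "t <= h" for t
      using smooth_on_differentiable[OF f subsetD[OF sub inb[OF that]]] .
  qed
  obtain s where s: "0 < s" "s < t"
    "pd i f (step x t i) - pd i f x = t * pd i (pd i f) (step x s i)"
  proof (rule line_MVT[OF t(1), of "pd i f" x i])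
    show "pd i f differentiable (at (step x s i))" if "0 <= s" "s <= t" for s
      using that t(2) by (intro smooth_on_differentiable[OF smooth_on_pd[OF f] subsetD[OF sub inb]]) auto
  qed
  have "dq h i f x - pd i f x = t * pd i (pd i f) (step x s i)"
    using t(3) s(3) h by (simp add: dq_def)
  moreover have "\<bar>t * pd i (pd i f) (step x s i)\<bar> <= h * K"
    unfolding abs_mult using t s K[OF inb] h by (intro mult_mono) auto
  ultimately show ?thesis by simp
qed

text \<open>Third-order Taylor expansion to both sides, the even terms adding up. After division by
  \<open>h\<^sup>2\<close> the error is of order \<open>h\<close>, which is all that convergence
  needs.\<close>

lemma second_difference_consistent:
  fixes f :: "real^'n => real"
  assumes h: "0 < h" and f: "smooth_on S f" and sub: "cball x h \<subseteq> S"
    and K: "!!z. z \<in> cball x h ==> \<bar>pd i (pd i (pd i f)) z\<bar> <= K"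
  shows "\<bar>f (step x h i) + f (x - h *\<^sub>R axis i 1) - 2 * f x - h\<^sup>2 * pd i (pd i f) x\<bar> <= h\<^sup>2 * (h * K)"
proof -
  define df where "df m t = Dd (replicate m i) f (step x t i)" for m t
  have inb: "step x t i \<in> cball x h" if "\<bar>t\<bar> <= h" for t
    using that by (simp add: dist_norm)
  have der: "(df m has_real_derivative df (Suc m) t) (at t)" if "\<bar>t\<bar> <= h" for m t
    using line_deriv[OF smooth_on_differentiable[OF smooth_on_Dd[OF f, of "replicate m i"]
        subsetD[OF sub inb[OF that]]]]
    by (simp add: df_def[abs_def])
  have df0: "df 0 = (%t. f (step x t i))" by (rule ext) (simp add: df_def)
  have K3: "\<bar>df 3 t\<bar> <= K" if "\<bar>t\<bar> <= h" for t
    using K[OF inb[OF that]] by (simp add: df_def numeral_3_eq_3)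
  obtain a where a: "0 < a" "a < h"
    "f (step x h i) = (\<Sum>m<3. df m 0 / fact m * h ^ m) + df 3 a / fact 3 * h ^ 3"
    using Maclaurin[of h 3 df "%t. f (step x t i)"] h der df0 by auto
  obtain b where b: "- h < b" "b < 0"
    "f (step x (- h) i) = (\<Sum>m<3. df m 0 / fact m * (- h) ^ m) + df 3 b / fact 3 * (- h) ^ 3"
    using Maclaurin_minus[of "-h" 3 df "%t. f (step x t i)"] h der df0 by auto
  have "f (step x h i) + f (x - h *\<^sub>R axis i 1) - 2 * f x - h\<^sup>2 * pd i (pd i f) x
      = (df 3 a - df 3 b) / 6 * h ^ 3"
    using a(3) b(3) by (simp add: numeral_3_eq_3 numeral_2_eq_2 df_def fact_numeral field_simps)
  moreover have "\<bar>(df 3 a - df 3 b) / 6 * h ^ 3\<bar> <= K * h ^ 3"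
  proof -
    have "\<bar>df 3 a\<bar> <= K" "\<bar>df 3 b\<bar> <= K" using a b by (auto intro!: K3)
    then have "\<bar>(df 3 a - df 3 b) / 6\<bar> <= K" unfolding abs_le_iff by (auto simp: field_simps)
    then show ?thesis unfolding abs_mult using h by (intro mult_mono) auto
  qed
  ultimately show ?thesis by (simp add: power3_eq_cube power2_eq_square mult_ac)
qed

lemma dlap_consistent:
  fixes f :: "real^'n => real"
  assumes h: "0 < h" and f: "smooth_on S f" and sub: "cball x h \<subseteq> S"
    and K: "!!i z. z \<in> cball x h ==> \<bar>pd i (pd i (pd i f)) z\<bar> <= K"
  shows "\<bar>dlap h f x - laplacian f x\<bar> <= real CARD('n) * (h * K)"
proof -
  define e where "e i = f (step x h i) + f (x - h *\<^sub>R axis i 1) - 2 * f x - h\<^sup>2 * pd i (pd i f) x" for i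
  have "dlap h f x - laplacian f x = (\<Sum>i\<in>UNIV. e i) / h\<^sup>2"
    using h by (simp add: dlap_def laplacian_def e_def sum_subtractf sum_distrib_left[symmetric] diff_divide_distrib)
  also have "\<bar>...\<bar> <= (\<Sum>i\<in>(UNIV::'n set). h\<^sup>2 * (h * K)) / h\<^sup>2"
  proof -
    have "\<bar>\<Sum>i\<in>UNIV. e i\<bar> <= (\<Sum>i\<in>(UNIV::'n set). h\<^sup>2 * (h * K))"
      using second_difference_consistent[OF h f sub K]
      by (intro order_trans[OF sum_abs] sum_mono) (auto simp: e_def)
    from divide_right_mono[OF this, of "h\<^sup>2"] show ?thesis by (simp only: abs_divide) simp
  qed
  also have "... = real CARD('n) * (h * K)" using h by simp
  finally show ?thesis .
qed

section \<open>Existence of solutions by discretization\<close>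

text \<open>Monotone iteration from 0 below the supersolution \<open>w\<close>: \<open>T u\<close>
  adds to \<open>u\<close> a multiple of its residual, small enough for \<open>T\<close> to preserve
  order. The set \<open>S\<close> may be infinite, since the iterates converge pointwise by
  monotonicity alone.\<close>

lemma discrete_solution_exists:
  fixes c :: "'n::finite => real^'n => real"
  assumes h: "0 < h" and lam: "0 <= lam"
    and S: "!!x. x \<in> S ==> cball x h \<subseteq> \<Omega>" and c: "!!i x. x \<in> S ==> h * \<bar>c i x\<bar> <= 1"
    and w: "!!x. x \<in> \<Omega> ==> 0 <= w x" "!!x. x \<in> \<Omega> ==> w x < 1"
    and super: "!!x. x \<in> S ==> dlap h w x - (\<Sum>i\<in>UNIV. c i x * dq h i w x) + lam / (1 - w x)\<^sup>2 <= 0"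
  obtains u where "!!x. 0 <= u x" "!!x. x \<notin> S ==> u x = 0" "!!x. x \<in> \<Omega> ==> u x <= w x"
    "!!x. x \<in> S ==> dlap h u x = (\<Sum>i\<in>UNIV. c i x * dq h i u x) - lam / (1 - u x)\<^sup>2"
proof -
  define d where "d = real CARD('n)"
  \<comment> \<open>For this step length each direction contributes the weights 2, 1, 1 (over
    \<open>4 * d\<close>) to the point and its two neighbours; the bound on \<open>h * c\<close>
    keeps them nonnegative when the drift is added.\<close>
  define \<tau> where "\<tau> = h\<^sup>2 / (4 * d)"
  have d1: "1 <= d" unfolding d_def using finite_UNIV_card_ge_0[where 'a='n] by (simp add: Suc_leI)
  have \<tau>: "0 < \<tau>" using h d1 by (simp add: \<tau>_def)
  define E where "E u x = (\<Sum>j\<in>UNIV. (2 + h * c j x) * u x + (1 - h * c j x) * u (step x h j)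
      + u (x - h *\<^sub>R axis j 1)) / (4 * d)" for u :: "real^'n => real" and x
  define T where "T u x = (if x \<in> S then E u x + \<tau> * (lam / (1 - u x)\<^sup>2) else 0)" for u x
  have T_id: "T u x - u x = \<tau> * (dlap h u x - (\<Sum>i\<in>UNIV. c i x * dq h i u x) + lam / (1 - u x)\<^sup>2)"
    if "x \<in> S" for u x
  proof -
    have "\<tau> * (dlap h u x - (\<Sum>i\<in>UNIV. c i x * dq h i u x))
        = (\<Sum>j\<in>UNIV. (u (step x h j) + u (x - h *\<^sub>R axis j 1) - 2 * u x)
            - h * c j x * (u (step x h j) - u x)) / (4 * d)"
    proof -
      have "\<tau> * dlap h u x
          = (\<Sum>j\<in>UNIV. u (step x h j) + u (x - h *\<^sub>R axis j 1) - 2 * u x) / (4 * d)"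
        using h by (simp add: \<tau>_def dlap_def)
      moreover have "\<tau> * (\<Sum>i\<in>UNIV. c i x * dq h i u x)
          = (\<Sum>j\<in>UNIV. h * c j x * (u (step x h j) - u x)) / (4 * d)"
        unfolding sum_distrib_left sum_divide_distrib
        using h d1 by (intro sum.cong) (auto simp: \<tau>_def dq_def field_simps power2_eq_square)
      ultimately show ?thesis by (simp only: right_diff_distrib sum_subtractf diff_divide_distrib)
    qed
    also have "... = (\<Sum>j\<in>UNIV. ((2 + h * c j x) * u x + (1 - h * c j x) * u (step x h j)
      + u (x - h *\<^sub>R axis j 1)) - 4 * u x) / (4 * d)"
      by (intro arg_cong2[where f = "(/)"] sum.cong) (auto simp: algebra_simps)
    also have "... = E u x - u x"
      unfolding E_def sum_subtractf using d1 by (simp add: diff_divide_distrib d_def)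
    finally show ?thesis using that by (simp add: T_def distrib_left)
  qed
  have nb: "x \<in> \<Omega>" "step x h j \<in> \<Omega>" "x - h *\<^sub>R axis j 1 \<in> \<Omega>" if "x \<in> S" for x and j :: 'n
    using S[OF that] h by (auto simp: subset_iff dist_norm)
  have T_mono: "T u x <= T v x"
    if uv: "!!y. y \<in> \<Omega> ==> u y <= v y" "!!y. y \<in> \<Omega> ==> v y < 1" for u v x
  proof (cases "x \<in> S")
    case True
    have cb: "- 1 <= h * c j x" "h * c j x <= 1" for j
    proof -
      have "\<bar>h * c j x\<bar> <= 1" using c[OF True, of j] h by (simp add: abs_mult)
      then show "- 1 <= h * c j x" "h * c j x <= 1" by linarith+
    qed
    have "(2 + h * c j x) * u x + (1 - h * c j x) * u (step x h j) + u (x - h *\<^sub>R axis j 1)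
        <= (2 + h * c j x) * v x + (1 - h * c j x) * v (step x h j) + v (x - h *\<^sub>R axis j 1)" for j
    proof -
      have "0 <= 2 + h * c j x" "0 <= 1 - h * c j x" using cb[of j] by linarith+
      then show ?thesis using nb(1)[OF True] nb(2,3)[OF True, of j] uv by (intro add_mono mult_left_mono) auto
    qed
    then have "E u x <= E v x" unfolding E_def using d1 by (intro divide_right_mono sum_mono) auto
    \<comment> \<open>Order is preserved because the nonlinearity increases below its singularity,
      which is why \<open>v\<close> has to stay below 1.\<close>
    moreover have "lam / (1 - u x)\<^sup>2 <= lam / (1 - v x)\<^sup>2"
      using uv[OF nb(1)[OF True]] lam by (intro divide_left_mono power_mono mult_pos_pos) auto
    then have "\<tau> * (lam / (1 - u x)\<^sup>2) <= \<tau> * (lam / (1 - v x)\<^sup>2)"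
      using \<tau> by (intro mult_left_mono) auto
    ultimately show ?thesis using True unfolding T_def by (simp only: if_True add_mono)
  qed (simp add: T_def)
  define U where "U n = (T ^^ n) (%_. 0)" for n
  have U_Suc: "U (Suc n) = T (U n)" for n by (simp add: U_def)
  have U: "(\<forall>x. 0 <= U n x) & (\<forall>x. U n x <= U (Suc n) x) & (\<forall>x\<in>\<Omega>. U n x <= w x)" for n
  proof (induction n)
    case 0
    \<comment> \<open>The zero function is a subsolution because \<open>lam\<close> is
      nonnegative.\<close>
    have "T (%_. 0) x \<ge> 0" for x
    proof (cases "x \<in> S")
      case True
      have "E (%_. 0) x = 0" by (simp add: E_def)
      then show ?thesis using True \<tau> lam by (simp add: T_def)
    qed (simp add: T_def)
    then show ?case using w by (simp add: U_def)
  next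
    case (Suc n)
    have "U n x <= U (Suc n) x" for x using Suc by blast
    moreover have Sw: "U (Suc n) x <= w x" if "x \<in> \<Omega>" for x
    proof (cases "x \<in> S")
      case True
      have "U (Suc n) x <= T w x" unfolding U_Suc using Suc w by (intro T_mono) auto
      also have "T w x <= w x" using T_id[OF True, of w] super[OF True] \<tau> mult_nonneg_nonpos[of \<tau>] by fastforce
      finally show ?thesis .
    next
      case False
      then show ?thesis using w(1)[OF that] by (simp add: U_Suc T_def)
    qed
    moreover have "U (Suc n) y < 1" if "y \<in> \<Omega>" for y
      using le_less_trans[OF Sw[OF that] w(2)[OF that]] .
    ultimately have "T (U n) x <= T (U (Suc n)) x" for x
      by (intro T_mono) auto
    then have "U (Suc n) x <= U (Suc (Suc n)) x" for x
      by (simp only: U_Suc)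
    moreover have "0 <= U (Suc n) x" for x using Suc order_trans by blast
    ultimately show ?case using Sw by blast
  qed
  have U0: "U n x = 0" if "x \<notin> S" for n x using that by (cases n) (auto simp: U_def T_def)
  define u where "u x = lim (%n. U n x)" for x
  have lim: "(%n. U n x) \<longlonglongrightarrow> u x" for x
  proof -
    have inc: "incseq (%n. U n x)" using U by (intro incseq_SucI) auto
    have "U n x <= 1" for n
    proof (cases "x \<in> S")
      case True
      then have "x \<in> \<Omega>" by (rule nb(1))
      then have "U n x <= w x" "w x < 1" using U w(2) by auto
      then show ?thesis by linarith
    qed (simp add: U0)
    then obtain l where "(%n. U n x) \<longlonglongrightarrow> l" using incseq_convergent[OF inc] by metis
    then show ?thesis unfolding u_def by (simp add: limI)
  qed
  have uw: "u x <= w x" if "x \<in> \<Omega>" for x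
    using lim[of x] U that by (intro LIMSEQ_le_const2[of "%n. U n x"]) auto
  have u0: "0 <= u x" for x using lim[of x] U by (intro LIMSEQ_le_const[of "%n. U n x"]) auto
  have uS: "u x = 0" if "x \<notin> S" for x using lim[of x] U0[OF that] by (simp add: LIMSEQ_const_iff)
  have fixp: "T u x = u x" if "x \<in> S" for x
  proof -
    have "1 - u x ~= 0" using uw[OF nb(1)[OF that]] w(2)[OF nb(1)[OF that]] by linarith
    then have "(%n. T (U n) x) \<longlonglongrightarrow> T u x"
      unfolding T_def E_def using that lim d1 by (auto intro!: tendsto_intros)
    moreover have "(%n. T (U n) x) \<longlonglongrightarrow> u x" using LIMSEQ_Suc[OF lim[of x]] by (simp add: U_Suc)
    ultimately show ?thesis using LIMSEQ_unique by blast
  qed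
  have "dlap h u x = (\<Sum>i\<in>UNIV. c i x * dq h i u x) - lam / (1 - u x)\<^sup>2" if "x \<in> S" for x
    using T_id[OF that, of u] fixp[OF that] \<tau> by simp
  then show ?thesis using that[of u] u0 uS uw by blast
qed

text \<open>When the indices include the points of a domain they are uncountable, and a convergent
  subsequence may not exist. Tychonoff's theorem gives a finer filter along which all components
  converge at once.\<close>

lemma cluster_filter:
  fixes s :: "nat => 'i => real"
  assumes "!!i. \<exists>C. \<forall>\<^sub>F m in sequentially. \<bar>s m i\<bar> <= C"
  obtains G V where "G ~= bot" "G <= sequentially" "!!i. ((%m. s m i) \<longlongrightarrow> V i) G"
proof -
  obtain C where C: "!!i. \<forall>\<^sub>F m in sequentially. \<bar>s m i\<bar> <= C i" using assms by metis
  \<comment> \<open>The bounds hold only eventually. Clamping puts every term into one compact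
    product and alters each component for finitely many \<open>m\<close> only.\<close>
  define t where "t m i = max (- \<bar>C i\<bar>) (min \<bar>C i\<bar> (s m i))" for m i
  define K where "K = PiE UNIV (%i. {- \<bar>C i\<bar>..\<bar>C i\<bar>})"
  define F where "F = filtermap t sequentially"
  have tK: "t m \<in> K" for m by (auto simp: K_def t_def)
  have "compactin (product_topology (%i. euclidean) UNIV) K"
    unfolding K_def compactin_PiE by auto
  then have "compact K" by (simp add: euclidean_product_topology)
  moreover have "F ~= bot" by (simp add: F_def filtermap_bot_iff)
  moreover have "eventually (%x. x \<in> K) F" using tK by (simp add: F_def eventually_filtermap)
  ultimately obtain v where v: "inf (nhds v) F ~= bot" unfolding compact_filter by blast
  \<comment> \<open>The indices at which the clamped sequence is near the cluster point, restricted
    to large ones.\<close>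
  define G where "G = inf (filtercomap t (nhds v)) sequentially"
  have "G ~= bot"
  proof
    assume "G = bot"
    then have "eventually (%_. False) G" by simp
    then obtain P Q where PQ: "eventually P (filtercomap t (nhds v))" "eventually Q sequentially"
      "!!m. P m ==> Q m ==> False" unfolding G_def eventually_inf by blast
    then obtain P' where P': "eventually P' (nhds v)" "!!m. P' (t m) ==> P m"
      unfolding eventually_filtercomap by blast
    have "eventually (%y. \<exists>m. Q m & y = t m) F"
      unfolding F_def eventually_filtermap using PQ(2) by (rule eventually_mono) auto
    then have "eventually (%_. False) (inf (nhds v) F)"
      unfolding eventually_inf using P' PQ(3) by blast
    then show False using v by (simp add: eventually_False)
  qed
  moreover have Gs: "G <= sequentially" by (simp add: G_def)
  moreover have "((%m. s m i) \<longlongrightarrow> v i) G" for i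
  proof -
    have "filterlim t (nhds v) (filtercomap t (nhds v))" by (rule filterlim_filtercomap)
    then have "(t \<longlongrightarrow> v) G" unfolding G_def by (rule filterlim_mono) auto
    have "((%m. t m i) \<longlongrightarrow> v i) G"
    proof (rule topological_tendstoI)
      fix S :: "real set" assume S: "open S" "v i \<in> S"
      have "open ((%x. x i) -` S)"
        using S(1) continuous_on_product_coordinates by (rule open_vimage)
      then have "\<forall>\<^sub>F m in G. t m \<in> (%x. x i) -` S"
        using \<open>(t \<longlongrightarrow> v) G\<close> S(2) by (intro topological_tendstoD) auto
      then show "\<forall>\<^sub>F m in G. t m i \<in> S" by simp
    qed
    moreover have "\<forall>\<^sub>F m in G. t m i = s m i"
      using Gs C[of i] by (rule filter_leD[THEN eventually_mono]) (auto simp: t_def)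
    ultimately show ?thesis by (rule Lim_transform_eventually)
  qed
  ultimately show ?thesis using that by blast
qed

text \<open>The remainders in the hypothesis are one-sided, \<open>t \<ge> 0\<close>, since that is what forward
  difference quotients provide in the limit.\<close>

lemma smooth_on_if_taylor:
  fixes V :: "'n::finite list => real^'n => real"
  assumes \<Omega>: "open \<Omega>"
    and V: "!!x0 k. x0 \<in> \<Omega> ==> \<exists>C r. 0 < r & ball x0 r \<subseteq> \<Omega> &
      (\<forall>is x. length is <= k --> x \<in> ball x0 r --> \<bar>V is x\<bar> <= C) &
      (\<forall>is x i t. length is <= k --> x \<in> ball x0 r --> step x t i \<in> ball x0 r --> 0 <= t -->
        \<bar>V is (step x t i) - V is x - t * V (i # is) x\<bar> <= C * t\<^sup>2)"
  shows "smooth_on \<Omega> (V [])" "!!is x. x \<in> \<Omega> ==> Dd is (V []) x = V is x"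
proof -
  have der: "V is differentiable (at x0) & pd i (V is) x0 = V (i # is) x0" if x0: "x0 \<in> \<Omega>" for x0 "is" i
  proof -
    obtain C r0 where r0: "0 < r0" "ball x0 r0 \<subseteq> \<Omega>"
      and bd: "!!js x. length js <= length is + 2 ==> x \<in> ball x0 r0 ==> \<bar>V js x\<bar> <= C"
      and ty: "!!js x i t. length js <= length is + 2 ==> x \<in> ball x0 r0 ==> step x t i \<in> ball x0 r0 ==> 0 <= t ==>
        \<bar>V js (step x t i) - V js x - t * V (i # js) x\<bar> <= C * t\<^sup>2"
      using V[OF x0, of "length is + 2"] by blast
    \<comment> \<open>Steps inside the ball then have length at most 1, so their squares are bounded
      by their lengths.\<close>
    define r where "r = min r0 (1/2)"
    have r: "0 < r" "r <= r0" "r <= 1/2" using r0 by (auto simp: r_def)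
    have sub: "ball x0 r \<subseteq> ball x0 r0" using r by auto
    have C0: "0 <= C" using bd[of "[]" x0] r0(1) by (simp add: order_trans[OF abs_ge_zero])
    have tsmall: "\<bar>t\<bar> <= 1" if "x \<in> ball x0 r" "step x t i \<in> ball x0 r" for x t and i :: 'n
    proof -
      have "dist x (step x t i) <= dist x0 x + dist x0 (step x t i)" by (rule dist_triangle3)
      then show ?thesis using that r by (simp add: dist_norm)
    qed
    have lip1: "\<bar>V js (step x t i) - V js x\<bar> <= 2 * C * \<bar>t\<bar>"
      if js: "length js <= length is + 1" and x: "x \<in> ball x0 r" "step x t i \<in> ball x0 r" for js x t i
    proof -
      have pos: "\<bar>V js (step x t i) - V js x\<bar> <= 2 * C * t"
        if x: "x \<in> ball x0 r" "step x t i \<in> ball x0 r" and t: "0 <= t" for x t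
      proof -
        have "\<bar>V js (step x t i) - V js x - t * V (i # js) x\<bar> <= C * t\<^sup>2"
          using js x t sub by (intro ty) (auto simp del: mem_ball)
        moreover have "\<bar>t * V (i # js) x\<bar> <= t * C"
          unfolding abs_mult using t bd[of "i # js" x] js x sub
          by (intro mult_mono) (auto simp del: mem_ball)
        moreover have "C * t\<^sup>2 <= C * t"
          using tsmall[OF x] t C0 by (intro mult_left_mono) (auto simp: power2_eq_square mult_left_le)
        ultimately have "\<bar>V js (step x t i) - V js x\<bar> <= C * t + t * C" by linarith
        then show ?thesis by simp
      qed
      show ?thesis
      proof (cases "0 <= t")
        case True then show ?thesis using pos[OF x] by simp
      next
        case False
        then show ?thesis using pos[of "step x t i" "-t"] x by (simp add: abs_minus_commute del: mem_ball)
      qed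
    qed
    have tay: "\<bar>V is (step x t i) - V is x - t * V (i # is) x\<bar> <= 3 * C * t\<^sup>2"
      if x: "x \<in> ball x0 r" "step x t i \<in> ball x0 r" for x t i
    proof (cases "0 <= t")
      case True
      then have "\<bar>V is (step x t i) - V is x - t * V (i # is) x\<bar> <= C * t\<^sup>2"
        using x sub by (intro ty) (auto simp del: mem_ball)
      also have "... <= 3 * C * t\<^sup>2" using C0 by (intro mult_right_mono) auto
      finally show ?thesis .
    next
      case False
      \<comment> \<open>A negative step is a positive step from the other end; moving
        \<open>V (i # is)\<close> from that end back to \<open>x\<close> costs
        \<open>2 * C * t\<^sup>2\<close>, whence the constant 3.\<close>
      define y where "y = step x t i"
      have "\<bar>V is (step y (- t) i) - V is y - (- t) * V (i # is) y\<bar> <= C * (- t)\<^sup>2"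
        using ty[of "is" y "-t" i] x sub False by (auto simp: y_def simp del: mem_ball)
      then have 1: "\<bar>V is x - V is y + t * V (i # is) y\<bar> <= C * t\<^sup>2" by (simp add: y_def)
      have "\<bar>V (i # is) y - V (i # is) x\<bar> <= 2 * C * \<bar>t\<bar>" unfolding y_def using x by (intro lip1) auto
      then have "\<bar>t\<bar> * \<bar>V (i # is) y - V (i # is) x\<bar> <= \<bar>t\<bar> * (2 * C * \<bar>t\<bar>)" by (intro mult_left_mono) auto
      also have "... = 2 * C * t\<^sup>2" by (simp add: power2_eq_square)
      finally have 2: "\<bar>t * V (i # is) y - t * V (i # is) x\<bar> <= 2 * C * t\<^sup>2"
        by (simp add: abs_mult[symmetric] right_diff_distrib)
      show ?thesis using 1 2 unfolding y_def[symmetric] by linarith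
    qed
    \<comment> \<open>From \<open>x0\<close> to \<open>x0 + y\<close> one coordinate at a time:
      \<open>part J y\<close> keeps the coordinates in \<open>J\<close>, and all corners of the path
      stay in the ball.\<close>
    define part where "part J y = (\<Sum>j\<in>J. (y $ j) *\<^sub>R axis j (1::real))" for J and y :: "real^'n"
    have part_nth: "part J y $ i = (if i \<in> J then y $ i else 0)" for J y i
    proof -
      have "part J y $ i = (\<Sum>j\<in>J. if j = i then y $ j else 0)"
        unfolding part_def sum_component by (intro sum.cong) (auto simp: axis_def)
      then show ?thesis by simp
    qed
    have part_norm: "norm (part J y) <= norm y" for J y
    proof (rule norm_le_componentwise_cart)
      fix i show "norm (part J y $ i) <= norm (y $ i)"
        by (auto simp: part_nth)
    qed
    have inb: "x0 + part J y \<in> ball x0 r" if "norm y < r" for J y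
      using that part_norm[of J y] by (simp add: dist_norm)
    have stepeq: "x0 + part (insert j J) y = x0 + part J y + (y $ j) *\<^sub>R axis j 1" if "j \<notin> J" for j J y
      using that by (simp add: part_def)
    have yj: "\<bar>y $ j\<bar> <= norm y" for y :: "real^'n" and j by (rule component_le_norm_cart)
    have lip: "\<bar>V js (x0 + part J y) - V js x0\<bar> <= card J * (2 * C * norm y)"
      if "length js <= length is + 1" "norm y < r" for js J y
      using finite[of J]
    proof (induction J rule: finite_induct)
      case (insert j J)
      have "\<bar>V js (x0 + part J y + (y $ j) *\<^sub>R axis j 1) - V js (x0 + part J y)\<bar> <= 2 * C * \<bar>y $ j\<bar>"
        using that inb[OF that(2), of J] inb[OF that(2), of "insert j J"] insert(2) stepeq
        by (intro lip1) auto
      also have "... <= 2 * C * norm y" using C0 yj by (intro mult_left_mono) auto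
      finally show ?case using insert unfolding stepeq[OF insert(2)] by (simp add: algebra_simps)
    qed (simp add: part_def)
    \<comment> \<open>Every coordinate step is expanded at its own corner; \<open>lip\<close> moves
      the derivative back to \<open>x0\<close> at quadratic cost.\<close>
    have exp: "\<bar>V is (x0 + part J y) - V is x0 - (\<Sum>j\<in>J. y $ j * V (j # is) x0)\<bar>
        <= card J * ((3 * C + 2 * C * CARD('n)) * (norm y)\<^sup>2)" if y: "norm y < r" for J y
      using finite[of J]
    proof (induction J rule: finite_induct)
      case (insert j J)
      have yj2: "(y $ j)\<^sup>2 <= (norm y)\<^sup>2" using yj[of y j] abs_le_square_iff[of "y $ j" "norm y"] by simp
      have "\<bar>V is (x0 + part J y + (y $ j) *\<^sub>R axis j 1) - V is (x0 + part J y)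
          - y $ j * V (j # is) (x0 + part J y)\<bar> <= 3 * C * (y $ j)\<^sup>2"
        using inb[OF y, of J] inb[OF y, of "insert j J"] insert(2) stepeq by (intro tay) auto
      also have "... <= 3 * C * (norm y)\<^sup>2" using C0 yj2 by (intro mult_left_mono) auto
      finally have 1: "\<bar>V is (x0 + part J y + (y $ j) *\<^sub>R axis j 1) - V is (x0 + part J y)
          - y $ j * V (j # is) (x0 + part J y)\<bar> <= 3 * C * (norm y)\<^sup>2" .
      have "\<bar>V (j # is) (x0 + part J y) - V (j # is) x0\<bar> <= card J * (2 * C * norm y)"
        using y by (intro lip) auto
      also have "... <= CARD('n) * (2 * C * norm y)"
        using C0 by (intro mult_right_mono) (auto intro: card_mono)
      finally have "\<bar>y $ j\<bar> * \<bar>V (j # is) (x0 + part J y) - V (j # is) x0\<bar> <= norm y * (CARD('n) * (2 * C * norm y))"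
        using yj by (intro mult_mono) auto
      then have 2: "\<bar>y $ j * V (j # is) (x0 + part J y) - y $ j * V (j # is) x0\<bar>
          <= 2 * C * CARD('n) * (norm y)\<^sup>2"
        by (simp add: abs_mult[symmetric] right_diff_distrib power2_eq_square mult_ac)
      show ?case using insert(1,2,3) 1 2 unfolding stepeq[OF insert(2)]
        by (simp add: algebra_simps)
    qed (simp add: part_def)
    define B where "B = CARD('n) * (3 * C + 2 * C * CARD('n))"
    have part_UNIV: "part UNIV y = y" for y
      by (auto simp: part_nth vec_eq_iff)
    have "(V is has_derivative (%v. \<Sum>j\<in>UNIV. v $ j * V (j # is) x0)) (at x0)"
    proof (rule has_derivativeI_sandwich[OF r(1), where H = "%y. B * norm (y - x0)"])
      show "bounded_linear (%v::real^'n. \<Sum>j\<in>UNIV. v $ j * V (j # is) x0)"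
        by (intro bounded_linear_sum bounded_linear_mult_const[OF bounded_linear_vec_nth])
      show "norm (V is y - V is x0 - (\<Sum>j\<in>UNIV. (y - x0) $ j * V (j # is) x0)) / norm (y - x0) <= B * norm (y - x0)"
        if "y ~= x0" "dist y x0 < r" for y
        using exp[of "y - x0" UNIV] that
        by (simp add: part_UNIV dist_norm B_def divide_le_eq power2_eq_square mult_ac)
      have "((%y. B * norm (y - x0)) \<longlongrightarrow> B * norm (x0 - x0)) (at x0)" by (intro tendsto_intros)
      then show "((%y. B * norm (y - x0)) \<longlongrightarrow> 0) (at x0)" by simp
    qed
    moreover from pd_eqI[OF this] have "pd i (V is) x0 = V (i # is) x0"
      by (simp add: axis_def if_distrib[of "%c. c * _"] sum.If_cases)
    ultimately show ?thesis using differentiable_def by blast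
  qed
  show eq: "Dd is (V []) x = V is x" if "x \<in> \<Omega>" for "is" x
    using that
  proof (induction "is" arbitrary: x)
    case (Cons i "is")
    show ?case using pd_cong[OF \<Omega> Cons(2) Cons(1)] der[OF Cons(2)] by simp
  qed simp
  show "smooth_on \<Omega> (V [])"
    unfolding smooth_on_def
  proof (intro allI ballI)
    fix "is" x assume x: "x \<in> \<Omega>"
    show "Dd is (V []) differentiable at x"
      using differentiable_cong_open[OF \<Omega> x, of "Dd is (V [])" "V is"] eq der[OF x] by blast
  qed
qed

section \<open>Derivative bounds up to the closure\<close>

lemma smooth_on_closure_bounded:
  assumes "bounded \<Omega>" "smooth_on_closure \<Omega> f"
  obtains K where "0 <= K" "!!x. x \<in> \<Omega> ==> norm (Dd is f x) <= K"
proof -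
  obtain g where g: "continuous_on (closure \<Omega>) g" "!!x. x \<in> \<Omega> ==> g x = Dd is f x"
    using assms(2) unfolding smooth_on_closure_def by blast
  have "compact (closure \<Omega>)" using assms(1) by (simp add: compact_closure)
  then have "bounded (g ` closure \<Omega>)" using compact_continuous_image[OF g(1)] compact_imp_bounded by blast
  then obtain K where K: "!!x. x \<in> closure \<Omega> ==> norm (g x) <= K" unfolding bounded_iff by blast
  have "norm (Dd is f x) <= max K 0" if "x \<in> \<Omega>" for x
    using K[of x] closure_subset that g(2)[OF that] by (auto simp: le_max_iff_disj)
  then show ?thesis using that[of "max K 0"] by simp
qed

lemma finite_lists_bound:
  fixes P :: "'i list => real => bool"
  assumes "finite (UNIV :: 'i set)" "!!is. \<exists>K. P is K" "!!is K K'. P is K ==> K <= K' ==> P is K'"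
  obtains K where "0 <= K" "!!is. length is <= m ==> P is K"
proof -
  obtain k where k: "!!is. P is (k is)" using assms(2) by metis
  define L where "L = {is :: 'i list. length is <= m}"
  have "finite L" unfolding L_def using finite_lists_length_le[OF assms(1), of m] by simp
  then have "k is <= (\<Sum>is\<in>L. \<bar>k is\<bar>)" if "is \<in> L" for "is"
    using member_le_sum[of "is" L "%is. \<bar>k is\<bar>"] that by (auto intro: order_trans[OF abs_ge_self])
  then have "P is (\<Sum>is\<in>L. \<bar>k is\<bar>)" if "length is <= m" for "is"
    using assms(3)[OF k[of "is"]] that by (auto simp: L_def)
  then show ?thesis using that[of "\<Sum>is\<in>L. \<bar>k is\<bar>"] by (simp add: sum_nonneg)
qed

lemma smooth_on_closure_bounded_upto:
  fixes f :: "real^'n => 'b::real_normed_vector"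
  assumes "bounded \<Omega>" "smooth_on_closure \<Omega> f"
  obtains K where "0 <= K" "!!is x. length is <= m ==> x \<in> \<Omega> ==> norm (Dd is f x) <= K"
proof -
  obtain K where "0 <= K" "!!is. length is <= m ==> (\<forall>x\<in>\<Omega>. norm (Dd is f x) <= K)"
  proof (rule finite_lists_bound[where P = "%is K. \<forall>x\<in>\<Omega>. norm (Dd is f x) <= K" and m = m])
    show "\<exists>K. \<forall>x\<in>\<Omega>. norm (Dd is f x) <= K" for "is"
      using smooth_on_closure_bounded[OF assms] by metis
  qed (auto intro: order_trans)
  then show ?thesis using that by blast
qed

lemma inner_gradient: "c x \<bullet> gradient w x = (\<Sum>i\<in>UNIV. c x $ i * pd i w x)"
  by (simp add: inner_vec_def gradient_def)

text \<open>A solution for a larger parameter is a supersolution with margin at least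
  \<open>lam' - lam\<close>, and this absorbs the consistency error of the scheme. The last conjunct
  is a modulus of continuity, for later rounding to the lattice.\<close>

lemma discrete_solution_below:
  fixes w :: "real^'n => real"
  assumes \<Omega>: "open \<Omega>" "bounded \<Omega>" and c: "smooth_on_closure \<Omega> c"
    and w: "smooth_solution \<Omega> c lam' w" and lam: "0 <= lam" "lam < lam'" and e: "0 < e"
  shows "\<exists>h u. 0 < h & h < e & (\<forall>x. 0 <= u x) & (\<forall>x\<in>\<Omega>. u x <= w x) & (\<forall>x. x \<notin> \<Omega> --> u x = 0) &
    (\<forall>x. cball x h \<subseteq> \<Omega> --> dlap h u x = (\<Sum>i\<in>UNIV. c x $ i * dq h i u x) - lam / (1 - u x)\<^sup>2) &
    (\<forall>x\<in>\<Omega>. \<forall>y\<in>\<Omega>. dist x y <= real CARD('n) * h --> \<bar>w x - w y\<bar> <= e)"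
proof -
  define d where "d = real CARD('n)"
  have d1: "1 <= d" unfolding d_def using finite_UNIV_card_ge_0[where 'a='n] by (simp add: Suc_leI)
  have wc: "smooth_on_closure \<Omega> w" and w01: "!!x. x \<in> closure \<Omega> ==> 0 <= w x & w x < 1"
    and weq: "!!x. x \<in> \<Omega> ==> - laplacian w x + c x \<bullet> gradient w x = lam' / (1 - w x)\<^sup>2"
    using w unfolding smooth_solution_def by auto
  have ws: "smooth_on \<Omega> w" using wc by (simp add: smooth_on_closure_def)
  obtain K where K: "0 <= K" "!!is x. length is <= 3 ==> x \<in> \<Omega> ==> norm (Dd is w x) <= K"
    using smooth_on_closure_bounded_upto[OF \<Omega>(2) wc] by blast
  obtain Kc where Kc: "0 <= Kc" "!!x. x \<in> \<Omega> ==> norm (Dd [] c x) <= Kc"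
    using smooth_on_closure_bounded[OF \<Omega>(2) c] by blast
  have Kci: "\<bar>c x $ i\<bar> <= Kc" if "x \<in> \<Omega>" for x i
    using Kc(2)[OF that] component_le_norm_cart[of "c x" i] by simp
  have "uniformly_continuous_on (closure \<Omega>) w"
    using wc \<Omega>(2) by (intro compact_uniformly_continuous) (auto simp: smooth_on_closure_def compact_closure)
  then obtain \<delta> where \<delta>: "0 < \<delta>" "!!x y. x \<in> closure \<Omega> ==> y \<in> closure \<Omega> ==> dist x y < \<delta> ==> dist (w x) (w y) < e"
    unfolding uniformly_continuous_on_def using e by (metis dist_commute)
  \<comment> \<open>In this order the entries give \<open>h < e\<close>, order preservation of the
    iteration, the modulus of continuity, and a consistency error of at most
    \<open>lam' - lam\<close>.\<close>
  define h where "h = min (e/2) (min (1 / (Kc + 1)) (min (\<delta> / (2 * d)) ((lam' - lam) / (d * K + d * Kc * K + 1))))"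
  have den: "0 < d * K + d * Kc * K + 1" "0 < Kc + 1" using K Kc d1 by (auto intro!: add_nonneg_pos)
  have h: "0 < h" "h < e" using e den \<delta> lam d1 by (auto simp: h_def)
  have hc: "h * Kc <= 1"
  proof -
    have "h * Kc <= (1 / (Kc + 1)) * Kc" using Kc by (intro mult_right_mono) (auto simp: h_def)
    also have "... <= 1" using Kc by (simp add: field_simps)
    finally show ?thesis .
  qed
  have h\<delta>: "d * h < \<delta>"
  proof -
    have "d * h <= d * (\<delta> / (2 * d))" using d1 by (intro mult_left_mono) (auto simp: h_def)
    also have "... < \<delta>" using d1 \<delta> by simp
    finally show ?thesis .
  qed
  have herr: "d * (h * K) + d * (Kc * (h * K)) <= lam' - lam"
  proof -
    have "h * (d * K + d * Kc * K + 1) <= lam' - lam"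
    proof -
      have "h <= (lam' - lam) / (d * K + d * Kc * K + 1)" by (simp add: h_def)
      then show ?thesis using pos_le_divide_eq[OF den(1)] by blast
    qed
    then show ?thesis using h by (simp add: algebra_simps)
  qed
  define S where "S = {x. cball x h \<subseteq> \<Omega>}"
  have S\<Omega>: "x \<in> \<Omega>" if "x \<in> S" for x using that h by (auto simp: S_def subset_iff)
  have super: "dlap h w x - (\<Sum>i\<in>UNIV. c x $ i * dq h i w x) + lam / (1 - w x)\<^sup>2 <= 0" if x: "x \<in> S" for x
  proof -
    have sub: "cball x h \<subseteq> \<Omega>" using x by (simp add: S_def)
    have D3: "\<bar>pd i (pd i (pd i w)) z\<bar> <= K" "\<bar>pd i (pd i w) z\<bar> <= K" if "z \<in> cball x h" for z i
      using K(2)[of "[i,i,i]" z] K(2)[of "[i,i]" z] that sub by auto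
    have 1: "dlap h w x <= laplacian w x + d * (h * K)"
      using dlap_consistent[OF h(1) ws sub D3(1)] by (simp add: d_def abs_le_iff)
    have "\<bar>c x $ i * (pd i w x - dq h i w x)\<bar> <= Kc * (h * K)" for i
      unfolding abs_mult using Kci[OF S\<Omega>[OF x]] dq_consistent[OF h(1) ws sub D3(2), of i] h K Kc
      by (intro mult_mono) (auto simp: abs_minus_commute)
    then have "(\<Sum>i\<in>UNIV. c x $ i * (pd i w x - dq h i w x)) <= (\<Sum>i\<in>(UNIV::'n set). Kc * (h * K))"
      by (intro sum_mono) (use abs_le_D1 in blast)
    then have 2: "c x \<bullet> gradient w x - (\<Sum>i\<in>UNIV. c x $ i * dq h i w x) <= d * (Kc * (h * K))"
      by (simp add: inner_gradient right_diff_distrib sum_subtractf d_def)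
    have w1: "0 <= w x" "w x < 1" using w01[of x] closure_subset S\<Omega>[OF x] by blast+
    have "(1 - w x)\<^sup>2 <= 1" using w1 by (simp add: power_le_one)
    then have "(lam' - lam) / 1 <= (lam' - lam) / (1 - w x)\<^sup>2"
      using w1 lam by (intro divide_left_mono) auto
    then have 3: "lam / (1 - w x)\<^sup>2 <= lam' / (1 - w x)\<^sup>2 - (lam' - lam)" by (simp add: diff_divide_distrib)
    show ?thesis using 1 2 3 weq[OF S\<Omega>[OF x]] herr by linarith
  qed
  obtain u where u: "!!x. 0 <= u x" "!!x. x \<notin> S ==> u x = 0" "!!x. x \<in> \<Omega> ==> u x <= w x"
    "!!x. x \<in> S ==> dlap h u x = (\<Sum>i\<in>UNIV. c x $ i * dq h i u x) - lam / (1 - u x)\<^sup>2"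
  proof (rule discrete_solution_exists[OF h(1) lam(1), of S \<Omega> "%i x. c x $ i" w])
    show "cball x h \<subseteq> \<Omega>" if "x \<in> S" for x using that by (simp add: S_def)
    show "h * \<bar>c x $ i\<bar> <= 1" if "x \<in> S" for x i
      using order_trans[OF mult_left_mono[OF Kci[OF S\<Omega>[OF that]]] hc] h by simp
    show "0 <= w x" "w x < 1" if "x \<in> \<Omega>" for x using w01[of x] closure_subset that by blast+
  qed (use super in blast)+
  show ?thesis
  proof (intro exI[of _ h] exI[of _ u] conjI allI ballI impI)
    show "u x = 0" if "x \<notin> \<Omega>" for x using u(2) S\<Omega> that by blast
    show "\<bar>w x - w y\<bar> <= e" if "x \<in> \<Omega>" "y \<in> \<Omega>" "dist x y <= real CARD('n) * h" for x y
      using \<delta>(2)[of x y] that h\<delta> closure_subset[of \<Omega>] by (auto simp: d_def dist_real_def subset_iff)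
  qed (use u h in \<open>auto simp: S_def\<close>)
qed

text \<open>The quotient bounds relate only points that differ by whole mesh steps, and discrete
  solutions need not be continuous. Rounding puts all sample points on one lattice, where increments
  are chains of such steps.\<close>

definition fl :: "real => real^'n => real^'n"
  where "fl h x = (\<chi> i. h * of_int \<lfloor>x $ i / h\<rfloor>)"

lemma dist_fl:
  fixes x :: "real^'n"
  assumes "0 < h" shows "dist x (fl h x) <= real CARD('n) * h"
proof -
  have "\<bar>(x - fl h x) $ i\<bar> <= h" for i
  proof -
    define q where "q = x $ i / h"
    have q: "x $ i = h * q" using assms by (simp add: q_def)
    have "0 <= q - of_int \<lfloor>q\<rfloor>" "q - of_int \<lfloor>q\<rfloor> <= 1" by linarith+
    then have "0 <= h * (q - of_int \<lfloor>q\<rfloor>)" "h * (q - of_int \<lfloor>q\<rfloor>) <= h * 1"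
      using assms by (auto intro!: mult_nonneg_nonneg mult_left_mono simp del: mult_1_right)
    then show ?thesis unfolding fl_def vector_minus_component vec_lambda_beta q_def[symmetric] q
      by (simp add: algebra_simps)
  qed
  then have "(\<Sum>i\<in>UNIV. \<bar>(x - fl h x) $ i\<bar>) <= (\<Sum>i\<in>(UNIV::'n set). h)" by (intro sum_mono) auto
  then show ?thesis using norm_le_l1_cart[of "x - fl h x"] by (simp add: dist_norm)
qed

lemma fl_step:
  fixes x :: "real^'n"
  assumes "0 < h" "0 <= t"
  obtains j :: nat where "fl h (step x t i) = fl h x + (real j * h) *\<^sub>R axis i 1" "\<bar>real j * h - t\<bar> <= h"
proof -
  define a where "a = \<lfloor>(x $ i + t) / h\<rfloor>"
  define b where "b = \<lfloor>x $ i / h\<rfloor>"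
  have "b <= a" unfolding a_def b_def using assms by (intro floor_mono divide_right_mono) auto
  then have j: "real (nat (a - b)) = of_int a - of_int b" by simp
  have "fl h (step x t i) = fl h x + (real (nat (a - b)) * h) *\<^sub>R axis i 1"
    unfolding j by (auto simp: vec_eq_iff fl_def axis_def a_def b_def algebra_simps)
  moreover have "\<bar>real (nat (a - b)) * h - t\<bar> <= h"
  proof -
    have "of_int a <= (x $ i + t) / h" "(x $ i + t) / h <= of_int a + 1"
      "of_int b <= x $ i / h" "x $ i / h <= of_int b + 1" unfolding a_def b_def by linarith+
    moreover have "real_of_int a - real_of_int b - t / h = (of_int a - (x $ i + t) / h) - (of_int b - x $ i / h)"
      by (simp add: add_divide_distrib)
    ultimately have "\<bar>real_of_int a - real_of_int b - t / h\<bar> <= 1" by linarith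
    then have "h * \<bar>real_of_int a - real_of_int b - t / h\<bar> <= h * 1" using assms by (intro mult_left_mono) auto
    moreover have "h * \<bar>real_of_int a - real_of_int b - t / h\<bar> = \<bar>h * (real_of_int a - real_of_int b - t / h)\<bar>"
      using assms by (simp add: abs_mult)
    moreover have "h * (real_of_int a - real_of_int b - t / h) = (of_int a - of_int b) * h - t"
      using assms by (simp add: algebra_simps)
    ultimately show ?thesis unfolding j by simp
  qed
  ultimately show ?thesis using that by blast
qed

text \<open>Taylor's formula by summation along a chain of lattice steps; convexity keeps the chain
  inside \<open>X\<close>.\<close>

lemma dq_chain:
  fixes f :: "real^'n => real"
  assumes h: "0 < h" and X: "convex X" "y \<in> X" "step y (real j * h) i \<in> X" and C: "0 <= C"
    "!!z. z \<in> X ==> \<bar>dq h i (dq h i f) z\<bar> <= C"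
  shows "\<bar>f (step y (real j * h) i) - f y - (real j * h) * dq h i f y\<bar> <= C * (real j * h)\<^sup>2"
proof -
  define p where "p l = step y (real l * h) i" for l :: nat
  have p_Suc: "p (Suc l) = p l + h *\<^sub>R axis i 1" for l by (simp add: p_def algebra_simps)
  have pX: "p l \<in> X" if "l <= j" for l
  proof (cases "j = 0")
    case True then show ?thesis using that X by (simp add: p_def)
  next
    case False
    have "p l = (1 - real l / real j) *\<^sub>R y + (real l / real j) *\<^sub>R (step y (real j * h) i)"
      using False by (simp add: p_def algebra_simps)
    moreover have "0 <= real l / real j" "real l / real j <= 1" using that False by auto
    ultimately show ?thesis using X convexD_alt[OF X(1), of "y" "step y (real j * h) i" "real l / real j"] by simp
  qed
  have g: "\<bar>dq h i f (p l) - dq h i f y\<bar> <= C * (real l * h)" if "l <= j" for l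
    using that
  proof (induction l)
    case (Suc l)
    have "dq h i f (p (Suc l)) - dq h i f (p l) = h * dq h i (dq h i f) (p l)"
      unfolding p_Suc using h by (simp add: dq_def)
    then have "\<bar>dq h i f (p (Suc l)) - dq h i f (p l)\<bar> <= h * C"
      using C(2)[OF pX[of l]] Suc(2) h by (simp add: abs_mult)
    then show ?case using Suc by (simp add: algebra_simps)
  qed (simp add: p_def)
  have "\<bar>f (p l) - f y - (real l * h) * dq h i f y\<bar> <= C * (real l * h)\<^sup>2" if "l <= j" for l
    using that
  proof (induction l)
    case (Suc l)
    have "f (p (Suc l)) - f (p l) = h * dq h i f (p l)"
      unfolding p_Suc using h by (simp add: dq_def)
    then have "f (p (Suc l)) - f y - (real (Suc l) * h) * dq h i f y
        = (f (p l) - f y - (real l * h) * dq h i f y) + h * (dq h i f (p l) - dq h i f y)"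
      by (simp add: algebra_simps)
    moreover have "\<bar>h * (dq h i f (p l) - dq h i f y)\<bar> <= h * (C * (real l * h))"
      unfolding abs_mult using g[of l] Suc(2) h by simp
    ultimately have "\<bar>f (p (Suc l)) - f y - (real (Suc l) * h) * dq h i f y\<bar>
        <= C * (real l * h)\<^sup>2 + h * (C * (real l * h))" using Suc by linarith
    also have "... = C * h\<^sup>2 * (real l * real l + real l)" by (simp add: power2_eq_square algebra_simps)
    also have "... <= C * h\<^sup>2 * (real (Suc l) * real (Suc l))"
      using C(1) by (intro mult_left_mono) (auto simp: algebra_simps)
    finally show ?case by (simp add: power2_eq_square mult_ac)
  qed (simp add: p_def)
  from this[of j] show ?thesis by (simp add: p_def)
qed

lemma dlap_eq_dq: "0 < h ==> dlap h f y = (\<Sum>j\<in>UNIV. dq h j (dq h j f) (y - h *\<^sub>R axis j 1))"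
  unfolding dlap_def sum_divide_distrib
  by (intro sum.cong) (auto simp: dq_def field_simps power2_eq_square)

lemma discrete_family_bounded:
  fixes c :: "real^'n => real^'n"
  assumes \<Omega>: "open \<Omega>" "bounded \<Omega>" and c: "smooth_on_closure \<Omega> c" and d0: "0 < d0"
    and hs: "h \<longlonglongrightarrow> 0" "!!m. 0 < h m" and lm: "!!m. \<bar>lm m\<bar> <= L"
    and u: "!!m x. x \<in> \<Omega> ==> 0 <= u m x & u m x <= 1 - d0"
    and eq: "!!m x. cball x (h m) \<subseteq> \<Omega> ==>
      dlap (h m) (u m) x = (\<Sum>i\<in>UNIV. c x $ i * dq (h m) i (u m) x) - lm m / (1 - u m x)\<^sup>2"
    and x0: "x0 \<in> \<Omega>"
  obtains C R where "0 < R" "ball x0 R \<subseteq> \<Omega>" "0 <= C"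
    "\<forall>\<^sub>F m in sequentially. \<forall>is y. length is <= k --> y \<in> ball x0 R --> \<bar>dqs (h m) is (u m) y\<bar> <= C"
proof -
  \<comment> \<open>Three radii are spent: one to reach the centre \<open>y\<close>, one for the
    ball of the interior estimate, one for the shifts of the quotients. The fourth keeps the
    inequalities strict.\<close>
  obtain R where R: "0 < R" "ball x0 (4 * R) \<subseteq> \<Omega>"
  proof -
    obtain e where "0 < e" "ball x0 e \<subseteq> \<Omega>" using \<Omega>(1) x0 open_contains_ball by blast
    then show ?thesis using that[of "e / 4"] by simp
  qed
  obtain K where K: "0 <= K" "!!is x. length is <= k ==> x \<in> \<Omega> ==> norm (Dd is c x) <= K"
    using smooth_on_closure_bounded_upto[OF \<Omega>(2) c] by blast
  have cs: "smooth_on \<Omega> c" using c by (simp add: smooth_on_closure_def)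
  have near: "y \<in> \<Omega>" if "dist x0 x < R" "dist x z < R" "dist z y <= R" for x y z
  proof -
    have "dist x0 y < 4 * R"
      using that R(1) dist_triangle[of x0 y x] dist_triangle[of x y z] by linarith
    then show ?thesis using R(2) by auto
  qed
  obtain C h0 where h0: "0 < h0" and C0: "\<forall>h u lam c (x0::real^'n). 0 < h & h < h0 & \<bar>lam\<bar> <= L &
    (\<forall>x\<in>ball x0 R. 0 <= u x & u x <= 1 - d0 &
      dlap h u x = (\<Sum>i\<in>UNIV. c i x * dq h i u x) - lam / (1 - u x)\<^sup>2) &
    (\<forall>is i. \<forall>x\<in>ball x0 R. length is <= k --> \<bar>dqs h is (c i) x\<bar> <= K) -->
    (\<forall>is. length is <= k --> \<bar>dqs h is u x0\<bar> <= C)"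
    using discrete_regularity[OF d0 R(1), where L = L and A = "%_. K" and k = k] by blast
  have C: "\<bar>dqs (h m) is (u m) y\<bar> <= C"
    if m: "h m < h0" "real (k + 1) * h m < R" and "is": "length is <= k" and y: "y \<in> ball x0 R" for m y "is"
  proof -
    have kh: "real l * h m <= R" if "l <= k + 1" for l
    proof -
      have "real l * h m <= real (k + 1) * h m"
        using that hs(2)[of m] by (intro mult_right_mono) (auto simp del: of_nat_add)
      then show ?thesis using m(2) by linarith
    qed
    have "0 <= u m x & u m x <= 1 - d0 &
      dlap (h m) (u m) x = (\<Sum>i\<in>UNIV. c x $ i * dq (h m) i (u m) x) - lm m / (1 - u m x)\<^sup>2"
      if "x \<in> ball y R" for x
    proof -
      have "x \<in> \<Omega>" using near[of y x x] that y R(1) by simp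
      moreover have "cball x (h m) \<subseteq> \<Omega>" using near[of y x] that y kh[of 1] by auto
      ultimately show ?thesis using u eq by blast
    qed
    moreover have "\<bar>dqs (h m) js (%x. c x $ i) x\<bar> <= K" if "x \<in> ball y R" "length js <= k" for js i x
    proof (rule dqs_smooth_bound[OF hs(2)])
      have sub: "cball x (real (length js) * h m) \<subseteq> \<Omega>"
        using near[of y x] that y kh[of "length js"] by auto
      then show "cball x (real (length js) * h m) \<subseteq> \<Omega>" .
      show "smooth_on \<Omega> (%x. c x $ i)" using smooth_on_component[OF \<Omega>(1) cs] .
      fix ls :: "'n list" and z assume ls: "length ls = length js" "z \<in> cball x (real (length js) * h m)"
      have z: "z \<in> \<Omega>" using sub ls by blast
      have "\<bar>Dd ls c z $ i\<bar> <= K"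
        using K(2)[OF _ z, of ls] component_le_norm_cart[of "Dd ls c z" i] ls that by simp
      then show "\<bar>Dd ls (%x. c x $ i) z\<bar> <= K" using Dd_component[OF \<Omega>(1) cs z] by simp
    qed
    ultimately show ?thesis
      using C0[rule_format, of "h m" "lm m" y "u m" "%i x. c x $ i" "is"] m lm hs(2) "is" by blast
  qed
  have "\<forall>\<^sub>F m in sequentially. h m < h0" using order_tendstoD(2)[OF hs(1) h0] .
  moreover have "(%m. real (k + 1) * h m) \<longlonglongrightarrow> real (k + 1) * 0" by (intro tendsto_intros hs(1))
  then have "\<forall>\<^sub>F m in sequentially. real (k + 1) * h m < R" using R(1) by (intro order_tendstoD(2)[of _ "real (k + 1) * 0"]) auto
  ultimately have "\<forall>\<^sub>F m in sequentially. \<forall>is y. length is <= k --> y \<in> ball x0 R --> \<bar>dqs (h m) is (u m) y\<bar> <= max C 0"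
    by eventually_elim (use C in \<open>auto simp: le_max_iff_disj simp del: mem_ball\<close>)
  moreover have "ball x0 R \<subseteq> \<Omega>" using R by (auto simp: subset_iff)
  ultimately show ?thesis using that[of R "max C 0"] R(1) by simp
qed

text \<open>Parameter and supersolution may vary with \<open>m\<close>, for two uses: constant
  sequences give solutions below a given one, and an increasing sequence reaches the critical
  parameter, beyond which no supersolution of this kind exists.\<close>

lemma existence_interior:
  fixes c :: "real^'n => real^'n"
  assumes \<Omega>: "open \<Omega>" "bounded \<Omega>" and c: "smooth_on_closure \<Omega> c" and d0: "0 < d0"
    and lm: "lm \<longlonglongrightarrow> lam" "!!m. 0 <= lm m" "!!m. lm m < lm' m"
    and w: "!!m. smooth_solution \<Omega> c (lm' m) (w m)" "!!m x. x \<in> \<Omega> ==> w m x <= 1 - d0"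
  obtains v where "smooth_on \<Omega> v" "!!x. x \<in> \<Omega> ==> 0 <= v x"
    "!!x. x \<in> \<Omega> ==> - laplacian v x + c x \<bullet> gradient v x = lam / (1 - v x)\<^sup>2"
    "!!x b. x \<in> \<Omega> ==> (!!m. w m x <= b) ==> v x <= b"
proof -
  define d where "d = real CARD('n)"
  define Q where "Q m h u \<longleftrightarrow> 0 < h & h < 1 / real (Suc m) & (\<forall>x. 0 <= u x) & (\<forall>x\<in>\<Omega>. u x <= w m x) & (\<forall>x. x \<notin> \<Omega> --> u x = 0) &
    (\<forall>x. cball x h \<subseteq> \<Omega> --> dlap h u x = (\<Sum>i\<in>UNIV. c x $ i * dq h i u x) - lm m / (1 - u x)\<^sup>2) &
    (\<forall>x\<in>\<Omega>. \<forall>y\<in>\<Omega>. dist x y <= real CARD('n) * h --> \<bar>w m x - w m y\<bar> <= 1 / real (Suc m))" for m h u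
  have "\<exists>h u. Q m h u" for m unfolding Q_def
    by (rule discrete_solution_below[OF \<Omega> c w(1) lm(2,3)]) simp
  then obtain h u where "!!m. Q m (h m) (u m)" by metis
  note hu = this[unfolded Q_def]
  have h: "0 < h m" "h m < 1 / real (Suc m)" and u0: "0 <= u m x" and uw: "x \<in> \<Omega> ==> u m x <= w m x"
    and eq: "cball x (h m) \<subseteq> \<Omega> ==>
      dlap (h m) (u m) x = (\<Sum>i\<in>UNIV. c x $ i * dq (h m) i (u m) x) - lm m / (1 - u m x)\<^sup>2"
    and wunif: "x \<in> \<Omega> ==> y \<in> \<Omega> ==> dist x y <= d * h m ==> \<bar>w m x - w m y\<bar> <= 1 / real (Suc m)"
    for m x y using hu unfolding d_def by blast+
  have inv0: "(%m. 1 / real (Suc m)) \<longlonglongrightarrow> 0"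
    using LIMSEQ_Suc[OF lim_1_over_n] by simp
  have h0: "h \<longlonglongrightarrow> 0"
  proof (rule tendsto_sandwich[OF _ _ tendsto_const inv0])
    show "\<forall>\<^sub>F m in sequentially. 0 <= h m" using h(1) by (intro always_eventually) (auto intro: less_imp_le)
    show "\<forall>\<^sub>F m in sequentially. h m <= 1 / real (Suc m)" using h(2) by (intro always_eventually allI less_imp_le)
  qed
  obtain L where L: "!!m. \<bar>lm m\<bar> <= L"
  proof -
    obtain L where "\<forall>m. norm (lm m) <= L" using convergent_imp_Bseq[OF convergentI[OF lm(1)]] unfolding Bseq_def by blast
    then show ?thesis using that[of L] by simp
  qed
  have ud: "0 <= u m x & u m x <= 1 - d0" if "x \<in> \<Omega>" for m x
    using u0[of m x] uw[OF that, of m] w(2)[OF that, of m] by linarith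
  have local: "\<exists>C R. 0 < R & ball x0 R \<subseteq> \<Omega> & 0 <= C & (\<forall>\<^sub>F m in sequentially. \<forall>is y. length is <= k -->
      y \<in> ball x0 R --> \<bar>dqs (h m) is (u m) y\<bar> <= C)" if x0: "x0 \<in> \<Omega>" for x0 k
  proof -
    obtain C R where "0 < R" "ball x0 R \<subseteq> \<Omega>" "0 <= C" "\<forall>\<^sub>F m in sequentially. \<forall>is y. length is <= k -->
      y \<in> ball x0 R --> \<bar>dqs (h m) is (u m) y\<bar> <= C"
      by (rule discrete_family_bounded[OF \<Omega> c d0 h0 h(1) L ud eq x0, where k = k]) auto
    then show ?thesis by blast
  qed
  have fl_lim: "(%m. fl (h m) x) \<longlonglongrightarrow> x" for x :: "real^'n"
  proof -
    have "(%m. d * h m) \<longlonglongrightarrow> d * 0" by (intro tendsto_intros h0)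
    then have 0: "(%m. d * h m) \<longlonglongrightarrow> 0" by simp
    have "(%m. dist x (fl (h m) x)) \<longlonglongrightarrow> 0"
    proof (rule tendsto_sandwich[OF _ _ tendsto_const 0])
      show "\<forall>\<^sub>F m in sequentially. dist x (fl (h m) x) <= d * h m"
        unfolding d_def by (intro always_eventually allI dist_fl h(1))
    qed simp
    then show ?thesis by (subst tendsto_dist_iff) (simp add: dist_commute)
  qed
  have fl_ev: "\<forall>\<^sub>F m in sequentially. fl (h m) x \<in> S" if "open S" "x \<in> S" for x :: "real^'n" and S
    by (rule topological_tendstoD[OF fl_lim that])
  \<comment> \<open>The index is a pair of a list of directions and a point; points outside the
    domain get 0, so that every component is eventually bounded.\<close>
  define s where "s m p = (if snd p \<in> \<Omega> then dqs (h m) (fst p) (u m) (fl (h m) (snd p)) else 0)" for m p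
  have "\<exists>C. \<forall>\<^sub>F m in sequentially. \<bar>s m p\<bar> <= C" for p
  proof (cases "snd p \<in> \<Omega>")
    case True
    then obtain C R where CR: "0 < R" "\<forall>\<^sub>F m in sequentially. \<forall>is y. length is <= length (fst p) -->
      y \<in> ball (snd p) R --> \<bar>dqs (h m) is (u m) y\<bar> <= C" using local by blast
    have "\<forall>\<^sub>F m in sequentially. fl (h m) (snd p) \<in> ball (snd p) R" using CR(1) by (intro fl_ev) auto
    with CR(2) have "\<forall>\<^sub>F m in sequentially. \<bar>s m p\<bar> <= C"
      by eventually_elim (use True in \<open>auto simp: s_def\<close>)
    then show ?thesis by blast
  qed (auto simp: s_def intro!: exI[of _ 0])
  then obtain G V' where G: "G ~= bot" "G <= sequentially" and V': "!!p. ((%m. s m p) \<longlongrightarrow> V' p) G"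
    by (rule cluster_filter[of s]) auto
  define V where "V is x = V' (is, x)" for "is" x
  have V: "((%m. dqs (h m) is (u m) (fl (h m) x)) \<longlongrightarrow> V is x) G" if "x \<in> \<Omega>" for "is" x
    using V'[of "(is, x)"] that by (simp add: s_def V_def)
  note evG = filter_leD[OF G(2)]
  have hG: "(h \<longlongrightarrow> 0) G" using h0 G(2) by (rule tendsto_mono[rotated])
  have taylor: "\<exists>C r. 0 < r & ball x0 r \<subseteq> \<Omega> &
      (\<forall>is x. length is <= k --> x \<in> ball x0 r --> \<bar>V is x\<bar> <= C) &
      (\<forall>is x i t. length is <= k --> x \<in> ball x0 r --> step x t i \<in> ball x0 r --> 0 <= t -->
        \<bar>V is (step x t i) - V is x - t * V (i # is) x\<bar> <= C * t\<^sup>2)" if x0: "x0 \<in> \<Omega>" for x0 k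
  proof -
    \<comment> \<open>Two further orders, because second quotients control the remainder of a
      step.\<close>
    obtain C R where CR: "0 < R" "ball x0 R \<subseteq> \<Omega>" "0 <= C" and CR2: "\<forall>\<^sub>F m in sequentially. \<forall>is y. length is <= k + 2 -->
      y \<in> ball x0 R --> \<bar>dqs (h m) is (u m) y\<bar> <= C" using local[OF x0, of "k + 2"] by blast
    have in\<Omega>: "x \<in> \<Omega>" if "x \<in> ball x0 R" for x using that CR(2) by blast
    have flR: "\<forall>\<^sub>F m in sequentially. fl (h m) x \<in> ball x0 R" if "x \<in> ball x0 R" for x
      using that by (intro fl_ev) auto
    show ?thesis
    proof (rule exI[of _ C], rule exI[of _ R], intro conjI allI impI CR)
      fix "is" :: "'n list" and x assume *: "length is <= k" "x \<in> ball x0 R"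
      have "\<forall>\<^sub>F m in sequentially. \<bar>dqs (h m) is (u m) (fl (h m) x)\<bar> <= C"
        using CR2 flR[OF *(2)] by eventually_elim (use * in \<open>auto simp del: mem_ball\<close>)
      then show "\<bar>V is x\<bar> <= C"
        using tendsto_upperbound[OF tendsto_rabs[OF V[OF in\<Omega>[OF *(2)]]] evG G(1)] by blast
    next
      fix "is" :: "'n list" and x i and t :: real
      assume *: "length is <= k" "x \<in> ball x0 R" "step x t i \<in> ball x0 R" "0 <= t"
      define E where "E m = C * (t + h m)\<^sup>2 + h m * C" for m
      have "\<forall>\<^sub>F m in sequentially. \<bar>dqs (h m) is (u m) (fl (h m) (step x t i)) - dqs (h m) is (u m) (fl (h m) x)
          - t * dqs (h m) (i # is) (u m) (fl (h m) x)\<bar> <= E m"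
        using CR2 flR[OF *(2)] flR[OF *(3)]
      proof eventually_elim
        case (elim m)
        define f where "f = dqs (h m) is (u m)"
        define y where "y = fl (h m) x"
        obtain j :: nat where j: "fl (h m) (step x t i) = step y (real j * h m) i" "\<bar>real j * h m - t\<bar> <= h m"
          by (rule fl_step[OF h(1)[of m] *(4), where x = x and i = i]) (auto simp: y_def)
        have b: "\<bar>dq (h m) i f z\<bar> <= C" "\<bar>dq (h m) i (dq (h m) i f) z\<bar> <= C" if "z \<in> ball x0 R" for z
          using elim(1)[rule_format, of "i # is" z] elim(1)[rule_format, of "i # i # is" z] *(1) that
          by (auto simp: f_def simp del: mem_ball)
        have 1: "\<bar>f (step y (real j * h m) i) - f y - (real j * h m) * dq (h m) i f y\<bar> <= C * (real j * h m)\<^sup>2"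
          using elim(2,3) j(1) b(2) CR(3) by (intro dq_chain[OF h(1) convex_ball[of x0 R]]) (auto simp: y_def simp del: mem_ball)
        have "\<bar>(real j * h m - t) * dq (h m) i f y\<bar> <= h m * C"
          unfolding abs_mult using j(2) b(1)[OF elim(2)] h(1)[of m] by (intro mult_mono) (auto simp: y_def)
        moreover have "C * (real j * h m)\<^sup>2 <= C * (t + h m)\<^sup>2"
          using j(2) CR(3) h(1)[of m] *(4) by (intro mult_left_mono power_mono) auto
        moreover have "f (step y (real j * h m) i) - f y - t * dq (h m) i f y
          = (f (step y (real j * h m) i) - f y - (real j * h m) * dq (h m) i f y)
            + (real j * h m - t) * dq (h m) i f y" by (simp add: algebra_simps)
        ultimately have "\<bar>f (step y (real j * h m) i) - f y - t * dq (h m) i f y\<bar> <= E m"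
          using 1 unfolding E_def by linarith
        then show ?case by (simp add: j(1) f_def y_def)
      qed
      moreover have "(E \<longlongrightarrow> C * (t + 0)\<^sup>2 + 0 * C) G" unfolding E_def by (intro tendsto_intros hG)
      ultimately show "\<bar>V is (step x t i) - V is x - t * V (i # is) x\<bar> <= C * t\<^sup>2"
        using * in\<Omega> evG by (intro tendsto_le[OF G(1) _ tendsto_rabs[OF tendsto_diff[OF tendsto_diff[OF V V] tendsto_mult[OF tendsto_const V]]]])
          (auto simp del: mem_ball)
    qed
  qed
  define v where "v = V []"
  have smooth: "smooth_on \<Omega> v" and Dv: "!!is x. x \<in> \<Omega> ==> Dd is v x = V is x"
    unfolding v_def using smooth_on_if_taylor[OF \<Omega>(1) taylor] by blast+
  have v_lim: "((%m. u m (fl (h m) x)) \<longlongrightarrow> v x) G" if "x \<in> \<Omega>" for x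
    using V[OF that, of "[]"] by (simp add: v_def)
  have v0: "0 <= v x" if "x \<in> \<Omega>" for x
    using tendsto_lowerbound[OF v_lim[OF that] _ G(1)] u0 by (simp add: always_eventually)
  \<comment> \<open>The bound on \<open>w m\<close> is given at \<open>x\<close>, that on
    \<open>u m\<close> at the rounded point; the modulus of continuity connects the two.\<close>
  have vb: "v x <= b" if x: "x \<in> \<Omega>" and b: "!!m. w m x <= b" for x b
  proof -
    have "\<forall>\<^sub>F m in sequentially. u m (fl (h m) x) <= b + 1 / real (Suc m)"
      using fl_ev[OF \<Omega>(1) x]
    proof eventually_elim
      case (elim m)
      have "\<bar>w m x - w m (fl (h m) x)\<bar> <= 1 / real (Suc m)"
        using wunif[OF x elim] dist_fl[OF h(1)[of m], of x] by (simp add: d_def)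
      then show ?case using uw[OF elim, of m] b[of m] by linarith
    qed
    moreover have "((%m. b + 1 / real (Suc m)) \<longlongrightarrow> b + 0) G"
      by (intro tendsto_intros tendsto_mono[OF G(2) inv0])
    ultimately show ?thesis using tendsto_le[OF G(1) _ v_lim[OF x]] evG by fastforce
  qed
  have v1: "v x <= 1 - d0" if "x \<in> \<Omega>" for x using vb[OF that w(2)[OF that]] .
  have pde: "- laplacian v x + c x \<bullet> gradient v x = lam / (1 - v x)\<^sup>2" if x: "x \<in> \<Omega>" for x
  proof -
    obtain C R where CR: "0 < R" "ball x R \<subseteq> \<Omega>" "0 <= C" and CR2: "\<forall>\<^sub>F m in sequentially. \<forall>is y. length is <= 3 -->
      y \<in> ball x R --> \<bar>dqs (h m) is (u m) y\<bar> <= C" using local[OF x, of 3] by blast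
    define y where "y m = fl (h m) x" for m
    have hR: "\<forall>\<^sub>F m in sequentially. h m < R / 2" using order_tendstoD(2)[OF h0, of "R / 2"] CR(1) by simp
    have yR: "\<forall>\<^sub>F m in sequentially. y m \<in> ball x (R / 2)" unfolding y_def using CR(1) by (intro fl_ev) auto
    have near: "z \<in> ball x R" if "y m \<in> ball x (R / 2)" "h m < R / 2" "dist (y m) z <= h m" for z m
      using that dist_triangle[of x z "y m"] by simp
    \<comment> \<open>The second differences in \<open>dlap\<close> are centred, those in
      \<open>dqs\<close> are forward ones; the shift by a mesh width costs \<open>h m\<close> times
      a third quotient.\<close>
    have "((%m. dq (h m) j (dq (h m) j (u m)) (y m - h m *\<^sub>R axis j 1)) \<longlongrightarrow> V [j, j] x) G" for j
    proof -
      have "\<forall>\<^sub>F m in sequentially. norm (dq (h m) j (dq (h m) j (u m)) (y m - h m *\<^sub>R axis j 1) - dqs (h m) [j, j] (u m) (y m)) <= h m * C"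
        using CR2 hR yR
      proof eventually_elim
        case (elim m)
        define z where "z = y m - h m *\<^sub>R axis j 1"
        have "dist (y m) z <= h m" using h(1)[of m] by (simp add: z_def dist_norm)
        then have "z \<in> ball x R" using near elim by blast
        then have "\<bar>dqs (h m) [j, j, j] (u m) z\<bar> <= C"
          using elim(1)[rule_format, of "[j, j, j]" z] by simp
        moreover have "dqs (h m) [j, j, j] (u m) z * h m = dqs (h m) [j, j] (u m) (y m) - dqs (h m) [j, j] (u m) z"
          using h(1)[of m] by (simp add: dq_def[of _ _ "dq _ _ (dq _ _ _)"] z_def)
        moreover have "\<bar>dqs (h m) [j, j, j] (u m) z * h m\<bar> <= C * h m"
          unfolding abs_mult using h(1)[of m] calculation(1) by (intro mult_mono) auto
        ultimately have "\<bar>dqs (h m) [j, j] (u m) (y m) - dqs (h m) [j, j] (u m) z\<bar> <= C * h m"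
          by simp
        then show ?case by (simp add: z_def abs_minus_commute mult.commute)
      qed
      from filter_leD[OF G(2) this] have "((%m. dq (h m) j (dq (h m) j (u m)) (y m - h m *\<^sub>R axis j 1) - dqs (h m) [j, j] (u m) (y m)) \<longlongrightarrow> 0) G"
        by (rule Lim_null_comparison) (use tendsto_mult_right[OF hG, of C] in simp)
      from tendsto_add[OF this V[OF x, of "[j, j]"]] show ?thesis by (simp add: y_def)
    qed
    then have "((%m. dlap (h m) (u m) (y m)) \<longlongrightarrow> (\<Sum>j\<in>UNIV. V [j, j] x)) G"
      unfolding dlap_eq_dq[OF h(1)] by (intro tendsto_sum)
    moreover have "(\<Sum>j\<in>UNIV. V [j, j] x) = laplacian v x"
      using Dv[OF x, of "[j, j]" for j] by (simp add: laplacian_def)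
    moreover have "((%m. (\<Sum>i\<in>UNIV. c (y m) $ i * dq (h m) i (u m) (y m)) - lm m / (1 - u m (y m))\<^sup>2)
        \<longlongrightarrow> (\<Sum>i\<in>UNIV. c x $ i * V [i] x) - lam / (1 - v x)\<^sup>2) G"
    proof (intro tendsto_intros)
      have "isCont c x" using c x \<Omega>(1) smooth_on_continuous_on continuous_on_eq_continuous_at
        unfolding smooth_on_closure_def by blast
      then have "(%m. c (y m)) \<longlonglongrightarrow> c x" unfolding y_def by (rule isCont_tendsto_compose[OF _ fl_lim])
      then show "((%m. c (y m)) \<longlongrightarrow> c x) G" using G(2) by (rule tendsto_mono[rotated])
      show "((%m. dq (h m) i (u m) (y m)) \<longlongrightarrow> V [i] x) G" for i
        using V[OF x, of "[i]"] by (simp add: y_def)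
      show "(lm \<longlongrightarrow> lam) G" using lm(1) G(2) by (rule tendsto_mono[rotated])
      show "((%m. u m (y m)) \<longlongrightarrow> v x) G" using v_lim[OF x] by (simp add: y_def)
      show "(1 - v x)\<^sup>2 ~= 0" using v1[OF x] d0 by auto
    qed
    moreover have "\<forall>\<^sub>F m in G. dlap (h m) (u m) (y m)
        = (\<Sum>i\<in>UNIV. c (y m) $ i * dq (h m) i (u m) (y m)) - lm m / (1 - u m (y m))\<^sup>2"
    proof (rule evG)
      show "\<forall>\<^sub>F m in sequentially. dlap (h m) (u m) (y m)
        = (\<Sum>i\<in>UNIV. c (y m) $ i * dq (h m) i (u m) (y m)) - lm m / (1 - u m (y m))\<^sup>2"
        using hR yR
      proof eventually_elim
        case (elim m)
        have "cball (y m) (h m) \<subseteq> \<Omega>" using near[OF elim(2,1)] CR(2) by auto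
        then show ?case by (rule eq)
      qed
    qed
    ultimately have "laplacian v x = (\<Sum>i\<in>UNIV. c x $ i * V [i] x) - lam / (1 - v x)\<^sup>2"
      using tendsto_unique[OF G(1)] by (simp add: tendsto_cong)
    moreover have "(\<Sum>i\<in>UNIV. c x $ i * V [i] x) = c x \<bullet> gradient v x"
      using Dv[OF x, of "[i]" for i] by (simp add: inner_gradient)
    ultimately show ?thesis by simp
  qed
  show ?thesis using that[OF smooth v0 pde vb] by blast
qed

text \<open>One chain rule and one product rule per order. Only the fact that the value depends on
  \<open>A\<close>, \<open>K\<close> and the order alone will matter.\<close>

fun chain_bound :: "real => real => nat => real" where
  "chain_bound A K 0 = A"
| "chain_bound A K (Suc n) = A + 2 ^ n * chain_bound A K n * K"

context
  fixes S :: "(real^'n) set" and x u and g :: "nat => real => real"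
  assumes S: "open S" "x \<in> S" and u: "smooth_on S u"
    and der: "!!m z. z \<in> S ==> (g m has_real_derivative g (Suc m) (u z)) (at (u z))"
begin

lemma smooth_on_compose_real: "smooth_on S (%y. g m (u y))"
  using u unfolding smooth_on_Ck by (blast intro: Ck_compose_real[where g = g, OF S(1)] der)

lemma Dd_compose_real_snoc: "Dd (ks @ [i]) (%y. g m (u y)) x = Dd ks (%y. g (Suc m) (u y) * pd i u y) x"
  unfolding Dd_snoc by (rule Dd_cong[OF S(1) pd_compose_real(1)[OF smooth_on_differentiable[OF u] der] S(2)])

lemma Dd_compose_real_bound:
  assumes "!!p. p <= m + n ==> \<bar>g p (u x)\<bar> <= A" "!!js. length js <= n ==> \<bar>Dd js u x\<bar> <= K" "length js <= n"
  shows "\<bar>Dd js (%y. g m (u y)) x\<bar> <= chain_bound A K n"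
  using assms
proof (induction n arbitrary: m js)
  case (Suc n)
  have IH: "\<bar>Dd ls (%y. g (Suc m) (u y)) x\<bar> <= chain_bound A K n" if "length ls <= n" for ls
    using Suc.prems(1,2) that by (intro Suc.IH) auto
  have K: "0 <= K" using Suc.prems(2)[of "[]"] by simp
  have nn: "0 <= A" "0 <= 2 ^ n * chain_bound A K n * K"
    using Suc.prems(1)[of m] IH[of "[]"] K by (auto intro!: mult_nonneg_nonneg intro: order_trans[OF abs_ge_zero])
  show ?case
  proof (cases js rule: rev_cases)
    case Nil
    then show ?thesis using Suc.prems(1)[of m] nn by simp
  next
    case (snoc ks i)
    have "\<bar>Dd ks (%y. g (Suc m) (u y) * pd i u y) x\<bar> <= 2 ^ n * chain_bound A K n * K"
    proof (rule Dd_mult_bound[OF S smooth_on_compose_real smooth_on_pd[OF u] IH])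
      show "\<bar>Dd ls (pd i u) x\<bar> <= K" if "length ls <= n" for ls
        using Suc.prems(2)[of "ls @ [i]"] that by (simp add: Dd_snoc)
    qed (use Suc.prems(3) snoc in auto)
    then show ?thesis using nn unfolding snoc Dd_compose_real_snoc by simp
  qed
qed simp

text \<open>Linear in the bound \<open>B\<close> of the derivatives of top order; the boundary regularity
  iteration depends on this.\<close>

lemma Dd_compose_real_linear_bound:
  assumes A: "!!p. p <= m + n ==> \<bar>g p (u x)\<bar> <= A" and K: "!!js. length js < n ==> \<bar>Dd js u x\<bar> <= K"
    and B: "0 <= B" "!!js. length js <= n ==> \<bar>Dd js u x\<bar> <= B" and js: "length js <= n"
  shows "\<bar>Dd js (%y. g m (u y)) x\<bar> <= (A + 2 ^ (n - 1) * \<bar>chain_bound A K (n - 1)\<bar>) * (1 + B)"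
proof (cases js rule: rev_cases)
  case Nil
  have "0 <= A" using A[of m] by (auto intro: order_trans[OF abs_ge_zero])
  then have "A * 1 <= (A + 2 ^ (n - 1) * \<bar>chain_bound A K (n - 1)\<bar>) * (1 + B)" using B by (intro mult_mono) auto
  then show ?thesis using Nil A[of m] by simp
next
  case (snoc ks i)
  have "\<bar>Dd ks (%y. g (Suc m) (u y) * pd i u y) x\<bar> <= 2 ^ (n - 1) * \<bar>chain_bound A K (n - 1)\<bar> * B"
  proof (rule Dd_mult_bound[OF S smooth_on_compose_real smooth_on_pd[OF u]])
    fix ls :: "'n list" assume ls: "length ls <= n - 1"
    have "\<bar>Dd ls (%y. g (Suc m) (u y)) x\<bar> <= chain_bound A K (n - 1)"
      using A K js snoc ls by (intro Dd_compose_real_bound) auto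
    then show "\<bar>Dd ls (%y. g (Suc m) (u y)) x\<bar> <= \<bar>chain_bound A K (n - 1)\<bar>" by simp
    show "\<bar>Dd ls (pd i u) x\<bar> <= B" using B(2)[of "ls @ [i]"] js snoc ls by (simp add: Dd_snoc)
  qed (use js snoc in auto)
  also have "... <= (A + 2 ^ (n - 1) * \<bar>chain_bound A K (n - 1)\<bar>) * (1 + B)"
    using A[of m] B by (intro mult_mono) (auto intro: order_trans[OF abs_ge_zero])
  finally show ?thesis unfolding snoc Dd_compose_real_snoc .
qed

end

section \<open>Translations and powers of a coordinate\<close>

lemma pd_shift:
  assumes "f differentiable (at (x + v))"
  shows "pd i (%y. f (y + v)) x = pd i f (x + v)" "(%y. f (y + v)) differentiable (at x)"
proof -
  obtain f' where d: "(f has_derivative f') (at (x + v))" using assms unfolding differentiable_def by blast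
  have l: "((%y. y + v) has_derivative (%w. w)) (at x)" by (auto intro!: derivative_eq_intros)
  have h: "((%y. f (y + v)) has_derivative f') (at x)" using has_derivative_compose[OF l, of f f'] d by simp
  show "pd i (%y. f (y + v)) x = pd i f (x + v)" using pd_eqI[OF h] pd_eqI[OF d] by simp
  show "(%y. f (y + v)) differentiable (at x)" using h differentiable_def by blast
qed

lemma Dd_shift:
  assumes S: "open S" "!!x. x \<in> S ==> x + v \<in> T" and f: "smooth_on T f" and x: "x \<in> S"
  shows "Dd is (%y. f (y + v)) x = Dd is f (x + v)"
  using x
proof (induction "is" arbitrary: x)
  case (Cons i "is")
  show ?case
    using pd_cong[OF S(1) Cons(2) Cons(1)] pd_shift(1)[OF smooth_on_differentiable[OF smooth_on_Dd[OF f] S(2)[OF Cons(2)]]]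
    by simp
qed simp

lemma smooth_on_shift:
  assumes S: "open S" "!!x. x \<in> S ==> x + v \<in> T" and f: "smooth_on T f"
  shows "smooth_on S (%y. f (y + v))"
  unfolding smooth_on_def
proof (intro allI ballI)
  fix "is" x assume x: "x \<in> S"
  show "Dd is (%y. f (y + v)) differentiable at x"
    using differentiable_cong_open[OF S(1) x, of "Dd is (%y. f (y + v))" "%y. Dd is f (y + v)"]
      Dd_shift[OF S f] pd_shift(2)[OF smooth_on_differentiable[OF smooth_on_Dd[OF f] S(2)[OF x]]] by blast
qed

lemma pd_component_id: "pd i (%x::real^'n. x $ j) x = (if i = j then 1 else 0)"
proof -
  have "pd i (%x::real^'n. x $ j) x = axis i 1 $ j"
    by (rule pd_eqI) (rule bounded_linear_imp_has_derivative[OF bounded_linear_vec_nth])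
  then show ?thesis by (simp add: axis_def)
qed

text \<open>The falling factorial: for positive \<open>t\<close> the \<open>m\<close>-th derivative
  of \<open>t powr s\<close> is \<open>powr_coef s m * t powr (s - m)\<close>.\<close>

definition powr_coef :: "real => nat => real" where "powr_coef s m = (\<Prod>j<m. s - real j)"

lemma smooth_on_powr:
  assumes "open S" "!!x. x \<in> S ==> 0 < x $ k"
  shows "smooth_on S (%x::real^'n. (x $ k) powr s)"
proof -
  define g where "g m t = powr_coef s m * t powr (s - real m)" for m t
  have "(g m has_real_derivative g (Suc m) t) (at t)" if "0 < t" for m t
  proof -
    have "((%t. powr_coef s m * t powr (s - real m)) has_real_derivative
        powr_coef s m * ((s - real m) * t powr (s - real m - 1))) (at t)"
      by (intro DERIV_cmult has_real_derivative_powr that)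
    moreover have m: "s - real (Suc m) = s - real m - 1" by simp
    ultimately show ?thesis unfolding g_def m by (simp add: powr_coef_def mult_ac)
  qed
  then have "Ck n S (%x. g 0 (x $ k))" for n
    using assms smooth_on_component_id[of S k] unfolding smooth_on_Ck
    by (intro Ck_compose_real[OF assms(1), of n "%x. x $ k" g]) auto
  then show ?thesis by (simp add: smooth_on_Ck g_def powr_coef_def)
qed

section \<open>Regularity up to a flat boundary\<close>

definition half_ball :: "real^'n => 'n => real => (real^'n) set"
  where "half_ball y0 k r = {y. dist y0 y < r & 0 < y $ k}"

text \<open>The shape that the Laplacian takes in other coordinates; there is no term of order
  zero.\<close>

definition ellop :: "('n => 'n => real^'n => real) => ('n => real^'n => real) => (real^'n => real) => real^'n => real"
  where "ellop a e f y = (\<Sum>i\<in>UNIV. \<Sum>j\<in>UNIV. a i j y * pd i (pd j f) y) + (\<Sum>i\<in>UNIV. e i y * pd i f y)"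

lemma open_half_ball: "open (half_ball y0 k r)"
proof -
  have "half_ball y0 k r = ball y0 r \<inter> {y. 0 < y $ k}" by (auto simp: half_ball_def)
  then show ?thesis by (simp add: open_Int open_Collect_less continuous_on_component)
qed

lemma half_ball_mono: "r <= s ==> half_ball y0 k r \<subseteq> half_ball y0 k s"
  by (auto simp: half_ball_def)

lemma cball_half_ball:
  assumes "y \<in> half_ball y0 k r" "\<rho> < y $ k" "r + \<rho> <= s"
  shows "cball y \<rho> \<subseteq> half_ball y0 k s"
proof
  fix z assume z: "z \<in> cball y \<rho>"
  have "\<bar>(y - z) $ k\<bar> <= dist y z" unfolding dist_norm by (rule component_le_norm_cart)
  then have "0 < z $ k" using z assms(2) by (auto simp: abs_le_iff)
  moreover have "dist y0 z < s" using z assms dist_triangle[of y0 z y] by (simp add: half_ball_def)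
  ultimately show "z \<in> half_ball y0 k s" by (simp add: half_ball_def)
qed

text \<open>The drift sits in \<open>b\<close>, on the right-hand side, so that
  \<open>ellop a e\<close> is the transformed Laplacian alone. For this operator the maximum
  principle and the interior gradient estimate can be carried over from Euclidean coordinates; they
  are assumed here instead of being derived for variable coefficients. Ellipticity is demanded in
  the normal direction \<open>k\<close> only.\<close>

locale boundary_chart =
  fixes y0 :: "real^'n" and k :: 'n and R \<theta> C0 d0 lam :: real
    and a :: "'n => 'n => real^'n => real" and e b :: "'n => real^'n => real"
    and AB :: "nat => real" and u :: "real^'n => real"
  assumes R: "0 < R" "R <= 1" and y0: "y0 $ k = 0" and \<theta>: "0 < \<theta>" and C0: "0 <= C0" and d0: "0 < d0"
    and coef_smooth: "!!i j. smooth_on (half_ball y0 k R) (a i j)" "!!i. smooth_on (half_ball y0 k R) (e i)"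
      "!!i. smooth_on (half_ball y0 k R) (b i)"
    and AB: "!!is y i j. y \<in> half_ball y0 k R ==> \<bar>Dd is (a i j) y\<bar> <= AB (length is)"
      "!!is y i. y \<in> half_ball y0 k R ==> \<bar>Dd is (e i) y\<bar> <= AB (length is)"
      "!!is y i. y \<in> half_ball y0 k R ==> \<bar>Dd is (b i) y\<bar> <= AB (length is)"
    and AB_mono: "mono AB"
    and R_small: "4 * R * (AB 0 + 1) <= \<theta>"
    and elliptic: "!!y. y \<in> half_ball y0 k R ==> \<theta> <= a k k y"
    and max_principle: "!!f y r. r <= R ==> smooth_on (half_ball y0 k r) f ==> y \<in> half_ball y0 k r ==>
      (!!z. z \<in> half_ball y0 k r ==> f z <= f y) ==> ellop a e f y <= 0"
    and interior_gradient: "!!f y r \<rho> M N i. r <= R ==> smooth_on (half_ball y0 k r) f ==> 0 < \<rho> ==>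
      cball y \<rho> \<subseteq> half_ball y0 k r ==> 0 < M ==> 0 <= N ==> (!!z. z \<in> cball y \<rho> ==> \<bar>f z\<bar> <= M) ==>
      (!!z. z \<in> cball y \<rho> ==> \<bar>ellop a e f z\<bar> <= N) ==> \<bar>pd i f y\<bar> <= C0 * (M / \<rho> + \<rho> * N)"
    and u_smooth: "smooth_on (half_ball y0 k R) u"
    and u_bounds: "!!y. y \<in> half_ball y0 k R ==> 0 <= u y" "!!y. y \<in> half_ball y0 k R ==> u y <= 1 - d0"
    and u_eq: "!!y. y \<in> half_ball y0 k R ==>
      ellop a e u y = (\<Sum>i\<in>UNIV. b i y * pd i u y) - lam * (1 / (1 - u y)\<^sup>2)"
    and u_vanish: "!!\<epsilon>. 0 < \<epsilon> ==> \<exists>\<delta>>0. \<forall>y\<in>half_ball y0 k R. y $ k < \<delta> --> \<bar>u y\<bar> < \<epsilon>"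
begin

abbreviation "H \<equiv> half_ball y0 k"

abbreviation "L \<equiv> ellop a e"

lemma H_mono: "r <= R ==> y \<in> H r ==> y \<in> H R"
  using half_ball_mono by blast

lemma HD: "y \<in> H r ==> 0 < y $ k" "y \<in> H r ==> y $ k < r"
proof -
  assume y: "y \<in> H r"
  show "0 < y $ k" using y by (simp add: half_ball_def)
  have "\<bar>(y0 - y) $ k\<bar> <= dist y0 y" unfolding dist_norm by (rule component_le_norm_cart)
  then show "y $ k < r" using y y0 by (auto simp: half_ball_def abs_le_iff)
qed

lemma AB_nonneg: "0 <= AB m"
proof -
  have "dist y0 (step y0 (R/2) k) < R" using R by (simp add: dist_norm)
  then have "step y0 (R/2) k \<in> H R" using R y0 by (simp add: half_ball_def axis_def)
  from order_trans[OF abs_ge_zero AB(2)[OF this, of "[]"]] have "0 <= AB 0" by simp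
  also have "AB 0 <= AB m" using AB_mono by (simp add: monoD)
  finally show ?thesis .
qed

lemma AB_le:
  assumes "y \<in> H R" "length is <= m"
  shows "\<bar>Dd is (a i j) y\<bar> <= AB m" "\<bar>Dd is (e i) y\<bar> <= AB m" "\<bar>Dd is (b i) y\<bar> <= AB m"
  using AB(1)[OF assms(1), of "is" i j] AB(2)[OF assms(1), of "is" i] AB(3)[OF assms(1), of "is" i]
    monoD[OF AB_mono assms(2)] by linarith+

lemma L_smooth:
  assumes "r <= R" "smooth_on (H r) f"
  shows "smooth_on (H r) (L f)"
proof -
  have "smooth_on (H r) (a i j)" "smooth_on (H r) (e i)" for i j
    using coef_smooth smooth_on_subset half_ball_mono[OF assms(1)] by blast+
  then show ?thesis unfolding ellop_def[abs_def]
    using assms(2) by (intro smooth_on_add smooth_on_sum smooth_on_mult smooth_on_pd open_half_ball) auto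
qed

text \<open>The derivatives of order \<open>length js + 2\<close> cancel, so the error sees
  \<open>f\<close> only up to order \<open>length js + 1\<close>; the constant counts the
  coefficients of the operator.\<close>

lemma Dd_L_commutator:
  assumes "r <= R" "smooth_on (H r) f" "y \<in> H r"
    and B: "0 <= B" "!!is. length is <= length js + 1 ==> \<bar>Dd is f y\<bar> <= B"
  shows "\<bar>Dd js (L f) y - L (Dd js f) y\<bar> <= (CARD('n) * CARD('n) + CARD('n)) * (2 ^ length js * AB (length js)) * B"
proof -
  note op = open_half_ball[of y0 k r]
  have yR: "y \<in> H R" using H_mono assms by blast
  have cs: "smooth_on (H r) (a i j)" "smooth_on (H r) (e i)" for i j
    using coef_smooth smooth_on_subset half_ball_mono[OF assms(1)] by blast+
  define D where "D = 2 ^ length js * AB (length js) * B"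
  have a: "\<bar>Dd js (%y. a i j y * pd i (pd j f) y) y - a i j y * pd i (pd j (Dd js f)) y\<bar> <= D" for i j
  proof -
    have "Dd js (pd i (pd j f)) y = pd i (pd j (Dd js f)) y"
      using Dd_perm[OF op assms(2) _ assms(3), of "js @ [i, j]" "[i, j] @ js"] by (simp add: Dd_append)
    moreover have "\<bar>Dd js (%y. a i j y * pd i (pd j f) y) y - a i j y * Dd js (pd i (pd j f)) y\<bar> <= D"
      unfolding D_def
    proof (rule Dd_commutator_bound[OF op assms(3) cs(1)])
      show "smooth_on (H r) (pd i (pd j f))" using assms(2) smooth_on_pd by blast
      show "\<bar>Dd is (pd i (pd j f)) y\<bar> <= B" if "length is < length js" for "is"
        using B(2)[of "is @ [i, j]"] that by (simp add: Dd_append)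
    qed (use AB_le yR B in auto)
    ultimately show ?thesis by simp
  qed
  have e: "\<bar>Dd js (%y. e i y * pd i f y) y - e i y * pd i (Dd js f) y\<bar> <= D" for i
  proof -
    have "Dd js (pd i f) y = pd i (Dd js f) y" using Dd_pd[OF op assms(2,3)] .
    moreover have "\<bar>Dd js (%y. e i y * pd i f y) y - e i y * Dd js (pd i f) y\<bar> <= D"
      unfolding D_def
    proof (rule Dd_commutator_bound[OF op assms(3) cs(2)])
      show "smooth_on (H r) (pd i f)" using assms(2) smooth_on_pd by blast
      show "\<bar>Dd is (pd i f) y\<bar> <= B" if "length is < length js" for "is"
        using B(2)[of "is @ [i]"] that by (simp add: Dd_append)
    qed (use AB_le yR B in auto)
    ultimately show ?thesis by simp
  qed
  have sa: "smooth_on (H r) (%y. a i j y * pd i (pd j f) y)" for i j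
    using assms(2) by (intro smooth_on_mult op cs smooth_on_pd)
  have se: "smooth_on (H r) (%y. e i y * pd i f y)" for i
    using assms(2) by (intro smooth_on_mult op cs smooth_on_pd)
  have "Dd js (L f) y = (\<Sum>i\<in>UNIV. \<Sum>j\<in>UNIV. Dd js (%y. a i j y * pd i (pd j f) y) y)
      + (\<Sum>i\<in>UNIV. Dd js (%y. e i y * pd i f y) y)"
  proof -
    have "Dd js (L f) y = Dd js (%y. \<Sum>i\<in>UNIV. \<Sum>j\<in>UNIV. a i j y * pd i (pd j f) y) y
        + Dd js (%y. \<Sum>i\<in>UNIV. e i y * pd i f y) y"
      unfolding ellop_def[abs_def] using sa se
      by (intro Dd_add[OF op _ _ assms(3)] smooth_on_sum op) auto
    also have "Dd js (%y. \<Sum>i\<in>UNIV. e i y * pd i f y) y = (\<Sum>i\<in>UNIV. Dd js (%y. e i y * pd i f y) y)"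
      using se by (intro Dd_sum[OF op _ _ assms(3)]) auto
    also have "Dd js (%y. \<Sum>i\<in>UNIV. \<Sum>j\<in>UNIV. a i j y * pd i (pd j f) y) y
        = (\<Sum>i\<in>UNIV. Dd js (%y. \<Sum>j\<in>UNIV. a i j y * pd i (pd j f) y) y)"
      using sa by (intro Dd_sum[OF op _ _ assms(3)] smooth_on_sum op) auto
    also have "... = (\<Sum>i\<in>UNIV. \<Sum>j\<in>UNIV. Dd js (%y. a i j y * pd i (pd j f) y) y)"
      using sa by (intro sum.cong Dd_sum[OF op _ _ assms(3)]) auto
    finally show ?thesis .
  qed
  then have "Dd js (L f) y - L (Dd js f) y
      = (\<Sum>i\<in>UNIV. \<Sum>j\<in>UNIV. Dd js (%y. a i j y * pd i (pd j f) y) y - a i j y * pd i (pd j (Dd js f)) y)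
      + (\<Sum>i\<in>UNIV. Dd js (%y. e i y * pd i f y) y - e i y * pd i (Dd js f) y)"
    by (simp add: ellop_def sum_subtractf)
  also have "\<bar>...\<bar> <= (\<Sum>i\<in>(UNIV::'n set). \<Sum>j\<in>(UNIV::'n set). D) + (\<Sum>i\<in>(UNIV::'n set). D)"
    using a e by (intro order_trans[OF abs_triangle_ineq] add_mono order_trans[OF sum_abs] sum_mono)
  also have "... = (CARD('n) * CARD('n) + CARD('n)) * D" by (simp add: algebra_simps)
  finally show ?thesis by (simp add: D_def mult.assoc)
qed

text \<open>The constant may depend on the bound \<open>K\<close> of the lower orders, but the
  growth in \<open>B\<close> is linear. Weights that are singular at the boundary can therefore be
  inserted for \<open>B\<close> at no loss of exponent.\<close>

lemma L_Dd_u_bound: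
  "\<exists>C\<ge>0. \<forall>y B. y \<in> H R --> (\<forall>is. length is < m --> \<bar>Dd is u y\<bar> <= K) --> 0 <= B -->
    (\<forall>is. length is <= m + 1 --> \<bar>Dd is u y\<bar> <= B) -->
    (\<forall>js. length js <= m --> \<bar>Dd js (L u) y\<bar> <= C * (1 + B) & \<bar>L (Dd js u) y\<bar> <= C * (1 + B))"
proof -
  \<comment> \<open>The \<open>p\<close>-th derivative of
    \<open>1 / (1 - t)\<^sup>2\<close>.\<close>
  define g where "g p t = fact (Suc p) * (1 / (1 - t)) ^ Suc (Suc p)" for p and t :: real
  have gder: "(g p has_real_derivative g (Suc p) t) (at t)" if "t < 1" for p t
  proof -
    have "((%t. 1 / (1 - t)) has_real_derivative (1 / (1 - t))\<^sup>2) (at t)"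
      using that by (auto intro!: derivative_eq_intros simp: power2_eq_square)
    from DERIV_cmult[OF DERIV_power[OF this, of "Suc (Suc p)"], of "fact (Suc p)"] show ?thesis
      unfolding g_def[abs_def] by (rule DERIV_cong) (simp add: power2_eq_square mult_ac)
  qed
  define A where "A = (\<Sum>p\<le>m. fact (Suc p) * (1 / d0) ^ Suc (Suc p))"
  define C1 where "C1 = A + 2 ^ (m - 1) * \<bar>chain_bound A K (m - 1)\<bar>"
  have C1: "0 <= C1" unfolding C1_def A_def using d0 by (intro add_nonneg_nonneg sum_nonneg) auto
  note op = open_half_ball[of y0 k R]
  define d where "d = real CARD('n)"
  define C2 where "C2 = d * (2 ^ m * AB m) + \<bar>lam\<bar> * C1"
  define C3 where "C3 = (d * d + d) * (2 ^ m * AB m)"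
  have nn: "0 <= C2" "0 <= C3" using C1 AB_nonneg by (auto simp: C2_def C3_def d_def)
  show ?thesis
  proof (intro exI[of _ "C2 + C3"] conjI allI impI)
    show "0 <= C2 + C3" using nn by simp
    fix y and B :: real and js :: "'n list"
    assume y: "y \<in> H R" and K: "\<forall>is. length is < m --> \<bar>Dd is u y\<bar> <= K" and B: "0 <= B"
      "\<forall>is. length is <= m + 1 --> \<bar>Dd is u y\<bar> <= B" and js: "length js <= m"
    have u1: "\<forall>z\<in>H R. u z < 1" using u_bounds(2) d0 by fastforce
    have "d0 <= 1 - u y" using u_bounds(2)[OF y] by simp
    have g0: "g 0 = (%t. 1 / (1 - t)\<^sup>2)" by (simp add: g_def fun_eq_iff power2_eq_square power_divide)
    have gA: "\<bar>g p (u y)\<bar> <= A" if "p <= m" for p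
    proof -
      have "\<bar>g p (u y)\<bar> <= fact (Suc p) * (1 / d0) ^ Suc (Suc p)"
        using \<open>d0 <= 1 - u y\<close> d0 unfolding g_def abs_mult power_abs
        by (intro mult_mono power_mono) (auto intro: frac_le)
      also have "... <= A" unfolding A_def using d0 that
        by (intro member_le_sum[where f = "%p. fact (Suc p) * (1 / d0) ^ Suc (Suc p)"]) auto
      finally show ?thesis .
    qed
    have nl: "\<bar>Dd js (%y. 1 / (1 - u y)\<^sup>2) y\<bar> <= C1 * (1 + B)"
      using Dd_compose_real_linear_bound[where g = g and m = 0, OF op y u_smooth gder _ _ B(1) _ js] u1 gA K B(2)
      unfolding g0 C1_def by auto
    have nls: "smooth_on (H R) (%y. 1 / (1 - u y)\<^sup>2)"
      unfolding power2_eq_square using u1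
      by (intro smooth_on_inverse smooth_on_mult smooth_on_diff smooth_on_const op u_smooth) auto
    have bs: "smooth_on (H R) (%y. b i y * pd i u y)" for i
      by (intro smooth_on_mult op coef_smooth smooth_on_pd u_smooth)
    have eq: "Dd js (L u) y = (\<Sum>i\<in>UNIV. Dd js (%y. b i y * pd i u y) y) - lam * Dd js (%y. 1 / (1 - u y)\<^sup>2) y"
    proof -
      have "Dd js (L u) y = Dd js (%y. (\<Sum>i\<in>UNIV. b i y * pd i u y) - lam * (1 / (1 - u y)\<^sup>2)) y"
        by (rule Dd_cong[OF op u_eq y])
      also have "... = Dd js (%y. \<Sum>i\<in>UNIV. b i y * pd i u y) y - Dd js (%y. lam * (1 / (1 - u y)\<^sup>2)) y"
        by (rule Dd_diff[OF op smooth_on_sum[OF op finite bs] smooth_on_cmult[OF op nls] y])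
      finally show ?thesis
        unfolding Dd_cmult[OF op nls y] Dd_sum[OF op finite bs y] .
    qed
    have bb: "\<bar>Dd js (%y. b i y * pd i u y) y\<bar> <= 2 ^ m * AB m * B" for i
    proof (rule Dd_mult_bound[OF op y coef_smooth(3) smooth_on_pd[OF u_smooth] _ _ js])
      show "\<bar>Dd is (pd i u) y\<bar> <= B" if "length is <= m" for "is"
        using B(2)[rule_format, of "is @ [i]"] that by (simp add: Dd_snoc)
    qed (use AB_le y in auto)
    have "\<bar>\<Sum>i\<in>UNIV. Dd js (%y. b i y * pd i u y) y\<bar> <= (\<Sum>i\<in>(UNIV::'n set). 2 ^ m * AB m * B)"
      using bb by (intro order_trans[OF sum_abs] sum_mono)
    moreover have "\<bar>lam * Dd js (%y. 1 / (1 - u y)\<^sup>2) y\<bar> <= \<bar>lam\<bar> * (C1 * (1 + B))"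
      unfolding abs_mult using nl by (intro mult_left_mono) auto
    ultimately have "\<bar>Dd js (L u) y\<bar> <= d * (2 ^ m * AB m) * B + \<bar>lam\<bar> * C1 * (1 + B)"
      unfolding eq by (simp add: d_def mult.assoc)
    also have "... <= C2 * (1 + B)" using AB_nonneg[of m] by (simp add: C2_def algebra_simps d_def)
    finally have 1: "\<bar>Dd js (L u) y\<bar> <= C2 * (1 + B)" .
    have "\<bar>Dd js (L u) y - L (Dd js u) y\<bar> <= (CARD('n) * CARD('n) + CARD('n)) * (2 ^ length js * AB (length js)) * B"
      using B js by (intro Dd_L_commutator[OF order_refl u_smooth y]) auto
    also have "... <= C3 * (1 + B)"
    proof -
      have "2 ^ length js * AB (length js) <= 2 ^ m * AB m"
        using js AB_nonneg AB_mono by (intro mult_mono power_increasing) (auto simp: monoD)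
      then have "(d * d + d) * (2 ^ length js * AB (length js)) <= C3"
        unfolding C3_def by (rule mult_left_mono) (simp add: d_def)
      then show ?thesis using B nn by (intro mult_mono) (auto simp: d_def)
    qed
    finally have 2: "\<bar>Dd js (L u) y - L (Dd js u) y\<bar> <= C3 * (1 + B)" .
    have 3: "0 <= C2 * (1 + B)" "0 <= C3 * (1 + B)" using nn B by auto
    show "\<bar>Dd js (L u) y\<bar> <= (C2 + C3) * (1 + B)" "\<bar>L (Dd js u) y\<bar> <= (C2 + C3) * (1 + B)"
      unfolding distrib_right[of C2 C3] using 1 2 3 by linarith+
  qed
qed

end

section \<open>Interior step and square-root barrier at a flat boundary\<close>

lemma sum_square_dist:
  fixes x y :: "real^'n"
  shows "(\<Sum>j\<in>UNIV. (y $ j - x $ j) * (y $ j - x $ j)) = (dist x y)\<^sup>2"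
proof -
  have "(dist x y)\<^sup>2 = (norm (y - x))\<^sup>2" by (simp add: dist_norm norm_minus_commute)
  then show ?thesis by (simp add: power2_norm_eq_inner inner_vec_def)
qed

lemma sqrt_derivatives:
  fixes y :: "real^'n"
  assumes "0 < y $ k"
  shows "pd i (%y. sqrt (y $ k)) y = (if i = k then 1 / (2 * sqrt (y $ k)) else 0)"
    "pd i (pd j (%y. sqrt (y $ k))) y = (if i = k & j = k then - 1 / (4 * (y $ k * sqrt (y $ k))) else 0)"
proof -
  have id: "(%y::real^'n. y $ k) differentiable (at y)" for y
    by (simp add: bounded_linear_imp_differentiable bounded_linear_vec_nth)
  have 1: "pd i (%y. sqrt (y $ k)) y = (if i = k then 1 / (2 * sqrt (y $ k)) else 0)" if "0 < y $ k" for y i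
    using pd_compose_real(1)[OF id DERIV_real_sqrt[OF that], of i] pd_component_id[of i k y]
    by (simp add: inverse_eq_divide)
  then show "pd i (%y. sqrt (y $ k)) y = (if i = k then 1 / (2 * sqrt (y $ k)) else 0)" using assms .
  have op: "open {y::real^'n. 0 < y $ k}" by (simp add: open_Collect_less continuous_on_component)
  have "pd i (pd j (%y. sqrt (y $ k))) y = pd i (%y. if j = k then 1 / (2 * sqrt (y $ k)) else 0) y"
    using assms by (intro pd_cong[OF op] 1) auto
  also have "... = (if i = k & j = k then - 1 / (4 * (y $ k * sqrt (y $ k))) else 0)"
  proof (cases "j = k")
    case True
    have "((%t. 1 / (2 * sqrt t)) has_real_derivative - 1 / (4 * (y $ k * sqrt (y $ k)))) (at (y $ k))"
      using assms by (auto intro!: derivative_eq_intros simp: field_simps power2_eq_square)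
    from pd_compose_real(1)[of "%y. y $ k" y "%t. 1 / (2 * sqrt t)", OF id this, of i] show ?thesis
      using True pd_component_id[of i k y] by simp
  qed simp
  finally show "pd i (pd j (%y. sqrt (y $ k))) y = (if i = k & j = k then - 1 / (4 * (y $ k * sqrt (y $ k))) else 0)" .
qed

lemma smooth_on_sqrt:
  assumes "open S" "!!x. x \<in> S ==> 0 < x $ k"
  shows "smooth_on S (%x::real^'n. sqrt (x $ k))"
  using smooth_on_powr[OF assms, of "1/2"] smooth_on_cong[OF assms(1), of "%x. (x $ k) powr (1/2)" "%x. sqrt (x $ k)"]
    assms(2) by (simp add: powr_half_sqrt less_imp_le)

lemma pd_pd_mult:
  fixes f g :: "real^'n => real"
  assumes S: "open S" "x \<in> S" and s: "smooth_on S f" "smooth_on S g"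
  shows "pd i (pd j (%y. f y * g y)) x = pd i (pd j f) x * g x + pd j f x * pd i g x + pd i f x * pd j g x + f x * pd i (pd j g) x"
proof -
  note df = smooth_on_differentiable[OF s(1)] smooth_on_differentiable[OF smooth_on_pd[OF s(1)]]
  note dg = smooth_on_differentiable[OF s(2)] smooth_on_differentiable[OF smooth_on_pd[OF s(2)]]
  have "pd i (pd j (%y. f y * g y)) x = pd i (%y. pd j f y * g y + f y * pd j g y) x"
    using df dg by (intro pd_cong[OF S] pd_mult) auto
  also have "... = pd i (%y. pd j f y * g y) x + pd i (%y. f y * pd j g y) x"
    using df dg S(2) by (intro pd_add) auto
  finally show ?thesis using df dg S(2) by (simp add: pd_mult)
qed

context boundary_chart
begin

text \<open>The gradient estimate on a ball of radius comparable to \<open>y $ k\<close> costs one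
  factor \<open>1 / (y $ k)\<close>, which turns the exponent -1/2 at order \<open>n\<close> into
  -3/2 at order \<open>Suc n\<close>. The equation for the derivatives of order \<open>n\<close>
  contains those of order \<open>Suc n\<close> linearly, and \<open>absorb\<close> removes
  them.\<close>

lemma interior_step:
  assumes r: "r <= R" and K: "0 <= K" and C: "0 < C"
    and lower: "!!y is. y \<in> H r ==> length is < n ==> \<bar>Dd is u y\<bar> <= K"
    and top: "!!y is. y \<in> H r ==> length is = n ==> \<bar>Dd is u y\<bar> <= C / sqrt (y $ k)"
  shows "\<exists>C'>0. \<forall>y\<in>H (r/2). \<forall>is. length is = Suc n --> \<bar>Dd is u y\<bar> <= C' / (y $ k * sqrt (y $ k))"
proof -
  obtain C1 where C1: "0 <= C1" and eqb: "\<forall>y B. y \<in> H R --> (\<forall>is. length is < n --> \<bar>Dd is u y\<bar> <= K) --> 0 <= B -->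
    (\<forall>is. length is <= n + 1 --> \<bar>Dd is u y\<bar> <= B) -->
    (\<forall>js. length js <= n --> \<bar>Dd js (L u) y\<bar> <= C1 * (1 + B) & \<bar>L (Dd js u) y\<bar> <= C1 * (1 + B))"
    using L_Dd_u_bound[of n K] by blast
  define J where "J = {is :: 'n list. length is = Suc n}"
  have finJ: "finite J" unfolding J_def using finite_lists_length_eq[of "UNIV :: 'n set" "Suc n"] by simp
  define G where "G = card J * C0"
  define q where "q = 1 / (2 * (G * C1 + 1))"
  define D where "D z = (\<Sum>is\<in>J. \<bar>Dd is u z\<bar>)" for z
  have G: "0 <= G" using C0 by (simp add: G_def)
  have GC: "0 < G * C1 + 1" using G C1 by (simp add: add_nonneg_pos)
  have q: "0 < q" "q <= 1/2" "G * C1 * q <= 1/2"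
    using GC G C1 by (auto simp: q_def field_simps)
  have D_ge: "\<bar>Dd is u z\<bar> <= D z" if "length is = Suc n" for "is" z
    unfolding D_def using finJ that by (intro member_le_sum) (auto simp: J_def)
  have D_le: "D z <= card J * c" if c: "!!i js. length js = n ==> \<bar>pd i (Dd js u) z\<bar> <= c" for z and c :: real
  proof -
    have "\<bar>Dd is u z\<bar> <= c" if "is \<in> J" for "is" using that c by (cases "is") (auto simp: J_def)
    then show ?thesis unfolding D_def using sum_bounded_above[of J "%is. \<bar>Dd is u z\<bar>" c] by simp
  qed
  define C' where "C' = 8 * G * C / q + G * C1 * (1 + K) + 2 * G * C1 * C + 1"
  have C': "0 < C'" using G C q C1 K by (simp add: C'_def add_nonneg_pos)
  have "\<bar>Dd is u y\<bar> <= C' / (y $ k * sqrt (y $ k))" if y: "y \<in> H (r/2)" and len: "length is = Suc n" for y "is"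
  proof -
    define d where "d = y $ k"
    have d: "0 < d" "d < r / 2" "d < 1" using HD[OF y] r R by (auto simp: d_def)
    \<comment> \<open>At most half the distance to the flat boundary, so that weights are comparable
      on the ball, and at most the radius \<open>q\<close> for which \<open>absorb\<close>
      applies.\<close>
    define t where "t = min (d/2) q"
    have t: "0 < t" "t <= d/2" "t <= q" "q * d <= t" "t <= 1"
      using d q mult_left_le[of d q] mult_right_mono[OF q(2), of d] by (auto simp: t_def)
    define M where "M = 2 * C / sqrt d"
    have M: "0 < M" using C d by (simp add: M_def)
    have sub: "cball y t \<subseteq> H r" using d t y by (intro cball_half_ball[OF y]) (auto simp: d_def)
    have zk: "d / 2 <= z $ k" if "z \<in> cball y t" for z
    proof -
      have "\<bar>(y - z) $ k\<bar> <= dist y z" unfolding dist_norm by (rule component_le_norm_cart)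
      then show ?thesis using that t by (auto simp: d_def abs_le_iff)
    qed
    have topM: "\<bar>Dd is u z\<bar> <= M" if z: "z \<in> cball y t" and "length is = n" for z "is"
    proof -
      have "sqrt (d / 4) <= sqrt (z $ k)" using zk[OF z] d by simp
      then have s: "sqrt d / 2 <= sqrt (z $ k)" by (simp add: real_sqrt_divide)
      have "\<bar>Dd is u z\<bar> <= C / sqrt (z $ k)" using top z sub that by blast
      also have "... <= C / (sqrt d / 2)" using s C d by (intro divide_left_mono) (auto intro!: mult_pos_pos order_less_le_trans[OF _ s])
      also have "... = M" by (simp add: M_def)
      finally show ?thesis .
    qed
    define K1 where "K1 = C1 * (1 + K + M)"
    have K1: "0 <= K1" using C1 K M by (simp add: K1_def)
    have LL: "\<bar>L (Dd js u) z\<bar> <= K1 + C1 * B" if z: "z \<in> cball y t" and js: "length js = n" and B: "D z <= B" "0 <= B" for js z B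
    proof -
      have "z \<in> H r" using z sub by blast
      then have "z \<in> H R" using H_mono r by blast
      moreover have "\<bar>Dd is u z\<bar> <= K + M + B" if ln: "length is <= n + 1" for "is"
      proof -
        consider "length is < n" | "length is = n" | "length is = Suc n" using ln by linarith
        then show ?thesis
        proof cases
          case 1 then show ?thesis using lower[OF \<open>z \<in> H r\<close>, of "is"] M B by simp
        next
          case 2 then show ?thesis using topM[OF z, of "is"] K B by simp
        next
          case 3 then show ?thesis using D_ge[of "is" z] K B M by simp
        qed
      qed
      ultimately have "\<bar>L (Dd js u) z\<bar> <= C1 * (1 + (K + M + B))"
        using eqb[rule_format, of z "K + M + B" js] lower[OF \<open>z \<in> H r\<close>] K M B js by auto
      then show ?thesis by (simp add: K1_def algebra_simps)
    qed
    have Dcont: "continuous_on (cball y t) D" unfolding D_def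
      by (intro continuous_on_sum continuous_on_rabs continuous_on_subset[OF
            smooth_on_continuous_on[OF smooth_on_Dd[OF u_smooth]] order_trans[OF sub half_ball_mono[OF r]]])
    have "bounded (D ` cball y t)"
      using compact_continuous_image[OF Dcont compact_cball] compact_imp_bounded by blast
    then obtain bd where bd: "!!z. z \<in> cball y t ==> \<bar>D z\<bar> <= bd" unfolding bounded_iff by (auto simp del: mem_cball)
    have "D y <= 4 * G * M / t + G * K1 * t"
    proof (rule absorb[where D = D and bd = bd and K' = C1])
      show "0 <= D z & D z <= bd" if "z \<in> ball y t" for z
        using bd[of z] that by (auto simp: D_def sum_nonneg)
      have "G * C1 * t <= G * C1 * q" using t G C1 by (intro mult_left_mono) auto
      then show "G * C1 * t <= 1 / 2" using q by linarith
      fix x and \<rho> B :: real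
      assume \<rho>: "0 < \<rho>" "cball x \<rho> \<subseteq> ball y t" and B: "0 <= B" "!!z. z \<in> cball x \<rho> ==> D z <= B"
      have in_t: "z \<in> cball y t" if "z \<in> cball x \<rho>" for z
        using subsetD[OF \<rho>(2) that] by simp
      have "\<bar>pd i (Dd js u) x\<bar> <= C0 * (M / \<rho> + \<rho> * (K1 + C1 * B))" if js: "length js = n" for i js
      proof (rule interior_gradient[OF r _ \<rho>(1) _ M])
        show "smooth_on (H r) (Dd js u)"
          using smooth_on_subset[OF smooth_on_Dd[OF u_smooth] half_ball_mono[OF r]] .
        show "cball x \<rho> \<subseteq> H r" using in_t sub by blast
        show "\<bar>Dd js u z\<bar> <= M" "\<bar>L (Dd js u) z\<bar> <= K1 + C1 * B" if "z \<in> cball x \<rho>" for z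
          using topM LL in_t[OF that] js B(1) B(2)[OF that] by auto
      qed (use K1 C1 B in auto)
      from D_le[OF this] show "D x <= G * (M / \<rho> + \<rho> * (K1 + C1 * B))"
        by (simp add: G_def mult.assoc)
    qed (use t G M K1 C1 in auto)
    moreover have "4 * G * M / t <= (8 * G * C / q) / (d * sqrt d)"
    proof -
      have "4 * G * M / t <= 4 * G * M / (q * d)"
        using t G M q d by (intro divide_left_mono mult_nonneg_nonneg mult_pos_pos) auto
      then show ?thesis by (simp add: M_def mult_ac)
    qed
    moreover have "G * K1 * t <= (G * C1 * (1 + K) + 2 * G * C1 * C) / (d * sqrt d)"
    proof -
      have s: "0 < sqrt d" "sqrt d <= 1" using d by auto
      have dd: "d * sqrt d <= 1" "d * sqrt d <= sqrt d" "0 < d * sqrt d"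
        using d s mult_mono[of d 1 "sqrt d" 1] mult_right_mono[of d 1 "sqrt d"] by auto
      have "G * K1 * t <= G * K1 * 1" using t G K1 by (intro mult_left_mono) auto
      also have "... = G * C1 * (1 + K) / 1 + 2 * G * C1 * C / sqrt d"
        by (simp add: K1_def M_def algebra_simps)
      also have "... <= G * C1 * (1 + K) / (d * sqrt d) + 2 * G * C1 * C / (d * sqrt d)"
      proof (rule add_mono)
        show "G * C1 * (1 + K) / 1 <= G * C1 * (1 + K) / (d * sqrt d)"
          using G C1 K dd(3) by (intro divide_left_mono[OF dd(1)]) auto
        show "2 * G * C1 * C / sqrt d <= 2 * G * C1 * C / (d * sqrt d)"
          using G C1 C dd(3) s(1) by (intro divide_left_mono[OF dd(2)]) auto
      qed
      finally show ?thesis by (simp add: add_divide_distrib)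
    qed
    ultimately have "D y <= (8 * G * C / q) / (d * sqrt d) + (G * C1 * (1 + K) + 2 * G * C1 * C) / (d * sqrt d)"
      by linarith
    also have "... = (C' - 1) / (d * sqrt d)" by (simp add: C'_def add_divide_distrib)
    also have "... <= C' / (d * sqrt d)" using d by (intro divide_right_mono) auto
    finally show ?thesis using D_ge[OF len, of y] by (simp add: d_def)
  qed
  then show ?thesis using C' by blast
qed

lemma L_diff_cmult:
  assumes "r <= R" "smooth_on (H r) f" "smooth_on (H r) g" "y \<in> H r"
  shows "L (%y. f y - c * g y) y = L f y - c * L g y"
proof -
  note op = open_half_ball[of y0 k r]
  have cg: "smooth_on (H r) (%y. c * g y)" by (rule smooth_on_cmult[OF op assms(3)])
  have D: "Dd is (%y. f y - c * g y) y = Dd is f y - c * Dd is g y" for "is"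
    using Dd_diff[OF op assms(2) cg assms(4)] Dd_cmult[OF op assms(3,4)] by simp
  have 1: "pd i (%y. f y - c * g y) y = pd i f y - c * pd i g y" for i using D[of "[i]"] by simp
  have 2: "pd i (pd j (%y. f y - c * g y)) y = pd i (pd j f) y - c * pd i (pd j g) y" for i j
    using D[of "[i, j]"] by simp
  show ?thesis unfolding ellop_def 1 2
    by (simp add: right_diff_distrib distrib_left sum_subtractf sum_distrib_left mult.left_commute)
qed

lemma L_mult:
  assumes "r <= R" "smooth_on (H r) f" "smooth_on (H r) g" "y \<in> H r"
  shows "L (%y. f y * g y) y = f y * L g y + g y * L f y
    + (\<Sum>i\<in>UNIV. \<Sum>j\<in>UNIV. a i j y * (pd j f y * pd i g y + pd i f y * pd j g y))"
proof -
  note op = open_half_ball[of y0 k r]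
  have 1: "pd i (%y. f y * g y) y = pd i f y * g y + f y * pd i g y" for i
    using assms by (intro pd_mult smooth_on_differentiable[of "H r"])
  show ?thesis unfolding ellop_def 1 pd_pd_mult[OF op assms(4,2,3)]
    by (simp add: algebra_simps sum.distrib sum_distrib_left)
qed

text \<open>The barrier is a multiple of the square root of the distance \<open>y $ k\<close> to the flat boundary; the factor
  \<open>r\<^sup>2 - |y - y0|\<^sup>2\<close> removes the spherical part of the boundary, whatever the size of \<open>w\<close> there.\<close>

lemma barrier_one_sided:
  assumes r: "0 < r" "r <= R" and w: "smooth_on (H r) w" and C: "0 < C"
    and vanish: "!!\<epsilon>. 0 < \<epsilon> ==> \<exists>\<delta>>0. \<forall>y\<in>H r. y $ k < \<delta> --> \<bar>w y\<bar> < \<epsilon>"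
    and wb: "!!y. y \<in> H r ==> \<bar>w y\<bar> <= C / (y $ k * sqrt (y $ k))"
      "!!y i. y \<in> H r ==> \<bar>pd i w y\<bar> <= C / (y $ k * sqrt (y $ k))"
      "!!y. y \<in> H r ==> \<bar>L w y\<bar> <= C / (y $ k * sqrt (y $ k))"
    and y1: "y1 \<in> H (r/2)"
  shows "w y1 <= (32 * (1 + AB 0 * (6 * (CARD('n) * CARD('n)) + 4 * CARD('n))) / (\<theta> * r\<^sup>2)) * C * sqrt (y1 $ k)"
proof -
  define n where "n = real CARD('n)"
  define A where "A = AB 0"
  \<comment> \<open>Collects the terms of \<open>L (\<eta> * w)\<close>, the first and second
    derivatives of \<open>\<eta>\<close> being bounded by 2.\<close>
  define C1 where "C1 = 1 + A * (6 * (n * n) + 4 * n)"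
  define \<eta> where "\<eta> y = r\<^sup>2 - (\<Sum>j\<in>UNIV. (y $ j - y0 $ j) * (y $ j - y0 $ j))" for y :: "real^'n"
  define \<beta> where "\<beta> y = sqrt (y $ k)" for y :: "real^'n"
  define F where "F y = \<eta> y * w y" for y
  \<comment> \<open>Twice what is needed to dominate \<open>L F\<close>, so that \<open>L Z\<close>
    becomes strictly positive.\<close>
  define A1 where "A1 = 16 * C1 * C / \<theta>"
  define Z where "Z y = F y - A1 * \<beta> y" for y
  note op = open_half_ball[of y0 k r]
  have A: "0 <= A" unfolding A_def by (rule AB_nonneg)
  have n0: "0 <= n" by (simp add: n_def)
  have C1: "1 <= C1" using A n0 by (simp add: C1_def)
  have A1: "0 < A1" using C1 C \<theta> by (simp add: A1_def)
  have \<eta>_dist: "\<eta> y = r\<^sup>2 - (dist y0 y)\<^sup>2" for y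
    unfolding \<eta>_def sum_square_dist ..
  have \<eta>_le: "\<eta> y <= 1" "0 < \<eta> y" if "y \<in> H r" for y
  proof -
    have "r\<^sup>2 <= 1" using r R by (simp add: power_le_one)
    then show "\<eta> y <= 1" unfolding \<eta>_dist using zero_le_power2[of "dist y0 y"] by linarith
    show "0 < \<eta> y" using that unfolding \<eta>_dist half_ball_def by (simp add: power_strict_mono)
  qed
  have coord: "smooth_on (H r) (%y. y $ j - y0 $ j)" for j
    by (intro smooth_on_diff op smooth_on_component_id smooth_on_const)
  have \<eta>_s: "smooth_on (H r) \<eta>" unfolding \<eta>_def[abs_def]
    by (intro smooth_on_diff smooth_on_sum smooth_on_mult op coord smooth_on_const finite)
  have cd: "(%y::real^'n. y $ j - y0 $ j) differentiable (at y)" for j y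
    by (simp add: bounded_linear_imp_differentiable bounded_linear_vec_nth)
  have pc: "pd i (%y. y $ j - y0 $ j) y = (if i = j then 1 else 0)" for i j y
    using pd_diff[of "%y. y $ j" y "%_. y0 $ j" i] pd_component_id[of i j y]
    by (simp add: bounded_linear_imp_differentiable bounded_linear_vec_nth)
  have \<eta>1: "pd i \<eta> y = - 2 * (y $ i - y0 $ i)" for i y
  proof -
    have "pd i \<eta> y = 0 - (\<Sum>j\<in>UNIV. pd i (%y. (y $ j - y0 $ j) * (y $ j - y0 $ j)) y)"
      unfolding \<eta>_def[abs_def] using cd
      by (subst pd_diff) (auto simp: pd_sum intro!: differentiable_sum differentiable_mult)
    also have "... = - (\<Sum>j\<in>UNIV. if i = j then 2 * (y $ j - y0 $ j) else 0)"
      unfolding pd_mult[OF cd cd] pc by (simp add: if_distrib cong: if_cong)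
    finally show ?thesis by simp
  qed
  have \<eta>2: "pd i (pd j \<eta>) y = (if i = j then - 2 else 0)" for i j y
  proof -
    have e: "pd j \<eta> = (%y. (- 2) * (y $ j - y0 $ j))" by (rule ext) (simp add: \<eta>1)
    show ?thesis unfolding e pd_cmult[OF cd] pc by simp
  qed
  have \<eta>1_le: "\<bar>pd i \<eta> y\<bar> <= 2" if "y \<in> H r" for i y
  proof -
    have "\<bar>(y0 - y) $ i\<bar> <= dist y0 y" unfolding dist_norm by (rule component_le_norm_cart)
    then have "\<bar>y $ i - y0 $ i\<bar> <= 1" using that r R by (simp add: half_ball_def abs_minus_commute)
    then show ?thesis unfolding \<eta>1 by (simp add: abs_mult)
  qed
  have Ha: "\<bar>a i j y\<bar> <= A" "\<bar>e i y\<bar> <= A" if "y \<in> H r" for i j y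
    using AB_le[OF H_mono[OF r(2) that], of "[]" 0] by (auto simp: A_def)
  have LF: "\<bar>L F y\<bar> <= C1 * (C / (y $ k * sqrt (y $ k)))" if y: "y \<in> H r" for y
  proof -
    define T where "T = C / (y $ k * sqrt (y $ k))"
    have T: "0 <= T" using C HD[OF y] by (simp add: T_def)
    have L\<eta>: "\<bar>L \<eta> y\<bar> <= 2 * A * (n * n) + 2 * A * n"
    proof -
      have "\<bar>a i j y * pd i (pd j \<eta>) y\<bar> <= A * 2" for i j
        unfolding abs_mult \<eta>2 using Ha[OF y] A by (intro mult_mono) auto
      then have "\<bar>\<Sum>i\<in>UNIV. \<Sum>j\<in>UNIV. a i j y * pd i (pd j \<eta>) y\<bar> <= (\<Sum>i\<in>(UNIV::'n set). \<Sum>j\<in>(UNIV::'n set). A * 2)"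
        by (intro order_trans[OF sum_abs] sum_mono)
      moreover have "\<bar>e i y * pd i \<eta> y\<bar> <= A * 2" for i
        unfolding abs_mult using Ha(2)[OF y] \<eta>1_le[OF y] A by (intro mult_mono) auto
      then have "\<bar>\<Sum>i\<in>UNIV. e i y * pd i \<eta> y\<bar> <= (\<Sum>i\<in>(UNIV::'n set). A * 2)"
        by (intro order_trans[OF sum_abs] sum_mono)
      ultimately show ?thesis unfolding ellop_def by (simp add: n_def mult_ac)
    qed
    have cross: "\<bar>\<Sum>i\<in>UNIV. \<Sum>j\<in>UNIV. a i j y * (pd j \<eta> y * pd i w y + pd i \<eta> y * pd j w y)\<bar> <= 4 * A * (n * n) * T"
    proof -
      have "\<bar>pd j \<eta> y * pd i w y\<bar> <= 2 * T" for i j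
        unfolding abs_mult using \<eta>1_le[OF y] wb(2)[OF y] by (intro mult_mono) (auto simp: T_def)
      then have "\<bar>pd j \<eta> y * pd i w y + pd i \<eta> y * pd j w y\<bar> <= 4 * T" for i j
        using abs_triangle_ineq[of "pd j \<eta> y * pd i w y" "pd i \<eta> y * pd j w y"] by (smt (verit, best))
      then have "\<bar>a i j y * (pd j \<eta> y * pd i w y + pd i \<eta> y * pd j w y)\<bar> <= A * (4 * T)" for i j
        unfolding abs_mult[of "a i j y"] using Ha(1)[OF y] A by (intro mult_mono) auto
      then have "\<bar>\<Sum>i\<in>UNIV. \<Sum>j\<in>UNIV. a i j y * (pd j \<eta> y * pd i w y + pd i \<eta> y * pd j w y)\<bar>
          <= (\<Sum>i\<in>(UNIV::'n set). \<Sum>j\<in>(UNIV::'n set). A * (4 * T))"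
        by (intro order_trans[OF sum_abs] sum_mono)
      then show ?thesis by (simp add: n_def mult_ac)
    qed
    have "\<bar>\<eta> y * L w y\<bar> <= 1 * T"
      unfolding abs_mult using \<eta>_le[OF y] wb(3)[OF y] by (intro mult_mono) (auto simp: T_def)
    moreover have "\<bar>w y * L \<eta> y\<bar> <= T * (2 * A * (n * n) + 2 * A * n)"
      unfolding abs_mult using L\<eta> wb(1)[OF y] T by (intro mult_mono) (auto simp: T_def)
    moreover have "L F y = \<eta> y * L w y + w y * L \<eta> y
        + (\<Sum>i\<in>UNIV. \<Sum>j\<in>UNIV. a i j y * (pd j \<eta> y * pd i w y + pd i \<eta> y * pd j w y))"
      unfolding F_def[abs_def] by (rule L_mult[OF r(2) \<eta>_s w y])
    ultimately have "\<bar>L F y\<bar> <= 1 * T + T * (2 * A * (n * n) + 2 * A * n) + 4 * A * (n * n) * T"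
      using cross by linarith
    also have "... <= C1 * T" using A n0 T by (simp add: C1_def algebra_simps)
    finally show ?thesis by (simp add: T_def)
  qed
  have \<beta>_s: "smooth_on (H r) \<beta>" unfolding \<beta>_def[abs_def]
    by (rule smooth_on_sqrt[OF op]) (simp add: half_ball_def)
  \<comment> \<open>The second derivative of the square root contributes at most
    \<open>- \<theta> / 4\<close> at the weight of exponent -3/2, and \<open>R_small\<close> lets
    the first-order term spoil at most half of it.\<close>
  have L\<beta>: "L \<beta> y <= - (\<theta> / 8) / (y $ k * sqrt (y $ k))" if y: "y \<in> H r" for y
  proof -
    define d where "d = y $ k"
    have d: "0 < d" "d < r" using HD[OF y] by (auto simp: d_def)
    have yR: "y \<in> H R" using H_mono[OF r(2) y] .
    have "L \<beta> y = a k k y * (- 1 / (4 * (d * sqrt d))) + e k y * (1 / (2 * sqrt d))"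
    proof -
      have "(\<Sum>j\<in>UNIV. a i j y * pd i (pd j \<beta>) y) = (if i = k then a k k y * (- 1 / (4 * (d * sqrt d))) else 0)" for i
        unfolding \<beta>_def[abs_def] using sqrt_derivatives(2)[of y k i] d
        by (auto simp: d_def if_distrib[of "%c. _ * c"] cong: if_cong)
      moreover have "(\<Sum>i\<in>UNIV. e i y * pd i \<beta> y) = e k y * (1 / (2 * sqrt d))"
        unfolding \<beta>_def[abs_def] using sqrt_derivatives(1)[of y k] d
        by (simp add: d_def if_distrib[of "%c. _ * c"] cong: if_cong)
      ultimately show ?thesis unfolding ellop_def by simp
    qed
    also have "... = (- a k k y / 4 + e k y * d / 2) / (d * sqrt d)"
      using d by (simp add: field_simps)
    also have "... <= (- (\<theta> / 8)) / (d * sqrt d)"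
    proof (rule divide_right_mono)
      have "e k y * d <= A * d" using Ha(2)[OF y, of k] d by (intro mult_right_mono) (auto simp: abs_le_iff)
      also have "... <= (A + 1) * R" using d r A by (intro mult_mono) auto
      also have "... <= \<theta> / 4" using R_small by (simp add: A_def mult_ac)
      finally show "- a k k y / 4 + e k y * d / 2 <= - (\<theta> / 8)" using elliptic[OF yR] by simp
      show "0 <= d * sqrt d" using d by simp
    qed
    finally show ?thesis by (simp add: d_def)
  qed
  have F_s: "smooth_on (H r) F" unfolding F_def[abs_def] by (rule smooth_on_mult[OF op \<eta>_s w])
  have Z_s: "smooth_on (H r) Z" unfolding Z_def[abs_def]
    by (rule smooth_on_diff[OF op F_s smooth_on_cmult[OF op \<beta>_s]])
  have LZ: "0 < L Z y" if y: "y \<in> H r" for y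
  proof -
    define T where "T = 1 / (y $ k * sqrt (y $ k))"
    have T: "0 < T" using HD[OF y] by (simp add: T_def)
    have "L Z y = L F y - A1 * L \<beta> y" unfolding Z_def[abs_def] by (rule L_diff_cmult[OF r(2) F_s \<beta>_s y])
    moreover have "A1 * L \<beta> y <= A1 * (- (\<theta> / 8) * T)"
      using L\<beta>[OF y] A1 by (intro mult_left_mono) (auto simp: T_def)
    moreover have "A1 * (- (\<theta> / 8) * T) = - 2 * (C1 * C * T)" using \<theta> by (simp add: A1_def)
    moreover have "- (C1 * C * T) <= L F y" using LF[OF y] by (simp add: T_def abs_le_iff mult.assoc)
    moreover have "0 < C1 * C * T" using C1 C T by simp
    ultimately show ?thesis by linarith
  qed
  have Z_le: "Z y2 <= 0" if y2: "y2 \<in> H r" for y2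
  proof (rule ccontr)
    assume "\<not> ?thesis"
    then have pos: "0 < Z y2" by simp
    obtain \<delta> where \<delta>: "0 < \<delta>" "\<forall>y\<in>H r. y $ k < \<delta> --> \<bar>w y\<bar> < Z y2" using vanish[OF pos] by blast
    define W where "W = C / (\<delta> * sqrt \<delta>)"
    have W: "0 < W" using C \<delta> by (simp add: W_def)
    have Zw: "Z y <= \<eta> y * \<bar>w y\<bar>" if "y \<in> H r" for y
    proof -
      have "\<eta> y * w y <= \<eta> y * \<bar>w y\<bar>" using \<eta>_le(2)[OF that] by simp
      moreover have "0 <= A1 * \<beta> y" using A1 HD[OF that] by (simp add: \<beta>_def)
      ultimately show ?thesis by (simp add: Z_def F_def)
    qed
    \<comment> \<open>Off \<open>X\<close> the function stays below \<open>Z y2\<close>: near the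
      flat boundary by \<open>vanish\<close>, elsewhere because \<open>\<eta>\<close> is small while
      \<open>w\<close> is bounded by \<open>W\<close>. So the supremum is attained in the compact
      set \<open>X\<close>, although nothing is known about continuous extension of \<open>w\<close>
      to the boundary.\<close>
    define X where "X = {y. \<delta> <= y $ k & Z y2 / W <= \<eta> y}"
    have out: "Z y < Z y2" if y: "y \<in> H r" "y \<notin> X" for y
    proof (cases "y $ k < \<delta>")
      case True
      have "\<eta> y * \<bar>w y\<bar> <= 1 * \<bar>w y\<bar>" using \<eta>_le[OF y(1)] by (intro mult_right_mono) auto
      then show ?thesis using Zw[OF y(1)] \<delta>(2) y(1) True by fastforce
    next
      case False
      then have "\<eta> y < Z y2 / W" using y by (auto simp: X_def)
      moreover have "\<bar>w y\<bar> <= W"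
      proof -
        have "\<delta> * sqrt \<delta> <= y $ k * sqrt (y $ k)" using False \<delta> by (intro mult_mono) auto
        then have "C / (y $ k * sqrt (y $ k)) <= W"
          unfolding W_def using C \<delta> False by (intro divide_left_mono mult_pos_pos) auto
        then show ?thesis using wb(1)[OF y(1)] by linarith
      qed
      ultimately have "\<eta> y * \<bar>w y\<bar> <= \<eta> y * W" "\<eta> y * W < Z y2"
        using \<eta>_le[OF y(1)] W by (auto intro!: mult_left_mono simp: pos_less_divide_eq)
      then show ?thesis using Zw[OF y(1)] by linarith
    qed
    have XH: "X \<subseteq> H r"
    proof
      fix y assume "y \<in> X"
      then have "0 < y $ k" "0 < \<eta> y" using \<delta> pos W by (auto simp: X_def intro: less_le_trans[rotated])
      then have "(dist y0 y)\<^sup>2 < r\<^sup>2" by (simp add: \<eta>_dist)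
      from power2_less_imp_less[OF this less_imp_le[OF r(1)]] have "dist y0 y < r" .
      then show "y \<in> H r" using \<open>0 < y $ k\<close> by (simp add: half_ball_def)
    qed
    have "closed X" unfolding X_def \<eta>_def
      by (intro closed_Collect_conj closed_Collect_le continuous_intros)
    moreover have "bounded X"
      by (rule bounded_subset[of "ball y0 r"]) (use XH in \<open>auto simp: half_ball_def\<close>)
    ultimately have "compact X" by (simp add: compact_eq_bounded_closed)
    moreover have y2X: "y2 \<in> X" using out[OF y2] by blast
    moreover have "continuous_on X Z" using smooth_on_continuous_on[OF Z_s] XH continuous_on_subset by blast
    ultimately obtain ys where ys: "ys \<in> X" "!!z. z \<in> X ==> Z z <= Z ys"
      using continuous_attains_sup[of X Z] by blast
    have "Z z <= Z ys" if "z \<in> H r" for z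
      using ys(2) y2X out[OF that] by (cases "z \<in> X") (auto intro: order_trans less_imp_le)
    then have "L Z ys <= 0" using max_principle[OF r(2) Z_s] ys(1) XH by blast
    then show False using LZ ys(1) XH by (meson not_less subsetD)
  qed
  have y1r: "y1 \<in> H r" using y1 half_ball_mono[of "r/2" r] r by auto
  have \<eta>q: "r\<^sup>2 / 2 <= \<eta> y1"
  proof -
    have "(dist y0 y1)\<^sup>2 <= (r/2)\<^sup>2" using y1 by (intro power_mono) (auto simp: half_ball_def)
    then have "4 * (dist y0 y1)\<^sup>2 <= r\<^sup>2" by (simp add: power_divide)
    then show ?thesis unfolding \<eta>_dist using zero_le_power2[of "dist y0 y1"] by linarith
  qed
  have sq: "0 <= A1 * sqrt (y1 $ k)" using A1 HD[OF y1] by simp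
  have fin: "w y1 <= (2 * A1 / r\<^sup>2) * sqrt (y1 $ k)"
  proof (cases "w y1 <= 0")
    case True
    have "0 <= (2 / r\<^sup>2) * (A1 * sqrt (y1 $ k))" by (rule mult_nonneg_nonneg[OF _ sq]) simp
    then show ?thesis using True by simp
  next
    case False
    have "r\<^sup>2 / 2 * w y1 <= \<eta> y1 * w y1" using \<eta>q False by (intro mult_right_mono) auto
    also have "... <= A1 * sqrt (y1 $ k)" using Z_le[OF y1r] by (simp add: Z_def F_def \<beta>_def)
    finally show ?thesis using r by (simp add: field_simps)
  qed
  then show ?thesis by (simp add: A1_def C1_def A_def n_def mult_ac)
qed

text \<open>For functions that vanish at the flat boundary, bounds with exponent -3/2 on the
  function, its gradient and \<open>L\<close> improve to square-root decay on half the radius. The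
  factor \<open>A0\<close> must not depend on the function, nor on how fast it vanishes.\<close>

definition sqrt_barrier :: "real => real => bool"
  where "sqrt_barrier r A0 \<longleftrightarrow> (\<forall>w C. smooth_on (H r) w --> 0 < C -->
    (\<forall>\<epsilon>>0. \<exists>\<delta>>0. \<forall>y\<in>H r. y $ k < \<delta> --> \<bar>w y\<bar> < \<epsilon>) -->
    (\<forall>y\<in>H r. \<bar>w y\<bar> <= C / (y $ k * sqrt (y $ k))) -->
    (\<forall>y\<in>H r. \<forall>i. \<bar>pd i w y\<bar> <= C / (y $ k * sqrt (y $ k))) -->
    (\<forall>y\<in>H r. \<bar>L w y\<bar> <= C / (y $ k * sqrt (y $ k))) -->
    (\<forall>y\<in>H (r/2). \<bar>w y\<bar> <= A0 * C * sqrt (y $ k)))"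

lemma sqrt_barrierD:
  assumes "sqrt_barrier r A0" "smooth_on (H r) w" "0 < C"
    "!!\<epsilon>. 0 < \<epsilon> ==> \<exists>\<delta>>0. \<forall>y\<in>H r. y $ k < \<delta> --> \<bar>w y\<bar> < \<epsilon>"
    "!!y. y \<in> H r ==> \<bar>w y\<bar> <= C / (y $ k * sqrt (y $ k))"
    "!!y i. y \<in> H r ==> \<bar>pd i w y\<bar> <= C / (y $ k * sqrt (y $ k))"
    "!!y. y \<in> H r ==> \<bar>L w y\<bar> <= C / (y $ k * sqrt (y $ k))" "y \<in> H (r/2)"
  shows "\<bar>w y\<bar> <= A0 * C * sqrt (y $ k)"
  by (rule assms(1)[unfolded sqrt_barrier_def, rule_format, OF assms(2-8)])

lemma barrier:
  assumes r: "0 < r" "r <= R"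
  shows "\<exists>A0>0. sqrt_barrier r A0"
proof -
  define A0 where "A0 = 32 * (1 + AB 0 * (6 * (CARD('n) * CARD('n)) + 4 * CARD('n))) / (\<theta> * r\<^sup>2)"
  have A0: "0 < A0" using AB_nonneg[of 0] \<theta> r by (auto simp: A0_def intro!: divide_pos_pos add_pos_nonneg)
  have main: "\<bar>w y\<bar> <= A0 * C * sqrt (y $ k)"
    if w: "smooth_on (H r) w" and C: "0 < C"
      and v: "!!\<epsilon>. 0 < \<epsilon> ==> \<exists>\<delta>>0. \<forall>y\<in>H r. y $ k < \<delta> --> \<bar>w y\<bar> < \<epsilon>"
      and b: "!!y. y \<in> H r ==> \<bar>w y\<bar> <= C / (y $ k * sqrt (y $ k))"
        "!!y i. y \<in> H r ==> \<bar>pd i w y\<bar> <= C / (y $ k * sqrt (y $ k))"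
        "!!y. y \<in> H r ==> \<bar>L w y\<bar> <= C / (y $ k * sqrt (y $ k))"
      and y: "y \<in> H (r/2)" for w C y
  proof -
    have 1: "w y <= A0 * C * sqrt (y $ k)"
      unfolding A0_def by (rule barrier_one_sided[OF r w C v b y])
    define w' where "w' = (%y. 0 - 1 * w y)"
    have w's: "smooth_on (H r) w'" unfolding w'_def
      by (intro smooth_on_diff smooth_on_const smooth_on_cmult open_half_ball w)
    have p: "pd i w' z = - pd i w z" "L w' z = - L w z" if "z \<in> H r" for i z
    proof -
      show "pd i w' z = - pd i w z"
        unfolding w'_def using pd_minus[OF smooth_on_differentiable[OF w that]] by simp
      have "pd j (%y::real^'n. 0::real) = (%y. 0)" for j by (rule ext) simp
      then have "L (%y. 0) z = 0" by (simp add: ellop_def)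
      moreover have "L (%y. 0 - 1 * w y) z = L (%y. 0) z - 1 * L w z"
        by (rule L_diff_cmult[OF r(2) smooth_on_const w that])
      ultimately show "L w' z = - L w z" unfolding w'_def by simp
    qed
    have "w' y <= A0 * C * sqrt (y $ k)"
      unfolding A0_def by (rule barrier_one_sided[OF r w's C _ _ _ _ y]) (use v b p in \<open>auto simp: w'_def\<close>)
    then show ?thesis using 1 by (simp add: w'_def)
  qed
  show ?thesis unfolding sqrt_barrier_def
    by (rule exI[of _ A0], intro conjI allI impI ballI A0, rule main) simp_all
qed


section \<open>Induction over the order of the derivatives\<close>

lemma weight:
  assumes "y \<in> H r" "r <= R"
  shows "0 < sqrt (y $ k)" "sqrt (y $ k) <= 1" "0 < y $ k * sqrt (y $ k)" "y $ k * sqrt (y $ k) <= 1"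
    "y $ k * sqrt (y $ k) <= sqrt (y $ k)"
proof -
  have d: "0 < y $ k" "y $ k <= 1" using HD[OF assms(1)] assms(2) R by auto
  show s: "0 < sqrt (y $ k)" "sqrt (y $ k) <= 1" using d by auto
  show "0 < y $ k * sqrt (y $ k)" using d by simp
  show "y $ k * sqrt (y $ k) <= 1" using d s mult_mono[of "y $ k" 1 "sqrt (y $ k)" 1] by simp
  show "y $ k * sqrt (y $ k) <= sqrt (y $ k)" using d s mult_right_mono[of "y $ k" 1 "sqrt (y $ k)"] by simp
qed

lemma weight_le:
  assumes "y \<in> H r" "r <= R" "0 <= c"
  shows "c <= c / sqrt (y $ k)" "c <= c / (y $ k * sqrt (y $ k))" "c / sqrt (y $ k) <= c / (y $ k * sqrt (y $ k))"
proof -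
  note w = weight[OF assms(1,2)]
  show "c <= c / sqrt (y $ k)" using w(1,2) assms(3) by (simp add: le_divide_eq mult_left_le)
  show "c <= c / (y $ k * sqrt (y $ k))" using w(3,4) assms(3) by (simp only: pos_le_divide_eq mult_left_le)
  show "c / sqrt (y $ k) <= c / (y $ k * sqrt (y $ k))"
    using w(1,3) by (intro divide_left_mono[OF w(5) assms(3)]) simp
qed

lemma all_orders_bound:
  assumes y: "y \<in> H r" "r <= R" and K: "0 <= K" and C: "0 < C"
    and lower: "!!is. length is < n ==> \<bar>Dd is u y\<bar> <= K"
    and top: "!!is. length is = n ==> \<bar>Dd is u y\<bar> <= C / sqrt (y $ k)"
    and top1: "!!is. length is = Suc n ==> \<bar>Dd is u y\<bar> <= C / (y $ k * sqrt (y $ k))"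
    and len: "length is <= n + 1"
  shows "\<bar>Dd is u y\<bar> <= (K + C) / (y $ k * sqrt (y $ k))"
proof -
  have w: "K / (y $ k * sqrt (y $ k)) \<ge> K" "0 <= K / (y $ k * sqrt (y $ k))" "0 <= C / (y $ k * sqrt (y $ k))"
    "C / sqrt (y $ k) <= C / (y $ k * sqrt (y $ k))"
    using weight_le[OF y, of K] weight_le[OF y, of C] weight[OF y] K C by auto
  consider "length is < n" | "length is = n" | "length is = Suc n" using len by linarith
  then show ?thesis unfolding add_divide_distrib
  proof cases
    case 1 then show "\<bar>Dd is u y\<bar> <= K / (y $ k * sqrt (y $ k)) + C / (y $ k * sqrt (y $ k))"
      using lower[OF 1] w by linarith
  next
    case 2 then show "\<bar>Dd is u y\<bar> <= K / (y $ k * sqrt (y $ k)) + C / (y $ k * sqrt (y $ k))"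
      using top[OF 2] w by linarith
  next
    case 3 then show "\<bar>Dd is u y\<bar> <= K / (y $ k * sqrt (y $ k)) + C / (y $ k * sqrt (y $ k))"
      using top1[OF 3] w by linarith
  qed
qed

lemma L_Dd_weighted:
  assumes r: "r <= R" and K: "0 <= K" and C: "0 < C"
    and lower: "!!y is. y \<in> H r ==> length is < n ==> \<bar>Dd is u y\<bar> <= K"
    and top: "!!y is. y \<in> H r ==> length is = n ==> \<bar>Dd is u y\<bar> <= C / sqrt (y $ k)"
    and top1: "!!y is. y \<in> H r ==> length is = Suc n ==> \<bar>Dd is u y\<bar> <= C / (y $ k * sqrt (y $ k))"
  shows "\<exists>C'>0. \<forall>y\<in>H r. \<forall>js. length js <= n --> \<bar>L (Dd js u) y\<bar> <= C' / (y $ k * sqrt (y $ k))"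
proof -
  obtain C1 where C1: "0 <= C1" and eqb: "\<forall>y B. y \<in> H R --> (\<forall>is. length is < n --> \<bar>Dd is u y\<bar> <= K) --> 0 <= B -->
    (\<forall>is. length is <= n + 1 --> \<bar>Dd is u y\<bar> <= B) -->
    (\<forall>js. length js <= n --> \<bar>Dd js (L u) y\<bar> <= C1 * (1 + B) & \<bar>L (Dd js u) y\<bar> <= C1 * (1 + B))"
    using L_Dd_u_bound[of n K] by blast
  have "\<bar>L (Dd js u) y\<bar> <= (C1 * (1 + K + C) + 1) / (y $ k * sqrt (y $ k))" if y: "y \<in> H r" and js: "length js <= n" for y js
  proof -
    define T where "T = 1 / (y $ k * sqrt (y $ k))"
    have T: "1 <= T" using weight_le(2)[OF y r, of 1] by (simp add: T_def)
    have "\<bar>L (Dd js u) y\<bar> <= C1 * (1 + (K + C) / (y $ k * sqrt (y $ k)))"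
      using eqb[rule_format, OF H_mono[OF r y], of "(K + C) / (y $ k * sqrt (y $ k))" js]
        lower[OF y] all_orders_bound[OF y r K C lower[OF y] top[OF y] top1[OF y]] js K C weight(3)[OF y r] by auto
    also have "... = C1 * (1 + (K + C) * T)" by (simp add: T_def)
    also have "... <= C1 * (T + (K + C) * T)" using T C1 by (intro mult_left_mono) auto
    also have "... <= (C1 * (1 + K + C) + 1) * T" using T by (simp add: algebra_simps)
    finally show ?thesis by (simp add: T_def)
  qed
  moreover have "0 < C1 * (1 + K + C) + 1" using C1 K C by (simp add: add_nonneg_pos)
  ultimately show ?thesis by blast
qed

text \<open>The barrier requires vanishing at the flat boundary, which is known for a tangential
  derivative \<open>w\<close> of order \<open>n - 1\<close> but not yet for its tangential
  derivatives. It is therefore applied to difference quotients of \<open>w\<close> in a direction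
  other than \<open>k\<close>; these vanish for each fixed \<open>h\<close>, and the bound is
  uniform in \<open>h\<close>. For \<open>n = 0\<close> it applies to \<open>u\<close>
  itself.\<close>

lemma tangential_step:
  assumes r: "0 < r" "r <= R" and K: "0 <= K" and C: "0 < C"
    and lower: "!!y is. y \<in> H r ==> length is < n ==> \<bar>Dd is u y\<bar> <= K"
    and top: "!!y is. y \<in> H r ==> length is = n ==> \<bar>Dd is u y\<bar> <= C / sqrt (y $ k)"
    and top1: "!!y is. y \<in> H r ==> length is = Suc n ==> \<bar>Dd is u y\<bar> <= C / (y $ k * sqrt (y $ k))"
    and Lb: "!!y is. y \<in> H r ==> length is <= n ==> \<bar>L (Dd is u) y\<bar> <= C / (y $ k * sqrt (y $ k))"
    and tang: "!!y is. y \<in> H r ==> Suc (length is) = n ==> k \<notin> set is ==> \<bar>Dd is u y\<bar> <= C * sqrt (y $ k)"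
  shows "\<exists>C'>0. \<forall>y\<in>H (r/4). \<forall>is. length is = n --> k \<notin> set is --> \<bar>Dd is u y\<bar> <= C' * sqrt (y $ k)"
proof (cases n)
  case 0
  obtain A0 where A0: "0 < A0" and bar: "sqrt_barrier r A0" using barrier[OF r] by blast
  have "\<bar>u y\<bar> <= A0 * C * sqrt (y $ k)" if y: "y \<in> H (r/4)" for y
  proof (rule sqrt_barrierD[OF bar smooth_on_subset[OF u_smooth half_ball_mono[OF r(2)]] C])
    show "\<exists>\<delta>>0. \<forall>y\<in>H r. y $ k < \<delta> --> \<bar>u y\<bar> < \<epsilon>" if "0 < \<epsilon>" for \<epsilon>
      using u_vanish[OF that] H_mono[OF r(2)] by blast
    show "y \<in> H (r/2)" using y r half_ball_mono[of "r/4" "r/2"] by auto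
    show "\<bar>u y\<bar> <= C / (y $ k * sqrt (y $ k))" if "y \<in> H r" for y
      using top[OF that, of "[]"] weight_le(3)[OF that r(2), of C] C 0 by simp
    show "\<bar>pd i u y\<bar> <= C / (y $ k * sqrt (y $ k))" if "y \<in> H r" for y i
      using top1[OF that, of "[i]"] 0 by simp
    show "\<bar>L u y\<bar> <= C / (y $ k * sqrt (y $ k))" if "y \<in> H r" for y
      using Lb[OF that, of "[]"] by simp
  qed
  then show ?thesis using A0 C 0 by (intro exI[of _ "A0 * C"]) auto
next
  case (Suc m)
  define N where "N = real CARD('n) * real CARD('n) + real CARD('n)"
  \<comment> \<open>The three parts bound \<open>L\<close> of the derivatives of \<open>w\<close>,
    the commutator with one derivative, and the difference quotients of the coefficients.\<close>
  define C3 where "C3 = C + (N * (2 * AB 1) * (K + C) + N * AB 1 * (K + C))"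
  have AB1: "0 <= AB 1" by (rule AB_nonneg)
  have N: "0 <= N" by (simp add: N_def)
  have C3: "C <= C3" "0 < C3" using C K AB1 N by (auto simp: C3_def add_pos_nonneg)
  have r2: "0 < r/2" "r/2 <= R" using r by auto
  obtain A0 where A0: "0 < A0" and bar: "sqrt_barrier (r/2) A0" using barrier[OF r2] by blast
  have "\<bar>Dd is u y\<bar> <= (A0 * C3) * sqrt (y $ k)" if y: "y \<in> H (r/4)" and "is": "length is = n" "k \<notin> set is" for y "is"
  proof -
    obtain i js where ijs: "is = i # js" using "is" Suc by (cases "is") auto
    have ik: "i ~= k" "k \<notin> set js" and js: "Suc (length js) = n" using "is" ijs by auto
    define w where "w = Dd js u"
    have ws: "smooth_on (H r) w" unfolding w_def
      using smooth_on_subset[OF smooth_on_Dd[OF u_smooth] half_ball_mono[OF r(2)]] .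
    have Dw: "Dd ls w = Dd (ls @ js) u" for ls by (simp add: w_def Dd_append)
    have ord: "\<bar>Dd ls w z\<bar> <= (K + C) / (z $ k * sqrt (z $ k))" if "z \<in> H r" "length ls <= 2" for ls z
      unfolding Dw using js that
      by (intro all_orders_bound[OF that(1) r(2) K C lower[OF that(1)] top[OF that(1)] top1[OF that(1)]]) auto
    have quot: "\<bar>(w (step y h i) - w y) / h\<bar> <= A0 * C3 * sqrt (y $ k)" if h: "0 < h" "h < r/2" for h
    proof -
      define v where "v = h *\<^sub>R axis i (1::real)"
      have sh: "step z t i \<in> H r" "(step z t i) $ k = z $ k"
        if z: "z \<in> H (r/2)" and t: "0 <= t" "t <= h" for z t
      proof -
        show e: "(step z t i) $ k = z $ k" using ik by (simp add: axis_def)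
        have "dist z (step z t i) = t" using t by (simp add: dist_norm)
        then have "dist y0 (step z t i) < r"
          using dist_triangle[of y0 "step z t i" z] z t h by (simp add: half_ball_def)
        then show "step z t i \<in> H r"
          unfolding half_ball_def mem_Collect_eq e using z by (auto simp: half_ball_def)
      qed
      have shv: "z + v \<in> H r" "(z + v) $ k = z $ k" if "z \<in> H (r/2)" for z
        using sh[OF that, of h] h by (auto simp: v_def)
      have zr: "z \<in> H r" if "z \<in> H (r/2)" for z using sh(1)[OF that, of 0] h by simp
      have ws2: "smooth_on (H (r/2)) w" using smooth_on_subset[OF ws] zr by blast
      define wv where "wv = (%y. w (y + v))"
      have wvs: "smooth_on (H (r/2)) wv" unfolding wv_def by (rule smooth_on_shift[OF open_half_ball shv(1) ws])
      have Dwv: "Dd ls wv z = Dd ls w (z + v)" if "z \<in> H (r/2)" for ls z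
        unfolding wv_def by (rule Dd_shift[OF open_half_ball shv(1) ws that])
      define q where "q y = (1 / h) * (wv y - w y)" for y
      have qs: "smooth_on (H (r/2)) q" unfolding q_def[abs_def]
        by (intro smooth_on_cmult smooth_on_diff open_half_ball wvs ws2)
      have Dq: "Dd ls q z = (1 / h) * (Dd ls w (z + v) - Dd ls w z)" if z: "z \<in> H (r/2)" for ls z
        unfolding q_def[abs_def]
        by (simp only: Dd_cmult[OF open_half_ball smooth_on_diff[OF open_half_ball wvs ws2] z]
            Dd_diff[OF open_half_ball wvs ws2 z] Dwv[OF z])
      have MV: "\<bar>(1 / h) * (f (z + v) - f z)\<bar> <= B"
        if z: "z \<in> H (r/2)" and f: "!!x. x \<in> H r ==> f differentiable (at x)"
          and B: "!!x. x \<in> H r ==> x $ k = z $ k ==> \<bar>pd i f x\<bar> <= B" for f :: "real^'n => real" and z B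
      proof -
        obtain t where t: "0 < t" "t < h" "f (step z h i) - f z = h * pd i f (step z t i)"
          by (rule line_MVT[OF h(1), of f z i]) (use sh(1)[OF z] f in auto)
        then have "(1 / h) * (f (z + v) - f z) = pd i f (step z t i)" using h by (simp add: v_def)
        then show ?thesis using B sh[OF z, of t] t by simp
      qed
      have "\<bar>q y\<bar> <= A0 * C3 * sqrt (y $ k)"
      proof (rule sqrt_barrierD[OF bar qs C3(2)])
        show "y \<in> H (r/2/2)" using y by simp
        fix \<epsilon> :: real assume \<epsilon>: "0 < \<epsilon>"
        \<comment> \<open>The threshold deteriorates with \<open>h\<close>, which is harmless
          because the barrier constant does not involve it.\<close>
        define \<delta> where "\<delta> = (\<epsilon> * h / (2 * C))\<^sup>2"
        have \<delta>: "0 < \<delta>" using \<epsilon> h C by (simp add: \<delta>_def)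
        have "\<bar>q z\<bar> < \<epsilon>" if z: "z \<in> H (r/2)" "z $ k < \<delta>" for z
        proof -
          have "\<bar>w (z + v)\<bar> <= C * sqrt (z $ k)" "\<bar>w z\<bar> <= C * sqrt (z $ k)"
            using tang[OF shv(1)[OF z(1)] js ik(2)] tang[OF zr[OF z(1)] js ik(2)] shv(2)[OF z(1)] by (auto simp: w_def)
          then have "\<bar>w (z + v) - w z\<bar> <= 2 * C * sqrt (z $ k)" by linarith
          moreover have "sqrt (z $ k) < \<epsilon> * h / (2 * C)"
          proof -
            have "sqrt (z $ k) < sqrt \<delta>" using z by simp
            then show ?thesis using \<epsilon> h C by (simp add: \<delta>_def)
          qed
          then have "2 * C * sqrt (z $ k) < \<epsilon> * h" using C by (simp add: field_simps)
          ultimately have "\<bar>w (z + v) - w z\<bar> < \<epsilon> * h" by linarith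
          then show ?thesis using h by (simp add: q_def wv_def abs_mult field_simps)
        qed
        then show "\<exists>\<delta>>0. \<forall>y\<in>H (r/2). y $ k < \<delta> --> \<bar>q y\<bar> < \<epsilon>" using \<delta> by blast
      next
        fix z assume z: "z \<in> H (r/2)"
        have "\<bar>pd i w x\<bar> <= C / sqrt (z $ k)" if "x \<in> H r" "x $ k = z $ k" for x
          using top[OF that(1), of "i # js"] js that(2) by (simp add: w_def)
        then have "\<bar>q z\<bar> <= C / sqrt (z $ k)"
          unfolding q_def wv_def using smooth_on_differentiable[OF ws] by (intro MV[OF z]) auto
        also have "... <= C / (z $ k * sqrt (z $ k))" using weight_le(3)[OF z r2(2), of C] C by simp
        also have "... <= C3 / (z $ k * sqrt (z $ k))" using C3 weight(3)[OF z r2(2)] by (intro divide_right_mono) auto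
        finally show "\<bar>q z\<bar> <= C3 / (z $ k * sqrt (z $ k))" .
      next
        fix z j assume z: "z \<in> H (r/2)"
        have "\<bar>pd i (pd j w) x\<bar> <= C / (z $ k * sqrt (z $ k))" if "x \<in> H r" "x $ k = z $ k" for x
          using top1[OF that(1), of "i # j # js"] js that(2) by (simp add: w_def)
        then have "\<bar>(1 / h) * (pd j w (z + v) - pd j w z)\<bar> <= C / (z $ k * sqrt (z $ k))"
          using smooth_on_differentiable[OF smooth_on_pd[OF ws]] by (intro MV[OF z]) auto
        also have "... <= C3 / (z $ k * sqrt (z $ k))" using C3 weight(3)[OF z r2(2)] by (intro divide_right_mono) auto
        finally show "\<bar>pd j q z\<bar> <= C3 / (z $ k * sqrt (z $ k))" using Dq[OF z, of "[j]"] by simp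
      next
        fix z assume z: "z \<in> H (r/2)"
        define T where "T = 1 / (z $ k * sqrt (z $ k))"
        have T: "0 < T" using weight(3)[OF z r2(2)] by (simp add: T_def)
        define x where "x = z + v"
        have x: "x \<in> H r" "x $ k = z $ k" using shv[OF z] by (auto simp: x_def)
        have ab: "\<bar>(1 / h) * (a i' j x - a i' j z)\<bar> <= AB 1" "\<bar>(1 / h) * (e j x - e j z)\<bar> <= AB 1" for i' j
          unfolding x_def
        proof -
          have "\<bar>pd i (a i' j) p\<bar> <= AB 1" "\<bar>pd i (e j) p\<bar> <= AB 1" if "p \<in> H r" for p
            using AB(1,2)[OF H_mono[OF r(2) that], of "[i]"] by auto
          then show "\<bar>(1 / h) * (a i' j (z + v) - a i' j z)\<bar> <= AB 1" "\<bar>(1 / h) * (e j (z + v) - e j z)\<bar> <= AB 1"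
            using smooth_on_differentiable[OF coef_smooth(1)] smooth_on_differentiable[OF coef_smooth(2)] H_mono[OF r(2)]
            by (blast intro: MV[OF z])+
        qed
        have dw: "\<bar>pd j w x\<bar> <= (K + C) * T" "\<bar>pd j (pd l w) x\<bar> <= (K + C) * T" for j l
          using ord[OF x(1), of "[j]"] ord[OF x(1), of "[j, l]"] x(2) by (auto simp: T_def)
        have 1: "\<bar>(1 / h) * (L w x - L w z)\<bar> <= (C + N * (2 * AB 1) * (K + C)) * T"
          unfolding x_def
        proof (rule MV[OF z])
          show "L w differentiable at p" if "p \<in> H r" for p
            using smooth_on_differentiable[OF L_smooth[OF r(2) ws] that] .
          fix p assume p: "p \<in> H r" "p $ k = z $ k"
          have "\<bar>Dd [i] (L w) p - L (Dd [i] w) p\<bar> <= (CARD('n) * CARD('n) + CARD('n)) * (2 ^ length [i] * AB (length [i])) * ((K + C) * T)"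
            using ord[OF p(1)] p(2) K C T by (intro Dd_L_commutator[OF r(2) ws p(1)]) (auto simp: T_def)
          moreover have "\<bar>L (Dd [i] w) p\<bar> <= C * T"
            using Lb[OF p(1), of "i # js"] js p(2) by (simp add: w_def T_def)
          ultimately show "\<bar>pd i (L w) p\<bar> <= (C + N * (2 * AB 1) * (K + C)) * T"
            by (simp add: N_def distrib_right mult.assoc)
        qed
        define S1 where "S1 = (\<Sum>i'\<in>UNIV. \<Sum>j\<in>UNIV. ((1 / h) * (a i' j x - a i' j z)) * pd i' (pd j w) x)"
        define S2 where "S2 = (\<Sum>j\<in>UNIV. ((1 / h) * (e j x - e j z)) * pd j w x)"
        \<comment> \<open>Discrete product rule: differencing \<open>L w\<close> also differences
          the coefficients, and the correction falls on derivatives of \<open>w\<close> at the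
          shifted point.\<close>
        have Lq: "L q z = (1 / h) * (L w x - L w z) - (S1 + S2)"
        proof -
          have p1: "pd j q z = (1 / h) * (pd j w x - pd j w z)" for j using Dq[OF z, of "[j]"] by (simp add: x_def)
          have p2: "pd i' (pd j q) z = (1 / h) * (pd i' (pd j w) x - pd i' (pd j w) z)" for i' j
            using Dq[OF z, of "[i', j]"] by (simp add: x_def)
          show ?thesis unfolding ellop_def S1_def S2_def p1 p2
            by (simp add: sum_distrib_left sum_subtractf sum.distrib algebra_simps diff_divide_distrib sum_divide_distrib)
        qed
        have "\<bar>S1\<bar> <= (\<Sum>i\<in>(UNIV::'n set). \<Sum>j\<in>(UNIV::'n set). AB 1 * ((K + C) * T))"
          unfolding S1_def
        proof (intro order_trans[OF sum_abs] sum_mono)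
          show "\<bar>((1 / h) * (a i' j x - a i' j z)) * pd i' (pd j w) x\<bar> <= AB 1 * ((K + C) * T)" for i' j
            unfolding abs_mult[of "_ * _" "pd _ _ _"] by (rule mult_mono[OF ab(1) dw(2) AB1]) simp
        qed
        moreover have "\<bar>S2\<bar> <= (\<Sum>j\<in>(UNIV::'n set). AB 1 * ((K + C) * T))"
          unfolding S2_def
        proof (intro order_trans[OF sum_abs] sum_mono)
          show "\<bar>((1 / h) * (e j x - e j z)) * pd j w x\<bar> <= AB 1 * ((K + C) * T)" for j
            unfolding abs_mult[of "_ * _" "pd _ _ _"] by (rule mult_mono[OF ab(2) dw(1) AB1]) simp
        qed
        moreover have "(\<Sum>i\<in>(UNIV::'n set). \<Sum>j\<in>(UNIV::'n set). AB 1 * ((K + C) * T)) + (\<Sum>j\<in>(UNIV::'n set). AB 1 * ((K + C) * T))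
            = N * AB 1 * (K + C) * T"
          by (simp add: N_def algebra_simps)
        ultimately have "\<bar>L q z\<bar> <= (C + N * (2 * AB 1) * (K + C)) * T + N * AB 1 * (K + C) * T"
          unfolding Lq using 1 by linarith
        also have "... = C3 * T" by (simp add: C3_def algebra_simps)
        finally show "\<bar>L q z\<bar> <= C3 / (z $ k * sqrt (z $ k))" by (simp add: T_def)
      qed
      then show ?thesis by (simp add: q_def wv_def v_def)
    qed
    have yr: "y \<in> H r" using y r half_ball_mono[of "r/4" r] by auto
    have "((%s. w (step y s i)) has_real_derivative pd i w (step y 0 i)) (at 0)"
      using smooth_on_differentiable[OF ws yr] by (intro line_deriv) simp
    then have "((%h. (w (step y h i) - w y) / h) \<longlongrightarrow> pd i w y) (at 0)"
      by (simp add: DERIV_def)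
    then have lim: "((%h. \<bar>(w (step y h i) - w y) / h\<bar>) \<longlongrightarrow> \<bar>pd i w y\<bar>) (at_right 0)"
      by (intro tendsto_rabs) (rule filterlim_at_split[THEN iffD1, THEN conjunct2])
    have ev: "\<forall>\<^sub>F h in at_right 0. \<bar>(w (step y h i) - w y) / h\<bar> <= A0 * C3 * sqrt (y $ k)"
      using eventually_at_right_real[OF r2(1)] by eventually_elim (use quot in auto)
    have "\<bar>pd i w y\<bar> <= A0 * C3 * sqrt (y $ k)"
      by (rule tendsto_upperbound[OF lim ev]) simp
    then show ?thesis by (simp add: ijs w_def)
  qed
  then show ?thesis using A0 C3 by (intro exI[of _ "A0 * C3"]) auto
qed


text \<open>On a ball of radius \<open>d / 2\<close> the function is of size \<open>sqrt d\<close>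
  and \<open>L\<close> of it has exponent -3/2; divided and multiplied by the radius respectively,
  both terms of the gradient estimate acquire exponent -1/2.\<close>

lemma tangential_gradient_step:
  assumes r: "0 < r" "r <= R" and C: "0 < C"
    and Lb: "!!y is. y \<in> H r ==> length is <= n ==> \<bar>L (Dd is u) y\<bar> <= C / (y $ k * sqrt (y $ k))"
    and tang: "!!y is. y \<in> H r ==> length is = n ==> k \<notin> set is ==> \<bar>Dd is u y\<bar> <= C * sqrt (y $ k)"
    and y: "y \<in> H (r/2)" and "is": "length is = n" "k \<notin> set is"
  shows "\<bar>pd j (Dd is u) y\<bar> <= 6 * C0 * C / sqrt (y $ k)"
proof -
  define d where "d = y $ k"
  have d: "0 < d" "d < r/2" using HD[OF y] by (auto simp: d_def)
  have sub: "cball y (d/2) \<subseteq> H r" using d by (intro cball_half_ball[OF y]) (auto simp: d_def)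
  have zk: "d / 2 <= z $ k" "z $ k <= 2 * d" if "z \<in> cball y (d/2)" for z
  proof -
    have "\<bar>(y - z) $ k\<bar> <= dist y z" unfolding dist_norm by (rule component_le_norm_cart)
    then have "\<bar>(y - z) $ k\<bar> <= d / 2" using that by simp
    then have "\<bar>d - z $ k\<bar> <= d / 2" by (simp add: d_def)
    then show "d / 2 <= z $ k" "z $ k <= 2 * d" using d(1) by linarith+
  qed
  have s: "0 < sqrt d" "d = sqrt d * sqrt d" using d by auto
  have sub_sm: "smooth_on (H r) (Dd is u)"
    using smooth_on_subset[OF smooth_on_Dd[OF u_smooth] half_ball_mono[OF r(2)]] .
  have "\<bar>pd j (Dd is u) y\<bar> <= C0 * (2 * C * sqrt d / (d/2) + (d/2) * (4 * C / (d * sqrt d)))"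
  proof (rule interior_gradient[OF r(2) sub_sm _ sub])
    fix z assume z: "z \<in> cball y (d/2)"
    have zH: "z \<in> H r" using z sub by blast
    have "\<bar>Dd is u z\<bar> <= C * sqrt (z $ k)" using tang[OF zH "is"] .
    also have "sqrt (z $ k) <= sqrt (4 * d)" using zk[OF z] d by simp
    also have "sqrt (4 * d) = 2 * sqrt d" by (simp add: real_sqrt_mult)
    finally show "\<bar>Dd is u z\<bar> <= 2 * C * sqrt d" using C by simp
    have "sqrt (d / 4) <= sqrt (z $ k)" using zk[OF z] d by simp
    then have "sqrt d / 2 <= sqrt (z $ k)" by (simp add: real_sqrt_divide)
    then have "(d / 2) * (sqrt d / 2) <= z $ k * sqrt (z $ k)" using zk(1)[OF z] d by (intro mult_mono) auto
    then have w: "d * sqrt d / 4 <= z $ k * sqrt (z $ k)" by simp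
    have "0 < d * sqrt d / 4" using d by simp
    have "\<bar>L (Dd is u) z\<bar> <= C / (z $ k * sqrt (z $ k))" using Lb[OF zH, of "is"] "is" by simp
    also have "... <= C / (d * sqrt d / 4)"
      by (rule divide_left_mono[OF w]) (use w \<open>0 < d * sqrt d / 4\<close> C in \<open>auto intro!: mult_pos_pos\<close>)
    finally show "\<bar>L (Dd is u) z\<bar> <= 4 * C / (d * sqrt d)" by (simp add: mult.commute)
  qed (use d C in auto)
  also have "2 * C * sqrt d / (d/2) + (d/2) * (4 * C / (d * sqrt d)) = 6 * C / sqrt d"
  proof -
    have "2 * C * sqrt d / (d/2) = 4 * C / sqrt d"
      using real_divide_square_eq[of "sqrt d" "4 * C"] s(2) by (simp add: mult_ac)
    moreover have "(d/2) * (4 * C / (d * sqrt d)) = 2 * C / sqrt d" using d by simp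
    ultimately show ?thesis by (simp add: add_divide_distrib[symmetric])
  qed
  finally show ?thesis by (simp add: d_def mult_ac)
qed

text \<open>The equation for \<open>Dd js u\<close>, solved for its second normal derivative,
  expresses a derivative with two more entries \<open>k\<close> through ones with at most one more.
  The induction runs over the number of normal derivatives; \<open>m = 0\<close> admits one of them
  and is covered by \<open>tang\<close>.\<close>

lemma normal_step:
  assumes r: "0 < r" "r <= R" and K: "0 <= K" and C: "0 < C"
    and lower: "!!y is. y \<in> H r ==> length is < n ==> \<bar>Dd is u y\<bar> <= K"
    and top: "!!y is. y \<in> H r ==> length is = n ==> \<bar>Dd is u y\<bar> <= C / sqrt (y $ k)"
    and tang: "!!y is j. y \<in> H r ==> length is = n ==> k \<notin> set is ==> \<bar>pd j (Dd is u) y\<bar> <= C / sqrt (y $ k)"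
  shows "\<exists>C'>0. \<forall>y\<in>H r. \<forall>is. length is = Suc n --> count (mset is) k <= Suc m --> \<bar>Dd is u y\<bar> <= C' / sqrt (y $ k)"
proof (induction m)
  case 0
  have "\<bar>Dd is u y\<bar> <= C / sqrt (y $ k)" if y: "y \<in> H r" and len: "length is = Suc n" and cnt: "count (mset is) k <= Suc 0" for y "is"
  proof -
    have yR: "y \<in> H R" using H_mono[OF r(2) y] .
    \<comment> \<open>Derivatives commute, so the single normal derivative, or any one if there is
      none, can be moved to the front.\<close>
    obtain j js where js: "mset is = mset (j # js)" "k \<notin> set js"
    proof (cases "k \<in> set is")
      case True
      then have "mset is = mset (k # remove1 k is)" by simp
      moreover have "k \<notin> set (remove1 k is)"
      proof
        assume "k \<in> set (remove1 k is)"
        then have "0 < count (mset (remove1 k is)) k" by (simp only: count_greater_zero_iff set_mset_mset)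
        moreover have "count (mset (remove1 k is)) k = count (mset is) k - 1" by simp
        ultimately show False using cnt by linarith
      qed
      ultimately show ?thesis using that by blast
    next
      case False
      then show ?thesis using that[of "hd is" "tl is"] len by (cases "is") auto
    qed
    have "length js = n" using len mset_eq_length[OF js(1)] by simp
    then show ?thesis
      using tang[OF y _ js(2), of j] Dd_perm[OF open_half_ball u_smooth js(1) yR] by simp
  qed
  then show ?case using C by blast
next
  case (Suc m)
  then obtain C2 where C2: "0 < C2" and IH: "\<forall>y\<in>H r. \<forall>is. length is = Suc n --> count (mset is) k <= Suc m --> \<bar>Dd is u y\<bar> <= C2 / sqrt (y $ k)"
    by blast
  obtain C1 where C1: "0 <= C1" and eqb: "\<forall>y B. y \<in> H R --> (\<forall>is. length is < n - 1 --> \<bar>Dd is u y\<bar> <= K) --> 0 <= B -->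
    (\<forall>is. length is <= (n - 1) + 1 --> \<bar>Dd is u y\<bar> <= B) -->
    (\<forall>js. length js <= n - 1 --> \<bar>Dd js (L u) y\<bar> <= C1 * (1 + B) & \<bar>L (Dd js u) y\<bar> <= C1 * (1 + B))"
    using L_Dd_u_bound[of "n - 1" K] by blast
  define N where "N = real CARD('n)"
  define C3 where "C3 = (C1 * (1 + K + C) + N * N * AB 0 * C2 + N * AB 0 * C) / \<theta>"
  have A0: "0 <= AB 0" by (rule AB_nonneg)
  have C3: "0 <= C3" using C1 K C A0 C2 \<theta> by (auto simp: C3_def N_def)
  have "\<bar>Dd is u y\<bar> <= (C2 + C3) / sqrt (y $ k)" if y: "y \<in> H r" and len: "length is = Suc n" and cnt: "count (mset is) k <= Suc (Suc m)" for y "is"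
  proof (cases "count (mset is) k <= Suc m")
    case True
    then have "\<bar>Dd is u y\<bar> <= C2 / sqrt (y $ k)" using IH y len by blast
    also have "... <= (C2 + C3) / sqrt (y $ k)" using C3 weight(1)[OF y r(2)] by (intro divide_right_mono) auto
    finally show ?thesis .
  next
    case False
    have yR: "y \<in> H R" using H_mono[OF r(2) y] .
    define T where "T = 1 / sqrt (y $ k)"
    have T: "1 <= T" using weight_le(1)[OF y r(2), of 1] by (simp add: T_def)
    have c2: "count (mset is) k = Suc (Suc m)" using cnt False by simp
    define js where "js = remove1 k (remove1 k is)"
    have k1: "k \<in> set is" using c2 by (metis count_mset_0_iff nat.distinct(1))
    have c1: "count (mset (remove1 k is)) k = Suc m" using c2 k1 by simp
    then have k2: "k \<in> set (remove1 k is)" by (metis count_mset_0_iff nat.distinct(1))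
    have ms1: "mset is = mset (k # remove1 k is)" using k1 by simp
    have ms2: "mset (remove1 k is) = mset (k # js)" using k2 unfolding js_def by (simp del: mset_remove1 add: mset_remove1[of k "remove1 k is"])
    have ms: "mset is = mset (k # k # js)" unfolding ms1 mset.simps(2) ms2 ..
    have cjs: "count (mset js) k = m" using c1 k2 by (simp add: js_def)
    have ljs: "Suc (length js) = n" using len mset_eq_length[OF ms] by simp
    have ord: "\<bar>Dd ls u y\<bar> <= (K + C) * T" if "length ls <= n" for ls
    proof (cases "length ls = n")
      case True
      then have "\<bar>Dd ls u y\<bar> <= C * T" using top[OF y] by (simp add: T_def)
      moreover have "0 <= K * T" using K T by simp
      ultimately show ?thesis by (simp add: distrib_right)
    next
      case False
      then have "\<bar>Dd ls u y\<bar> <= K" using lower[OF y] that by simp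
      moreover have "K * 1 <= K * T" "0 <= C * T" using K T C by (auto intro!: mult_left_mono simp del: mult_1_right)
      ultimately show ?thesis by (simp add: distrib_right)
    qed
    have LD: "\<bar>L (Dd js u) y\<bar> <= C1 * (1 + K + C) * T"
    proof -
      have "\<bar>L (Dd js u) y\<bar> <= C1 * (1 + (K + C) * T)"
        using eqb[rule_format, OF yR, of "(K + C) * T" js] lower[OF y] ord ljs K C T by auto
      also have "... <= C1 * (T + (K + C) * T)" using T C1 by (intro mult_left_mono) auto
      finally show ?thesis by (simp add: algebra_simps)
    qed
    \<comment> \<open>All second-order terms except the purely normal one; \<open>js\<close>
      contains \<open>k\<close> exactly \<open>m\<close> times, so each of them is covered by the
      induction hypothesis.\<close>
    define s where "s i j = (if i = k & j = k then 0 else a i j y * pd i (pd j (Dd js u)) y)" for i j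
    have ab: "\<bar>a i j y\<bar> <= AB 0" "\<bar>e i y\<bar> <= AB 0" for i j
      using AB_le[OF yR, of "[]" 0] by auto
    have sb: "\<bar>s i j\<bar> <= AB 0 * (C2 * T)" for i j
    proof (cases "i = k & j = k")
      case True
      then have "s i j = 0" by (simp add: s_def)
      moreover have "0 <= AB 0 * (C2 * T)" using A0 C2 T by simp
      ultimately show ?thesis by simp
    next
      case False
      have "\<bar>Dd (i # j # js) u y\<bar> <= C2 / sqrt (y $ k)"
        using False cjs ljs y by (intro IH[rule_format]) auto
      then have "\<bar>pd i (pd j (Dd js u)) y\<bar> <= C2 * T" by (simp add: T_def)
      then have "\<bar>a i j y * pd i (pd j (Dd js u)) y\<bar> <= AB 0 * (C2 * T)"
        unfolding abs_mult using ab A0 by (intro mult_mono) auto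
      then show ?thesis using False by (auto simp: s_def)
    qed
    have "\<bar>\<Sum>i\<in>UNIV. \<Sum>j\<in>UNIV. s i j\<bar> <= (\<Sum>i\<in>(UNIV::'n set). \<Sum>j\<in>(UNIV::'n set). AB 0 * (C2 * T))"
      using sb by (intro order_trans[OF sum_abs] sum_mono)
    then have S: "\<bar>\<Sum>i\<in>UNIV. \<Sum>j\<in>UNIV. s i j\<bar> <= N * N * AB 0 * C2 * T" by (simp add: N_def mult_ac)
    have "\<bar>e i y * pd i (Dd js u) y\<bar> <= AB 0 * (C * T)" for i
    proof -
      have "\<bar>Dd (i # js) u y\<bar> <= C / sqrt (y $ k)" using ljs by (intro top[OF y]) simp
      then have "\<bar>pd i (Dd js u) y\<bar> <= C * T" by (simp add: T_def)
      then show ?thesis unfolding abs_mult using ab A0 by (intro mult_mono) auto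
    qed
    then have "\<bar>\<Sum>i\<in>UNIV. e i y * pd i (Dd js u) y\<bar> <= (\<Sum>i\<in>(UNIV::'n set). AB 0 * (C * T))"
      by (intro order_trans[OF sum_abs] sum_mono)
    then have E: "\<bar>\<Sum>i\<in>UNIV. e i y * pd i (Dd js u) y\<bar> <= N * AB 0 * C * T" by (simp add: N_def mult_ac)
    have "(\<Sum>i\<in>UNIV. \<Sum>j\<in>UNIV. a i j y * pd i (pd j (Dd js u)) y)
        = (\<Sum>i\<in>UNIV. \<Sum>j\<in>UNIV. s i j + (if i = k then if j = k then a i j y * pd i (pd j (Dd js u)) y else 0 else 0))"
      by (intro sum.cong) (auto simp: s_def)
    also have "... = (\<Sum>i\<in>UNIV. \<Sum>j\<in>UNIV. s i j)
        + (\<Sum>i\<in>UNIV. if i = k then (\<Sum>j\<in>UNIV. if j = k then a i j y * pd i (pd j (Dd js u)) y else 0) else 0)"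
      unfolding sum.distrib by (intro arg_cong2[where f = "(+)"] sum.cong refl) auto
    also have "... = (\<Sum>i\<in>UNIV. \<Sum>j\<in>UNIV. s i j) + a k k y * pd k (pd k (Dd js u)) y" by simp
    finally have "a k k y * pd k (pd k (Dd js u)) y
        = L (Dd js u) y - (\<Sum>i\<in>UNIV. \<Sum>j\<in>UNIV. s i j) - (\<Sum>i\<in>UNIV. e i y * pd i (Dd js u) y)"
      by (simp add: ellop_def)
    then have "\<bar>a k k y * pd k (pd k (Dd js u)) y\<bar> <= C1 * (1 + K + C) * T + N * N * AB 0 * C2 * T + N * AB 0 * C * T"
      using LD S E by linarith
    also have "... = \<theta> * (C3 * T)" using \<theta> by (simp add: C3_def distrib_right)
    finally have "\<theta> * \<bar>pd k (pd k (Dd js u)) y\<bar> <= \<theta> * (C3 * T)"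
      using elliptic[OF yR] \<theta> mult_right_mono[of \<theta> "\<bar>a k k y\<bar>" "\<bar>pd k (pd k (Dd js u)) y\<bar>"]
      unfolding abs_mult by linarith
    then have "\<bar>pd k (pd k (Dd js u)) y\<bar> <= C3 * T" using \<theta> by simp
    moreover have "Dd is u y = pd k (pd k (Dd js u)) y" using Dd_perm[OF open_half_ball u_smooth ms yR] by simp
    moreover have "C3 * T <= (C2 + C3) * T" using C2 T by (intro mult_right_mono) auto
    ultimately show ?thesis by (simp add: T_def)
  qed
  then show ?case using C2 C3 by (intro exI[of _ "C2 + C3"]) auto
qed

text \<open>A normal derivative with exponent -1/2 is integrable up to the boundary. The auxiliary
  \<open>g\<close> adds the primitive \<open>2 * C * sqrt\<close> and is monotone along the normal
  segment of length \<open>r / 2\<close>.\<close>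

lemma normal_integration:
  assumes r: "0 < r" "r <= R" and C: "0 < C" and f: "smooth_on (H r) f"
    and fb: "!!y. y \<in> H r ==> \<bar>f y\<bar> <= C / sqrt (y $ k)" "!!y. y \<in> H r ==> \<bar>pd k f y\<bar> <= C / sqrt (y $ k)"
    and y: "y \<in> H (r/2)"
  shows "f y <= C / sqrt (r/2) + 2 * C"
proof -
  define t where "t = r/2"
  have t: "0 < t" using r by (simp add: t_def)
  have d: "0 < y $ k" using HD[OF y] by blast
  have p: "step y s k \<in> H r" "(step y s k) $ k = y $ k + s" if "0 <= s" "s <= t" for s
  proof -
    show e: "(step y s k) $ k = y $ k + s" by (simp add: axis_def)
    have "dist y (step y s k) = s" using that by (simp add: dist_norm)
    then have "dist y0 (step y s k) < r"
      using dist_triangle[of y0 "step y s k" y] y that by (simp add: half_ball_def t_def)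
    then show "step y s k \<in> H r" unfolding half_ball_def mem_Collect_eq e using d that by simp
  qed
  define g where "g s = f (step y s k) + 2 * C * sqrt (y $ k + s)" for s
  have der: "(g has_real_derivative (pd k f (step y s k) + C / sqrt (y $ k + s))) (at s)" if "0 <= s" "s <= t" for s
    unfolding g_def using d that
    by (auto intro!: derivative_eq_intros line_deriv smooth_on_differentiable[OF f p(1)] simp: divide_simps)
  have "g 0 <= g t"
  proof (rule DERIV_nonneg_imp_nondecreasing[OF less_imp_le[OF t]])
    fix s assume s: "0 <= s" "s <= t"
    have "0 <= pd k f (step y s k) + C / sqrt (y $ k + s)"
      using fb(2)[OF p(1)[OF s]] p(2)[OF s] by (simp add: abs_le_iff)
    then show "\<exists>m. (g has_real_derivative m) (at s) & 0 <= m" using der[OF s] by blast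
  qed
  moreover have "f y + 2 * C * sqrt (y $ k) = g 0" by (simp add: g_def)
  moreover have "0 <= 2 * C * sqrt (y $ k)" using C d by simp
  moreover have "g t = f (step y t k) + 2 * C * sqrt (y $ k + t)" by (rule g_def)
  ultimately have "f y <= f (step y t k) + 2 * C * sqrt (y $ k + t)" by linarith
  moreover have "f (step y t k) <= C / sqrt (r/2)"
  proof -
    have "f (step y t k) <= C / sqrt (y $ k + t)"
      using fb(1)[OF p(1)[of t]] p(2)[of t] t by auto
    also have "... <= C / sqrt (r/2)" using C d t by (intro divide_left_mono) (auto simp: t_def)
    finally show ?thesis .
  qed
  moreover have "2 * C * sqrt (y $ k + t) <= 2 * C"
  proof -
    have "sqrt (y $ k + t) <= 1" using HD[OF y] r R by (simp add: t_def)
    then show ?thesis using C by simp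
  qed
  ultimately show ?thesis by linarith
qed

text \<open>The three clauses form an inductive balance around order \<open>n\<close>: boundedness
  below it, exponent -1/2 at it, and square-root decay of the tangential derivatives just below it.
  For \<open>n = 0\<close> the bound on \<open>u\<close> suffices, since
  \<open>1 / sqrt (y $ k)\<close> is at least 1.\<close>

lemma regularity_induction:
  "\<exists>r C. 0 < r & r <= R & 0 < C & (\<forall>y\<in>H r. (\<forall>is. length is < n --> \<bar>Dd is u y\<bar> <= C) &
    (\<forall>is. length is = n --> \<bar>Dd is u y\<bar> <= C / sqrt (y $ k)) &
    (\<forall>is. Suc (length is) = n --> k \<notin> set is --> \<bar>Dd is u y\<bar> <= C * sqrt (y $ k)))"
proof (induction n)
  case 0
  have "\<bar>u y\<bar> <= 1 / sqrt (y $ k)" if "y \<in> H R" for y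
    using u_bounds[OF that] d0 weight_le(1)[OF that order_refl, of 1] by simp
  then show ?case using R by (intro exI[of _ R] exI[of _ 1]) auto
next
  case (Suc n)
  then obtain r C where r: "0 < r" "r <= R" and C: "0 < C" and H0: "\<forall>y\<in>H r. (\<forall>is. length is < n --> \<bar>Dd is u y\<bar> <= C) &
    (\<forall>is. length is = n --> \<bar>Dd is u y\<bar> <= C / sqrt (y $ k)) &
    (\<forall>is. Suc (length is) = n --> k \<notin> set is --> \<bar>Dd is u y\<bar> <= C * sqrt (y $ k))" by blast
  have mono: "C / sqrt (y $ k) <= C' / sqrt (y $ k)" "C / (y $ k * sqrt (y $ k)) <= C' / (y $ k * sqrt (y $ k))"
    "C * sqrt (y $ k) <= C' * sqrt (y $ k)" if "C <= C'" "y \<in> H s" "s <= R" for C C' y s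
    using that weight[OF that(2,3)] by (auto intro: divide_right_mono mult_right_mono)
  have lower: "\<bar>Dd is u y\<bar> <= C" if "y \<in> H r" "length is < n" for y "is" using H0 that by blast
  have top: "\<bar>Dd is u y\<bar> <= C / sqrt (y $ k)" if "y \<in> H r" "length is = n" for y "is" using H0 that by blast
  have tang: "\<bar>Dd is u y\<bar> <= C * sqrt (y $ k)" if "y \<in> H r" "Suc (length is) = n" "k \<notin> set is" for y "is"
    using H0 that by blast
  \<comment> \<open>Order \<open>n + 1\<close> is reached first with exponent -3/2 only.\<close>
  obtain C1 where C1: "0 < C1" "\<forall>y\<in>H (r/2). \<forall>is. length is = Suc n --> \<bar>Dd is u y\<bar> <= C1 / (y $ k * sqrt (y $ k))"
    using interior_step[OF r(2) less_imp_le[OF C] C lower top] by blast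
  define r2 where "r2 = r/2"
  define Ca where "Ca = max C C1"
  have r2: "0 < r2" "r2 <= R" using r by (auto simp: r2_def)
  have sub: "y \<in> H r" if "y \<in> H r2" for y using that r half_ball_mono[of r2 r] by (auto simp: r2_def)
  have Ca: "C <= Ca" "C1 <= Ca" "0 < Ca" using C by (auto simp: Ca_def)
  have topa: "\<bar>Dd is u y\<bar> <= Ca / sqrt (y $ k)" if "y \<in> H r2" "length is = n" for y "is"
    using top[OF sub[OF that(1)] that(2)] mono(1)[OF Ca(1) that(1) r2(2)] by linarith
  have top1: "\<bar>Dd is u y\<bar> <= Ca / (y $ k * sqrt (y $ k))" if "y \<in> H r2" "length is = Suc n" for y "is"
    using C1(2) that mono(2)[OF Ca(2) that(1) r2(2)] unfolding r2_def by fastforce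
  obtain C2 where C2: "0 < C2" "\<forall>y\<in>H r2. \<forall>js. length js <= n --> \<bar>L (Dd js u) y\<bar> <= C2 / (y $ k * sqrt (y $ k))"
    using L_Dd_weighted[OF r2(2) less_imp_le[OF C] Ca(3) lower[OF sub] topa top1] by blast
  define Cb where "Cb = max Ca C2"
  have Cb: "Ca <= Cb" "C2 <= Cb" "0 < Cb" "C <= Cb" using Ca by (auto simp: Cb_def)
  have Lb: "\<bar>L (Dd is u) y\<bar> <= Cb / (y $ k * sqrt (y $ k))" if "y \<in> H r2" "length is <= n" for y "is"
    using C2(2) that mono(2)[OF Cb(2) that(1) r2(2)] by fastforce
  \<comment> \<open>The barrier gives square-root decay of the tangential derivatives of order
    \<open>n\<close>, which is the third clause for the next order.\<close>
  have "\<exists>C'>0. \<forall>y\<in>H (r2/4). \<forall>is. length is = n --> k \<notin> set is --> \<bar>Dd is u y\<bar> <= C' * sqrt (y $ k)"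
  proof (rule tangential_step[OF r2 less_imp_le[OF C] Cb(3) lower[OF sub] _ _ Lb])
    show "\<bar>Dd is u y\<bar> <= Cb / sqrt (y $ k)" if "y \<in> H r2" "length is = n" for y "is"
      using topa[OF that] mono(1)[OF Cb(1) that(1) r2(2)] by linarith
    show "\<bar>Dd is u y\<bar> <= Cb / (y $ k * sqrt (y $ k))" if "y \<in> H r2" "length is = Suc n" for y "is"
      using top1[OF that] mono(2)[OF Cb(1) that(1) r2(2)] by linarith
    show "\<bar>Dd is u y\<bar> <= Cb * sqrt (y $ k)" if "y \<in> H r2" "Suc (length is) = n" "k \<notin> set is" for y "is"
      using tang[OF sub[OF that(1)] that(2,3)] mono(3)[OF Cb(4) that(1) r2(2)] by linarith
  qed auto
  then obtain C3 where C3: "0 < C3" "\<forall>y\<in>H (r2/4). \<forall>is. length is = n --> k \<notin> set is --> \<bar>Dd is u y\<bar> <= C3 * sqrt (y $ k)"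
    by blast
  define r3 where "r3 = r2/4"
  have r3: "0 < r3" "r3 <= R" using r2 by (auto simp: r3_def)
  have sub3: "y \<in> H r2" if "y \<in> H r3" for y using that r2 half_ball_mono[of r3 r2] by (auto simp: r3_def)
  define Cc where "Cc = max Cb C3"
  have Cc: "Cb <= Cc" "C3 <= Cc" "0 < Cc" using Cb by (auto simp: Cc_def)
  \<comment> \<open>With at most one derivative in the normal direction, order \<open>n + 1\<close>
    now has exponent -1/2.\<close>
  have tang3: "\<bar>pd j (Dd is u) y\<bar> <= 6 * C0 * Cc / sqrt (y $ k)"
    if "y \<in> H (r3/2)" "length is = n" "k \<notin> set is" for y "is" j
  proof (rule tangential_gradient_step[OF r3 Cc(3) _ _ that])
    show "\<bar>L (Dd is u) y\<bar> <= Cc / (y $ k * sqrt (y $ k))" if "y \<in> H r3" "length is <= n" for y "is"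
      using Lb[OF sub3[OF that(1)] that(2)] mono(2)[OF Cc(1) that(1) r3(2)] by linarith
    show "\<bar>Dd is u y\<bar> <= Cc * sqrt (y $ k)" if "y \<in> H r3" "length is = n" "k \<notin> set is" for y "is"
      using C3(2) that mono(3)[OF Cc(2) that(1) r3(2)] unfolding r3_def by fastforce
  qed
  define r4 where "r4 = r3/2"
  have r4: "0 < r4" "r4 <= R" using r3 by (auto simp: r4_def)
  have sub4: "y \<in> H r3" if "y \<in> H r4" for y using that r3 half_ball_mono[of r4 r3] by (auto simp: r4_def)
  define Cd where "Cd = max Cc (6 * C0 * Cc)"
  have Cd: "Cc <= Cd" "6 * C0 * Cc <= Cd" "0 < Cd" "Ca <= Cd" using Cc Cb by (auto simp: Cd_def)
  have top4: "\<bar>Dd is u y\<bar> <= Cd / sqrt (y $ k)" if "y \<in> H r4" "length is = n" for y "is"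
    using topa[OF sub3[OF sub4[OF that(1)]] that(2)] mono(1)[OF Cd(4) that(1) r4(2)] by linarith
  \<comment> \<open>The equation supplies the remaining normal derivatives. A list of length
    \<open>Suc n\<close> contains \<open>k\<close> at most \<open>Suc n\<close> times, so every list
    is covered.\<close>
  have "\<exists>C'>0. \<forall>y\<in>H r4. \<forall>is. length is = Suc n --> count (mset is) k <= Suc n --> \<bar>Dd is u y\<bar> <= C' / sqrt (y $ k)"
  proof (rule normal_step[OF r4 less_imp_le[OF C] Cd(3) _ top4])
    show "\<bar>Dd is u y\<bar> <= C" if "y \<in> H r4" "length is < n" for y "is"
      using lower sub sub3 sub4 that by blast
    show "\<bar>pd j (Dd is u) y\<bar> <= Cd / sqrt (y $ k)" if "y \<in> H r4" "length is = n" "k \<notin> set is" for y "is" j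
      using tang3[of y "is" j] that mono(1)[OF Cd(2) that(1) r4(2)] by (simp add: r4_def)
  qed auto
  then obtain C4 where C4: "0 < C4" "\<forall>y\<in>H r4. \<forall>is. length is = Suc n --> count (mset is) k <= Suc n --> \<bar>Dd is u y\<bar> <= C4 / sqrt (y $ k)"
    by blast
  define Ce where "Ce = max Cd C4"
  have Ce: "Cd <= Ce" "C4 <= Ce" "0 < Ce" using Cd by (auto simp: Ce_def)
  have top5: "\<bar>Dd is u y\<bar> <= Ce / sqrt (y $ k)" if "y \<in> H r4" "length is = Suc n" for y "is"
  proof -
    have "count (mset is) k <= Suc n" using count_le_length[of "is" k] that(2) by (simp add: count_mset)
    then have "\<bar>Dd is u y\<bar> <= C4 / sqrt (y $ k)" using C4(2) that by blast
    then show ?thesis using mono(1)[OF Ce(2) that(1) r4(2)] by linarith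
  qed
  \<comment> \<open>Integration along the normal removes the singularity at order
    \<open>n\<close>.\<close>
  define B where "B = Ce / sqrt (r4/2) + 2 * Ce"
  have B: "0 <= B" using Ce r4 by (simp add: B_def)
  have bnd: "\<bar>Dd is u y\<bar> <= B" if y: "y \<in> H (r4/2)" and len: "length is = n" for y "is"
  proof -
    have s: "smooth_on (H r4) (Dd is u)"
      using smooth_on_subset[OF smooth_on_Dd[OF u_smooth] half_ball_mono[OF r4(2)]] .
    have 1: "\<bar>Dd is u z\<bar> <= Ce / sqrt (z $ k)" if "z \<in> H r4" for z
      using top4[OF that len] mono(1)[OF Ce(1) that r4(2)] by linarith
    have 2: "\<bar>pd k (Dd is u) z\<bar> <= Ce / sqrt (z $ k)" if "z \<in> H r4" for z
      using top5[OF that, of "k # is"] len by simp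
    have "Dd is u y <= B" unfolding B_def by (rule normal_integration[OF r4 Ce(3) s 1 2 y])
    moreover have "(- 1) * Dd is u y <= B" unfolding B_def
    proof (rule normal_integration[OF r4 Ce(3) smooth_on_cmult[OF open_half_ball s] _ _ y])
      show "\<bar>(- 1) * Dd is u z\<bar> <= Ce / sqrt (z $ k)" if "z \<in> H r4" for z using 1[OF that] by simp
      show "\<bar>pd k (%y. (- 1) * Dd is u y) z\<bar> <= Ce / sqrt (z $ k)" if "z \<in> H r4" for z
        using 2[OF that] pd_cmult[OF smooth_on_differentiable[OF s that], of k "-1"] by simp
    qed
    ultimately show ?thesis by linarith
  qed
  define r5 where "r5 = r4/2"
  have r5: "0 < r5" "r5 <= R" using r4 by (auto simp: r5_def)
  have sub5: "y \<in> H r4" if "y \<in> H r5" for y using that r4 half_ball_mono[of r5 r4] by (auto simp: r5_def)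
  define Cf where "Cf = max Ce (max B (max C C3))"
  have Cf: "Ce <= Cf" "B <= Cf" "C <= Cf" "C3 <= Cf" "0 < Cf" using Ce by (auto simp: Cf_def)
  have "\<bar>Dd is u y\<bar> <= Cf" if "y \<in> H r5" "length is < Suc n" for y "is"
  proof (cases "length is = n")
    case True then show ?thesis using bnd[of y "is"] that Cf(2) by (simp add: r5_def)
  next
    case False
    then have "\<bar>Dd is u y\<bar> <= C" using lower[OF sub[OF sub3[OF sub4[OF sub5[OF that(1)]]]], of "is"] that by simp
    then show ?thesis using Cf(3) by linarith
  qed
  moreover have "\<bar>Dd is u y\<bar> <= Cf / sqrt (y $ k)" if "y \<in> H r5" "length is = Suc n" for y "is"
    using top5[OF sub5[OF that(1)] that(2)] mono(1)[OF Cf(1) that(1) r5(2)] by linarith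
  moreover have "\<bar>Dd is u y\<bar> <= Cf * sqrt (y $ k)" if "y \<in> H r5" "length is = n" "k \<notin> set is" for y "is"
  proof -
    have "\<bar>Dd is u y\<bar> <= C3 * sqrt (y $ k)" using C3(2) sub4[OF sub5[OF that(1)]] that unfolding r3_def by blast
    then show ?thesis using mono(3)[OF Cf(4) that(1) r5(2)] by linarith
  qed
  ultimately show ?case using r5 Cf(5) by (intro exI[of _ r5] conjI exI[of _ Cf]) auto
qed

theorem boundary_regularity:
  "\<exists>r C. 0 < r & r <= R & (\<forall>y\<in>H r. \<forall>is. length is <= m --> \<bar>Dd is u y\<bar> <= C)"
proof -
  obtain r C where "0 < r" "r <= R" "\<forall>y\<in>H r. \<forall>is. length is < Suc m --> \<bar>Dd is u y\<bar> <= C"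
    using regularity_induction[of "Suc m"] by blast
  then show ?thesis by (intro exI[of _ r] exI[of _ C]) auto
qed

end

section \<open>Straightening the boundary\<close>

text \<open>Bounds only: differentiability is carried by \<open>smooth_on\<close>, and
  \<open>S\<close> need not be open.\<close>

definition Cb :: "nat => (real^'n::finite) set => (real^'n => 'b::real_normed_vector) => bool"
  where "Cb n S f \<longleftrightarrow> (\<forall>is. length is <= n --> bounded (Dd is f ` S))"

lemma Cb_bound:
  fixes f :: "real^'n => 'b::real_normed_vector"
  assumes "Cb n S f"
  obtains B where "0 <= B" "!!is y. length is <= n ==> y \<in> S ==> norm (Dd is f y) <= B"
proof -
  define P where "P is B \<longleftrightarrow> length is <= n --> (\<forall>y\<in>S. norm (Dd is f y) <= B)" for "is" B
  have ex: "\<exists>B. P is B" for "is" using assms by (auto simp: Cb_def P_def bounded_iff)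
  have fin: "finite (UNIV :: 'n set)" by simp
  show ?thesis by (rule finite_lists_bound[of P n, OF fin ex]) (use that in \<open>force simp: P_def\<close>)+
qed

lemma Cb_boundI: "(!!is y. length is <= n ==> y \<in> S ==> norm (Dd is f y) <= B) ==> Cb n S f"
  by (auto simp: Cb_def bounded_iff)

lemma Cb_subset: "Cb n T f ==> S \<subseteq> T ==> Cb n S f"
  unfolding Cb_def by (blast intro: bounded_subset image_mono)

lemma Cb_Suc: "Cb (Suc n) S f \<longleftrightarrow> Cb n S f & (\<forall>i. Cb n S (pd i f))"
proof
  show "Cb n S f & (\<forall>i. Cb n S (pd i f))" if "Cb (Suc n) S f"
    using that unfolding Cb_def Dd_snoc[symmetric] by simp
  assume a: "Cb n S f & (\<forall>i. Cb n S (pd i f))"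
  show "Cb (Suc n) S f" unfolding Cb_def
  proof (intro allI impI)
    fix "is" :: "'a list" assume "length is <= Suc n"
    then show "bounded (Dd is f ` S)" using a
      by (cases "is" rule: rev_cases) (auto simp: Cb_def Dd_snoc dest: spec[of _ "[]"])
  qed
qed

lemma Cb_cong:
  assumes "open S" "!!y. y \<in> S ==> f y = g y" "Cb n S g"
  shows "Cb n S f"
proof -
  have "Dd is f ` S = Dd is g ` S" for "is" by (rule image_cong[OF refl Dd_cong[OF assms(1,2)]])
  then show ?thesis using assms(3) by (simp add: Cb_def)
qed

lemma Cb_mult:
  fixes f g :: "real^'n => real"
  assumes S: "open S" "smooth_on S f" "smooth_on S g" and b: "Cb n S f" "Cb n S g"
  shows "Cb n S (%x. f x * g x)"
proof -
  obtain A where A: "0 <= A" "!!is y. length is <= n ==> y \<in> S ==> norm (Dd is f y) <= A"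
    by (rule Cb_bound[OF b(1)]) (rule that)
  obtain B where B: "0 <= B" "!!is y. length is <= n ==> y \<in> S ==> norm (Dd is g y) <= B"
    by (rule Cb_bound[OF b(2)]) (rule that)
  show ?thesis
    by (rule Cb_boundI[where B = "2 ^ n * A * B"], unfold real_norm_def, rule Dd_mult_bound[OF S(1) _ S(2,3)])
       (use A B in auto)
qed

lemma Cb_sum:
  fixes f :: "'i => real^'n => real"
  assumes S: "open S" and I: "finite I" "!!j. j \<in> I ==> smooth_on S (f j)" "!!j. j \<in> I ==> Cb n S (f j)"
  shows "Cb n S (%x. \<Sum>j\<in>I. f j x)"
proof -
  have "\<exists>B. \<forall>is y. length is <= n --> y \<in> S --> norm (Dd is (f j) y) <= B" if "j \<in> I" for j
    using Cb_bound[OF I(3)[OF that]] by metis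
  then obtain B where B: "!!j is y. j \<in> I ==> length is <= n ==> y \<in> S ==> norm (Dd is (f j) y) <= B j" by metis
  show ?thesis
  proof (rule Cb_boundI)
    fix "is" :: "'n list" and y assume y: "length is <= n" "y \<in> S"
    show "norm (Dd is (%x. \<Sum>j\<in>I. f j x) y) <= (\<Sum>j\<in>I. B j)"
    proof -
      have "Dd is (%x. \<Sum>j\<in>I. f j x) y = (\<Sum>j\<in>I. Dd is (f j) y)" by (rule Dd_sum[OF S I(1) _ y(2)]) (rule I(2))
      then show ?thesis by (rule ssubst) (rule sum_norm_le, rule B[OF _ y])
    qed
  qed
qed

lemma Cb_compose:
  fixes f :: "real^'m => real" and g :: "real^'n => real^'m"
  assumes S: "open S" "smooth_on S g" "!!x. x \<in> S ==> g x \<in> T" and g: "!!l. Cb n S (%x. g x $ l)"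
    and f: "smooth_on T f" "Cb n T f"
  shows "Cb n S (%x. f (g x))"
  using g f
proof (induction n arbitrary: f)
  case 0
  have "(%x. f (g x)) ` S \<subseteq> f ` T" using S(3) by blast
  then show ?case using 0(3) by (auto simp: Cb_def intro: bounded_subset)
next
  case (Suc n)
  have gn: "Cb n S (%x. g x $ l)" for l using Suc.prems(1)[of l] by (simp add: Cb_Suc)
  have sc: "smooth_on S (%x. pd l f (g x))" "smooth_on S (pd i (%x. g x $ l))" for l i
    by (rule smooth_on_compose[OF S smooth_on_pd[OF Suc.prems(2)]] smooth_on_pd[OF smooth_on_component[OF S(1,2)]], assumption?)+
  have "Cb n S (pd i (%x. f (g x)))" for i
  proof (rule Cb_cong[OF S(1)])
    show "pd i (%x. f (g x)) y = (\<Sum>l\<in>UNIV. pd l f (g y) * pd i (%x. g x $ l) y)" if "y \<in> S" for y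
      by (rule pd_compose(1)[OF smooth_on_differentiable[OF S(2) that] smooth_on_differentiable[OF Suc.prems(2) S(3)[OF that]]])
    show "Cb n S (%y. \<Sum>l\<in>UNIV. pd l f (g y) * pd i (%x. g x $ l) y)"
    proof (intro Cb_sum[OF S(1) finite] smooth_on_mult[OF S(1) sc] Cb_mult[OF S(1) sc])
      show "Cb n S (%x. pd l f (g x))" for l
        using Suc.IH[OF gn smooth_on_pd[OF Suc.prems(2)]] Suc.prems(3) by (simp add: Cb_Suc)
      show "Cb n S (pd i (%x. g x $ l))" for l using Suc.prems(1)[of l] by (simp add: Cb_Suc)
    qed
  qed
  moreover have "Cb n S (%x. f (g x))" using Suc.IH[OF gn Suc.prems(2)] Suc.prems(3) by (simp add: Cb_Suc)
  ultimately show ?case by (simp add: Cb_Suc)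
qed

lemma Cb_component:
  fixes f :: "real^'n => real^'m"
  assumes "open T" "smooth_on T f" "S \<subseteq> T" "Cb n S f"
  shows "Cb n S (%x. f x $ l)"
proof -
  obtain B where B: "0 <= B" "!!is y. length is <= n ==> y \<in> S ==> norm (Dd is f y) <= B"
    by (rule Cb_bound[OF assms(4)]) (rule that)
  show ?thesis
  proof (rule Cb_boundI)
    fix "is" :: "'n list" and y assume y: "length is <= n" "y \<in> S"
    show "norm (Dd is (%x. f x $ l) y) <= B"
      using Dd_component[OF assms(1,2), of y "is" l] y assms(3) B(2)[OF y] component_le_norm_cart[of "Dd is f y" l] by auto
  qed
qed

lemma Cb_compact: "smooth_on S f ==> compact K ==> K \<subseteq> S ==> Cb n K f"
  unfolding Cb_def
  by (blast intro: compact_imp_bounded compact_continuous_image continuous_on_subset smooth_on_continuous_on smooth_on_Dd)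

lemmas smooth_on_compact_bounded = Cb_bound[OF Cb_compact]

text \<open>The lattice estimate as \<open>h\<close> tends to 0. Working on half the radius leaves
  room for the mesh and accounts for the larger constant.\<close>

lemma interior_gradient_laplacian:
  fixes f :: "real^'n => real"
  assumes S: "open S" "smooth_on S f" "cball x \<rho> \<subseteq> S" "0 < \<rho>" and M0: "0 < M" "0 <= N"
    and M: "!!z. z \<in> cball x \<rho> ==> \<bar>f z\<bar> <= M" and N: "!!z. z \<in> cball x \<rho> ==> \<bar>laplacian f z\<bar> <= N"
  shows "\<bar>pd i f x\<bar> <= 32 * (real CARD('n))\<^sup>2 * (M / \<rho> + \<rho> * N)"
proof -
  define n where "n = real CARD('n)"
  have n: "1 <= n" by (simp add: n_def Suc_leI)
  \<comment> \<open>Third derivatives enter the discretisation error only, which disappears in the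
    limit.\<close>
  obtain K where K0: "0 <= K" and K: "!!is y. length is <= 3 ==> y \<in> cball x \<rho> ==> norm (Dd is f y) <= K"
    using smooth_on_compact_bounded[OF S(2) compact_cball S(3)] by blast
  have K3: "\<bar>pd j (pd j (pd j f)) z\<bar> <= K" if "z \<in> cball x \<rho>" for z j
    using K[of "[j,j,j]" z] that by simp
  have est: "\<bar>dq h i f x\<bar> <= 16 * n\<^sup>2 * (2 * M / \<rho> + \<rho> / 2 * (N + n * (h * K)))" if h: "0 < h" "n * h <= \<rho> / 2" for h
  proof -
    have hn: "h <= n * h" using n h mult_right_mono[of 1 n h] by simp
    have sub: "cball z h \<subseteq> cball x \<rho>" if "z \<in> cball x (\<rho>/2)" for z
    proof
      fix w assume "w \<in> cball z h"
      then have "dist z w <= \<rho> / 2" "dist x z <= \<rho> / 2" using that hn h(2) by (auto simp del: mult_le_cancel_right1)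
      then show "w \<in> cball x \<rho>" using dist_triangle[of x w z] by (simp del: dist_commute)
    qed
    have "\<bar>dq h i f x\<bar> <= 16 * (CARD('n))\<^sup>2 * (M / (\<rho>/2) + \<rho>/2 * (N + n * (h * K)))"
    proof (rule dlap_gradient[OF h(1)])
      show "real CARD('n) * h <= \<rho>/2" using h(2) unfolding n_def .
      show "0 <= N + n * (h * K)" using M0(2) n h(1) K0 by simp
      fix z assume z: "z \<in> cball x (\<rho>/2)"
      then have zr: "z \<in> cball x \<rho>" using S(4) by simp
      show "\<bar>f z\<bar> <= M" by (rule M[OF zr])
      have "\<bar>dlap h f z - laplacian f z\<bar> <= n * (h * K)" unfolding n_def
        by (rule dlap_consistent[OF h(1) S(2)]) (use sub[OF z] S(3) K3 in auto)
      then show "\<bar>dlap h f z\<bar> <= N + n * (h * K)" using N[OF zr] by linarith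
    qed (use M0 in auto)
    then show ?thesis by (simp add: n_def mult.commute)
  qed
  have "\<bar>pd i f x\<bar> <= 16 * n\<^sup>2 * (2 * M / \<rho> + \<rho> / 2 * (N + n * (0 * K)))"
  proof (rule tendsto_le[where F = "at_right 0"])
    have "x \<in> S" using subsetD[OF S(3), of x] S(4) by simp
    show "((%h. \<bar>dq h i f x\<bar>) \<longlongrightarrow> \<bar>pd i f x\<bar>) (at_right 0)"
      using tendsto_rabs[OF dqs_limit[OF S(1) \<open>x \<in> S\<close> S(2), of "[i]"]] by simp
    show "((%h. 16 * n\<^sup>2 * (2 * M / \<rho> + \<rho> / 2 * (N + n * (h * K)))) \<longlongrightarrow>
        16 * n\<^sup>2 * (2 * M / \<rho> + \<rho> / 2 * (N + n * (0 * K)))) (at_right 0)"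
      by (intro tendsto_intros)
    have "0 < \<rho> / (2 * n)" using S(4) n by simp
    then have "\<forall>\<^sub>F h in at_right 0. h \<in> {0<..<\<rho> / (2 * n)}" by (rule eventually_at_right_real)
    then show "\<forall>\<^sub>F h in at_right 0. \<bar>dq h i f x\<bar> <= 16 * n\<^sup>2 * (2 * M / \<rho> + \<rho> / 2 * (N + n * (h * K)))"
    proof eventually_elim
      case (elim h)
      then have "n * h <= \<rho> / 2" using n by (simp add: field_simps)
      then show ?case using est elim by simp
    qed
  qed simp
  also have "... <= 32 * n\<^sup>2 * (M / \<rho> + \<rho> * N)"
  proof -
    have "0 <= \<rho> * N" using S(4) M0 by simp
    then have "2 * M / \<rho> + \<rho> / 2 * (N + n * (0 * K)) <= 2 * (M / \<rho> + \<rho> * N)" by (simp add: mult.commute)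
    then have "16 * n\<^sup>2 * (2 * M / \<rho> + \<rho> / 2 * (N + n * (0 * K))) <= 16 * n\<^sup>2 * (2 * (M / \<rho> + \<rho> * N))"
      by (rule mult_left_mono) simp
    also have "... = 32 * n\<^sup>2 * (M / \<rho> + \<rho> * N)" by simp
    finally show ?thesis .
  qed
  finally show ?thesis by (simp add: n_def)
qed

text \<open>At a maximum every summand of the discrete Laplacian is nonpositive, and the consistency
  error vanishes with \<open>h\<close>.\<close>

lemma laplacian_local_max:
  fixes f :: "real^'n => real"
  assumes S: "open S" "smooth_on S f" "x \<in> S" and max: "!!z. z \<in> S ==> f z <= f x"
  shows "laplacian f x <= 0"
proof -
  define n where "n = real CARD('n)"
  obtain \<rho> where \<rho>: "0 < \<rho>" "cball x \<rho> \<subseteq> S" using S(1,3) open_contains_cball by blast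
  obtain K where K0: "0 <= K" and K: "!!is y. length is <= 3 ==> y \<in> cball x \<rho> ==> norm (Dd is f y) <= K"
    using smooth_on_compact_bounded[OF S(2) compact_cball \<rho>(2)] by blast
  have K3: "\<bar>pd j (pd j (pd j f)) z\<bar> <= K" if "z \<in> cball x \<rho>" for z j
    using K[of "[j,j,j]" z] that by simp
  have est: "laplacian f x <= n * (h * K)" if h: "0 < h" "h < \<rho>" for h
  proof -
    have sub: "cball x h \<subseteq> cball x \<rho>" using h by auto
    have "\<bar>dlap h f x - laplacian f x\<bar> <= n * (h * K)" unfolding n_def
      by (rule dlap_consistent[OF h(1) S(2)]) (use sub \<rho>(2) K3 in auto)
    moreover have "dlap h f x <= 0"
    proof -
      have "f (step x h j) <= f x" "f (x - h *\<^sub>R axis j 1) <= f x" for j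
        using h \<rho>(2) by (auto intro!: max subsetD[OF \<rho>(2)] simp: dist_norm)
      then have "f (step x h j) + f (x - h *\<^sub>R axis j 1) - 2 * f x <= 0" for j
        by (smt (verit))
      then show ?thesis unfolding dlap_def by (intro divide_nonpos_nonneg sum_nonpos) auto
    qed
    ultimately show ?thesis by linarith
  qed
  have "laplacian f x <= n * (0 * K)"
  proof (rule tendsto_le[where F = "at_right 0"])
    show "((%h. laplacian f x) \<longlongrightarrow> laplacian f x) (at_right 0)" by (rule tendsto_const)
    show "((%h. n * (h * K)) \<longlongrightarrow> n * (0 * K)) (at_right 0)" by (intro tendsto_intros)
    show "\<forall>\<^sub>F h in at_right 0. laplacian f x <= n * (h * K)"
      using eventually_at_right_real[OF \<rho>(1)] by eventually_elim (use est in auto)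
  qed simp
  then show ?thesis by simp
qed

lemma laplacian_compose:
  fixes f :: "real^'n => real" and \<psi> :: "real^'n => real^'n"
  assumes S: "open S" "smooth_on S \<psi>" and T: "open T" "smooth_on T f" and m: "!!x. x \<in> S ==> \<psi> x \<in> T" and x: "x \<in> S"
  shows "laplacian (%x. f (\<psi> x)) x
    = ellop (%i j _. \<Sum>l\<in>UNIV. pd l (%x. \<psi> x $ i) x * pd l (%x. \<psi> x $ j) x) (%i _. laplacian (%x. \<psi> x $ i) x) f (\<psi> x)"
proof -
  have comp: "smooth_on S (%x. \<psi> x $ j)" for j by (rule smooth_on_component[OF S])
  have one: "pd l (%x. g (\<psi> x)) z = (\<Sum>j\<in>UNIV. pd j g (\<psi> z) * pd l (%x. \<psi> x $ j) z)"
    if "smooth_on T g" "z \<in> S" for g :: "real^'n => real" and l z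
    by (rule pd_compose(1)[OF smooth_on_differentiable[OF S(2) that(2)] smooth_on_differentiable[OF that(1) m[OF that(2)]]])
  have cf: "smooth_on S (%x. pd j f (\<psi> x))" for j
    by (rule smooth_on_compose[OF S m smooth_on_pd[OF T(2)]])
  have "pd l (pd l (%x. f (\<psi> x))) x
      = (\<Sum>j\<in>UNIV. (\<Sum>i\<in>UNIV. pd i (pd j f) (\<psi> x) * pd l (%x. \<psi> x $ i) x) * pd l (%x. \<psi> x $ j) x
          + pd j f (\<psi> x) * pd l (pd l (%x. \<psi> x $ j)) x)" for l
  proof -
    have "pd l (pd l (%x. f (\<psi> x))) x = pd l (%z. \<Sum>j\<in>UNIV. pd j f (\<psi> z) * pd l (%x. \<psi> x $ j) z) x"
      by (rule pd_cong[OF S(1) x]) (rule one[OF T(2)])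
    also have "... = (\<Sum>j\<in>UNIV. pd l (%z. pd j f (\<psi> z) * pd l (%x. \<psi> x $ j) z) x)"
      by (intro pd_sum finite smooth_on_differentiable[OF smooth_on_mult[OF S(1) cf smooth_on_pd[OF comp]] x])
    also have "... = (\<Sum>j\<in>UNIV. pd l (%z. pd j f (\<psi> z)) x * pd l (%x. \<psi> x $ j) x
        + pd j f (\<psi> x) * pd l (pd l (%x. \<psi> x $ j)) x)"
      by (intro sum.cong refl pd_mult smooth_on_differentiable[OF cf x] smooth_on_differentiable[OF smooth_on_pd[OF comp] x])
    finally show ?thesis by (simp add: one[OF smooth_on_pd[OF T(2)] x])
  qed
  then have "laplacian (%x. f (\<psi> x)) x
      = (\<Sum>l\<in>UNIV. \<Sum>j\<in>UNIV. \<Sum>i\<in>UNIV. pd i (pd j f) (\<psi> x) * pd l (%x. \<psi> x $ i) x * pd l (%x. \<psi> x $ j) x)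
        + (\<Sum>l\<in>UNIV. \<Sum>j\<in>UNIV. pd j f (\<psi> x) * pd l (pd l (%x. \<psi> x $ j)) x)"
    unfolding laplacian_def[of "%x. f (\<psi> x)"] by (simp only: sum.distrib sum_distrib_right)
  also have "(\<Sum>l\<in>UNIV. \<Sum>j\<in>UNIV. pd j f (\<psi> x) * pd l (pd l (%x. \<psi> x $ j)) x)
      = (\<Sum>j\<in>UNIV. \<Sum>l\<in>UNIV. pd j f (\<psi> x) * pd l (pd l (%x. \<psi> x $ j)) x)" by (rule sum.swap)
  also have "(\<Sum>l\<in>UNIV. \<Sum>j\<in>UNIV. \<Sum>i\<in>UNIV. pd i (pd j f) (\<psi> x) * pd l (%x. \<psi> x $ i) x * pd l (%x. \<psi> x $ j) x)
      = (\<Sum>j\<in>UNIV. \<Sum>l\<in>UNIV. \<Sum>i\<in>UNIV. pd i (pd j f) (\<psi> x) * pd l (%x. \<psi> x $ i) x * pd l (%x. \<psi> x $ j) x)"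
    by (rule sum.swap)
  also have "... = (\<Sum>j\<in>UNIV. \<Sum>i\<in>UNIV. \<Sum>l\<in>UNIV. pd i (pd j f) (\<psi> x) * pd l (%x. \<psi> x $ i) x * pd l (%x. \<psi> x $ j) x)"
    by (intro sum.cong refl sum.swap)
  also have "... = (\<Sum>i\<in>UNIV. \<Sum>j\<in>UNIV. \<Sum>l\<in>UNIV. pd i (pd j f) (\<psi> x) * pd l (%x. \<psi> x $ i) x * pd l (%x. \<psi> x $ j) x)"
    by (rule sum.swap)
  finally show ?thesis
    unfolding ellop_def laplacian_def[of "%x. \<psi> x $ _"] by (simp only: sum_distrib_left sum_distrib_right mult_ac)
qed

lemma pd_bound_lipschitz:
  fixes f :: "real^'n => real"
  assumes S: "convex S" "!!z. z \<in> S ==> f differentiable (at z)" and K: "0 <= K" "!!i z. z \<in> S ==> \<bar>pd i f z\<bar> <= K"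
    and x: "x \<in> S" "y \<in> S"
  shows "\<bar>f x - f y\<bar> <= real CARD('n) * K * dist x y"
proof -
  have "norm (f x - f y) <= (real CARD('n) * K) * norm (x - y)"
  proof (rule differentiable_bound[OF S(1) _ _ x])
    fix z assume z: "z \<in> S"
    show "(f has_derivative (%v. \<Sum>i\<in>UNIV. v $ i * pd i f z)) (at z within S)"
      using has_derivative_pd_real[OF S(2)[OF z]] has_derivative_at_withinI by blast
    show "onorm (%v. \<Sum>i\<in>UNIV. v $ i * pd i f z) <= real CARD('n) * K"
    proof (rule onorm_bound)
      fix v :: "real^'n"
      have "\<bar>v $ i * pd i f z\<bar> <= norm v * K" for i
        unfolding abs_mult by (intro mult_mono component_le_norm_cart K(2)[OF z]) auto
      then have "\<bar>\<Sum>i\<in>UNIV. v $ i * pd i f z\<bar> <= (\<Sum>i\<in>(UNIV::'n set). norm v * K)"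
        by (intro order_trans[OF sum_abs] sum_mono)
      then show "norm (\<Sum>i\<in>UNIV. v $ i * pd i f z) <= real CARD('n) * K * norm v" by (simp add: mult_ac)
    qed (use K in auto)
  qed
  then show ?thesis by (simp add: dist_norm)
qed

lemma pd_bound_lipschitz_vec:
  fixes f :: "real^'n => real^'m"
  assumes S: "convex S" "!!z. z \<in> S ==> f differentiable (at z)" and K: "0 <= K" "!!i z. z \<in> S ==> norm (pd i f z) <= K"
    and x: "x \<in> S" "y \<in> S"
  shows "dist (f x) (f y) <= real CARD('m) * (real CARD('n) * K) * dist x y"
proof -
  have "\<bar>f x $ l - f y $ l\<bar> <= real CARD('n) * K * dist x y" for l
  proof (rule pd_bound_lipschitz[OF S(1) _ K(1) _ x, where f = "%z. f z $ l"])
    fix z assume z: "z \<in> S"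
    show "(%z. f z $ l) differentiable (at z)" by (rule pd_component[OF S(2)[OF z]])
    show "\<bar>pd i (%z. f z $ l) z\<bar> <= K" for i
      using K(2)[OF z, of i] component_le_norm_cart[of "pd i f z" l] pd_component(1)[OF S(2)[OF z], of i l] by linarith
  qed
  then have "(\<Sum>l\<in>UNIV. \<bar>(f x - f y) $ l\<bar>) <= (\<Sum>l\<in>(UNIV::'m set). real CARD('n) * K * dist x y)"
    by (intro sum_mono) simp
  then show ?thesis unfolding dist_norm[of "f x"] using norm_le_l1_cart[of "f x - f y"] by (simp add: mult.assoc)
qed

locale straightened_boundary =
  fixes \<Omega> U V :: "(real^'n) set" and \<psi> \<phi> :: "real^'n => real^'n" and k :: 'n and p :: "real^'n"
    and c :: "real^'n => real^'n"
  assumes open_dom: "open \<Omega>" and bounded_dom: "bounded \<Omega>" and p: "p \<in> frontier \<Omega>" "p \<in> U"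
    and UV: "open U" "open V" "homeomorphism U V \<psi> \<phi>" "smooth_on U \<psi>" "smooth_on V \<phi>"
    and straight: "\<psi> ` (U \<inter> \<Omega>) = {y \<in> V. 0 < y $ k}" "\<psi> ` (U \<inter> frontier \<Omega>) = {y \<in> V. y $ k = 0}"
    and c: "smooth_on_closure \<Omega> c"
begin

lemma inverse: "x \<in> U ==> \<psi> x \<in> V" "x \<in> U ==> \<phi> (\<psi> x) = x" "y \<in> V ==> \<phi> y \<in> U" "y \<in> V ==> \<psi> (\<phi> y) = y"
proof -
  show "x \<in> U ==> \<psi> x \<in> V" using homeomorphism_image1[OF UV(3)] by blast
  show "y \<in> V ==> \<phi> y \<in> U" using homeomorphism_image2[OF UV(3)] by blast
qed (rule homeomorphism_apply1[OF UV(3)] homeomorphism_apply2[OF UV(3)], assumption)+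

lemma domain_iff:
  assumes x: "x \<in> U"
  shows "x \<in> \<Omega> \<longleftrightarrow> 0 < \<psi> x $ k"
proof
  show "0 < \<psi> x $ k" if "x \<in> \<Omega>"
    using imageI[of x "U \<inter> \<Omega>" \<psi>] x that unfolding straight by simp
  assume "0 < \<psi> x $ k"
  then have "\<psi> x \<in> \<psi> ` (U \<inter> \<Omega>)" unfolding straight using inverse(1)[OF x] by simp
  then obtain z where "z \<in> U" "z \<in> \<Omega>" "\<psi> x = \<psi> z" by blast
  moreover then have "x = z" using inverse(2)[OF x] inverse(2)[of z] by metis
  ultimately show "x \<in> \<Omega>" by simp
qed

lemma frontier_iff:
  assumes x: "x \<in> U"
  shows "x \<in> frontier \<Omega> \<longleftrightarrow> \<psi> x $ k = 0"
proof
  show "\<psi> x $ k = 0" if "x \<in> frontier \<Omega>"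
    using imageI[of x "U \<inter> frontier \<Omega>" \<psi>] x that unfolding straight by simp
  assume "\<psi> x $ k = 0"
  then have "\<psi> x \<in> \<psi> ` (U \<inter> frontier \<Omega>)" unfolding straight using inverse(1)[OF x] by simp
  then obtain z where "z \<in> U" "z \<in> frontier \<Omega>" "\<psi> x = \<psi> z" by blast
  moreover then have "x = z" using inverse(2)[OF x] inverse(2)[of z] by metis
  ultimately show "x \<in> frontier \<Omega>" by simp
qed

text \<open>Coefficients in the straightened coordinates: \<open>a\<close> is the Gram matrix of the
  gradients of the components of \<open>\<psi>\<close>, \<open>e\<close> comes from their second
  derivatives, and \<open>b\<close> is the drift \<open>c\<close> acting on them.\<close>

definition "a i j y = (\<Sum>l\<in>UNIV. pd l (%x. \<psi> x $ i) (\<phi> y) * pd l (%x. \<psi> x $ j) (\<phi> y))"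
definition "e i y = laplacian (%x. \<psi> x $ i) (\<phi> y)"
definition "b i y = (\<Sum>l\<in>UNIV. c (\<phi> y) $ l * pd l (%x. \<psi> x $ i) (\<phi> y))"

lemma psi_smooth: "smooth_on U (%x. \<psi> x $ i)" by (rule smooth_on_component[OF UV(1,4)])

lemma pulled_back_smooth:
  assumes "smooth_on U f"
  shows "smooth_on V (%y. (f :: _ => real) (\<phi> y))"
  by (rule smooth_on_compose[OF UV(2,5) inverse(3) assms])

lemma a_smooth: "smooth_on V (a i j)"
  unfolding a_def[abs_def] by (intro smooth_on_sum smooth_on_mult UV(2) finite pulled_back_smooth smooth_on_pd psi_smooth)

lemma e_smooth: "smooth_on V (e i)"
  unfolding e_def[abs_def] laplacian_def
  by (intro smooth_on_sum UV(2) finite pulled_back_smooth smooth_on_pd psi_smooth)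

definition "W = {y \<in> V. 0 < y $ k}"

lemma W: "open W" "y \<in> W ==> y \<in> V" "y \<in> W ==> \<phi> y \<in> \<Omega>" "y \<in> W ==> \<phi> y \<in> U"
proof -
  have "open {y::real^'n. 0 < y $ k}" by (intro open_Collect_less continuous_intros)
  moreover have "W = V \<inter> {y. 0 < y $ k}" by (auto simp: W_def)
  ultimately show "open W" using UV(2) by auto
  show "y \<in> W ==> \<phi> y \<in> \<Omega>" using domain_iff[OF inverse(3)] inverse(4) by (simp add: W_def)
qed (simp_all add: W_def inverse(3))

lemma laplacian_straightened:
  assumes T: "open T" "T \<subseteq> V" "smooth_on T f" "y \<in> T"
  shows "laplacian (%x. f (\<psi> x)) (\<phi> y) = ellop a e f y"
    "open (U \<inter> \<psi> -` T)" "smooth_on (U \<inter> \<psi> -` T) (%x. f (\<psi> x))" "\<phi> y \<in> U \<inter> \<psi> -` T"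
proof -
  have "continuous_on U \<psi>" by (rule homeomorphism_cont1[OF UV(3)])
  then show o: "open (U \<inter> \<psi> -` T)" using UV(1) T(1) by (rule continuous_open_preimage)
  show y: "\<phi> y \<in> U \<inter> \<psi> -` T" using T inverse(3,4)[of y] by auto
  have s: "smooth_on (U \<inter> \<psi> -` T) \<psi>" using smooth_on_subset[OF UV(4)] by blast
  show "smooth_on (U \<inter> \<psi> -` T) (%x. f (\<psi> x))" by (rule smooth_on_compose[OF o s _ T(3)]) auto
  have "\<psi> (\<phi> y) = y" using T inverse(4) by blast
  moreover have "laplacian (%x. f (\<psi> x)) (\<phi> y)
    = ellop (%i j _. \<Sum>l\<in>UNIV. pd l (%x. \<psi> x $ i) (\<phi> y) * pd l (%x. \<psi> x $ j) (\<phi> y))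
        (%i _. laplacian (%x. \<psi> x $ i) (\<phi> y)) f (\<psi> (\<phi> y))"
    by (rule laplacian_compose[OF o s T(1,3) _ y]) auto
  ultimately show "laplacian (%x. f (\<psi> x)) (\<phi> y) = ellop a e f y"
    by (simp add: ellop_def a_def e_def)
qed

lemma boundary_point: "\<psi> p \<in> V" "\<psi> p $ k = 0" "\<phi> (\<psi> p) = p"
  using p inverse frontier_iff by auto

text \<open>Balls on both sides of the chart are matched with a reserve of \<open>s / 2\<close>, so
  that a ball around \<open>\<phi> y\<close> of at most that radius still lies where
  \<open>\<psi>\<close> is Lipschitz.\<close>

lemma good_radius:
  obtains s R \<Lambda> B where "0 < s" "cball p s \<subseteq> U" "0 < R" "cball (\<psi> p) R \<subseteq> V"
    "!!y. y \<in> cball (\<psi> p) R ==> dist p (\<phi> y) < s / 2" "1 <= \<Lambda>" "1 <= B"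
    "!!x x'. x \<in> cball p s ==> x' \<in> cball p s ==> dist (\<psi> x) (\<psi> x') <= \<Lambda> * dist x x'"
    "!!y i l. y \<in> cball (\<psi> p) R ==> \<bar>pd i (%y. \<phi> y $ l) y\<bar> <= B"
proof -
  obtain s where s: "0 < s" "cball p s \<subseteq> U" using UV(1) p(2) open_contains_cball by blast
  obtain K where K: "0 <= K" "!!is x. length is <= 1 ==> x \<in> cball p s ==> norm (Dd is \<psi> x) <= K"
    using smooth_on_compact_bounded[OF UV(4) compact_cball s(2)] by blast
  define \<Lambda> where "\<Lambda> = max 1 (real CARD('n) * (real CARD('n) * K))"
  have lip: "dist (\<psi> x) (\<psi> x') <= \<Lambda> * dist x x'" if "x \<in> cball p s" "x' \<in> cball p s" for x x'
  proof -
    have "dist (\<psi> x) (\<psi> x') <= real CARD('n) * (real CARD('n) * K) * dist x x'"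
    proof (rule pd_bound_lipschitz_vec[OF convex_cball _ K(1) _ that])
      show "\<psi> differentiable (at z)" if "z \<in> cball p s" for z
        using smooth_on_differentiable[OF UV(4)] that s(2) by blast
      show "norm (pd i \<psi> z) <= K" if "z \<in> cball p s" for i z using K(2)[of "[i]" z] that by simp
    qed
    also have "... <= \<Lambda> * dist x x'" by (intro mult_right_mono) (auto simp: \<Lambda>_def)
    finally show ?thesis .
  qed
  have "continuous_on V \<phi>" by (rule homeomorphism_cont2[OF UV(3)])
  then have "open (V \<inter> \<phi> -` ball p (s/2))" by (rule continuous_open_preimage[OF _ UV(2) open_ball])
  moreover have "\<psi> p \<in> V \<inter> \<phi> -` ball p (s/2)" using boundary_point s by simp
  ultimately obtain R where R: "0 < R" "cball (\<psi> p) R \<subseteq> V \<inter> \<phi> -` ball p (s/2)"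
    using open_contains_cball by blast
  then have RV: "cball (\<psi> p) R \<subseteq> V" by blast
  obtain B where B: "0 <= B" "!!is y. length is <= 1 ==> y \<in> cball (\<psi> p) R ==> norm (Dd is \<phi> y) <= B"
    using smooth_on_compact_bounded[OF UV(5) compact_cball RV] by blast
  show ?thesis
  proof (rule that[OF s R(1) RV _ _ _ lip, of "max 1 B"])
    show "dist p (\<phi> y) < s / 2" if "y \<in> cball (\<psi> p) R" for y using R(2) that by auto
    show "\<bar>pd i (%y. \<phi> y $ l) y\<bar> <= max 1 B" if y: "y \<in> cball (\<psi> p) R" for y i l
    proof -
      have "pd i (%y. \<phi> y $ l) y = pd i \<phi> y $ l"
        using y RV by (intro pd_component smooth_on_differentiable[OF UV(5)]) auto
      then show ?thesis using component_le_norm_cart[of "pd i \<phi> y" l] B(2)[of "[i]" y] y by simp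
    qed
  qed (auto simp: \<Lambda>_def)
qed

lemma smooth_coefficients:
  "smooth_on \<Omega> c" "smooth_on W \<phi>" "smooth_on W (%y. c (\<phi> y) $ l)" "smooth_on W (%y. pd l (%x. \<psi> x $ i) (\<phi> y))"
  "smooth_on W (b i)"
proof -
  show s: "smooth_on \<Omega> c" using c by (simp add: smooth_on_closure_def)
  show W\<phi>: "smooth_on W \<phi>" using smooth_on_subset[OF UV(5)] W(2) by blast
  show 1: "smooth_on W (%y. c (\<phi> y) $ l)" for l
    by (rule smooth_on_compose[OF W(1) W\<phi> W(3) smooth_on_component[OF open_dom s]])
  show 2: "smooth_on W (%y. pd l (%x. \<psi> x $ i) (\<phi> y))" for l
    using smooth_on_subset[OF pulled_back_smooth[OF smooth_on_pd[OF psi_smooth]]] W(2) by blast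
  show "smooth_on W (b i)" unfolding b_def[abs_def] by (intro smooth_on_sum smooth_on_mult W(1) finite 1 2)
qed

lemma coefficient_bounds:
  assumes R: "cball (\<psi> p) R \<subseteq> V"
  obtains AB where "mono AB" "!!m. 0 <= AB m"
    "!!is y i j. y \<in> half_ball (\<psi> p) k R ==> \<bar>Dd is (a i j) y\<bar> <= AB (length is)"
    "!!is y i. y \<in> half_ball (\<psi> p) k R ==> \<bar>Dd is (e i) y\<bar> <= AB (length is)"
    "!!is y i. y \<in> half_ball (\<psi> p) k R ==> \<bar>Dd is (b i) y\<bar> <= AB (length is)"
proof -
  let ?H = "half_ball (\<psi> p) k R"
  note op = open_half_ball[of "\<psi> p" k R]
  have HR: "?H \<subseteq> cball (\<psi> p) R" by (auto simp: half_ball_def)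
  have HW: "?H \<subseteq> W" using R by (auto simp: half_ball_def W_def)
  have V: "Cb m ?H f" if "smooth_on V f" for f :: "real^'n => real" and m
    by (rule Cb_subset[OF Cb_compact[OF that compact_cball R] HR])
  \<comment> \<open>The drift is smooth only on the domain, whose boundary the half ball touches, so
    compactness in \<open>V\<close> does not bound its derivatives; smoothness up to the closure
    does.\<close>
  have c\<phi>: "Cb m ?H (%y. c (\<phi> y) $ l)" for m l
  proof (rule Cb_compose[OF op smooth_on_subset[OF smooth_coefficients(2) HW], where f = "%x. c x $ l"])
    show "\<phi> y \<in> \<Omega>" if "y \<in> ?H" for y using that HW W(3) by blast
    show "Cb m ?H (%y. \<phi> y $ l)" for l by (rule V[OF smooth_on_component[OF UV(2,5)]])
    show "smooth_on \<Omega> (%x. c x $ l)" by (rule smooth_on_component[OF open_dom smooth_coefficients(1)])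
    obtain K where "!!is x. length is <= m ==> x \<in> \<Omega> ==> norm (Dd is c x) <= K"
      using smooth_on_closure_bounded_upto[OF bounded_dom c] by blast
    then show "Cb m \<Omega> (%x. c x $ l)"
      by (rule Cb_component[OF open_dom smooth_coefficients(1) order_refl Cb_boundI])
  qed
  have bH: "Cb m ?H (b i)" for m i unfolding b_def[abs_def]
    by (intro Cb_sum Cb_mult smooth_on_mult op finite c\<phi> V pulled_back_smooth smooth_on_pd psi_smooth
        smooth_on_subset[OF smooth_coefficients(3) HW] smooth_on_subset[OF smooth_coefficients(4) HW])
  define \<F> where "\<F> = (\<Union>i. range (a i)) \<union> range e \<union> range b"
  have "Cb m ?H f" if "f \<in> \<F>" for f m
    using that V[OF a_smooth] V[OF e_smooth] bH by (auto simp: \<F>_def)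
  then have "\<exists>B. 0 <= B & (\<forall>is y. length is <= m --> y \<in> ?H --> norm (Dd is f y) <= B)" if "f \<in> \<F>" for f m
    using Cb_bound that by metis
  then obtain B where B: "!!f m. f \<in> \<F> ==> 0 <= B f m"
    "!!f m is y. f \<in> \<F> ==> length is <= m ==> y \<in> ?H ==> norm (Dd is f y) <= B f m" by metis
  \<comment> \<open>Summing over the finite family and over all lower orders gives one bound that
    increases with the order.\<close>
  define AB where "AB m = (\<Sum>q\<le>m. \<Sum>f\<in>\<F>. B f q)" for m
  have X0: "0 <= (\<Sum>f\<in>\<F>. B f q)" for q by (intro sum_nonneg B(1))
  have fin: "finite \<F>" by (simp add: \<F>_def)
  have AB: "\<bar>Dd is f y\<bar> <= AB (length is)" if "f \<in> \<F>" "y \<in> ?H" for f y "is"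
  proof -
    have "\<bar>Dd is f y\<bar> <= B f (length is)" using B(2)[OF that(1) order_refl that(2)] by simp
    also have "... <= (\<Sum>f\<in>\<F>. B f (length is))" by (intro member_le_sum that(1) fin B(1)) auto
    also have "... <= AB (length is)" unfolding AB_def
      by (rule member_le_sum[where f = "%q. \<Sum>f\<in>\<F>. B f q"]) (auto simp: X0)
    finally show ?thesis .
  qed
  have F: "a i j \<in> \<F>" "e i \<in> \<F>" "b i \<in> \<F>" for i j unfolding \<F>_def by blast+
  show ?thesis
  proof (rule that[of AB])
    show "mono AB" unfolding AB_def[abs_def] using X0 by (intro monoI sum_mono2) auto
    show "0 <= AB m" for m unfolding AB_def by (intro sum_nonneg X0)
  qed (intro AB F; assumption)+
qed


text \<open>The barrier \<open>g\<close> is uniformly continuous in the chart and vanishes at the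
  vertical projection \<open>y'\<close> of \<open>y\<close> to the flat boundary; \<open>v\<close>
  lies between 0 and \<open>g\<close>.\<close>

lemma chart_vanish:
  assumes R: "0 < R" "cball (\<psi> p) R \<subseteq> V" and g: "continuous_on (closure \<Omega>) g" "!!x. x \<in> frontier \<Omega> ==> g x = 0"
    and v: "!!x. x \<in> \<Omega> ==> 0 <= v x" "!!x. x \<in> \<Omega> ==> v x <= (g x :: real)" and \<epsilon>: "0 < \<epsilon>"
  shows "\<exists>\<delta>>0. \<forall>y\<in>half_ball (\<psi> p) k R. y $ k < \<delta> --> \<bar>v (\<phi> y)\<bar> < \<epsilon>"
proof -
  define K where "K = cball (\<psi> p) R \<inter> {y. 0 <= y $ k}"
  have "closed {y::real^'n. 0 <= y $ k}" by (intro closed_Collect_le continuous_intros)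
  then have K: "compact K" unfolding K_def by (rule compact_Int_closed[OF compact_cball])
  have cl: "\<phi> y \<in> closure \<Omega>" if "y \<in> K" for y
  proof -
    have y: "y \<in> V" "0 <= y $ k" using that R(2) by (auto simp: K_def)
    show ?thesis
    proof (cases "0 < y $ k")
      case True
      then have "\<phi> y \<in> \<Omega>" using domain_iff[OF inverse(3)[OF y(1)]] inverse(4)[OF y(1)] by simp
      then show ?thesis using closure_subset by blast
    next
      case False
      then have "\<phi> y \<in> frontier \<Omega>" using frontier_iff[OF inverse(3)[OF y(1)]] inverse(4)[OF y(1)] y by simp
      then show ?thesis by (simp add: frontier_def)
    qed
  qed
  have KV: "K \<subseteq> V" using R(2) by (auto simp: K_def)
  have "continuous_on K \<phi>" using homeomorphism_cont2[OF UV(3)] KV continuous_on_subset by blast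
  then have "continuous_on K (%y. g (\<phi> y))"
    by (rule continuous_on_compose2[OF g(1)]) (use cl in blast)
  then have "uniformly_continuous_on K (%y. g (\<phi> y))" using K by (rule compact_uniformly_continuous)
  then obtain \<delta> where \<delta>: "0 < \<delta>" "!!y y'. y \<in> K ==> y' \<in> K ==> dist y' y < \<delta> ==> dist (g (\<phi> y')) (g (\<phi> y)) < \<epsilon>"
    using \<epsilon> unfolding uniformly_continuous_on_def by metis
  have "\<bar>v (\<phi> y)\<bar> < \<epsilon>" if y: "y \<in> half_ball (\<psi> p) k R" "y $ k < \<delta>" for y
  proof -
    define y' where "y' = y - (y $ k) *\<^sub>R axis k 1"
    have y'k: "y' $ k = 0" by (simp add: y'_def)
    have yk: "0 < y $ k" using y by (simp add: half_ball_def)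
    have "norm (y' - \<psi> p) <= norm (y - \<psi> p)"
      using boundary_point(2) by (intro norm_le_componentwise_cart) (auto simp: y'_def axis_def)
    then have "y' \<in> K" "y \<in> K" using y y'k yk by (auto simp: K_def half_ball_def dist_norm norm_minus_commute)
    moreover have "dist y' y < \<delta>" using y yk by (simp add: y'_def dist_norm)
    ultimately have "dist (g (\<phi> y')) (g (\<phi> y)) < \<epsilon>" using \<delta>(2) by blast
    moreover have "g (\<phi> y') = 0"
    proof (rule g(2))
      have "y' \<in> V" using \<open>y' \<in> K\<close> KV by blast
      then show "\<phi> y' \<in> frontier \<Omega>" using frontier_iff[OF inverse(3)] inverse(4) y'k by simp
    qed
    moreover have "\<phi> y \<in> \<Omega>" using \<open>y \<in> K\<close> KV yk by (intro W(3)) (auto simp: W_def)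
    ultimately show ?thesis using v[of "\<phi> y"] by (simp add: dist_real_def)
  qed
  then show ?thesis using \<delta>(1) by blast
qed

text \<open>Differentiating the identity \<open>\<psi> (\<phi> y) $ k = y $ k\<close> in the
  direction \<open>k\<close> gives two vectors with inner product 1, one of which has square norm
  \<open>a k k y\<close>; Cauchy-Schwarz bounds it from below by the size of the other.\<close>

lemma elliptic_bound:
  assumes y: "y \<in> V" and B: "1 <= B" "!!i l. \<bar>pd i (%y. \<phi> y $ l) y\<bar> <= B"
  shows "1 / (real CARD('n) * B\<^sup>2) <= a k k y"
proof -
  have d: "\<phi> differentiable (at y)" "(%x. \<psi> x $ k) differentiable (at (\<phi> y))"
    by (rule smooth_on_differentiable[OF UV(5) y] smooth_on_differentiable[OF psi_smooth inverse(3)[OF y]])+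
  define P where "P l = pd l (%x. \<psi> x $ k) (\<phi> y)" for l
  define Q where "Q l = pd k (%y. \<phi> y $ l) y" for l
  have "1 = pd k (%y. y $ k) y" by (simp add: pd_component_id)
  also have "... = pd k (%y. \<psi> (\<phi> y) $ k) y" by (rule pd_cong[OF UV(2) y]) (simp add: inverse(4))
  also have "... = (\<Sum>l\<in>UNIV. P l * Q l)" unfolding P_def Q_def by (rule pd_compose(1)[OF d])
  finally have one: "(\<Sum>l\<in>UNIV. P l * Q l) = 1" by simp
  have "(\<Sum>l\<in>UNIV. P l * Q l)\<^sup>2 <= (\<Sum>l\<in>UNIV. (P l)\<^sup>2) * (\<Sum>l\<in>UNIV. (Q l)\<^sup>2)" by (rule Cauchy_Schwarz_ineq_sum)
  moreover have "a k k y = (\<Sum>l\<in>UNIV. (P l)\<^sup>2)" by (simp add: a_def P_def power2_eq_square)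
  moreover have "(\<Sum>l\<in>UNIV. (Q l)\<^sup>2) <= real CARD('n) * B\<^sup>2"
  proof -
    have "(Q l)\<^sup>2 <= B\<^sup>2" for l using power_mono[OF B(2)[of k l] abs_ge_zero, of 2] by (simp add: Q_def)
    then have "(\<Sum>l\<in>UNIV. (Q l)\<^sup>2) <= (\<Sum>l\<in>(UNIV::'n set). B\<^sup>2)" by (intro sum_mono)
    then show ?thesis by simp
  qed
  moreover have "0 <= (\<Sum>l\<in>UNIV. (P l)\<^sup>2)" by (intro sum_nonneg) simp
  ultimately have "1 <= a k k y * (real CARD('n) * B\<^sup>2)" using one mult_left_mono[of "\<Sum>l\<in>UNIV. (Q l)\<^sup>2"] by fastforce
  moreover have "0 < real CARD('n) * B\<^sup>2" using B(1) by simp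
  ultimately show ?thesis by (simp add: divide_le_eq)
qed

text \<open>Both analytic assumptions of \<open>boundary_chart\<close> are carried over from
  Euclidean coordinates, since \<open>ellop a e f\<close> is the Laplacian of the composite of
  \<open>f\<close> with \<open>\<psi>\<close>.\<close>

lemma chart_instance:
  assumes v: "smooth_on \<Omega> v" "!!x. x \<in> \<Omega> ==> 0 <= v x" "!!x. x \<in> \<Omega> ==> v x <= 1 - d0" and d0: "0 < d0"
    and eq: "!!x. x \<in> \<Omega> ==> - laplacian v x + c x \<bullet> gradient v x = lam / (1 - v x)\<^sup>2"
    and g: "continuous_on (closure \<Omega>) g" "!!x. x \<in> frontier \<Omega> ==> g x = 0" "!!x. x \<in> \<Omega> ==> v x <= (g x :: real)"
  obtains R \<theta> C0 AB where "boundary_chart (\<psi> p) k R \<theta> C0 d0 lam a e b AB (%y. v (\<phi> y))"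
proof -
  obtain s R1 \<Lambda> B where s: "0 < s" "cball p s \<subseteq> U" and R1: "0 < R1" "cball (\<psi> p) R1 \<subseteq> V"
    and near: "!!y. y \<in> cball (\<psi> p) R1 ==> dist p (\<phi> y) < s / 2" and \<Lambda>: "1 <= \<Lambda>" and B: "1 <= B"
    and lip: "!!x x'. x \<in> cball p s ==> x' \<in> cball p s ==> dist (\<psi> x) (\<psi> x') <= \<Lambda> * dist x x'"
    and db: "!!y i l. y \<in> cball (\<psi> p) R1 ==> \<bar>pd i (%y. \<phi> y $ l) y\<bar> <= B"
    using good_radius by metis
  obtain AB where AB: "mono AB" "!!m. 0 <= AB m"
    "!!is y i j. y \<in> half_ball (\<psi> p) k R1 ==> \<bar>Dd is (a i j) y\<bar> <= AB (length is)"
    "!!is y i. y \<in> half_ball (\<psi> p) k R1 ==> \<bar>Dd is (e i) y\<bar> <= AB (length is)"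
    "!!is y i. y \<in> half_ball (\<psi> p) k R1 ==> \<bar>Dd is (b i) y\<bar> <= AB (length is)"
    using coefficient_bounds[OF R1(2)] by metis
  define n where "n = real CARD('n)"
  have n: "1 <= n" by (simp add: n_def Suc_leI)
  define \<theta> where "\<theta> = 1 / (n * B\<^sup>2)"
  have \<theta>: "0 < \<theta>" using n B by (simp add: \<theta>_def)
  define R where "R = min (min R1 1) (min (s/2) (\<theta> / (4 * (AB 0 + 1))))"
  have AB0: "0 < 4 * (AB 0 + 1)" using AB(2)[of 0] by simp
  have R: "0 < R" "R <= R1" "R <= 1" "R <= s/2" "R <= \<theta> / (4 * (AB 0 + 1))"
  proof -
    have "0 < \<theta> / (4 * (AB 0 + 1))" using \<theta> AB0 by simp
    then show "0 < R" "R <= R1" "R <= 1" "R <= s/2" "R <= \<theta> / (4 * (AB 0 + 1))"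
      using R1(1) s(1) unfolding R_def by linarith+
  qed
  have HV: "half_ball (\<psi> p) k r \<subseteq> W" "half_ball (\<psi> p) k r \<subseteq> V" "half_ball (\<psi> p) k r \<subseteq> cball (\<psi> p) R1"
    "half_ball (\<psi> p) k r \<subseteq> half_ball (\<psi> p) k R1" if "r <= R" for r
    using that R(2) R1(2) by (auto simp: half_ball_def W_def)
  \<comment> \<open>\<open>32 * n\<^sup>2\<close> comes from the Euclidean estimate,
    \<open>\<Lambda>\<close> from the smaller radius used for it, and \<open>n * B\<close> from the
    chain rule for \<open>\<phi>\<close>.\<close>
  define C1 where "C1 = n * (32 * n\<^sup>2 * \<Lambda> * B)"
  have sm\<phi>: "smooth_on (half_ball (\<psi> p) k R) \<phi>" using smooth_on_subset[OF UV(5)] HV(2) by blast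
  have v\<phi>: "smooth_on (half_ball (\<psi> p) k R) (%y. v (\<phi> y))"
    by (rule smooth_on_compose[OF open_half_ball sm\<phi> _ v(1)]) (use HV(1) W(3) in blast)
  have "boundary_chart (\<psi> p) k R \<theta> C1 d0 lam a e b AB (%y. v (\<phi> y))"
  proof
    show "0 < R" "R <= 1" "\<psi> p $ k = 0" "0 < \<theta>" "0 < d0" "mono AB" by fact+ (rule boundary_point, fact+)
    show "0 <= C1" using n B \<Lambda> by (simp add: C1_def)
    show "smooth_on (half_ball (\<psi> p) k R) (a i j)" "smooth_on (half_ball (\<psi> p) k R) (e i)"
      "smooth_on (half_ball (\<psi> p) k R) (b i)" for i j
      by (rule smooth_on_subset[OF a_smooth HV(2)] smooth_on_subset[OF e_smooth HV(2)] smooth_on_subset[OF smooth_coefficients(5) HV(1)], simp)+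
    show "\<bar>Dd is (a i j) y\<bar> <= AB (length is)" "\<bar>Dd is (e i) y\<bar> <= AB (length is)" "\<bar>Dd is (b i) y\<bar> <= AB (length is)"
      if "y \<in> half_ball (\<psi> p) k R" for "is" y i j
      using that HV(4)[of R] AB(3-5) by (auto simp: subset_iff)
    show "4 * R * (AB 0 + 1) <= \<theta>" using R(5) AB0 by (simp add: pos_le_divide_eq mult_ac)
    show "\<theta> <= a k k y" if "y \<in> half_ball (\<psi> p) k R" for y
      unfolding \<theta>_def n_def using that HV(2,3)[of R] B db by (intro elliptic_bound) auto
    show "0 <= v (\<phi> y)" "v (\<phi> y) <= 1 - d0" if "y \<in> half_ball (\<psi> p) k R" for y
      using that HV(1)[of R] W(3) v by (auto simp: subset_iff)
    show "smooth_on (half_ball (\<psi> p) k R) (%y. v (\<phi> y))" by (rule v\<phi>)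
    show "\<exists>\<delta>>0. \<forall>y\<in>half_ball (\<psi> p) k R. y $ k < \<delta> --> \<bar>v (\<phi> y)\<bar> < \<epsilon>" if "0 < \<epsilon>" for \<epsilon>
      by (rule chart_vanish[OF R(1) _ g(1,2) v(2) g(3) that]) (use R R1 in auto)
  next
    fix f :: "real^'n => real" and y r assume r: "r <= R" and f: "smooth_on (half_ball (\<psi> p) k r) f" and y: "y \<in> half_ball (\<psi> p) k r"
      and max: "!!z. z \<in> half_ball (\<psi> p) k r ==> f z <= f y"
    note L = laplacian_straightened[OF open_half_ball HV(2)[OF r] f y]
    have "\<psi> (\<phi> y) = y" using y HV(2)[OF r] inverse(4) by blast
    then have "laplacian (%x. f (\<psi> x)) (\<phi> y) <= 0"
      by (intro laplacian_local_max[OF L(2,3,4)]) (auto intro!: max)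
    then show "ellop a e f y <= 0" unfolding L(1) .
  next
    fix f :: "real^'n => real" and y r \<rho> M N i assume r: "r <= R" and f: "smooth_on (half_ball (\<psi> p) k r) f" and \<rho>: "0 < \<rho>"
      and sub: "cball y \<rho> \<subseteq> half_ball (\<psi> p) k r" and MN: "0 < M" "0 <= N"
      and M: "!!z. z \<in> cball y \<rho> ==> \<bar>f z\<bar> <= M" and N: "!!z. z \<in> cball y \<rho> ==> \<bar>ellop a e f z\<bar> <= N"
    have y: "y \<in> half_ball (\<psi> p) k r" using sub \<rho> by (meson centre_in_cball less_imp_le subsetD)
    note L = laplacian_straightened[OF open_half_ball HV(2)[OF r] f]
    have yV: "y \<in> V" "y \<in> cball (\<psi> p) R1" using y HV(2,3)[OF r] by blast+
    have \<psi>\<phi>: "\<psi> (\<phi> y) = y" by (rule inverse(4)[OF yV(1)])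
    \<comment> \<open>A closed ball inside the half ball does not reach the flat boundary, so its
      radius is below \<open>y $ k\<close> and hence below \<open>r\<close>.\<close>
    have "\<rho> <= s/2"
    proof -
      have "dist y (y - \<rho> *\<^sub>R axis k 1) = \<rho>" using \<rho> by (simp add: dist_norm)
      then have "y - \<rho> *\<^sub>R axis k 1 \<in> half_ball (\<psi> p) k r" using sub \<rho> by (intro subsetD[OF sub]) simp
      then have "\<rho> < y $ k" by (simp add: half_ball_def)
      moreover have "\<bar>(y - \<psi> p) $ k\<bar> < r" using y component_le_norm_cart[of "y - \<psi> p" k]
        by (simp add: half_ball_def dist_norm norm_minus_commute)
      ultimately show ?thesis using boundary_point(2) r R(4) by simp
    qed
    moreover have "\<rho> / \<Lambda> <= \<rho>" using \<rho> \<Lambda> by (simp add: divide_le_eq)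
    ultimately have in_s: "z \<in> cball p s" if "z \<in> cball (\<phi> y) (\<rho> / \<Lambda>)" for z
      using that near[OF yV(2)] dist_triangle[of p z "\<phi> y"] by (simp del: dist_commute)
    \<comment> \<open>The radius is divided by the Lipschitz constant so that the image of this ball
      under \<open>\<psi>\<close> stays in \<open>cball y \<rho>\<close>.\<close>
    have img: "\<psi> z \<in> cball y \<rho>" "z \<in> U" "\<phi> (\<psi> z) = z" if "z \<in> cball (\<phi> y) (\<rho> / \<Lambda>)" for z
    proof -
      show U: "z \<in> U" using in_s[OF that] s(2) by blast
      show "\<phi> (\<psi> z) = z" by (rule inverse(2)[OF U])
      have "\<phi> y \<in> cball (\<phi> y) (\<rho> / \<Lambda>)" using \<rho> \<Lambda> by simp
      then have "dist (\<psi> (\<phi> y)) (\<psi> z) <= \<Lambda> * dist (\<phi> y) z" by (rule lip[OF in_s in_s[OF that]])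
      also have "... <= \<Lambda> * (\<rho> / \<Lambda>)" using that \<Lambda> by (intro mult_left_mono) auto
      finally show "\<psi> z \<in> cball y \<rho>" using \<psi>\<phi> \<Lambda> by simp
    qed
    define F where "F = (%x. f (\<psi> x))"
    define T where "T = 32 * n\<^sup>2 * (M / (\<rho> / \<Lambda>) + (\<rho> / \<Lambda>) * N)"
    have grad: "\<bar>pd l F (\<phi> y)\<bar> <= T" for l
      unfolding F_def T_def n_def
    proof (rule interior_gradient_laplacian[OF L(2)[OF y] L(3)[OF y] _ _ MN])
      show "cball (\<phi> y) (\<rho> / \<Lambda>) \<subseteq> U \<inter> \<psi> -` half_ball (\<psi> p) k r" using img sub by blast
      show "0 < \<rho> / \<Lambda>" using \<rho> \<Lambda> by simp
      fix z assume z: "z \<in> cball (\<phi> y) (\<rho> / \<Lambda>)"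
      show "\<bar>f (\<psi> z)\<bar> <= M" by (rule M[OF img(1)[OF z]])
      show "\<bar>laplacian (%x. f (\<psi> x)) z\<bar> <= N"
        using L(1)[OF subsetD[OF sub img(1)[OF z]]] N[OF img(1)[OF z]] img(3)[OF z] by simp
    qed
    have T0: "0 <= T" using grad[of i] by linarith
    have "pd i f y = pd i (%y. F (\<phi> y)) y"
    proof (rule pd_cong[OF open_half_ball y])
      show "f z = F (\<phi> z)" if "z \<in> half_ball (\<psi> p) k r" for z
        using inverse(4)[OF subsetD[OF HV(2)[OF r] that]] by (simp add: F_def)
    qed
    also have "... = (\<Sum>l\<in>UNIV. pd l F (\<phi> y) * pd i (%y. \<phi> y $ l) y)"
      unfolding F_def
      by (rule pd_compose(1)[OF smooth_on_differentiable[OF UV(5) yV(1)] smooth_on_differentiable[OF L(3)[OF y] L(4)[OF y]]])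
    also have "\<bar>...\<bar> <= (\<Sum>l\<in>(UNIV::'n set). T * B)"
    proof (rule order_trans[OF sum_abs sum_mono])
      show "\<bar>pd l F (\<phi> y) * pd i (%y. \<phi> y $ l) y\<bar> <= T * B" for l
        unfolding abs_mult by (rule mult_mono[OF grad db[OF yV(2)] T0 abs_ge_zero])
    qed
    also have "... = n * (T * B)" by (simp add: n_def)
    also have "... <= C1 * (M / \<rho> + \<rho> * N)"
    proof -
      have "\<rho> / \<Lambda> * N <= \<Lambda> * (\<rho> * N)"
      proof -
        have "\<rho> / \<Lambda> <= \<Lambda> * \<rho>" using \<open>\<rho> / \<Lambda> <= \<rho>\<close> \<rho> \<Lambda> mult_right_mono[of 1 \<Lambda> \<rho>] by linarith
        from mult_right_mono[OF this MN(2)] show ?thesis by (simp add: mult.assoc)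
      qed
      then have "M / (\<rho> / \<Lambda>) + \<rho> / \<Lambda> * N <= \<Lambda> * (M / \<rho> + \<rho> * N)" by (simp add: distrib_left mult_ac)
      then have "32 * n\<^sup>2 * (M / (\<rho> / \<Lambda>) + \<rho> / \<Lambda> * N) <= 32 * n\<^sup>2 * (\<Lambda> * (M / \<rho> + \<rho> * N))"
        by (rule mult_left_mono) simp
      then have "T * (n * B) <= 32 * n\<^sup>2 * (\<Lambda> * (M / \<rho> + \<rho> * N)) * (n * B)"
        unfolding T_def using n B by (intro mult_right_mono) auto
      then show ?thesis by (simp add: C1_def mult_ac)
    qed
    finally show "\<bar>pd i f y\<bar> <= C1 * (M / \<rho> + \<rho> * N)" .
  next
    fix y assume y: "y \<in> half_ball (\<psi> p) k R"
    note L = laplacian_straightened[OF open_half_ball HV(2)[OF order_refl] v\<phi> y]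
    have yV: "y \<in> V" and y\<Omega>: "\<phi> y \<in> \<Omega>" using y HV(1,2)[of R] W(3) by blast+
    have S: "open (U \<inter> \<psi> -` half_ball (\<psi> p) k R)" "\<phi> y \<in> U \<inter> \<psi> -` half_ball (\<psi> p) k R" by (rule L(2) L(4))+
    have inv: "v z = v (\<phi> (\<psi> z))" if "z \<in> U \<inter> \<psi> -` half_ball (\<psi> p) k R" for z using inverse(2)[of z] that by simp
    have pdv: "pd l v z = pd l (%x. v (\<phi> (\<psi> x))) z" if "z \<in> U \<inter> \<psi> -` half_ball (\<psi> p) k R" for l z
      by (rule pd_cong[OF S(1) that inv])
    have "laplacian v (\<phi> y) = laplacian (%x. v (\<phi> (\<psi> x))) (\<phi> y)"
      unfolding laplacian_def by (intro sum.cong refl pd_cong[OF S] pdv)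
    then have lap: "laplacian v (\<phi> y) = ellop a e (%y. v (\<phi> y)) y" using L(1) by simp
    have "pd l v (\<phi> y) = (\<Sum>i\<in>UNIV. pd i (%y. v (\<phi> y)) y * pd l (%x. \<psi> x $ i) (\<phi> y))" for l
    proof -
      have "pd l (%x. v (\<phi> (\<psi> x))) (\<phi> y) = (\<Sum>i\<in>UNIV. pd i (%y. v (\<phi> y)) (\<psi> (\<phi> y)) * pd l (%x. \<psi> x $ i) (\<phi> y))"
      proof (rule pd_compose(1)[where f = "%y. v (\<phi> y)"])
        show "\<psi> differentiable at (\<phi> y)" by (rule smooth_on_differentiable[OF UV(4) inverse(3)[OF yV]])
        show "(%y. v (\<phi> y)) differentiable at (\<psi> (\<phi> y))"
          unfolding inverse(4)[OF yV] by (rule smooth_on_differentiable[OF v\<phi> y])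
      qed
      then show ?thesis using pdv[OF S(2)] by (simp add: inverse(4)[OF yV])
    qed
    then have "c (\<phi> y) \<bullet> gradient v (\<phi> y)
        = (\<Sum>l\<in>UNIV. \<Sum>i\<in>UNIV. c (\<phi> y) $ l * (pd i (%y. v (\<phi> y)) y * pd l (%x. \<psi> x $ i) (\<phi> y)))"
      by (simp add: inner_gradient sum_distrib_left)
    also have "... = (\<Sum>i\<in>UNIV. \<Sum>l\<in>UNIV. c (\<phi> y) $ l * (pd i (%y. v (\<phi> y)) y * pd l (%x. \<psi> x $ i) (\<phi> y)))"
      by (rule sum.swap)
    also have "... = (\<Sum>i\<in>UNIV. b i y * pd i (%y. v (\<phi> y)) y)"
      unfolding b_def sum_distrib_right by (intro sum.cong refl) (simp add: mult_ac)
    finally show "ellop a e (%y. v (\<phi> y)) y = (\<Sum>i\<in>UNIV. b i y * pd i (%y. v (\<phi> y)) y) - lam * (1 / (1 - v (\<phi> y))\<^sup>2)"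
      using eq[OF y\<Omega>] lap by simp
  qed
  then show ?thesis by (rule that)
qed

end

section \<open>Extension of the derivatives to the closure\<close>

lemma convex_half_ball: "convex (half_ball y0 k r)"
proof -
  have "half_ball y0 k r = ball y0 r \<inter> {y. 0 < axis k 1 \<bullet> y}"
    by (auto simp: half_ball_def inner_axis' )
  then show ?thesis by (auto intro!: convex_Int convex_ball convex_halfspace_gt)
qed

context straightened_boundary
begin

text \<open>Bounds for one order more give a Lipschitz estimate. It is derived in the chart, because
  the half ball is convex whereas the domain near \<open>p\<close> need not be, and then returned
  through the Lipschitz map \<open>\<psi>\<close>.\<close>

lemma derivative_oscillation:
  assumes v: "smooth_on \<Omega> v" "!!x. x \<in> \<Omega> ==> 0 <= v x" "!!x. x \<in> \<Omega> ==> v x <= 1 - d0" and d0: "0 < d0"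
    and eq: "!!x. x \<in> \<Omega> ==> - laplacian v x + c x \<bullet> gradient v x = lam / (1 - v x)\<^sup>2"
    and g: "continuous_on (closure \<Omega>) g" "!!x. x \<in> frontier \<Omega> ==> g x = 0" "!!x. x \<in> \<Omega> ==> v x <= (g x :: real)"
    and \<epsilon>: "0 < \<epsilon>"
  shows "\<exists>N. open N & p \<in> N & (\<forall>x\<in>N\<inter>\<Omega>. \<forall>x'\<in>N\<inter>\<Omega>. \<bar>Dd is v x - Dd is v x'\<bar> < \<epsilon>)"
proof -
  obtain R \<theta> C0 AB where bc: "boundary_chart (\<psi> p) k R \<theta> C0 d0 lam a e b AB (%y. v (\<phi> y))"
    using chart_instance[OF v d0 eq g] by blast
  \<comment> \<open>One derivative beyond the one whose oscillation is estimated.\<close>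
  define m where "m = Suc (length is)"
  obtain r0 C where r0: "0 < r0" "r0 <= R" and C: "\<forall>y\<in>half_ball (\<psi> p) k r0. \<forall>is. length is <= m --> \<bar>Dd is (%y. v (\<phi> y)) y\<bar> <= C"
    using boundary_chart.boundary_regularity[OF bc, of m] by blast
  obtain s R1 \<Lambda> B where s: "0 < s" "cball p s \<subseteq> U" and R1: "0 < R1" "cball (\<psi> p) R1 \<subseteq> V"
    and near: "!!y. y \<in> cball (\<psi> p) R1 ==> dist p (\<phi> y) < s / 2" and \<Lambda>: "1 <= \<Lambda>" and B: "1 <= B"
    and lip: "!!x x'. x \<in> cball p s ==> x' \<in> cball p s ==> dist (\<psi> x) (\<psi> x') <= \<Lambda> * dist x x'"
    and db: "!!y i l. y \<in> cball (\<psi> p) R1 ==> \<bar>pd i (%y. \<phi> y $ l) y\<bar> <= B"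
    using good_radius by metis
  define r where "r = min r0 R1"
  have r: "0 < r" "r <= r0" "r <= R1" using r0 R1 by (auto simp: r_def)
  let ?H = "half_ball (\<psi> p) k r"
  have HV: "?H \<subseteq> cball (\<psi> p) R1" "?H \<subseteq> half_ball (\<psi> p) k r0" using r by (auto simp: half_ball_def)
  have HW: "?H \<subseteq> W" using HV(1) R1(2) by (auto simp: half_ball_def W_def)
  have sv: "smooth_on ?H (%y. v (\<phi> y))"
    by (rule smooth_on_subset[OF boundary_chart.u_smooth[OF bc] half_ball_mono[OF order_trans[OF r(2) r0(2)]]])
  define S where "S = U \<inter> \<psi> -` ?H"
  have S: "open S" unfolding S_def
    by (rule continuous_open_preimage[OF homeomorphism_cont1[OF UV(3)] UV(1) open_half_ball])
  have S\<Omega>: "S \<subseteq> \<Omega>"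
  proof
    fix x assume "x \<in> S"
    then have "x \<in> U" "0 < \<psi> x $ k" by (simp_all add: S_def half_ball_def)
    then show "x \<in> \<Omega>" using domain_iff by blast
  qed
  define S' where "S' = S \<inter> ball p s"
  have S': "open S'" "S' \<subseteq> S" "S' \<subseteq> cball p s" "S' \<subseteq> U" using S by (auto simp: S'_def S_def)
  have "Cb m S' (%x. v (\<phi> (\<psi> x)))"
  proof (rule Cb_compose[OF S'(1) smooth_on_subset[OF UV(4) S'(4)], where f = "%y. v (\<phi> y)" and T = ?H])
    show "\<psi> x \<in> ?H" if "x \<in> S'" for x using that S'(2) by (auto simp: S_def)
    show "Cb m S' (%x. \<psi> x $ l)" for l by (rule Cb_subset[OF Cb_compact[OF psi_smooth compact_cball s(2)] S'(3)])
    show "smooth_on ?H (%y. v (\<phi> y))" by (rule sv)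
    show "Cb m ?H (%y. v (\<phi> y))" using C HV(2) by (intro Cb_boundI[where B = C]) auto
  qed
  then have "Cb m S' v" by (rule Cb_cong[OF S'(1), rotated]) (use S'(4) inverse(2) in auto)
  then obtain C' where C': "0 <= C'" "!!js x. length js <= m ==> x \<in> S' ==> norm (Dd js v x) <= C'"
    by (rule Cb_bound) (rule that)
  define f where "f = Dd is v"
  have f: "smooth_on \<Omega> f" unfolding f_def by (rule smooth_on_Dd[OF v(1)])
  define n where "n = real CARD('n)"
  have n: "1 <= n" by (simp add: n_def Suc_leI)
  have S\<phi>: "\<phi> y \<in> S" "\<phi> y \<in> S'" "y \<in> V" if "y \<in> ?H" for y
  proof -
    show "y \<in> V" using that HW W(2) by blast
    then show "\<phi> y \<in> S" using that inverse(3,4) by (simp add: S_def)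
    then show "\<phi> y \<in> S'" using near[of y] that HV(1) s(1) by (auto simp: S'_def subset_iff)
  qed
  have lipf: "\<bar>f (\<phi> y) - f (\<phi> y')\<bar> <= n * (n * (C' * B)) * dist y y'" if y: "y \<in> ?H" "y' \<in> ?H" for y y'
    unfolding n_def
  proof (rule pd_bound_lipschitz[where f = "%y. f (\<phi> y)", OF convex_half_ball[of "\<psi> p" k r] _ _ _ y])
    show "0 <= real CARD('n) * (C' * B)" using C' B by simp
    fix z assume z: "z \<in> ?H"
    have d: "\<phi> differentiable at z" "f differentiable at (\<phi> z)"
      by (rule smooth_on_differentiable[OF UV(5) S\<phi>(3)[OF z]] smooth_on_differentiable[OF f subsetD[OF S\<Omega> S\<phi>(1)[OF z]]])+
    show "(%y. f (\<phi> y)) differentiable (at z)" by (rule pd_compose(2)[OF d])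
    show "\<bar>pd i (%y. f (\<phi> y)) z\<bar> <= real CARD('n) * (C' * B)" for i
    proof -
      have "\<bar>pd l f (\<phi> z) * pd i (%y. \<phi> y $ l) z\<bar> <= C' * B" for l
      proof -
        have "\<bar>pd l f (\<phi> z)\<bar> <= C'" using C'(2)[OF _ S\<phi>(2)[OF z], of "l # is"] by (simp add: f_def m_def)
        then show ?thesis unfolding abs_mult using db[of z i l] z HV(1) C' by (intro mult_mono) auto
      qed
      then have "\<bar>\<Sum>l\<in>UNIV. pd l f (\<phi> z) * pd i (%y. \<phi> y $ l) z\<bar> <= (\<Sum>l\<in>(UNIV::'n set). C' * B)"
        by (intro order_trans[OF sum_abs] sum_mono)
      then show ?thesis using pd_compose(1)[OF d, of i] by simp
    qed
  qed
  define K where "K = n * (n * (C' * B)) * \<Lambda>"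
  have K: "0 <= K" using n C' B \<Lambda> by (simp add: K_def)
  define t where "t = min s (min (r / \<Lambda>) (\<epsilon> / (2 * (K + 1))))"
  have t: "0 < t" "t <= s" "t <= r / \<Lambda>" "t <= \<epsilon> / (2 * (K + 1))" using s(1) r(1) \<Lambda> \<epsilon> K by (auto simp: t_def)
  have tK: "K * (2 * t) < \<epsilon>"
  proof -
    have "(K + 1) * (2 * t) <= \<epsilon>" using t(4) K by (simp add: field_simps)
    then show ?thesis using t(1) by (simp add: distrib_right)
  qed
  have "\<bar>Dd is v x - Dd is v x'\<bar> < \<epsilon>" if x: "x \<in> ball p t \<inter> \<Omega>" "x' \<in> ball p t \<inter> \<Omega>" for x x'
  proof -
    have H: "z \<in> cball p s & \<psi> z \<in> ?H & \<phi> (\<psi> z) = z" if z: "z \<in> ball p t \<inter> \<Omega>" for z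
    proof -
      have zs: "z \<in> cball p s" using z t(2) by simp
      then have zU: "z \<in> U" using s(2) by blast
      have "dist (\<psi> p) (\<psi> z) <= \<Lambda> * dist p z" using s(1) by (intro lip[OF _ zs]) simp
      also have "... < \<Lambda> * t" using z \<Lambda> by simp
      also have "... <= r" using t(3) \<Lambda> by (simp add: pos_le_divide_eq mult.commute)
      finally have "\<psi> z \<in> ?H" using domain_iff[OF zU] z by (simp add: half_ball_def)
      then show ?thesis using zs inverse(2)[OF zU] by blast
    qed
    have "\<bar>f (\<phi> (\<psi> x)) - f (\<phi> (\<psi> x'))\<bar> <= n * (n * (C' * B)) * dist (\<psi> x) (\<psi> x')"
      using H[OF x(1)] H[OF x(2)] by (intro lipf) auto
    also have "... <= n * (n * (C' * B)) * (\<Lambda> * dist x x')"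
      using H[OF x(1)] H[OF x(2)] n C' B by (intro mult_left_mono lip) auto
    also have "... = K * dist x x'" by (simp add: K_def)
    also have "... <= K * (2 * t)"
      using x dist_triangle3[of x x' p] K by (intro mult_left_mono) auto
    finally show ?thesis using H[OF x(1)] H[OF x(2)] tK by (simp add: f_def)
  qed
  then show ?thesis using t(1) by (intro exI[of _ "ball p t"]) auto
qed

end

text \<open>A Lebesgue number of a cover of the compact closure by sets of small oscillation; the
  oscillation is measured on \<open>S\<close> only, so \<open>f\<close> needs no values at the
  boundary.\<close>

lemma uniformly_continuous_if_oscillation:
  fixes f :: "'a::heine_borel => 'b::metric_space"
  assumes "bounded S" and osc: "!!p \<epsilon>. p \<in> closure S ==> 0 < \<epsilon> ==>
    \<exists>N. open N & p \<in> N & (\<forall>x\<in>N\<inter>S. \<forall>x'\<in>N\<inter>S. dist (f x) (f x') < \<epsilon>)"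
  shows "uniformly_continuous_on S f"
  unfolding uniformly_continuous_on_def
proof (intro allI impI)
  fix \<epsilon> :: real assume \<epsilon>: "0 < \<epsilon>"
  define G where "G = {N. open N & (\<forall>x\<in>N\<inter>S. \<forall>x'\<in>N\<inter>S. dist (f x) (f x') < \<epsilon>)}"
  have "compact (closure S)" using assms(1) by (simp add: compact_closure)
  moreover have "closure S \<subseteq> \<Union>G" using osc[OF _ \<epsilon>] by (force simp: G_def)
  moreover have "!!N. N \<in> G ==> open N" by (simp add: G_def)
  ultimately have "\<exists>\<delta>>0. \<forall>x\<in>closure S. \<exists>N\<in>G. ball x \<delta> \<subseteq> N"
    by (metis Heine_Borel_lemma)
  then obtain \<delta> where \<delta>: "0 < \<delta>" "!!x. x \<in> closure S ==> \<exists>N\<in>G. ball x \<delta> \<subseteq> N" by metis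
  have "dist (f x') (f x) < \<epsilon>" if xx: "x \<in> S" "x' \<in> S" "dist x' x < \<delta>" for x x'
  proof -
    obtain N where "N \<in> G" "ball x \<delta> \<subseteq> N" using \<delta>(2)[OF subsetD[OF closure_subset xx(1)]] by blast
    moreover have "x \<in> ball x \<delta>" "x' \<in> ball x \<delta>" using \<delta>(1) xx(3) by (auto simp: dist_commute)
    ultimately show ?thesis using xx(1,2) unfolding G_def by blast
  qed
  then show "\<exists>d>0. \<forall>x\<in>S. \<forall>x'\<in>S. dist x' x < d --> dist (f x') (f x) < \<epsilon>" using \<delta>(1) by blast
qed

text \<open>The derivatives extend because they are uniformly continuous. That the given boundary
  value 0 is the limit of \<open>v\<close> follows separately, as \<open>v\<close> is squeezed
  between 0 and \<open>g\<close>.\<close>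

lemma smooth_solution_if_barrier:
  fixes c :: "real^'n => real^'n"
  assumes \<Omega>: "open \<Omega>" "bounded \<Omega>" "smooth_boundary \<Omega>" and c: "smooth_on_closure \<Omega> c"
    and v: "smooth_on \<Omega> v" "!!x. x \<in> \<Omega> ==> 0 <= v x" "!!x. x \<in> \<Omega> ==> v x <= 1 - d0" and d0: "0 < d0"
    and eq: "!!x. x \<in> \<Omega> ==> - laplacian v x + c x \<bullet> gradient v x = lam / (1 - v x)\<^sup>2"
    and g: "continuous_on (closure \<Omega>) g" "!!x. x \<in> frontier \<Omega> ==> g x = 0" "!!x. x \<in> \<Omega> ==> v x <= (g x :: real)"
    and v0: "!!x. x \<in> frontier \<Omega> ==> v x = 0"
  shows "smooth_solution \<Omega> c lam v"
proof -
  have clo: "closure \<Omega> = \<Omega> \<union> frontier \<Omega>" using closure_Un_frontier by blast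
  have osc: "\<exists>N. open N & p \<in> N & (\<forall>x\<in>N\<inter>\<Omega>. \<forall>x'\<in>N\<inter>\<Omega>. dist (Dd is v x) (Dd is v x') < \<epsilon>)"
    if p: "p \<in> closure \<Omega>" and \<epsilon>: "0 < \<epsilon>" for p \<epsilon> "is"
  proof (cases "p \<in> \<Omega>")
    case True
    have "open (\<Omega> \<inter> Dd is v -` ball (Dd is v p) (\<epsilon>/2))"
      by (rule continuous_open_preimage[OF smooth_on_continuous_on[OF smooth_on_Dd[OF v(1)]] \<Omega>(1) open_ball])
    moreover have "dist a b < \<epsilon>" if "dist (Dd is v p) a < \<epsilon>/2" "dist (Dd is v p) b < \<epsilon>/2" for a b
      using dist_triangle3[of a b "Dd is v p"] that by linarith
    ultimately show ?thesis using True \<epsilon> by (intro exI[of _ "\<Omega> \<inter> Dd is v -` ball (Dd is v p) (\<epsilon>/2)"]) auto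
  next
    case False
    then have pf: "p \<in> frontier \<Omega>" using p clo by blast
    from \<Omega>(3)[unfolded smooth_boundary_def, rule_format, OF this] obtain U V \<psi> \<phi> k where ch: "open U" "p \<in> U" "open V" "homeomorphism U V \<psi> \<phi>" "smooth_on U \<psi>"
      "smooth_on V (\<phi> :: real^'n => real^'n)" "\<psi> ` (U \<inter> \<Omega>) = {y \<in> V. y $ (k::'n) > 0}"
      "\<psi> ` (U \<inter> frontier \<Omega>) = {y \<in> V. y $ k = 0}"
      by (elim exE conjE) rule
    interpret straightened_boundary \<Omega> U V \<psi> \<phi> k p c
      by unfold_locales (fact \<Omega> c ch pf)+
    show ?thesis unfolding dist_real_def by (rule derivative_oscillation[OF v d0 eq g \<epsilon>])
  qed
  have "\<exists>h. continuous_on (closure \<Omega>) h & (\<forall>x\<in>\<Omega>. h x = Dd is v x)" for "is"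
  proof -
    have "uniformly_continuous_on \<Omega> (Dd is v)" by (rule uniformly_continuous_if_oscillation[OF \<Omega>(2) osc])
    then obtain h where h: "uniformly_continuous_on (closure \<Omega>) h" "!!x. x \<in> \<Omega> ==> Dd is v x = h x"
      by (rule uniformly_continuous_on_extension_on_closure) blast
    show ?thesis using uniformly_continuous_imp_continuous[OF h(1)] h(2) by (intro exI[of _ h]) simp
  qed
  moreover have "continuous_on (closure \<Omega>) v"
    unfolding continuous_on_eq_continuous_within
  proof
    fix p assume p: "p \<in> closure \<Omega>"
    show "continuous (at p within closure \<Omega>) v"
    proof (cases "p \<in> \<Omega>")
      case True
      then show ?thesis
        using smooth_on_continuous_on[OF v(1)] \<Omega>(1) continuous_on_eq_continuous_at continuous_at_imp_continuous_at_within by blast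
    next
      case False
      then have pf: "p \<in> frontier \<Omega>" using p clo by blast
      have "(g \<longlongrightarrow> g p) (at p within closure \<Omega>)" using g(1) p by (simp add: continuous_on_def)
      then have "(g \<longlongrightarrow> 0) (at p within closure \<Omega>)" using g(2)[OF pf] by simp
      then have "(v \<longlongrightarrow> 0) (at p within closure \<Omega>)"
      proof (rule tendsto_sandwich[rotated 2, OF tendsto_const])
        have "0 <= v x & v x <= g x" if "x \<in> closure \<Omega>" for x using that v(2) g(2,3) v0 clo by force
        then show "\<forall>\<^sub>F x in at p within closure \<Omega>. 0 <= v x" "\<forall>\<^sub>F x in at p within closure \<Omega>. v x <= g x"
          by (auto simp: eventually_at_filter)
      qed
      then show ?thesis using v0[OF pf] by (simp add: continuous_within)
    qed
  qed
  ultimately have "smooth_on_closure \<Omega> v" using v(1) by (simp add: smooth_on_closure_def)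
  moreover have "0 <= v x & v x < 1" if "x \<in> closure \<Omega>" for x
    using that v(2,3) v0 d0 clo by force
  ultimately show ?thesis using eq v0 by (simp add: smooth_solution_def)
qed

theorem existence_between:
  fixes c :: "real^'n => real^'n"
  assumes \<Omega>: "open \<Omega>" "bounded \<Omega>" "smooth_boundary \<Omega>" and c: "smooth_on_closure \<Omega> c" and d0: "0 < d0"
    and lm: "lm \<longlonglongrightarrow> lam" "!!m. 0 <= lm m" "!!m. lm m < lm' m"
    and w: "!!m. smooth_solution \<Omega> c (lm' m) (w m)" "!!m x. x \<in> \<Omega> ==> w m x <= 1 - d0"
    and g: "continuous_on (closure \<Omega>) g" "!!x. x \<in> frontier \<Omega> ==> g x = 0" "!!m x. x \<in> \<Omega> ==> w m x <= g x"
  obtains v where "smooth_solution \<Omega> c lam v" "!!x b. x \<in> \<Omega> ==> (!!m. w m x <= b) ==> v x <= b"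
proof -
  obtain v where v: "smooth_on \<Omega> v" "!!x. x \<in> \<Omega> ==> 0 <= v x"
    "!!x. x \<in> \<Omega> ==> - laplacian v x + c x \<bullet> gradient v x = lam / (1 - v x)\<^sup>2"
    "!!x b. x \<in> \<Omega> ==> (!!m. w m x <= b) ==> v x <= b"
    using existence_interior[OF \<Omega>(1,2) c d0 lm w] by metis
  \<comment> \<open>The interior construction says nothing about values off the open domain, so the
    boundary value is put in here.\<close>
  define v' where "v' x = (if x \<in> \<Omega> then v x else 0)" for x
  have eq: "v' x = v x" if "x \<in> \<Omega>" for x using that by (simp add: v'_def)
  have "smooth_on \<Omega> v'" using v(1) smooth_on_cong[OF \<Omega>(1), of v' v] eq by blast
  moreover have pde: "- laplacian v' x + c x \<bullet> gradient v' x = lam / (1 - v' x)\<^sup>2" if x: "x \<in> \<Omega>" for x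
  proof -
    have p1: "pd i v' z = pd i v z" if "z \<in> \<Omega>" for i z by (rule pd_cong[OF \<Omega>(1) that eq])
    have "laplacian v' x = laplacian v x"
      unfolding laplacian_def by (intro sum.cong refl pd_cong[OF \<Omega>(1) x] p1)
    moreover have "gradient v' x = gradient v x" unfolding gradient_def by (simp add: p1[OF x])
    ultimately show ?thesis using v(3)[OF x] eq[OF x] by simp
  qed
  ultimately have "smooth_solution \<Omega> c lam v'"
  proof (intro smooth_solution_if_barrier[OF \<Omega> c _ _ _ d0 _ g(1,2)])
    show "v' x = 0" if "x \<in> frontier \<Omega>" for x using that \<Omega>(1) by (simp add: v'_def frontier_def interior_open)
    show "0 <= v' x" "v' x <= 1 - d0" "v' x <= g x" if "x \<in> \<Omega>" for x
      using v(2)[OF that] v(4)[OF that w(2)[OF that]] v(4)[OF that g(3)[OF that]] eq[OF that] by auto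
  qed auto
  then show ?thesis by (rule that) (use v(4) eq in simp)
qed

section \<open>The energy estimate\<close>

lemma integrable_compact_support:
  fixes g :: "'a::euclidean_space => real"
  assumes "continuous_on UNIV g" "compact K" "!!x. x \<notin> K ==> g x = 0"
  shows "integrable lborel g"
proof -
  have "integrable lborel (%x. indicator K x *\<^sub>R g x)"
    by (rule borel_integrable_compact[OF assms(2) continuous_on_subset[OF assms(1)]]) simp
  moreover have "(%x. indicator K x *\<^sub>R g x) = g"
    by (rule ext) (metis indicator_simps scaleR_one scaleR_zero_left assms(3))
  ultimately show ?thesis by simp
qed

text \<open>By translation invariance every difference quotient has integral 0, and dominated
  convergence passes to the derivative.\<close>

lemma integral_pd_zero:
  fixes f :: "real^'n => real"
  assumes f: "!!x. f differentiable (at x)" and cont: "continuous_on UNIV (pd i f)"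
    and K: "compact K" "!!x. x \<notin> K ==> f x = 0"
  shows "integrable lborel (pd i f)" "(\<integral>x. pd i f x \<partial>lborel) = 0"
proof -
  have cf: "continuous_on UNIV f"
    using f by (simp add: continuous_at_imp_continuous_on differentiable_imp_continuous_within)
  obtain r where "!!x. x \<in> K ==> norm x <= r" using compact_imp_bounded[OF K(1)] by (auto simp: bounded_iff)
  then have r: "K \<subseteq> cball 0 r" by auto
  have pd0: "pd i f x = 0" if "x \<notin> K" for x
  proof -
    have "pd i f x = pd i (%x. 0) x"
      by (rule pd_cong[of "- K"]) (use that K compact_imp_closed in auto)
    then show ?thesis by simp
  qed
  have "bounded (pd i f ` K)"
    using compact_imp_bounded compact_continuous_image[OF continuous_on_subset[OF cont] K(1)] by blast
  then obtain B0 where B0: "!!x. x \<in> K ==> \<bar>pd i f x\<bar> <= B0" by (auto simp: bounded_iff)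
  define B where "B = max 0 B0"
  have B: "\<bar>pd i f x\<bar> <= B" "0 <= B" for x using B0[of x] pd0[of x] by (cases "x \<in> K"; auto simp: B_def)+
  have int_f: "integrable lborel f" by (rule integrable_compact_support[OF cf K])
  have shift: "integrable lborel (%x. f (x + v))" "(\<integral>x. f (x + v) \<partial>lborel) = (\<integral>x. f x \<partial>lborel)" for v
  proof -
    have m: "f \<in> borel_measurable borel" using cf by (rule borel_measurable_continuous_onI)
    have d: "distr lborel borel (%x. v + x) = lborel" using lborel_distr_plus[of v] by simp
    show "integrable lborel (%x. f (x + v))"
      using int_f integrable_distr_eq[of "%x. v + x" lborel borel f] m unfolding d by (simp add: add.commute)
    show "(\<integral>x. f (x + v) \<partial>lborel) = (\<integral>x. f x \<partial>lborel)"
      using integral_distr[of "%x. v + x" lborel borel f] m unfolding d by (simp add: add.commute)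
  qed
  define h where "h m = inverse (real (Suc m))" for m
  have h: "0 < h m" "h m <= 1" "h \<longlonglongrightarrow> 0" for m
  proof -
    show "0 < h m" "h m <= 1" by (auto simp: h_def field_simps)
    show "h \<longlonglongrightarrow> 0" unfolding h_def[abs_def] by (rule LIMSEQ_inverse_real_of_nat)
  qed
  have dqint: "integrable lborel (dq (h m) i f)" "(\<integral>x. dq (h m) i f x \<partial>lborel) = 0" for m
    unfolding dq_def[abs_def] using shift int_f by simp_all
  have lim: "(%m. dq (h m) i f x) \<longlonglongrightarrow> pd i f x" for x
  proof (rule filterlim_compose[where g = "%h. dq h i f x" and f = h])
    have "((%s. f (step x s i)) has_real_derivative pd i f (step x 0 i)) (at 0)"
      by (intro line_deriv f)
    then have "((%h. dq h i f x) \<longlongrightarrow> pd i f x) (at 0)" by (simp add: DERIV_def dq_def)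
    then show "((%h. dq h i f x) \<longlongrightarrow> pd i f x) (at_right 0)"
      by (rule filterlim_mono) (auto simp: at_le)
    show "filterlim h (at_right 0) sequentially"
      unfolding filterlim_at using h(1,3) by (auto intro!: always_eventually simp: less_imp_neq[symmetric])
  qed
  \<comment> \<open>Steps have length at most 1, so all quotients are supported in one enlarged ball
    and bounded by the supremum of the derivative.\<close>
  have bound: "norm (dq (h m) i f x) <= indicator (cball 0 (r + 1)) x *\<^sub>R B" for m x
  proof (cases "x \<in> cball 0 (r + 1)")
    case True
    obtain t where "f (step x (h m) i) - f x = h m * pd i f (step x t i)"
      using line_MVT[OF h(1) f] by blast
    then have "dq (h m) i f x = pd i f (step x t i)" using h(1)[of m] by (simp add: dq_def)
    then show ?thesis using True B(1) by simp
  next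
    case False
    then have n: "r + 1 < norm x" by simp
    have "x \<notin> K" using n r by (auto simp: subset_iff)
    moreover have "norm x <= norm (step x (h m) i) + h m"
      using norm_triangle_sub[of x "step x (h m) i"] h(1)[of m] by simp
    then have "r < norm (step x (h m) i)" using n h(2)[of m] by linarith
    then have "step x (h m) i \<notin> K" using r by (auto simp: subset_iff)
    ultimately have "dq (h m) i f x = 0" using K(2) by (simp add: dq_def)
    then show ?thesis using B(2) by (simp add: indicator_def)
  qed
  have mpd: "pd i f \<in> borel_measurable lborel" using borel_measurable_continuous_onI[OF cont] by simp
  have ib: "integrable lborel (%x. indicator (cball 0 (r + 1)) x *\<^sub>R B)"
    by (rule borel_integrable_compact) auto
  have "(%m. (\<integral>x. dq (h m) i f x \<partial>lborel)) \<longlonglongrightarrow> (\<integral>x. pd i f x \<partial>lborel)"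
    by (rule integral_dominated_convergence[OF mpd borel_measurable_integrable[OF dqint(1)] ib])
       (use lim bound in auto)
  then show "(\<integral>x. pd i f x \<partial>lborel) = 0" using dqint(2) by (simp add: LIMSEQ_const_iff)
  show "integrable lborel (pd i f)" by (rule integrable_compact_support[OF cont K(1) pd0])
qed

definition ext0 :: "'a set => ('a => real) => 'a => real"
  where "ext0 S f x = (if x \<in> S then f x else 0)"

lemma ext0_continuous:
  assumes "open S" "compact K" "K \<subseteq> S" "continuous_on S f" "!!x. x \<in> S ==> x \<notin> K ==> f x = 0"
  shows "continuous_on UNIV (ext0 S (f :: 'a::t2_space => real))"
proof -
  have "continuous_on (S \<union> - K) (ext0 S f)"
  proof (rule continuous_on_open_Un[OF assms(1)])
    show "open (- K)" using assms(2) compact_imp_closed by blast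
    show "continuous_on S (ext0 S f)" using assms(4) by (rule continuous_on_eq) (simp add: ext0_def)
    show "continuous_on (- K) (ext0 S f)"
      by (rule continuous_on_eq[OF continuous_on_const[of _ 0]]) (use assms(5) in \<open>auto simp: ext0_def\<close>)
  qed
  moreover have "S \<union> - K = UNIV" using assms(3) by blast
  ultimately show ?thesis by simp
qed

lemma ext0_pd:
  fixes f :: "real^'n => real"
  assumes S: "open S" "compact K" "K \<subseteq> S" and f: "!!x. x \<in> S ==> x \<notin> K ==> f x = 0" "!!x. x \<in> S ==> f differentiable (at x)"
  shows "ext0 S f differentiable (at x)" "pd i (ext0 S f) x = ext0 S (pd i f) x"
    "x \<in> S ==> x \<notin> K ==> pd i f x = 0"
proof -
  have oK: "open (- K)" using S(2) compact_imp_closed by blast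
  have e: "ext0 S f y = f y" if "y \<in> S" for y using that by (simp add: ext0_def)
  have z: "ext0 S f y = 0" if "y \<in> - K" for y using that f(1) by (auto simp: ext0_def)
  have zK: "ext0 S f differentiable (at x)" "pd i (ext0 S f) x = 0" if "x \<notin> K" for x i
  proof -
    have "x \<in> - K" using that by simp
    then show "ext0 S f differentiable (at x)"
      using differentiable_cong_open[OF oK, of x "ext0 S f" "%x. 0"] z by simp
    have "pd i (ext0 S f) x = pd i (%x. 0) x" by (rule pd_cong[OF oK \<open>x \<in> - K\<close>]) (rule z)
    then show "pd i (ext0 S f) x = 0" by simp
  qed
  have eS: "pd i (ext0 S f) x = pd i f x" if "x \<in> S" for x i by (rule pd_cong[OF S(1) that e])
  show "ext0 S f differentiable (at x)"
  proof (cases "x \<in> S")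
    case True
    then show ?thesis using differentiable_cong_open[OF S(1) True, of "ext0 S f" f] e f(2) by simp
  next
    case False
    then show ?thesis using zK S(3) by blast
  qed
  show "pd i (ext0 S f) x = ext0 S (pd i f) x"
  proof (cases "x \<in> S")
    case True
    then show ?thesis using eS by (simp add: ext0_def)
  next
    case False
    then show ?thesis using zK(2)[of x i] S(3) by (auto simp: ext0_def)
  qed
  show "x \<in> S ==> x \<notin> K ==> pd i f x = 0" using zK(2)[of x i] eS[of x i] by simp
qed

section \<open>The weights of the energy estimate and their algebra\<close>

lemma pos_part_power_deriv:
  "((%t. (max 0 t) ^ Suc (Suc n)) has_real_derivative real (Suc (Suc n)) * (max 0 t) ^ Suc n) (at t)"
proof -
  consider "t < 0" | "0 < t" | "t = 0" by linarith
  then show ?thesis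
  proof cases
    case 1
    have "((%t::real. 0) has_real_derivative 0) (at t)" by simp
    then have "((%t. (max 0 t) ^ Suc (Suc n)) has_real_derivative 0) (at t)"
      by (rule has_field_derivative_transform_within_open[of _ _ _ "{..<0}"]) (use 1 in auto)
    then show ?thesis using 1 by simp
  next
    case 2
    have "((%t. t ^ Suc (Suc n)) has_real_derivative real (Suc (Suc n)) * t ^ Suc n) (at t)"
      by (rule DERIV_cong[OF DERIV_pow]) simp
    then have "((%t. (max 0 t) ^ Suc (Suc n)) has_real_derivative real (Suc (Suc n)) * t ^ Suc n) (at t)"
      by (rule has_field_derivative_transform_within_open[of _ _ _ "{0<..}"]) (use 2 in auto)
    then show ?thesis using 2 by simp
  next
    case 3
    have "((%h::real. \<bar>h\<bar> ^ Suc n) \<longlongrightarrow> \<bar>0\<bar> ^ Suc n) (at 0)" by (intro tendsto_intros)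
    then have "((%h::real. \<bar>h\<bar> ^ Suc n) \<longlongrightarrow> 0) (at 0)" by simp
    then have "((%h::real. (max 0 h) ^ Suc (Suc n) / h) \<longlongrightarrow> 0) (at 0)"
    proof (rule Lim_null_comparison[rotated])
      have "norm ((max 0 h) ^ Suc (Suc n) / h) <= \<bar>h\<bar> ^ Suc n" for h :: real
      proof (cases "h <= 0")
        case True
        then have "max 0 h = 0" by simp
        then show ?thesis by (simp only: power_0_Suc div_0 norm_zero zero_le_power abs_ge_zero)
      qed auto
      then show "\<forall>\<^sub>F h in at 0. norm ((max 0 h) ^ Suc (Suc n) / h) <= \<bar>h\<bar> ^ Suc n" for S :: "real set" by simp
    qed
    then show ?thesis unfolding 3 by (simp add: DERIV_def)
  qed
qed

text \<open>Vanishes for \<open>s <= 1/2\<close>. A solution is 0 on the frontier, so powers of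
  \<open>qq (u x)\<close> have compact support in the domain; where it is positive it equals
  \<open>1 / (1 - s) - 2\<close>.\<close>

definition qq :: "real => real" where "qq s = max 0 (1 / (1 - s) - 2)"

lemma qq_power_deriv:
  assumes "s < 1"
  shows "((%s. qq s ^ Suc (Suc n)) has_real_derivative real (Suc (Suc n)) * qq s ^ Suc n * (1 / (1 - s))\<^sup>2) (at s)"
proof -
  have "((%s. 1 / (1 - s) - 2) has_real_derivative (1 / (1 - s))\<^sup>2) (at s)"
    using assms by (auto intro!: derivative_eq_intros simp: power2_eq_square)
  from DERIV_chain2[OF pos_part_power_deriv this] show ?thesis unfolding qq_def .
qed

lemma qq_zero: "s <= 1/2 ==> qq s = 0"
proof -
  assume "s <= 1/2"
  then have "1 / (1 - s) <= 2" by (simp add: divide_le_eq)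
  then show ?thesis by (simp add: qq_def)
qed

text \<open>The primitive of \<open>16 * Q ^ 6 * P ^ 4\<close> in the variable \<open>u\<close>,
  where \<open>Q + 2 = P = 1 / (1 - u)\<close> on the support. The divergence of \<open>gg u\<close>
  times the gradient of \<open>u\<close> then reproduces the quadratic term that completing the
  square leaves behind.\<close>

definition gg :: "real => real" where "gg s = 16 * (qq s ^ 9 / 9 + qq s ^ 8 / 2 + 4 * qq s ^ 7 / 7)"

lemma gg_deriv:
  assumes "s < 1"
  shows "(gg has_real_derivative 16 * qq s ^ 6 * (1 / (1 - s)) ^ 4) (at s)"
proof -
  define P where "P = 1 / (1 - s)"
  have d: "((%s. qq s ^ 9) has_real_derivative 9 * qq s ^ 8 * P\<^sup>2) (at s)"
    "((%s. qq s ^ 8) has_real_derivative 8 * qq s ^ 7 * P\<^sup>2) (at s)"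
    "((%s. qq s ^ 7) has_real_derivative 7 * qq s ^ 6 * P\<^sup>2) (at s)"
    using qq_power_deriv[OF assms, of 7] qq_power_deriv[OF assms, of 6] qq_power_deriv[OF assms, of 5]
    by (simp_all add: P_def numeral_eq_Suc)
  have "(gg has_real_derivative 16 * (9 * qq s ^ 8 * P\<^sup>2 / 9 + 8 * qq s ^ 7 * P\<^sup>2 / 2 + 4 * (7 * qq s ^ 6 * P\<^sup>2) / 7)) (at s)"
    unfolding gg_def[abs_def] by (intro DERIV_cmult DERIV_add DERIV_cdivide d)
  moreover have "16 * (9 * qq s ^ 8 * P\<^sup>2 / 9 + 8 * qq s ^ 7 * P\<^sup>2 / 2 + 4 * (7 * qq s ^ 6 * P\<^sup>2) / 7)
      = 16 * (qq s ^ 6 * (qq s + 2)\<^sup>2) * P\<^sup>2"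
    by (simp add: field_simps power2_eq_square eval_nat_numeral)
  moreover have "qq s ^ 6 * (qq s + 2)\<^sup>2 = qq s ^ 6 * P\<^sup>2"
  proof (cases "qq s = 0")
    case False
    then have "qq s + 2 = P" by (auto simp: qq_def P_def)
    then show ?thesis by simp
  qed simp
  moreover have "P\<^sup>2 * P\<^sup>2 = P ^ 4" by (simp add: power_add[symmetric])
  ultimately show ?thesis by (simp add: P_def mult.assoc)
qed

text \<open>Here \<open>p\<close> stands for grad u and \<open>\<xi>\<close> for grad phi / phi. A
  square removes \<open>\<xi>\<close>; of the factor \<open>10/9\<close> the part 1 cancels the
  resulting term in \<open>p\<close>, and the surplus \<open>1/9\<close> absorbs the drift.\<close>

lemma energy_pointwise:
  fixes p \<xi> c :: "'a::real_inner"
  assumes Q: "0 <= Q" and P: "P = Q + 2" and c: "norm c <= \<Gamma>"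
    and g: "g = 16 * (Q ^ 9 / 9 + Q ^ 8 / 2 + 4 * Q ^ 7 / 7)"
  shows "8 * Q ^ 7 * P\<^sup>2 * (p \<bullet> \<xi>) + Q ^ 8 * (c \<bullet> \<xi> - 2 * lam * P ^ 3 - \<xi> \<bullet> \<xi>)
      - 10/9 * (16 * Q ^ 6 * P ^ 4 * (p \<bullet> p) + g * (c \<bullet> p - lam * P\<^sup>2))
    <= 5/2 * \<Gamma>\<^sup>2 * Q ^ 8 + lam * (10/9 * g * P\<^sup>2 - 2 * Q ^ 8 * P ^ 3)"
proof -
  \<comment> \<open>Chosen so that \<open>Q ^ 6 * (v \<bullet> v)\<close> contains all terms with
    \<open>\<xi>\<close>, including its product with the drift.\<close>
  define v where "v = Q *\<^sub>R \<xi> - (4 * P\<^sup>2) *\<^sub>R p - (Q / 2) *\<^sub>R c"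
  have "v \<bullet> v = Q\<^sup>2 * (\<xi> \<bullet> \<xi>) - 8 * (Q * P\<^sup>2) * (p \<bullet> \<xi>) - Q\<^sup>2 * (c \<bullet> \<xi>) + 16 * P ^ 4 * (p \<bullet> p)
      + 4 * (Q * P\<^sup>2) * (c \<bullet> p) + Q\<^sup>2 / 4 * (c \<bullet> c)"
    by (simp add: v_def inner_diff_left inner_diff_right inner_commute[of \<xi> p] inner_commute[of \<xi> c] inner_commute[of p c]
        algebra_simps power2_eq_square eval_nat_numeral)
  moreover have "0 <= Q ^ 6 * (v \<bullet> v)" using Q by simp
  ultimately have sq: "0 <= Q ^ 6 * (Q\<^sup>2 * (\<xi> \<bullet> \<xi>) - 8 * (Q * P\<^sup>2) * (p \<bullet> \<xi>) - Q\<^sup>2 * (c \<bullet> \<xi>) + 16 * P ^ 4 * (p \<bullet> p)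
      + 4 * (Q * P\<^sup>2) * (c \<bullet> p) + Q\<^sup>2 / 4 * (c \<bullet> c))" by simp
  \<comment> \<open>\<open>Q ^ 7 * t\<close> is the coefficient that remains in front of
    \<open>c \<bullet> p\<close>.\<close>
  define t where "t = 4 * P\<^sup>2 - 10/9 * 16 * (Q\<^sup>2 / 9 + Q / 2 + 4 / 7)"
  have ht: "4 * (Q ^ 7 * P\<^sup>2) - 10/9 * g = Q ^ 7 * t"
    by (simp add: t_def g field_simps eval_nat_numeral)
  have P2: "P\<^sup>2 = Q\<^sup>2 + 4 * Q + 4" by (simp add: P power2_eq_square algebra_simps)
  have "\<bar>t\<bar> <= 4 * P\<^sup>2"
  proof -
    have q: "0 <= Q\<^sup>2" by simp
    have "t = 164/81 * Q\<^sup>2 + 64/9 * Q + 368/63" by (simp add: t_def P2 field_simps)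
    then show ?thesis using q Q unfolding P2 distrib_left by linarith
  qed
  then have "\<bar>t\<bar> * \<bar>c \<bullet> p\<bar> <= 4 * P\<^sup>2 * (norm c * norm p)"
    by (intro mult_mono Cauchy_Schwarz_ineq2) auto
  then have tc: "t * (c \<bullet> p) <= 4 * P\<^sup>2 * (norm c * norm p)"
    using abs_ge_self[of "t * (c \<bullet> p)"] by (simp add: abs_mult)
  \<comment> \<open>The weights 4/3 and 3/2 spend exactly the surplus \<open>16/9\<close>; with the
    quarter from the first square the drift costs \<open>9/4 + 1/4 = 5/2\<close>.\<close>
  have "0 <= (4/3 * (P\<^sup>2 * norm p) - 3/2 * (Q * norm c))\<^sup>2" by simp
  then have "4 * P\<^sup>2 * (norm c * norm p) * Q <= 16/9 * P ^ 4 * (norm p)\<^sup>2 + 9/4 * Q\<^sup>2 * (norm c)\<^sup>2"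
    by (simp add: power2_eq_square algebra_simps eval_nat_numeral)
  then have "t * (c \<bullet> p) * Q <= 16/9 * P ^ 4 * (p \<bullet> p) + 9/4 * Q\<^sup>2 * (c \<bullet> c)"
    using mult_right_mono[OF tc Q] by (simp add: power2_norm_eq_inner)
  then have "Q ^ 6 * (t * (c \<bullet> p) * Q) <= Q ^ 6 * (16/9 * P ^ 4 * (p \<bullet> p) + 9/4 * Q\<^sup>2 * (c \<bullet> c))"
    using Q by (intro mult_left_mono) auto
  then have A: "Q ^ 7 * t * (c \<bullet> p) <= 16/9 * (Q ^ 6 * P ^ 4 * (p \<bullet> p)) + 9/4 * (Q ^ 8 * (c \<bullet> c))"
    by (simp add: algebra_simps power2_eq_square eval_nat_numeral)
  have "c \<bullet> c <= \<Gamma>\<^sup>2" using power_mono[OF c norm_ge_zero, of 2] by (simp add: power2_norm_eq_inner)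
  then have G: "Q ^ 8 * (c \<bullet> c) <= Q ^ 8 * \<Gamma>\<^sup>2" by (intro mult_left_mono) auto
  have B: "8 * Q ^ 7 * P\<^sup>2 * (p \<bullet> \<xi>) + Q ^ 8 * (c \<bullet> \<xi>) - Q ^ 8 * (\<xi> \<bullet> \<xi>)
      <= 16 * (Q ^ 6 * P ^ 4 * (p \<bullet> p)) + 4 * (Q ^ 7 * P\<^sup>2) * (c \<bullet> p) + Q ^ 8 * (c \<bullet> c) / 4"
    using sq by (simp add: algebra_simps power2_eq_square eval_nat_numeral)
  have "Q ^ 7 * t * (c \<bullet> p) = 4 * (Q ^ 7 * P\<^sup>2) * (c \<bullet> p) - 10/9 * g * (c \<bullet> p)"
    unfolding ht[symmetric] by (simp add: algebra_simps)
  then show ?thesis using A B G by (simp add: algebra_simps)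
qed

text \<open>Either \<open>Q\<close> is so large that one surplus power pays for \<open>A\<close>, or
  all powers involved are bounded.\<close>

lemma absorb_power:
  fixes Q A \<kappa> :: real
  assumes "0 <= Q" "0 <= A" "0 < \<kappa>" "j <= 10"
  shows "A * Q ^ j <= \<kappa> * Q ^ 11 + A * (max 1 (A / \<kappa>)) ^ 10"
proof -
  define M where "M = max 1 (A / \<kappa>)"
  have M: "1 <= M" "A <= \<kappa> * M" using assms(3) by (auto simp: M_def max_def divide_le_eq mult.commute)
  show ?thesis
  proof (cases "M <= Q")
    case True
    then have "A <= \<kappa> * Q" using M assms(3) mult_left_mono[OF True, of \<kappa>] by linarith
    have "Q ^ j <= Q ^ 10" using True M assms(4) by (intro power_increasing) auto
    then have "A * Q ^ j <= \<kappa> * Q * Q ^ 10" using \<open>A <= \<kappa> * Q\<close> assms by (intro mult_mono) auto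
    moreover have "0 <= A * M ^ 10" using assms M by simp
    ultimately show ?thesis by (simp add: M_def eval_nat_numeral mult.assoc)
  next
    case False
    then have "Q ^ j <= M ^ j" using assms by (intro power_mono) auto
    also have "... <= M ^ 10" using M assms(4) by (intro power_increasing) auto
    finally have "A * Q ^ j <= A * M ^ 10" using assms by (intro mult_left_mono)
    moreover have "0 <= \<kappa> * Q ^ 11" using assms by simp
    ultimately show ?thesis by (simp add: M_def)
  qed
qed

text \<open>At top order the factor of \<open>lam\<close> is
  \<open>10/9 * 16/9 - 2 = - 2/81\<close>. Half of this absorbs the lower powers, uniformly for
  \<open>lam\<close> between \<open>l0\<close> and \<open>L\<close>.\<close>

lemma energy_polynomial:
  assumes l: "0 < l0"
  shows "\<exists>K\<ge>0. \<forall>Q lam g P. 0 <= Q --> l0 <= lam --> lam <= L --> P = Q + 2 -->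
    g = 16 * (Q ^ 9 / 9 + Q ^ 8 / 2 + 4 * Q ^ 7 / 7) -->
    5/2 * \<Gamma>\<^sup>2 * Q ^ 8 + lam * (10/9 * g * P\<^sup>2 - 2 * Q ^ 8 * P ^ 3) <= K - l0 / 81 * (Q::real) ^ 11"
proof -
  define A where "A = 61 * max 0 L + 5/2 * \<Gamma>\<^sup>2"
  have A: "0 <= A" by (simp add: A_def)
  \<comment> \<open>Four lower powers at \<open>l0 / 324\<close> each use up
    \<open>l0 / 81\<close>.\<close>
  define \<kappa> where "\<kappa> = l0 / 324"
  have \<kappa>: "0 < \<kappa>" using l by (simp add: \<kappa>_def)
  define N where "N = A * (max 1 (A / \<kappa>)) ^ 10"
  have N: "0 <= N" using A by (simp add: N_def)
  have "5/2 * \<Gamma>\<^sup>2 * Q ^ 8 + lam * (10/9 * g * P\<^sup>2 - 2 * Q ^ 8 * P ^ 3) <= 4 * N - l0 / 81 * Q ^ 11"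
    if Q: "0 <= Q" and lam: "l0 <= lam" "lam <= L" and P: "P = Q + 2"
      and g: "g = 16 * (Q ^ 9 / 9 + Q ^ 8 / 2 + 4 * Q ^ 7 / 7)" for Q lam g P :: real
  proof -
    have e: "10/9 * g * P\<^sup>2 - 2 * Q ^ 8 * P ^ 3
        = - (2/81) * Q ^ 11 + 388/81 * Q ^ 10 + 16792/567 * Q ^ 9 + 1264/21 * Q ^ 8 + 2560/63 * Q ^ 7"
      unfolding P g by (simp add: field_simps power2_eq_square eval_nat_numeral)
    have nn: "0 <= Q ^ 7" "0 <= Q ^ 8" "0 <= Q ^ 9" "0 <= Q ^ 10" "0 <= Q ^ 11" using Q by auto
    \<comment> \<open>61 exceeds every coefficient of the four lower powers.\<close>
    then have "10/9 * g * P\<^sup>2 - 2 * Q ^ 8 * P ^ 3 <= - (2/81) * Q ^ 11 + 61 * (Q ^ 10 + Q ^ 9 + Q ^ 8 + Q ^ 7)"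
      unfolding e distrib_left by linarith
    then have "lam * (10/9 * g * P\<^sup>2 - 2 * Q ^ 8 * P ^ 3) <= lam * (- (2/81) * Q ^ 11 + 61 * (Q ^ 10 + Q ^ 9 + Q ^ 8 + Q ^ 7))"
      using l lam by (intro mult_left_mono) auto
    also have "... = - (2/81) * (lam * Q ^ 11) + 61 * (lam * (Q ^ 10 + Q ^ 9 + Q ^ 8 + Q ^ 7))" by (simp add: algebra_simps)
    also have "... <= - (2/81) * (l0 * Q ^ 11) + 61 * (max 0 L * (Q ^ 10 + Q ^ 9 + Q ^ 8 + Q ^ 7))"
      using mult_right_mono[OF lam(1) nn(5)] mult_right_mono[of lam "max 0 L" "Q ^ 10 + Q ^ 9 + Q ^ 8 + Q ^ 7"] lam(2) nn
      by linarith
    finally have 1: "lam * (10/9 * g * P\<^sup>2 - 2 * Q ^ 8 * P ^ 3)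
        <= - (2/81) * (l0 * Q ^ 11) + 61 * (max 0 L * (Q ^ 10 + Q ^ 9 + Q ^ 8 + Q ^ 7))" .
    have "5/2 * \<Gamma>\<^sup>2 * Q ^ 8 <= 5/2 * \<Gamma>\<^sup>2 * (Q ^ 10 + Q ^ 9 + Q ^ 8 + Q ^ 7)"
      using nn by (intro mult_left_mono) auto
    with 1 have "5/2 * \<Gamma>\<^sup>2 * Q ^ 8 + lam * (10/9 * g * P\<^sup>2 - 2 * Q ^ 8 * P ^ 3)
        <= - (2/81) * (l0 * Q ^ 11) + A * (Q ^ 10 + Q ^ 9 + Q ^ 8 + Q ^ 7)"
      by (simp add: A_def algebra_simps)
    moreover have "A * Q ^ j <= \<kappa> * Q ^ 11 + N" if "j <= 10" for j
      unfolding N_def by (rule absorb_power[OF Q A \<kappa> that])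
    from this[of 10] this[of 9] this[of 8] this[of 7]
    have "A * (Q ^ 10 + Q ^ 9 + Q ^ 8 + Q ^ 7) <= 4 * \<kappa> * Q ^ 11 + 4 * N"
      by (simp add: distrib_left)
    moreover have "4 * \<kappa> * Q ^ 11 = l0 / 81 * Q ^ 11" by (simp add: \<kappa>_def)
    moreover have "(2/81) * (l0 * Q ^ 11) = 2 * (l0 / 81 * Q ^ 11)" by simp
    ultimately show ?thesis by linarith
  qed
  then show ?thesis using N by (intro exI[of _ "4 * N"]) auto
qed

section \<open>Differences of two solutions, and the integrated estimate\<close>

lemma superlevel_compact:
  assumes "bounded \<Omega>" and u: "smooth_solution \<Omega> c lam u"
  shows "compact {x \<in> closure \<Omega>. 1/2 <= u x}" "{x \<in> closure \<Omega>. 1/2 <= u x} \<subseteq> \<Omega>"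
proof -
  have cont: "continuous_on (closure \<Omega>) u" and f: "\<forall>x\<in>frontier \<Omega>. u x = 0"
    using u by (auto simp: smooth_solution_def smooth_on_closure_def)
  have "closed {x \<in> closure \<Omega>. 1/2 <= u x}"
    using continuous_closed_preimage[OF cont closed_closure closed_atLeast[of "1/2"]]
    by (simp add: vimage_def Int_def)
  moreover have "bounded {x \<in> closure \<Omega>. 1/2 <= u x}"
    by (rule bounded_subset[OF bounded_closure[OF assms(1)]]) blast
  ultimately show "compact {x \<in> closure \<Omega>. 1/2 <= u x}" by (simp add: compact_eq_bounded_closed)
  have "closure \<Omega> = \<Omega> \<union> frontier \<Omega>" using closure_Un_frontier by blast
  then show "{x \<in> closure \<Omega>. 1/2 <= u x} \<subseteq> \<Omega>" using f by force
qed

text \<open>The tangent inequality of the convex function \<open>1 / (1 - s)\<^sup>2\<close>, with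
  \<open>a\<close> and \<open>b\<close> as the values of \<open>1 - s\<close>.\<close>

lemma inverse_square_convex:
  fixes a b :: real
  assumes "0 < b" "b <= a"
  shows "2 * (1 / a) ^ 3 * (a - b) <= (1 / b)\<^sup>2 - (1 / a)\<^sup>2"
proof -
  have "2 * b\<^sup>2 <= a * (a + b)"
  proof -
    have "b * b <= a * a" "b * b <= a * b" using assms by (auto intro: mult_mono)
    then show ?thesis unfolding power2_eq_square distrib_left by linarith
  qed
  then have "2 * b\<^sup>2 * (a - b) <= a * (a + b) * (a - b)" using assms by (intro mult_right_mono) auto
  also have "... = (a\<^sup>2 - b\<^sup>2) * a" by (simp add: power2_eq_square algebra_simps)
  finally have "2 * b\<^sup>2 * (a - b) / (a ^ 3 * b\<^sup>2) <= (a\<^sup>2 - b\<^sup>2) * a / (a ^ 3 * b\<^sup>2)"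
    using assms by (intro divide_right_mono) auto
  moreover have "2 * b\<^sup>2 * (a - b) / (a ^ 3 * b\<^sup>2) = 2 * (1 / a) ^ 3 * (a - b)"
    using assms by (simp add: power_divide)
  moreover have "(a\<^sup>2 - b\<^sup>2) * a / (a ^ 3 * b\<^sup>2) = (1 / b)\<^sup>2 - (1 / a)\<^sup>2"
    using assms by (simp add: power_divide divide_simps eval_nat_numeral)
  ultimately show ?thesis by simp
qed

lemma laplacian_diff:
  assumes "open S" "smooth_on S f" "smooth_on S g" "x \<in> S"
  shows "laplacian (%x. f x - g x) x = laplacian f x - laplacian g x"
    "gradient (%x. f x - g x) x = gradient f x - gradient g x"
proof -
  have "pd i (pd i (%x. f x - g x)) x = pd i (pd i f) x - pd i (pd i g) x" for i
    using Dd_diff[OF assms, of "[i, i]"] by simp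
  then show "laplacian (%x. f x - g x) x = laplacian f x - laplacian g x"
    by (simp add: laplacian_def sum_subtractf)
  have "pd i (%x. f x - g x) x = pd i f x - pd i g x" for i
    using Dd_diff[OF assms, of "[i]"] by simp
  then show "gradient (%x. f x - g x) x = gradient f x - gradient g x"
    by (simp add: gradient_def vec_eq_iff)
qed

text \<open>Convexity makes the difference a supersolution of the problem linearised at the smaller
  solution. The summand \<open>lam' - lam\<close> is kept for the proof of strict
  monotonicity.\<close>

lemma solution_difference_ineq:
  assumes \<Omega>: "open \<Omega>" and u: "smooth_solution \<Omega> c lam u" and u': "smooth_solution \<Omega> c lam' u'"
    and lam: "0 <= lam" "lam <= lam'" and x: "x \<in> \<Omega>" "u x <= u' x"
  shows "(lam' - lam) + 2 * lam * (1 / (1 - u x)) ^ 3 * (u' x - u x)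
    <= - laplacian (%x. u' x - u x) x + c x \<bullet> gradient (%x. u' x - u x) x"
proof -
  have xc: "x \<in> closure \<Omega>" using x closure_subset by blast
  have b: "0 < 1 - u' x" "1 - u' x <= 1 - u x" "1 - u' x <= 1" using u' x(2) xc by (auto simp: smooth_solution_def)
  have "1 <= 1 / (1 - u' x)" using b by simp
  then have "1 <= (1 / (1 - u' x))\<^sup>2" by simp
  then have "(lam' - lam) * 1 <= (lam' - lam) * (1 / (1 - u' x))\<^sup>2" using lam by (intro mult_left_mono) auto
  moreover have "lam * (2 * (1 / (1 - u x)) ^ 3 * (u' x - u x)) <= lam * ((1 / (1 - u' x))\<^sup>2 - (1 / (1 - u x))\<^sup>2)"
    using inverse_square_convex[OF b(1,2)] lam by (intro mult_left_mono) auto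
  moreover have "- laplacian (%x. u' x - u x) x + c x \<bullet> gradient (%x. u' x - u x) x
      = lam' * (1 / (1 - u' x))\<^sup>2 - lam * (1 / (1 - u x))\<^sup>2"
  proof -
    have "- laplacian u x + c x \<bullet> gradient u x = lam * (1 / (1 - u x))\<^sup>2"
      "- laplacian u' x + c x \<bullet> gradient u' x = lam' * (1 / (1 - u' x))\<^sup>2"
      using u u' x(1) by (auto simp: smooth_solution_def power_divide)
    moreover have "smooth_on \<Omega> u" "smooth_on \<Omega> u'" using u u' by (auto simp: smooth_solution_def smooth_on_closure_def)
    ultimately show ?thesis using laplacian_diff[OF \<Omega> _ _ x(1), of u' u] by (simp add: inner_diff_right)
  qed
  ultimately show ?thesis by (simp add: algebra_simps)
qed

text \<open>The difference to a solution with larger parameter plays the role of a positive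
  eigenfunction of the linearisation. The bound depends neither on \<open>lam'\<close> nor on
  \<open>u'\<close>, so any larger parameter will do.\<close>

theorem energy_bound:
  fixes c :: "real^'n => real^'n"
  assumes \<Omega>: "open \<Omega>" "bounded \<Omega>" and c: "!!x. x \<in> \<Omega> ==> norm (c x) <= \<Gamma>" and l0: "0 < l0"
  shows "\<exists>C. \<forall>lam lam' u u'. l0 <= lam --> lam < lam' --> lam <= L --> smooth_solution \<Omega> c lam u -->
    smooth_solution \<Omega> c lam' u' --> (\<forall>x\<in>\<Omega>. u x < u' x) -->
    (\<integral>x. ext0 \<Omega> (%x. qq (u x) ^ 11) x \<partial>lborel) <= C"
proof -
  obtain K where K0: "0 <= K" and K: "!!Q lam g P. 0 <= Q ==> l0 <= lam ==> lam <= L ==> P = Q + 2 ==>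
    g = 16 * (Q ^ 9 / 9 + Q ^ 8 / 2 + 4 * Q ^ 7 / 7) ==>
    5/2 * \<Gamma>\<^sup>2 * Q ^ 8 + lam * (10/9 * g * P\<^sup>2 - 2 * Q ^ 8 * P ^ 3) <= K - l0 / 81 * (Q::real) ^ 11"
    using energy_polynomial[OF l0, of L \<Gamma>] by metis
  have "(\<integral>x. ext0 \<Omega> (%x. qq (u x) ^ 11) x \<partial>lborel) <= 81 / l0 * (K * measure lborel \<Omega>)"
    if lam: "l0 <= lam" "lam < lam'" "lam <= L" and u: "smooth_solution \<Omega> c lam u"
      and u': "smooth_solution \<Omega> c lam' u'" and less: "\<forall>x\<in>\<Omega>. u x < u' x" for lam lam' u u'
  proof -
    define S where "S = {x \<in> closure \<Omega>. 1/2 <= u x}"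
    have S: "compact S" "S \<subseteq> \<Omega>" unfolding S_def by (rule superlevel_compact[OF \<Omega>(2) u])+
    have q0: "qq (u x) = 0" if "x \<in> \<Omega>" "x \<notin> S" for x
      using that closure_subset by (intro qq_zero) (auto simp: S_def)
    have su: "smooth_on \<Omega> u" "smooth_on \<Omega> u'" using u u' by (auto simp: smooth_solution_def smooth_on_closure_def)
    have u1: "u x < 1" if "x \<in> \<Omega>" for x using u that closure_subset by (auto simp: smooth_solution_def)
    define \<phi> where "\<phi> x = u' x - u x" for x
    have \<phi>: "smooth_on \<Omega> \<phi>" unfolding \<phi>_def[abs_def] by (rule smooth_on_diff[OF \<Omega>(1) su(2,1)])
    have \<phi>0: "0 < \<phi> x" if "x \<in> \<Omega>" for x using less that by (simp add: \<phi>_def)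
    define r where "r x = 1 / \<phi> x" for x
    have r: "smooth_on \<Omega> r" unfolding r_def[abs_def] using \<phi>0 by (intro smooth_on_inverse[OF \<Omega>(1) \<phi>]) fastforce
    define Q where "Q x = qq (u x)" for x
    define P where "P x = 1 / (1 - u x)" for x
    define G where "G x = gg (u x)" for x
    have Q0: "0 <= Q x" for x by (simp add: Q_def qq_def)
    have dif: "f differentiable (at x)" if "smooth_on \<Omega> f" "x \<in> \<Omega>" for f :: "real^'n => real" and x
      by (rule smooth_on_differentiable[OF that])
    have pdr: "pd i r x = - (pd i \<phi> x * (r x)\<^sup>2)" if x: "x \<in> \<Omega>" for i x
    proof -
      have "((%t. 1 / t) has_real_derivative - (r x)\<^sup>2) (at (\<phi> x))"
        using \<phi>0[OF x] by (auto intro!: derivative_eq_intros simp: r_def power2_eq_square)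
      from pd_compose_real(1)[OF dif[OF \<phi> x] this, of i] show ?thesis by (simp add: r_def[abs_def])
    qed
    have pdQ: "pd i (%x. Q x ^ 8) x = 8 * Q x ^ 7 * (P x)\<^sup>2 * pd i u x" "(%x. Q x ^ 8) differentiable (at x)"
      if x: "x \<in> \<Omega>" for i x
    proof -
      have d: "((%s. qq s ^ 8) has_real_derivative 8 * Q x ^ 7 * (P x)\<^sup>2) (at (u x))"
        using qq_power_deriv[OF u1[OF x], of 6] by (simp add: Q_def P_def numeral_eq_Suc)
      show "pd i (%x. Q x ^ 8) x = 8 * Q x ^ 7 * (P x)\<^sup>2 * pd i u x" "(%x. Q x ^ 8) differentiable (at x)"
        unfolding Q_def by (rule pd_compose_real[OF dif[OF su(1) x] d[unfolded Q_def]])+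
    qed
    have pdG: "pd i G x = 16 * Q x ^ 6 * (P x) ^ 4 * pd i u x" "G differentiable (at x)" if x: "x \<in> \<Omega>" for i x
    proof -
      have d: "(gg has_real_derivative 16 * Q x ^ 6 * (P x) ^ 4) (at (u x))"
        unfolding Q_def P_def by (rule gg_deriv[OF u1[OF x]])
      show "pd i G x = 16 * Q x ^ 6 * (P x) ^ 4 * pd i u x" "G differentiable (at x)"
        unfolding G_def[abs_def] by (rule pd_compose_real[OF dif[OF su(1) x] d])+
    qed
    \<comment> \<open>\<open>X\<close> is the field that carries semi-stability; \<open>Y\<close> is
      the one subtracted to remove the square of the gradient of \<open>u\<close>.\<close>
    define X where "X i x = Q x ^ 8 * (pd i \<phi> x * r x)" for i x
    define Y where "Y i x = G x * pd i u x" for i x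
    define Z where "Z i x = X i x - 10/9 * Y i x" for i x
    \<comment> \<open>The derivative of \<open>Z i\<close> written out, so that its continuity can
      be read off.\<close>
    define D where "D i x = (8 * Q x ^ 7 * (P x)\<^sup>2 * pd i u x * (pd i \<phi> x * r x)
        + Q x ^ 8 * (pd i (pd i \<phi>) x * r x + pd i \<phi> x * - (pd i \<phi> x * (r x)\<^sup>2)))
        - 10/9 * (16 * Q x ^ 6 * (P x) ^ 4 * pd i u x * pd i u x + G x * pd i (pd i u) x)" for i x
    have pdZ: "pd i (Z i) x = D i x" "Z i differentiable (at x)" if x: "x \<in> \<Omega>" for i x
    proof -
      have s: "smooth_on \<Omega> (%x. pd i \<phi> x * r x)" by (rule smooth_on_mult[OF \<Omega>(1) smooth_on_pd[OF \<phi>] r])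
      have dX: "X i differentiable (at x)" unfolding X_def[abs_def]
        by (rule differentiable_mult[OF pdQ(2)[OF x] dif[OF s x]])
      have dY: "Y i differentiable (at x)" unfolding Y_def[abs_def]
        by (rule differentiable_mult[OF pdG(2)[OF x] dif[OF smooth_on_pd[OF su(1)] x]])
      have dcY: "(%x. 10/9 * Y i x) differentiable (at x)" using dY by (intro differentiable_mult) auto
      show "Z i differentiable (at x)" unfolding Z_def[abs_def] by (rule differentiable_diff[OF dX dcY])
      have "pd i (Z i) x = pd i (X i) x - 10/9 * pd i (Y i) x"
        unfolding Z_def[abs_def] pd_diff[OF dX dcY] pd_cmult[OF dY] ..
      also have "pd i (X i) x = 8 * Q x ^ 7 * (P x)\<^sup>2 * pd i u x * (pd i \<phi> x * r x)
          + Q x ^ 8 * (pd i (pd i \<phi>) x * r x + pd i \<phi> x * - (pd i \<phi> x * (r x)\<^sup>2))"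
        unfolding X_def[abs_def] pd_mult[OF pdQ(2)[OF x] dif[OF s x]] pdQ(1)[OF x]
          pd_mult[OF dif[OF smooth_on_pd[OF \<phi>] x] dif[OF r x]] pdr[OF x] ..
      also have "pd i (Y i) x = 16 * Q x ^ 6 * (P x) ^ 4 * pd i u x * pd i u x + G x * pd i (pd i u) x"
        unfolding Y_def[abs_def] pd_mult[OF pdG(2)[OF x] dif[OF smooth_on_pd[OF su(1)] x]] pdG(1)[OF x] ..
      finally show "pd i (Z i) x = D i x" by (simp add: D_def)
    qed
    have Z0: "Z i x = 0" if "x \<in> \<Omega>" "x \<notin> S" for i x
      using q0[OF that] by (simp add: Z_def X_def Y_def G_def gg_def Q_def)
    have cu: "continuous_on \<Omega> u" by (rule smooth_on_continuous_on[OF su(1)])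
    have cP: "continuous_on \<Omega> P" unfolding P_def[abs_def]
      using u1 by (intro continuous_intros cu) fastforce
    have cQ: "continuous_on \<Omega> Q" unfolding Q_def[abs_def] qq_def
      using u1 by (intro continuous_intros cu) fastforce
    have cG: "continuous_on \<Omega> G" unfolding G_def[abs_def] gg_def using cQ unfolding Q_def[abs_def]
      by (intro continuous_intros) auto
    have cD: "continuous_on \<Omega> (D i)" for i unfolding D_def[abs_def]
      by (intro continuous_intros cP cQ cG smooth_on_continuous_on[OF \<phi>] smooth_on_continuous_on[OF r]
          smooth_on_continuous_on[OF smooth_on_pd[OF \<phi>]] smooth_on_continuous_on[OF smooth_on_pd[OF su(1)]]
          smooth_on_continuous_on[OF smooth_on_pd[OF smooth_on_pd[OF \<phi>]]] smooth_on_continuous_on[OF smooth_on_pd[OF smooth_on_pd[OF su(1)]]])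
    have D0: "D i x = 0" if "x \<in> \<Omega>" "x \<notin> S" for i x
      using ext0_pd(3)[OF \<Omega>(1) S Z0 pdZ(2) that] pdZ(1)[OF that(1)] by simp
    have eD: "pd i (ext0 \<Omega> (Z i)) = ext0 \<Omega> (D i)" for i
    proof
      fix x
      have "pd i (ext0 \<Omega> (Z i)) x = ext0 \<Omega> (pd i (Z i)) x"
        by (rule ext0_pd(2)[OF \<Omega>(1) S]) (rule Z0 pdZ(2), assumption+)+
      then show "pd i (ext0 \<Omega> (Z i)) x = ext0 \<Omega> (D i) x" by (simp add: ext0_def pdZ(1))
    qed
    have int0: "integrable lborel (ext0 \<Omega> (D i))" "(\<integral>x. ext0 \<Omega> (D i) x \<partial>lborel) = 0" for i
    proof -
      have "continuous_on UNIV (pd i (ext0 \<Omega> (Z i)))"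
        unfolding eD by (rule ext0_continuous[OF \<Omega>(1) S cD D0])
      moreover have "ext0 \<Omega> (Z i) x = 0" if "x \<notin> S" for x using that Z0 by (simp add: ext0_def)
      ultimately show "integrable lborel (ext0 \<Omega> (D i))" "(\<integral>x. ext0 \<Omega> (D i) x \<partial>lborel) = 0"
        using integral_pd_zero[of "ext0 \<Omega> (Z i)" i S] ext0_pd(1)[OF \<Omega>(1) S Z0 pdZ(2)] S(1) unfolding eD by blast+
    qed
    have pw: "(\<Sum>i\<in>UNIV. D i x) <= K - l0 / 81 * Q x ^ 11" if x: "x \<in> \<Omega>" for x
    proof (cases "Q x = 0")
      case True
      \<comment> \<open>All terms of \<open>D\<close> carry a power of \<open>Q\<close>, so 0 is
        compared with the nonnegative \<open>K\<close>; the identity \<open>P = Q + 2\<close> holds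
        only in the other case.\<close>
      then show ?thesis using K0 by (simp add: D_def G_def gg_def Q_def)
    next
      case False
      then have PQ: "P x = Q x + 2" by (auto simp: Q_def P_def qq_def)
      define p where "p = gradient u x"
      define \<xi> where "\<xi> = r x *\<^sub>R gradient \<phi> x"
      have inn: "p \<bullet> \<xi> = (\<Sum>i\<in>UNIV. pd i u x * (pd i \<phi> x * r x))" "p \<bullet> p = (\<Sum>i\<in>UNIV. pd i u x * pd i u x)"
        "\<xi> \<bullet> \<xi> = (\<Sum>i\<in>UNIV. pd i \<phi> x * (pd i \<phi> x * (r x)\<^sup>2))"
        by (simp_all add: p_def \<xi>_def gradient_def inner_vec_def mult_ac power2_eq_square)
      have "(\<Sum>i\<in>UNIV. D i x) = 8 * Q x ^ 7 * (P x)\<^sup>2 * (p \<bullet> \<xi>) + Q x ^ 8 * (laplacian \<phi> x * r x - \<xi> \<bullet> \<xi>)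
          - 10/9 * (16 * Q x ^ 6 * P x ^ 4 * (p \<bullet> p) + G x * laplacian u x)"
      proof -
        have "D i x = 8 * Q x ^ 7 * (P x)\<^sup>2 * (pd i u x * (pd i \<phi> x * r x)) + Q x ^ 8 * r x * pd i (pd i \<phi>) x
            - Q x ^ 8 * (pd i \<phi> x * (pd i \<phi> x * (r x)\<^sup>2)) - 160/9 * Q x ^ 6 * P x ^ 4 * (pd i u x * pd i u x)
            - 10/9 * G x * pd i (pd i u) x" for i
          by (simp add: D_def algebra_simps)
        then have "(\<Sum>i\<in>UNIV. D i x) = 8 * Q x ^ 7 * (P x)\<^sup>2 * (p \<bullet> \<xi>) + Q x ^ 8 * r x * laplacian \<phi> x - Q x ^ 8 * (\<xi> \<bullet> \<xi>)
            - 160/9 * Q x ^ 6 * P x ^ 4 * (p \<bullet> p) - 10/9 * G x * laplacian u x"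
          unfolding inn laplacian_def by (simp only: sum.distrib sum_subtractf sum_distrib_left)
        then show ?thesis by (simp add: algebra_simps)
      qed
      also have "... <= 8 * Q x ^ 7 * (P x)\<^sup>2 * (p \<bullet> \<xi>) + Q x ^ 8 * (c x \<bullet> \<xi> - 2 * lam * P x ^ 3 - \<xi> \<bullet> \<xi>)
          - 10/9 * (16 * Q x ^ 6 * P x ^ 4 * (p \<bullet> p) + G x * (c x \<bullet> p - lam * (P x)\<^sup>2))"
      proof -
        have rx: "0 < r x" "\<phi> x * r x = 1" using \<phi>0[OF x] by (auto simp: r_def)
        have "2 * lam * P x ^ 3 * \<phi> x <= - laplacian \<phi> x + c x \<bullet> gradient \<phi> x"
          using solution_difference_ineq[OF \<Omega>(1) u u' _ _ x] lam l0 less x by (fastforce simp: P_def \<phi>_def[abs_def])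
        then have "2 * lam * P x ^ 3 * \<phi> x * r x <= (- laplacian \<phi> x + c x \<bullet> gradient \<phi> x) * r x"
          using rx by (intro mult_right_mono) auto
        moreover have "2 * lam * P x ^ 3 * \<phi> x * r x = 2 * lam * P x ^ 3" using rx(2) by (simp add: mult.assoc)
        moreover have "(- laplacian \<phi> x + c x \<bullet> gradient \<phi> x) * r x = c x \<bullet> \<xi> - laplacian \<phi> x * r x"
          by (simp add: \<xi>_def algebra_simps)
        ultimately have "laplacian \<phi> x * r x <= c x \<bullet> \<xi> - 2 * lam * P x ^ 3" by linarith
        then have "Q x ^ 8 * (laplacian \<phi> x * r x - \<xi> \<bullet> \<xi>) <= Q x ^ 8 * (c x \<bullet> \<xi> - 2 * lam * P x ^ 3 - \<xi> \<bullet> \<xi>)"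
          by (intro mult_left_mono) auto
        moreover have "laplacian u x = c x \<bullet> p - lam * (P x)\<^sup>2"
          using u x by (auto simp: smooth_solution_def p_def P_def power_divide)
        ultimately show ?thesis by simp
      qed
      also have "... <= 5/2 * \<Gamma>\<^sup>2 * Q x ^ 8 + lam * (10/9 * G x * (P x)\<^sup>2 - 2 * Q x ^ 8 * P x ^ 3)"
        by (rule energy_pointwise[OF Q0 PQ c[OF x]]) (simp add: G_def gg_def Q_def)
      also have "... <= K - l0 / 81 * Q x ^ 11"
        by (rule K[OF Q0 lam(1,3) PQ]) (simp add: G_def gg_def Q_def)
      finally show ?thesis .
    qed
    define F where "F = ext0 \<Omega> (%x. qq (u x) ^ 11)"
    have F: "integrable lborel F"
    proof -
      have "continuous_on UNIV F" unfolding F_def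
        by (rule ext0_continuous[OF \<Omega>(1) S]) (use cQ q0 in \<open>auto intro!: continuous_intros simp: Q_def[abs_def]\<close>)
      then show ?thesis
        by (rule integrable_compact_support[OF _ S(1)]) (use q0 in \<open>auto simp: F_def ext0_def\<close>)
    qed
    have fin: "emeasure lborel \<Omega> < \<infinity>" by (rule emeasure_bounded_finite[OF \<Omega>(2)])
    have m\<Omega>: "\<Omega> \<in> sets lborel" using \<Omega>(1) by simp
    have "0 = (\<integral>x. (\<Sum>i\<in>UNIV. ext0 \<Omega> (D i) x) \<partial>lborel)"
      using int0 by (simp add: Bochner_Integration.integral_sum)
    also have "... <= (\<integral>x. K * indicator \<Omega> x - l0 / 81 * F x \<partial>lborel)"
    proof (rule integral_mono)
      show "integrable lborel (%x. \<Sum>i\<in>UNIV. ext0 \<Omega> (D i) x)" using int0 by simp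
      show "integrable lborel (%x. K * indicator \<Omega> x - l0 / 81 * F x)"
        using F fin m\<Omega> by (intro Bochner_Integration.integrable_diff integrable_mult_right integrable_real_indicator) auto
      show "(\<Sum>i\<in>UNIV. ext0 \<Omega> (D i) x) <= K * indicator \<Omega> x - l0 / 81 * F x" for x
        using pw[of x] by (cases "x \<in> \<Omega>") (auto simp: ext0_def F_def Q_def)
    qed
    also have "... = K * measure lborel \<Omega> - l0 / 81 * (\<integral>x. F x \<partial>lborel)"
      using F fin m\<Omega> by (subst Bochner_Integration.integral_diff) (auto intro!: integrable_mult_right integrable_real_indicator)
    finally have "l0 / 81 * (\<integral>x. F x \<partial>lborel) <= K * measure lborel \<Omega>" by simp
    then have "81 / l0 * (l0 / 81 * (\<integral>x. F x \<partial>lborel)) <= 81 / l0 * (K * measure lborel \<Omega>)"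
      using l0 by (intro mult_left_mono) auto
    then show ?thesis using l0 by (simp add: F_def)
  qed
  then show ?thesis by blast
qed

section \<open>A lower bound for the energy near the maximum\<close>

text \<open>Differentiation under the integral is carried out over a box; this one contains the
  support of the weights.\<close>

abbreviation unit_cube :: "(real^'n) set" where "unit_cube \<equiv> cbox (\<chi> i. -1) (\<chi> i. 1)"

lemma norm_outside_cube: "y \<notin> unit_cube ==> 1 < norm y"
proof -
  assume "y \<notin> unit_cube"
  then obtain i where "\<not> (-1 <= y $ i & y $ i <= 1)" by (auto simp: mem_box_cart)
  then have "1 < \<bar>y $ i\<bar>" by linarith
  then show ?thesis using component_le_norm_cart[of y i] by linarith
qed

lemma integral_unit_cube:
  fixes g :: "real^'n => real"
  assumes g: "continuous_on UNIV g" "!!y. 1 < norm y ==> g y = 0"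
  shows "integrable lborel g" "integral unit_cube g = (\<integral>y. g y \<partial>lborel)"
proof -
  show i: "integrable lborel g"
    by (rule integrable_compact_support[OF g(1) compact_cball[of 0 1]]) (use g(2) in auto)
  have z: "indicator unit_cube y *\<^sub>R g y = g y" for y
    using norm_outside_cube[of y] g(2)[of y] by (cases "y \<in> (unit_cube :: (real^'n) set)") auto
  have "set_integrable lborel unit_cube g" unfolding set_integrable_def z by (rule i)
  from set_borel_integral_eq_integral(2)[OF this]
  show "integral unit_cube g = (\<integral>y. g y \<partial>lborel)" unfolding set_lebesgue_integral_def z by simp
qed

definition bump :: "nat => real^'n => real" where "bump m y = (max 0 (1 - y \<bullet> y)) ^ m"

lemma bump_continuous [continuous_intros]: "continuous_on S (bump m)"
  unfolding bump_def[abs_def] by (intro continuous_intros)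

lemma bump_bounds: "0 <= bump m y" "bump m y <= 1"
  unfolding bump_def by (auto intro!: power_le_one)

lemma bump_outside: "1 < norm y ==> bump (Suc m) y = 0"
proof -
  assume "1 < norm y"
  then have "1 < (norm y)\<^sup>2" by (simp add: power2_eq_square less_1_mult)
  then have "1 < y \<bullet> y" by (simp add: power2_norm_eq_inner)
  then show ?thesis by (simp add: bump_def)
qed

lemma bump_pd: "pd i (bump 3) y = - 6 * bump 2 y * y $ i" "bump 3 differentiable (at (y :: real^'n))"
proof -
  have d: "((%y::real^'n. 1 - y \<bullet> y) has_derivative (%v. - (y \<bullet> v + v \<bullet> y))) (at y)"
    by (auto intro!: derivative_eq_intros)
  have f: "(%y::real^'n. 1 - y \<bullet> y) differentiable (at y)" using d unfolding differentiable_def by blast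
  have p: "pd i (%y::real^'n. 1 - y \<bullet> y) y = - 2 * y $ i"
    using pd_eqI[OF d, of i] by (simp add: inner_axis inner_axis' inner_commute)
  have g: "((%t. (max 0 t) ^ 3) has_real_derivative 3 * (max 0 (1 - y \<bullet> y))\<^sup>2) (at (1 - y \<bullet> y))"
    using pos_part_power_deriv[of 1 "1 - y \<bullet> y"] by (simp add: numeral_eq_Suc)
  show "pd i (bump 3) y = - 6 * bump 2 y * y $ i"
    using pd_compose_real(1)[OF f g, of i] p unfolding bump_def[abs_def] by simp
  show "bump 3 differentiable (at y)"
    using pd_compose_real(2)[OF f g] unfolding bump_def[abs_def] by simp
qed

lemma affine_derivative:
  fixes f :: "real^'n => real"
  assumes f: "f differentiable (at (x + s *\<^sub>R y))"
  shows "pd i (%y. f (x + s *\<^sub>R y)) y = s * pd i f (x + s *\<^sub>R y)" "(%y. f (x + s *\<^sub>R y)) differentiable (at y)"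
    "((%s. f (x + s *\<^sub>R y)) has_real_derivative (\<Sum>i\<in>UNIV. y $ i * pd i f (x + s *\<^sub>R y))) (at s)"
proof -
  have "((%y. x + s *\<^sub>R y) has_derivative (%v. s *\<^sub>R v)) (at y)" by (auto intro!: derivative_eq_intros)
  from has_derivative_compose[OF this has_derivative_pd_real[OF f]]
  have d: "((%y. f (x + s *\<^sub>R y)) has_derivative (%v. \<Sum>j\<in>UNIV. (s *\<^sub>R v) $ j * pd j f (x + s *\<^sub>R y))) (at y)" .
  then show "(%y. f (x + s *\<^sub>R y)) differentiable (at y)" unfolding differentiable_def by blast
  have "(\<Sum>j\<in>UNIV. (s *\<^sub>R axis i 1) $ j * pd j f (x + s *\<^sub>R y)) = (\<Sum>j\<in>UNIV. if j = i then s * pd j f (x + s *\<^sub>R y) else 0)"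
    by (intro sum.cong) (auto simp: axis_def)
  then show "pd i (%y. f (x + s *\<^sub>R y)) y = s * pd i f (x + s *\<^sub>R y)" using pd_eqI[OF d, of i] by simp
  have "((%s. x + s *\<^sub>R y) has_derivative (%h. h *\<^sub>R y)) (at s)" by (auto intro!: derivative_eq_intros)
  from has_derivative_compose[OF this has_derivative_pd_real[OF f]]
  show "((%s. f (x + s *\<^sub>R y)) has_real_derivative (\<Sum>i\<in>UNIV. y $ i * pd i f (x + s *\<^sub>R y))) (at s)"
    unfolding has_field_derivative_def
    by (rule has_derivative_eq_rhs) (auto simp: fun_eq_iff sum_distrib_left mult_ac)
qed

text \<open>The derivative of the weighted mean \<open>M s\<close> of \<open>z\<close> over the ball of radius \<open>s\<close> is an integral of
  the Laplacian because \<open>y * bump 2 y\<close> is the gradient of \<open>- bump 3 y / 6\<close>.\<close>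

lemma mean_value_inequality:
  fixes z :: "real^'n => real"
  assumes z1: "!!x. z differentiable (at x)" and z2: "!!i x. pd i z differentiable (at x)"
    and cz: "!!i. continuous_on UNIV (pd i (pd i z))"
    and N: "!!x. - N <= laplacian z x" and r: "0 <= r"
  shows "(\<integral>y. (z x0 - z (x0 + r *\<^sub>R y)) * bump 2 y \<partial>lborel) <= r\<^sup>2 / 2 * N * (\<integral>y. bump 3 (y :: real^'n) / 6 \<partial>lborel)"
proof -
  have c0: "continuous_on UNIV z" "continuous_on UNIV (pd i z)" for i
    using z1 z2 by (simp_all add: continuous_at_imp_continuous_on differentiable_imp_continuous_within)
  have c1: "continuous_on S (%y. f (x0 + s *\<^sub>R y))" if "continuous_on UNIV f" for f :: "real^'n => real" and s S
    by (rule continuous_on_compose2[OF that]) (auto intro!: continuous_intros)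
  define \<kappa> where "\<kappa> = (\<integral>y. bump 3 (y::real^'n) / 6 \<partial>lborel)"
  define M where "M s = integral unit_cube (%y. z (x0 + s *\<^sub>R y) * bump 2 y)" for s
  define M' where "M' s = integral unit_cube (%y. (\<Sum>i\<in>UNIV. y $ i * pd i z (x0 + s *\<^sub>R y)) * bump 2 y)" for s
  have b0: "bump 2 y = 0" "bump 3 y = 0" if "1 < norm y" for y :: "real^'n"
    using bump_outside[OF that, of 1] bump_outside[OF that, of 2] by (simp_all add: numeral_eq_Suc)
  have der: "(M has_real_derivative M' s) (at s)" for s
  proof -
    have "((%s. integral unit_cube (%y. z (x0 + s *\<^sub>R y) * bump 2 y)) has_field_derivative
        integral unit_cube (%y. (\<Sum>i\<in>UNIV. y $ i * pd i z (x0 + s *\<^sub>R y)) * bump 2 y)) (at s within UNIV)"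
    proof (rule leibniz_rule_field_derivative)
      show "((%s. z (x0 + s *\<^sub>R y) * bump 2 y) has_field_derivative (\<Sum>i\<in>UNIV. y $ i * pd i z (x0 + s *\<^sub>R y)) * bump 2 y) (at s within UNIV)"
        for s y by (rule DERIV_cmult_right[OF affine_derivative(3)[OF z1]])
      show "(%y. z (x0 + s *\<^sub>R y) * bump 2 y) integrable_on unit_cube" for s
        by (intro integrable_continuous continuous_intros c1 c0)
      have "continuous_on (UNIV \<times> unit_cube) (%p. (\<Sum>i\<in>UNIV. snd p $ i * pd i z (x0 + fst p *\<^sub>R snd p)) * bump 2 (snd p))"
        by (intro continuous_intros continuous_on_compose2[OF c0(2)] continuous_on_compose2[OF bump_continuous[of UNIV]]) auto
      then show "continuous_on (UNIV \<times> unit_cube) (%(s, y). (\<Sum>i\<in>UNIV. y $ i * pd i z (x0 + s *\<^sub>R y)) * bump 2 y)"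
        by (simp add: split_beta')
    qed auto
    then show ?thesis by (simp add: M_def[abs_def] M'_def)
  qed
  have low: "- (s * N * \<kappa>) <= M' s" if s: "0 <= s" for s
  proof -
    \<comment> \<open>Its divergence is \<open>A - 6 * B\<close>, where \<open>A\<close> contains
      the Laplacian of \<open>z\<close> and \<open>B\<close> is the integrand of
      \<open>M'\<close>.\<close>
    define V where "V i y = pd i z (x0 + s *\<^sub>R y) * bump 3 y" for i y
    have pV: "pd i (V i) y = s * pd i (pd i z) (x0 + s *\<^sub>R y) * bump 3 y + pd i z (x0 + s *\<^sub>R y) * (- 6 * bump 2 y * y $ i)"
      "V i differentiable (at y)" for i y
    proof -
      note d = affine_derivative[OF z2[of i "x0 + s *\<^sub>R y"]]
      show "V i differentiable (at y)" unfolding V_def[abs_def] by (rule differentiable_mult[OF d(2) bump_pd(2)])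
      show "pd i (V i) y = s * pd i (pd i z) (x0 + s *\<^sub>R y) * bump 3 y + pd i z (x0 + s *\<^sub>R y) * (- 6 * bump 2 y * y $ i)"
        unfolding V_def[abs_def] pd_mult[OF d(2) bump_pd(2)] d(1) bump_pd(1) ..
    qed
    have cV: "continuous_on UNIV (pd i (V i))" for i unfolding pV(1)[abs_def]
      by (intro continuous_intros c1 c0 cz)
    have V0: "V i y = 0" if "y \<notin> cball 0 1" for i y using that b0[of y] by (simp add: V_def)
    have IV: "integrable lborel (pd i (V i))" "(\<integral>y. pd i (V i) y \<partial>lborel) = 0" for i
      using integral_pd_zero[OF pV(2) cV compact_cball[of 0 1] V0] by blast+
    define A where "A y = s * laplacian z (x0 + s *\<^sub>R y) * bump 3 y" for y
    define B where "B y = (\<Sum>i\<in>UNIV. y $ i * pd i z (x0 + s *\<^sub>R y)) * bump 2 y" for y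
    have AB: "(\<Sum>i\<in>UNIV. pd i (V i) y) = A y - 6 * B y" for y
      unfolding pV(1) A_def B_def laplacian_def
      by (simp add: sum.distrib sum_subtractf sum_distrib_left sum_distrib_right sum_negf mult_ac)
    have cA: "continuous_on UNIV A" unfolding A_def[abs_def] laplacian_def
      by (intro continuous_intros c1 cz)
    have cB: "continuous_on UNIV B" unfolding B_def[abs_def] by (intro continuous_intros c1 c0)
    have iA: "integrable lborel A" by (rule integral_unit_cube(1)[OF cA]) (simp add: A_def b0)
    have iB: "integrable lborel B" "integral unit_cube B = (\<integral>y. B y \<partial>lborel)"
      by (rule integral_unit_cube[OF cB], simp add: B_def b0)+
    have "0 = (\<integral>y. (\<Sum>i\<in>UNIV. pd i (V i) y) \<partial>lborel)"
      using IV by (simp add: Bochner_Integration.integral_sum)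
    also have "... = (\<integral>y. A y \<partial>lborel) - 6 * (\<integral>y. B y \<partial>lborel)"
      unfolding AB using iA iB by simp
    finally have "6 * M' s = (\<integral>y. A y \<partial>lborel)" unfolding M'_def using iB(2) by (simp add: B_def[abs_def])
    moreover have "(\<integral>y. - (s * N) * bump 3 (y :: real^'n) \<partial>lborel) <= (\<integral>y. A y \<partial>lborel)"
    proof (rule integral_mono[OF _ iA])
      show "integrable lborel (%y::real^'n. - (s * N) * bump 3 y)"
        by (rule integral_unit_cube(1)) (auto intro!: continuous_intros simp: b0)
      show "- (s * N) * bump 3 y <= A y" for y
        using mult_right_mono[OF mult_left_mono[OF N[of "x0 + s *\<^sub>R y"] s] bump_bounds(1)[of 3 y]] by (simp add: A_def)
    qed
    ultimately show ?thesis by (simp add: \<kappa>_def)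
  qed
  \<comment> \<open>The parabola compensates the lower bound of \<open>M'\<close>.\<close>
  define g where "g s = M s + s\<^sup>2 / 2 * N * \<kappa>" for s
  have "g 0 <= g r"
  proof (rule DERIV_nonneg_imp_nondecreasing[OF r])
    fix s :: real assume "0 <= s"
    have "(g has_real_derivative (M' s + s * N * \<kappa>)) (at s)" unfolding g_def[abs_def]
      by (auto intro!: derivative_eq_intros der)
    moreover have "0 <= M' s + s * N * \<kappa>" using low[OF \<open>0 <= s\<close>] by linarith
    ultimately show "\<exists>y. (g has_real_derivative y) (at s) & 0 <= y" by blast
  qed
  then have "M 0 - M r <= r\<^sup>2 / 2 * N * \<kappa>" by (simp add: g_def)
  moreover have "M 0 - M r = (\<integral>y. (z x0 - z (x0 + r *\<^sub>R y)) * bump 2 y \<partial>lborel)"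
  proof -
    have I: "integrable lborel (%y. z (x0 + s *\<^sub>R y) * bump 2 y)" "M s = (\<integral>y. z (x0 + s *\<^sub>R y) * bump 2 y \<partial>lborel)" for s
      unfolding M_def by (rule integral_unit_cube; (intro continuous_intros c1 c0 | simp add: b0))+
    then show ?thesis using I(1)[of 0] by (simp add: left_diff_distrib)
  qed
  ultimately show ?thesis by (simp add: \<kappa>_def)
qed

lemma integral_rescale:
  fixes F :: "real^'n => real"
  assumes r: "0 < r" and F: "F \<in> borel_measurable borel"
  shows "(\<integral>x. F x \<partial>lborel) = r ^ CARD('n) * (\<integral>y. F (x0 + r *\<^sub>R y) \<partial>lborel)"
proof -
  have "(\<integral>x. F x \<partial>lborel) = (\<integral>x. F x \<partial>(density (distr lborel borel (%x. x0 + r *\<^sub>R x)) (%_. ennreal (r ^ CARD('n)))))"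
    using lborel_affine[of r x0] r by (simp add: ennreal_power)
  also have "... = (\<integral>x. r ^ CARD('n) *\<^sub>R F x \<partial>(distr lborel borel (%x. x0 + r *\<^sub>R x)))"
    using F r by (intro integral_density) auto
  also have "... = (\<integral>y. r ^ CARD('n) *\<^sub>R F (x0 + r *\<^sub>R y) \<partial>lborel)"
    using F by (intro integral_distr) auto
  finally show ?thesis by simp
qed

lemma bump_integral_pos: "0 < (\<integral>y. bump 2 (y :: real^'n) \<partial>lborel)"
proof -
  have b0: "bump 2 y = 0" if "1 < norm y" for y :: "real^'n"
    using bump_outside[OF that, of 1] by (simp add: numeral_eq_Suc)
  have e: "integral unit_cube (bump 2 :: real^'n => real) = (\<integral>y. bump 2 (y :: real^'n) \<partial>lborel)"
    using integral_unit_cube(2)[OF bump_continuous[of UNIV 2] b0] by simp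
  have "integral unit_cube (bump 2 :: real^'n => real) ~= 0"
  proof
    assume "integral unit_cube (bump 2 :: real^'n => real) = 0"
    moreover have "(bump 2 :: real^'n => real) integrable_on unit_cube"
      by (rule integrable_continuous[OF bump_continuous])
    ultimately have "((bump 2 :: real^'n => real) has_integral 0) unit_cube"
      using integrable_integral by metis
    then have "bump 2 (0 :: real^'n) = 0"
      by (rule has_integral_0_cbox_imp_0[OF bump_continuous bump_bounds(1)]) (auto simp: mem_box_cart interval_ne_empty_cart)
    then show False by (simp add: bump_def)
  qed
  moreover have "0 <= (\<integral>y. bump 2 (y :: real^'n) \<partial>lborel)" by (simp add: bump_bounds)
  ultimately show ?thesis using e by linarith
qed

text \<open>The cube is the first power for which truncation at \<open>u = 1/2\<close> leaves a
  twice continuously differentiable function; extended by 0 it lives on the whole space, so balls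
  may leave the domain.\<close>

lemma truncated_cube_regular:
  fixes u :: "real^'n => real"
  assumes \<Omega>: "open \<Omega>" and u: "smooth_on \<Omega> u" and S: "compact S" "S \<subseteq> \<Omega>" "!!x. x \<in> \<Omega> ==> x \<notin> S ==> u x <= 1/2"
  defines "m \<equiv> %x. max 0 (u x - 1/2)"
  defines "z \<equiv> ext0 \<Omega> (%x. m x ^ 3)"
  shows "z differentiable (at x)" "pd i z differentiable (at x)" "continuous_on UNIV (pd i (pd i z))"
    "pd i (pd i z) = ext0 \<Omega> (%x. 6 * m x * pd i u x * pd i u x + 3 * (m x)\<^sup>2 * pd i (pd i u) x)"
proof -
  have pow: "pd i (%x. m x ^ Suc (Suc n)) x = real (Suc (Suc n)) * m x ^ Suc n * pd i u x"
    "(%x. m x ^ Suc (Suc n)) differentiable (at x)" if x: "x \<in> \<Omega>" for i n x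
  proof -
    have d: "((%s. (max 0 (s - 1/2)) ^ Suc (Suc n)) has_real_derivative real (Suc (Suc n)) * m x ^ Suc n * 1) (at (u x))"
      unfolding m_def by (rule DERIV_chain2[OF pos_part_power_deriv]) (auto intro!: derivative_eq_intros)
    show "pd i (%x. m x ^ Suc (Suc n)) x = real (Suc (Suc n)) * m x ^ Suc n * pd i u x"
      "(%x. m x ^ Suc (Suc n)) differentiable (at x)"
      using pd_compose_real(1)[OF smooth_on_differentiable[OF u x] d, of i]
        pd_compose_real(2)[OF smooth_on_differentiable[OF u x] d] unfolding m_def by simp_all
  qed
  have p3: "pd i (%x. m x ^ 3) x = 3 * (m x)\<^sup>2 * pd i u x" "(%x. m x ^ 3) differentiable (at x)" if "x \<in> \<Omega>" for i x
    using pow(1)[OF that, of i 1] pow(2)[OF that, of 1] by (simp_all add: numeral_eq_Suc)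
  have p2: "pd i (%x. (m x)\<^sup>2) x = 2 * m x * pd i u x" "(%x. (m x)\<^sup>2) differentiable (at x)" if "x \<in> \<Omega>" for i x
    using pow(1)[OF that, of i 0] pow(2)[OF that, of 0] by (simp_all add: numeral_eq_Suc)
  have m0: "m x = 0" if "x \<in> \<Omega>" "x \<notin> S" for x using S(3)[OF that] by (simp add: m_def)
  have z0: "m x ^ 3 = 0" if "x \<in> \<Omega>" "x \<notin> S" for x using m0[OF that] by simp
  show "z differentiable (at x)" unfolding z_def by (rule ext0_pd(1)[OF \<Omega> S(1,2) z0 p3(2)])
  define v where "v i x = 3 * ((m x)\<^sup>2 * pd i u x)" for i x
  have pz: "pd i z = ext0 \<Omega> (v i)" for i
  proof
    fix x
    have "pd i z x = ext0 \<Omega> (pd i (%x. m x ^ 3)) x" unfolding z_def by (rule ext0_pd(2)[OF \<Omega> S(1,2) z0 p3(2)])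
    then show "pd i z x = ext0 \<Omega> (v i) x" by (simp add: ext0_def p3(1) v_def)
  qed
  have v0: "v i x = 0" if "x \<in> \<Omega>" "x \<notin> S" for i x using m0[OF that] by (simp add: v_def)
  have pv: "pd i (v i) x = 6 * m x * pd i u x * pd i u x + 3 * (m x)\<^sup>2 * pd i (pd i u) x" "v i differentiable (at x)"
    if x: "x \<in> \<Omega>" for i x
  proof -
    note dp = smooth_on_differentiable[OF smooth_on_pd[OF u] x]
    have d: "(%x. (m x)\<^sup>2 * pd i u x) differentiable (at x)" by (rule differentiable_mult[OF p2(2)[OF x] dp])
    show "v i differentiable (at x)" unfolding v_def[abs_def] by (rule differentiable_mult[OF differentiable_const d])
    show "pd i (v i) x = 6 * m x * pd i u x * pd i u x + 3 * (m x)\<^sup>2 * pd i (pd i u) x"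
      unfolding v_def[abs_def] pd_cmult[OF d] pd_mult[OF p2(2)[OF x] dp] p2(1)[OF x] by (simp add: algebra_simps)
  qed
  show "pd i z differentiable (at x)" unfolding pz by (rule ext0_pd(1)[OF \<Omega> S(1,2) v0 pv(2)])
  show ppz: "pd i (pd i z) = ext0 \<Omega> (%x. 6 * m x * pd i u x * pd i u x + 3 * (m x)\<^sup>2 * pd i (pd i u) x)"
  proof
    fix x
    have "pd i (pd i z) x = ext0 \<Omega> (pd i (v i)) x" unfolding pz by (rule ext0_pd(2)[OF \<Omega> S(1,2) v0 pv(2)])
    then show "pd i (pd i z) x = ext0 \<Omega> (%x. 6 * m x * pd i u x * pd i u x + 3 * (m x)\<^sup>2 * pd i (pd i u) x) x"
      by (simp add: ext0_def pv(1))
  qed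
  show "continuous_on UNIV (pd i (pd i z))" unfolding ppz
  proof (rule ext0_continuous[OF \<Omega> S(1,2)])
    show "continuous_on \<Omega> (%x. 6 * m x * pd i u x * pd i u x + 3 * (m x)\<^sup>2 * pd i (pd i u) x)" unfolding m_def
      by (intro continuous_intros smooth_on_continuous_on[OF u] smooth_on_continuous_on[OF smooth_on_pd[OF u]]
          smooth_on_continuous_on[OF smooth_on_pd[OF smooth_on_pd[OF u]]])
  qed (simp add: m0)
qed

text \<open>The bound is affine in the cubes because the mean value inequality controls their mean.
  Either \<open>w\<close> is within \<open>d\<close> of \<open>w0\<close>, and then \<open>Q\<close>
  is at least \<open>1 / (4 * d)\<close>, or the cubes differ by at least \<open>d / 16\<close> and
  the left-hand side is nonpositive.\<close>

lemma peak_lower_bound: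
  fixes d w0 w Q :: real
  assumes d: "0 < d" "d <= 1/8" and w0: "w0 = 1/2 - d" and w: "0 <= w" "w <= w0"
    and Q: "0 <= Q" "0 < w ==> 1 / (1/2 - w) - 2 <= Q"
  shows "(1 / (4 * d)) ^ 11 * (1 - 16 / d * (w0 ^ 3 - w ^ 3)) <= Q ^ 11"
proof -
  have "w0 ^ 3 - w ^ 3 = (w0 - w) * (w0\<^sup>2 + w0 * w + w\<^sup>2)" by (simp add: algebra_simps power2_eq_square power3_eq_cube)
  moreover have "1/16 <= w0\<^sup>2 + w0 * w + w\<^sup>2"
  proof -
    have "(1/4)\<^sup>2 <= w0\<^sup>2" using d w0 by (intro power_mono) auto
    moreover have "0 <= w0 * w" using w by simp
    moreover have "(1/4)\<^sup>2 = (1/16 :: real)" by (simp add: power2_eq_square)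
    ultimately show ?thesis using zero_le_power2[of w] by linarith
  qed
  then have "(w0 - w) * (1/16) <= (w0 - w) * (w0\<^sup>2 + w0 * w + w\<^sup>2)" using w by (intro mult_left_mono) auto
  ultimately have diff: "(w0 - w) / 16 <= w0 ^ 3 - w ^ 3" by simp
  show ?thesis
  proof (cases "w0 - w <= d")
    case True
    then have w': "0 < w" "1/2 - w <= 2 * d" "0 < 1/2 - w" using d w0 w by auto
    then have "1 / (2 * d) <= 1 / (1/2 - w)" by (intro divide_left_mono) auto
    \<comment> \<open>This is where \<open>d <= 1/8\<close> pays for the 2 subtracted in
      \<open>Q\<close>.\<close>
    moreover have "1 / (4 * d) + 2 <= 1 / (2 * d)" using d by (simp add: field_simps)
    ultimately have "1 / (4 * d) <= Q" using Q(2)[OF w'(1)] by linarith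
    then have "(1 / (4 * d)) ^ 11 <= Q ^ 11" using d by (intro power_mono) auto
    moreover have "(1 / (4 * d)) ^ 11 * (1 - 16 / d * (w0 ^ 3 - w ^ 3)) <= (1 / (4 * d)) ^ 11 * 1"
      using diff w d by (intro mult_left_mono) auto
    ultimately show ?thesis by simp
  next
    case False
    then have "d / 16 <= w0 ^ 3 - w ^ 3" using diff by simp
    then have "16 / d * (d / 16) <= 16 / d * (w0 ^ 3 - w ^ 3)" using d by (intro mult_left_mono) auto
    then have "1 - 16 / d * (w0 ^ 3 - w ^ 3) <= 0" using d by simp
    then have "(1 / (4 * d)) ^ 11 * (1 - 16 / d * (w0 ^ 3 - w ^ 3)) <= 0" using d by (intro mult_nonneg_nonpos) auto
    moreover have "0 <= Q ^ 11" using Q by simp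
    ultimately show ?thesis by linarith
  qed
qed

text \<open>With gap \<open>\<tau>\<^sup>2\<close> at the maximum point, \<open>u\<close> stays within a multiple of \<open>\<tau>\<^sup>2\<close> of \<open>1\<close> on most of a ball of
  radius proportional to \<open>\<tau>\<^sup>3\<close>. The energy on this ball is of order \<open>\<tau> ^ (3 * N - 22)\<close>, whose
  exponent is negative exactly when \<open>N <= 7\<close>.\<close>

theorem gap_bound:
  fixes c :: "real^'n => real^'n"
  assumes \<Omega>: "open \<Omega>" "bounded \<Omega>" and c: "!!x. x \<in> \<Omega> ==> norm (c x) <= \<Gamma>" and n7: "CARD('n) <= 7" and L: "0 <= L"
  shows "\<exists>t0>0. \<forall>lam u x0 \<tau>. 0 <= lam --> lam <= L --> smooth_solution \<Omega> c lam u --> x0 \<in> \<Omega> -->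
    (\<forall>x\<in>\<Omega>. u x <= u x0) --> u x0 = 1 - \<tau>\<^sup>2 --> 0 < \<tau> --> \<tau>\<^sup>2 <= 1/8 -->
    (\<integral>x. ext0 \<Omega> (%x. qq (u x) ^ 11) x \<partial>lborel) <= C --> t0 <= \<tau>"
proof -
  define R where "R = (\<integral>y. bump 2 (y :: real^'n) \<partial>lborel)"
  define \<kappa> where "\<kappa> = (\<integral>y. bump 3 (y :: real^'n) / 6 \<partial>lborel)"
  have R: "0 < R" unfolding R_def by (rule bump_integral_pos)
  have \<kappa>: "0 <= \<kappa>" by (simp add: \<kappa>_def bump_bounds)
  define N0 where "N0 = \<Gamma>\<^sup>2 + L"
  have N0: "0 <= N0" using L by (simp add: N0_def)
  \<comment> \<open>The scale of the radius, so small that the mean deficit of \<open>z\<close> uses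
    up at most half of \<open>R\<close>.\<close>
  define a where "a = min 1 (R / (16 * (N0 * \<kappa> + 1)))"
  have a: "0 < a" "a <= 1" "a <= R / (16 * (N0 * \<kappa> + 1))"
    using R mult_nonneg_nonneg[OF N0 \<kappa>] by (auto simp: a_def intro!: divide_pos_pos)
  have a8: "8 * a\<^sup>2 * N0 * \<kappa> <= R / 2"
  proof -
    have nk: "0 <= N0 * \<kappa>" using N0 \<kappa> by simp
    have "a * (16 * (N0 * \<kappa> + 1)) <= R" using a(3) nk by (simp add: pos_le_divide_eq)
    moreover have "a\<^sup>2 * (N0 * \<kappa>) <= a * (N0 * \<kappa>)" using a nk by (intro mult_right_mono) (auto simp: power2_eq_square mult_left_le_one_le)
    ultimately show ?thesis using a(1) by (simp add: algebra_simps)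
  qed
  define t0 where "t0 = a ^ 7 * R / (2 * 4 ^ 11 * max 1 C)"
  have t0: "0 < t0" using a R by (simp add: t0_def)
  have "t0 <= \<tau>" if lam: "0 <= lam" "lam <= L" and u: "smooth_solution \<Omega> c lam u" and x0: "x0 \<in> \<Omega>"
    and max: "\<forall>x\<in>\<Omega>. u x <= u x0" and \<tau>: "u x0 = 1 - \<tau>\<^sup>2" "0 < \<tau>" "\<tau>\<^sup>2 <= 1/8"
    and C: "(\<integral>x. ext0 \<Omega> (%x. qq (u x) ^ 11) x \<partial>lborel) <= C" for lam u x0 \<tau>
  proof -
    define S where "S = {x \<in> closure \<Omega>. 1/2 <= u x}"
    have S: "compact S" "S \<subseteq> \<Omega>" unfolding S_def by (rule superlevel_compact[OF \<Omega>(2) u])+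
    have S3: "u x <= 1/2" if "x \<in> \<Omega>" "x \<notin> S" for x using that closure_subset by (auto simp: S_def)
    have su: "smooth_on \<Omega> u" using u by (simp add: smooth_solution_def smooth_on_closure_def)
    define d where "d = \<tau>\<^sup>2"
    have d: "0 < d" "d <= 1/8" "u x <= 1 - d" if "x \<in> \<Omega>" for x using \<tau> max that by (auto simp: d_def)
    note d12 = d(1,2)[OF x0]
    define m where "m x = max 0 (u x - 1/2)" for x
    define z where "z = ext0 \<Omega> (%x. m x ^ 3)"
    note reg = truncated_cube_regular[OF \<Omega>(1) su S S3, folded m_def, folded z_def]
    have m: "0 <= m x" "x \<in> \<Omega> ==> m x <= 1/2 - d" for x using d(3)[of x] d12 by (auto simp: m_def)
    \<comment> \<open>The square of the gradient, which enters with a positive sign, absorbs the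
      drift; the nonlinearity costs a multiple of \<open>L / d\<^sup>2\<close>.\<close>
    have lap: "- (N0 / d\<^sup>2) <= laplacian z x" for x
    proof (cases "x \<in> \<Omega>")
      case False
      then show ?thesis using N0 by (simp add: laplacian_def reg(4) ext0_def)
    next
      case True
      define p where "p = gradient u x"
      have "laplacian z x = 6 * m x * (p \<bullet> p) + 3 * (m x)\<^sup>2 * laplacian u x"
        using True by (simp add: laplacian_def reg(4) ext0_def p_def gradient_def inner_vec_def sum.distrib sum_distrib_left mult.assoc)
      moreover have "laplacian u x = c x \<bullet> p - lam * (1 / (1 - u x))\<^sup>2"
        using u True by (auto simp: smooth_solution_def p_def power_divide)
      ultimately have e: "laplacian z x = 6 * m x * (p \<bullet> p) + 3 * (m x)\<^sup>2 * (c x \<bullet> p) - 3 * (m x)\<^sup>2 * (lam * (1 / (1 - u x))\<^sup>2)"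
        by (simp add: algebra_simps)
      have m1: "m x <= 1/2" using m(2)[OF True] d12 by simp
      have m2: "(m x)\<^sup>2 <= 1/4" using power_mono[OF m1 m(1), of 2] by (simp add: power2_eq_square)
      have "- (norm p * \<Gamma>) <= c x \<bullet> p"
        using Cauchy_Schwarz_ineq2[of "c x" p] mult_right_mono[OF c[OF True] norm_ge_zero[of p]] by (simp add: mult.commute)
      then have "3 * (m x)\<^sup>2 * - (norm p * \<Gamma>) <= 3 * (m x)\<^sup>2 * (c x \<bullet> p)" by (intro mult_left_mono) auto
      moreover have "0 <= 6 * m x * (norm p - m x * \<Gamma> / 4)\<^sup>2" using m by simp
      then have "0 <= 6 * m x * (p \<bullet> p) - 3 * (m x)\<^sup>2 * (norm p * \<Gamma>) + 3/8 * (m x)\<^sup>2 * (m x * \<Gamma>\<^sup>2)"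
        by (simp add: power2_eq_square algebra_simps flip: power2_norm_eq_inner)
      moreover have "3/8 * (m x)\<^sup>2 * (m x * \<Gamma>\<^sup>2) <= 3/8 * (1/4) * (1/2 * \<Gamma>\<^sup>2)"
        using m1 m2 m(1)[of x] by (intro mult_mono) auto
      moreover have "3 * (m x)\<^sup>2 * (lam * (1 / (1 - u x))\<^sup>2) <= 3 * (1/4) * (L * (1 / d)\<^sup>2)"
      proof -
        have "1 / (1 - u x) <= 1 / d" using d(3)[OF True] d12 by (intro divide_left_mono) auto
        then have "(1 / (1 - u x))\<^sup>2 <= (1 / d)\<^sup>2" using d(3)[OF True] d12 by (intro power_mono) auto
        then show ?thesis using m2 lam by (intro mult_mono) auto
      qed
      moreover have "\<Gamma>\<^sup>2 <= \<Gamma>\<^sup>2 / d\<^sup>2"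
      proof -
        have "d\<^sup>2 <= 1" using power_le_one[of d 2] d12 by simp
        then show ?thesis using d12 by (simp add: pos_le_divide_eq mult_left_le)
      qed
      moreover have "0 <= L * (1 / d)\<^sup>2" using L by simp
      moreover have "N0 / d\<^sup>2 = \<Gamma>\<^sup>2 / d\<^sup>2 + L * (1 / d)\<^sup>2" by (simp add: N0_def add_divide_distrib power_divide)
      moreover have "3/8 * (1/4) * (1/2 * \<Gamma>\<^sup>2) <= \<Gamma>\<^sup>2" by simp
      ultimately show ?thesis unfolding e by linarith
    qed
    \<comment> \<open>The exponent makes \<open>r\<^sup>2 / d ^ 3\<close> constant, which is the
      quantity that the mean value inequality produces.\<close>
    define r where "r = a * \<tau> ^ 3"
    have r: "0 < r" using a \<tau> by (simp add: r_def)
    define F where "F = ext0 \<Omega> (%x. qq (u x) ^ 11)"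
    have q0: "qq (u x) ^ 11 = 0" if "x \<in> \<Omega>" "x \<notin> S" for x using qq_zero[OF S3[OF that]] by simp
    have F0: "0 <= F x" for x by (simp add: F_def ext0_def qq_def)
    have cF: "continuous_on UNIV F" unfolding F_def
    proof (rule ext0_continuous[OF \<Omega>(1) S _ q0])
      show "continuous_on \<Omega> (%x. qq (u x) ^ 11)" unfolding qq_def
        using d(3) d12(1) by (intro continuous_intros smooth_on_continuous_on[OF su]) fastforce
    qed
    define w0 where "w0 = 1/2 - d"
    have zx0: "z x0 = w0 ^ 3" using x0 \<tau> d12 by (simp add: z_def ext0_def m_def w0_def d_def)
    \<comment> \<open>Valid on the whole space, so that it can be integrated against the bump;
      points off the domain correspond to \<open>w = 0\<close>.\<close>
    have peak: "(1 / (4 * d)) ^ 11 * (1 - 16 / d * (z x0 - z x)) <= F x" for x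
    proof (cases "x \<in> \<Omega>")
      case True
      have "(1 / (4 * d)) ^ 11 * (1 - 16 / d * (w0 ^ 3 - m x ^ 3)) <= qq (u x) ^ 11"
      proof (rule peak_lower_bound[OF d12 w0_def m(1)])
        show "m x <= w0" using m(2)[OF True] by (simp add: w0_def)
        show "0 <= qq (u x)" by (simp add: qq_def)
        assume "0 < m x"
        then have "1/2 - m x = 1 - u x" by (auto simp: m_def max_def split: if_splits)
        then show "1 / (1/2 - m x) - 2 <= qq (u x)" by (simp add: qq_def)
      qed
      then show ?thesis using True zx0 by (simp add: z_def F_def ext0_def)
    next
      case False
      have "(1 / (4 * d)) ^ 11 * (1 - 16 / d * (w0 ^ 3 - 0 ^ 3)) <= 0 ^ 11"
        by (rule peak_lower_bound[OF d12 w0_def]) (use d12 in \<open>auto simp: w0_def\<close>)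
      then show ?thesis using False zx0 by (simp add: z_def F_def ext0_def)
    qed
    have b0: "bump 2 y = 0" if "1 < norm y" for y :: "real^'n"
      using bump_outside[OF that, of 1] by (simp add: numeral_eq_Suc)
    have c1: "continuous_on UNIV (%y. f (x0 + r *\<^sub>R y))" if "continuous_on UNIV f" for f :: "real^'n => real"
      by (rule continuous_on_compose2[OF that]) (auto intro!: continuous_intros)
    have cz: "continuous_on UNIV z"
      using reg(1) by (simp add: continuous_at_imp_continuous_on differentiable_imp_continuous_within)
    define Z where "Z y = (z x0 - z (x0 + r *\<^sub>R y)) * bump 2 y" for y
    have iZ: "integrable lborel Z"
      by (rule integral_unit_cube(1)) (unfold Z_def[abs_def], intro continuous_intros c1 cz, simp add: b0)
    have iB: "integrable lborel (bump 2 :: real^'n => real)"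
      by (rule integral_unit_cube(1)[OF bump_continuous b0])
    have iF: "integrable lborel (%y. F (x0 + r *\<^sub>R y))"
    proof (rule integrable_compact_support[OF c1[OF cF]])
      show "compact ((%x. (1 / r) *\<^sub>R (x - x0)) ` S)"
        by (rule compact_continuous_image[OF _ S(1)]) (intro continuous_intros)
      show "F (x0 + r *\<^sub>R y) = 0" if "y \<notin> (%x. (1 / r) *\<^sub>R (x - x0)) ` S" for y
      proof -
        have "x0 + r *\<^sub>R y \<notin> S"
        proof
          assume "x0 + r *\<^sub>R y \<in> S"
          then have "(1 / r) *\<^sub>R ((x0 + r *\<^sub>R y) - x0) \<in> (%x. (1 / r) *\<^sub>R (x - x0)) ` S" by blast
          then show False using that r by simp
        qed
        then show ?thesis using q0 by (simp add: F_def ext0_def)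
      qed
    qed
    define E where "E = (1 / (4 * d)) ^ 11"
    have E: "0 < E" using d12 by (simp add: E_def)
    have "E * (R - 16 / d * (\<integral>y. Z y \<partial>lborel)) = (\<integral>y. E * (bump 2 y - 16 / d * Z y) \<partial>lborel)"
      using iZ iB by (simp add: R_def)
    also have "... <= (\<integral>y. F (x0 + r *\<^sub>R y) \<partial>lborel)"
    proof (rule integral_mono[OF _ iF])
      show "integrable lborel (%y. E * (bump 2 y - 16 / d * Z y))" using iZ iB by simp
      fix y :: "real^'n"
      have "E * (bump 2 y - 16 / d * Z y) = (E * (1 - 16 / d * (z x0 - z (x0 + r *\<^sub>R y)))) * bump 2 y"
        by (simp add: Z_def algebra_simps)
      also have "... <= F (x0 + r *\<^sub>R y) * bump 2 y"
        unfolding E_def by (rule mult_right_mono[OF peak bump_bounds(1)])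
      also have "... <= F (x0 + r *\<^sub>R y) * 1" by (rule mult_left_mono[OF bump_bounds(2) F0])
      finally show "E * (bump 2 y - 16 / d * Z y) <= F (x0 + r *\<^sub>R y)" by simp
    qed
    finally have low: "E * (R - 16 / d * (\<integral>y. Z y \<partial>lborel)) <= (\<integral>y. F (x0 + r *\<^sub>R y) \<partial>lborel)" .
    have "(\<integral>y. Z y \<partial>lborel) <= r\<^sup>2 / 2 * (N0 / d\<^sup>2) * \<kappa>"
      unfolding Z_def \<kappa>_def by (rule mean_value_inequality[OF reg(1-3) lap less_imp_le[OF r]])
    then have "16 / d * (\<integral>y. Z y \<partial>lborel) <= 16 / d * (r\<^sup>2 / 2 * (N0 / d\<^sup>2) * \<kappa>)" using d12 by (intro mult_left_mono) auto
    also have "... = 8 * a\<^sup>2 * N0 * \<kappa>"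
    proof -
      have "r\<^sup>2 = a\<^sup>2 * d ^ 3" by (simp add: r_def d_def power_mult_distrib flip: power_mult)
      then show ?thesis using d12 by (simp add: field_simps eval_nat_numeral)
    qed
    finally have "R / 2 <= R - 16 / d * (\<integral>y. Z y \<partial>lborel)" using a8 by linarith
    then have "E * (R / 2) <= E * (R - 16 / d * (\<integral>y. Z y \<partial>lborel))" using E by (intro mult_left_mono) auto
    then have "r ^ CARD('n) * (E * (R / 2)) <= r ^ CARD('n) * (\<integral>y. F (x0 + r *\<^sub>R y) \<partial>lborel)"
      by (rule mult_left_mono[OF order_trans[OF _ low]]) (use r in auto)
    also have "... = (\<integral>x. F x \<partial>lborel)"
      by (rule integral_rescale[symmetric, OF r borel_measurable_continuous_onI[OF cF]])
    also have "... <= max 1 C" using C by (simp add: F_def)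
    finally have up: "r ^ CARD('n) * (E * (R / 2)) <= max 1 C" .
    have \<tau>1: "\<tau> <= 1" using \<tau>(2,3) power2_le_imp_le[of \<tau> 1] by simp
    \<comment> \<open>Since \<open>r <= 1\<close>, dimension 7 is the worst case.\<close>
    have "r ^ 7 <= r ^ CARD('n)"
    proof (rule power_decreasing[OF n7])
      have "\<tau> ^ 3 <= 1" using \<tau>1 \<tau>(2) by (intro power_le_one) auto
      then show "r <= 1" using a \<tau> mult_mono[of a 1 "\<tau> ^ 3" 1] by (simp add: r_def)
    qed (use r in simp)
    then have "r ^ 7 * (E * (R / 2)) <= max 1 C"
      by (rule order_trans[OF mult_right_mono up]) (use E R in simp)
    \<comment> \<open>The power count: \<open>\<tau> ^ 21\<close> from the volume against
      \<open>\<tau> ^ 22\<close> from the energy density.\<close>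
    moreover have "r ^ 7 * (E * (R / 2)) = a ^ 7 * R / (2 * 4 ^ 11) / \<tau>"
    proof -
      have "r ^ 7 = a ^ 7 * \<tau> ^ 21" by (simp add: r_def power_mult_distrib flip: power_mult)
      moreover have "E = 1 / (4 ^ 11 * (\<tau> ^ 21 * \<tau>))"
        by (simp add: E_def d_def power_divide power_mult_distrib flip: power_mult power_Suc2)
      ultimately show ?thesis using \<tau>(2) by (simp add: field_simps)
    qed
    ultimately have "a ^ 7 * R / (2 * 4 ^ 11) / \<tau> <= max 1 C" by (simp only:)
    then have "a ^ 7 * R / (2 * 4 ^ 11) <= max 1 C * \<tau>" using \<tau>(2) by (simp add: pos_divide_le_eq)
    then have "a ^ 7 * R / (2 * 4 ^ 11) / max 1 C <= \<tau>" by (subst pos_divide_le_eq) (auto simp: mult.commute)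
    then show "t0 <= \<tau>" by (simp add: t0_def)
  qed
  then show ?thesis using t0 by blast
qed

section \<open>The extremal solution\<close>

lemma interior_maximum:
  fixes f :: "real^'n => real"
  assumes S: "open S" "smooth_on S f" "x \<in> S" "!!z. z \<in> S ==> f z <= f x"
  shows "laplacian f x <= 0" "gradient f x = 0"
proof -
  show "laplacian f x <= 0" by (rule laplacian_local_max[OF S])
  have d: "(f has_derivative (%v. \<Sum>i\<in>UNIV. v $ i * pd i f x)) (at x)"
    by (rule has_derivative_pd_real[OF smooth_on_differentiable[OF S(2,3)]])
  have "(%v. \<Sum>i\<in>UNIV. v $ i * pd i f x) = (%v. 0)"
    by (rule differential_zero_maxmin[OF S(3,1) d]) (use S(4) in blast)
  then have "pd i f x = 0" for i using pd_eqI[OF d, of i] by metis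
  then show "gradient f x = 0" by (simp add: gradient_def vec_eq_iff)
qed

lemma attains_sup_closure:
  fixes f :: "'a::heine_borel => real"
  assumes "bounded S" "continuous_on (closure S) f" "x \<in> closure S"
  obtains z where "z \<in> closure S" "!!y. y \<in> closure S ==> f y <= f z"
proof -
  have "compact (closure S)" using assms(1) by (simp add: compact_closure)
  moreover have "closure S ~= {}" using assms(3) by force
  ultimately have "\<exists>z\<in>closure S. \<forall>y\<in>closure S. f y <= f z" by (rule continuous_attains_sup[OF _ _ assms(2)])
  then show ?thesis using that by blast
qed

text \<open>The strict inequality already contradicts an interior maximum, where the gradient
  vanishes and the Laplacian is nonpositive.\<close>

lemma weak_maximum_principle:
  fixes f :: "real^'n => real"
  assumes \<Omega>: "open \<Omega>" "bounded \<Omega>" and f: "smooth_on \<Omega> f" "continuous_on (closure \<Omega>) f"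
    and b: "!!x. x \<in> frontier \<Omega> ==> f x <= 0"
    and L: "!!x. x \<in> \<Omega> ==> 0 < laplacian f x - c x \<bullet> gradient f x" and x: "x \<in> closure \<Omega>"
  shows "f x <= 0"
proof -
  have clo: "closure \<Omega> = \<Omega> \<union> frontier \<Omega>" using closure_Un_frontier by blast
  obtain z where z: "z \<in> closure \<Omega>" "!!y. y \<in> closure \<Omega> ==> f y <= f z"
    using attains_sup_closure[OF \<Omega>(2) f(2) x] by blast
  have "z \<notin> \<Omega>"
  proof
    assume "z \<in> \<Omega>"
    then have "laplacian f z <= 0" "gradient f z = 0"
      using interior_maximum[OF \<Omega>(1) f(1)] z(2) clo by blast+
    then show False using L[OF \<open>z \<in> \<Omega>\<close>] by simp
  qed
  then have "f z <= 0" using z(1) b clo by blast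
  then show ?thesis using z(2)[OF x] by linarith
qed

lemma smooth_solutionD:
  assumes "smooth_solution \<Omega> c lam u"
  shows "smooth_on \<Omega> u" "continuous_on (closure \<Omega>) u" "!!x. x \<in> closure \<Omega> ==> 0 <= u x"
    "!!x. x \<in> closure \<Omega> ==> u x < 1" "!!x. x \<in> frontier \<Omega> ==> u x = 0"
    "!!x. x \<in> \<Omega> ==> - laplacian u x + c x \<bullet> gradient u x = lam / (1 - u x)\<^sup>2"
  using assms by (auto simp: smooth_solution_def smooth_on_closure_def)

lemma smooth_solution_gap:
  assumes "bounded \<Omega>" "smooth_solution \<Omega> c lam u"
  shows "\<exists>d0>0. \<forall>x\<in>closure \<Omega>. u x <= 1 - d0"
proof (cases "closure \<Omega> = {}")
  case False
  then obtain x where "x \<in> closure \<Omega>" by (metis ex_in_conv)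
  then obtain z where z: "z \<in> closure \<Omega>" "!!y. y \<in> closure \<Omega> ==> u y <= u z"
    using attains_sup_closure[OF assms(1) smooth_solutionD(2)[OF assms(2)]] by blast
  then show ?thesis using smooth_solutionD(4)[OF assms(2) z(1)] by (intro exI[of _ "1 - u z"]) auto
qed (auto intro: exI[of _ 1])

text \<open>The larger solution \<open>w\<close> acts as supersolution and as boundary barrier at
  the same time, with constant sequences in \<open>existence_between\<close>.\<close>

lemma solution_below:
  fixes c :: "real^'n => real^'n"
  assumes \<Omega>: "open \<Omega>" "bounded \<Omega>" "smooth_boundary \<Omega>" and c: "smooth_on_closure \<Omega> c"
    and lam: "0 <= lam" "lam < lam'" and w: "smooth_solution \<Omega> c lam' w"
  obtains v where "smooth_solution \<Omega> c lam v" "!!x. x \<in> \<Omega> ==> v x <= w x"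
proof -
  obtain d0 where d0: "0 < d0" "!!x. x \<in> closure \<Omega> ==> w x <= 1 - d0" using smooth_solution_gap[OF \<Omega>(2) w] by blast
  have wd: "w x <= 1 - d0" if "x \<in> \<Omega>" for x using d0(2) that closure_subset by blast
  obtain v where v: "smooth_solution \<Omega> c lam v" "!!x b. x \<in> \<Omega> ==> (!!m::nat. w x <= b) ==> v x <= b"
    using existence_between[OF \<Omega> c d0(1), of "%_. lam" lam "%_. lam'" "%_. w" w]
      lam w wd smooth_solutionD(2,5)[OF w] by auto
  show ?thesis by (rule that[OF v(1)]) (use v(2) in blast)
qed

text \<open>By continuity the set where the inequality fails is open, and an open negligible set is
  empty.\<close>

lemma minimal_solution_le:
  assumes \<Omega>: "open \<Omega>" and u: "minimal_solution \<Omega> c lam u" and v: "smooth_solution \<Omega> c lam v" and x: "x \<in> \<Omega>"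
  shows "u x <= v x"
proof -
  have su: "smooth_solution \<Omega> c lam u" using u by (simp add: minimal_solution_def)
  define W where "W = {y\<in>\<Omega>. v y < u y}"
  have cont: "continuous_on \<Omega> (%y. u y - v y)"
    using smooth_on_continuous_on smooth_solutionD(1)[OF su] smooth_solutionD(1)[OF v] by (intro continuous_intros) blast+
  have "open (\<Omega> \<inter> (%y. u y - v y) -` {0<..})" by (rule continuous_open_preimage[OF cont \<Omega>]) simp
  also have "\<Omega> \<inter> (%y. u y - v y) -` {0<..} = W" by (auto simp: W_def)
  finally have "open W" .
  have "AE y in lebesgue_on \<Omega>. u y <= v y" using u v by (simp add: minimal_solution_def)
  then have "AE y in lebesgue. y \<in> \<Omega> --> u y <= v y" using \<Omega> by (simp add: AE_restrict_space_iff)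
  then have "AE y in lebesgue. y \<notin> W" by eventually_elim (auto simp: W_def)
  then have "negligible W" using \<open>open W\<close> by (simp add: negligible_iff_null_sets AE_iff_null_sets)
  then have "W = {}" using \<open>open W\<close> open_not_negligible by blast
  then show ?thesis using x by (force simp: W_def)
qed

text \<open>At a contact point \<open>u - w\<close> would have an interior maximum, and there the
  difference inequality leaves \<open>lam' - lam <= 0\<close>; strictness thus needs no strong
  maximum principle.\<close>

lemma minimal_solution_mono:
  fixes c :: "real^'n => real^'n"
  assumes \<Omega>: "open \<Omega>" "bounded \<Omega>" "smooth_boundary \<Omega>" and c: "smooth_on_closure \<Omega> c"
    and lam: "0 <= lam" "lam < lam'" and u: "minimal_solution \<Omega> c lam u" and w: "smooth_solution \<Omega> c lam' w"
    and x: "x \<in> \<Omega>"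
  shows "u x < w x"
proof -
  have le: "u y <= w y" if y: "y \<in> \<Omega>" for y
  proof -
    obtain v where v: "smooth_solution \<Omega> c lam v" "!!x. x \<in> \<Omega> ==> v x <= w x"
      using solution_below[OF \<Omega> c lam w] by metis
    show ?thesis using minimal_solution_le[OF \<Omega>(1) u v(1) y] v(2)[OF y] by linarith
  qed
  have su: "smooth_solution \<Omega> c lam u" using u by (simp add: minimal_solution_def)
  have "u x ~= w x"
  proof
    assume e: "u x = w x"
    note s = smooth_solutionD(1)[OF su] smooth_solutionD(1)[OF w]
    have "laplacian (%y. u y - w y) x <= 0" "gradient (%y. u y - w y) x = 0"
      using interior_maximum[OF \<Omega>(1) smooth_on_diff[OF \<Omega>(1) s] x] le e by auto
    then have "laplacian u x <= laplacian w x" "gradient u x = gradient w x"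
      unfolding laplacian_diff[OF \<Omega>(1) s x] by auto
    moreover have "(lam' - lam) + 2 * lam * (1 / (1 - u x)) ^ 3 * (w x - u x)
        <= - laplacian (%x. w x - u x) x + c x \<bullet> gradient (%x. w x - u x) x"
      using lam e by (intro solution_difference_ineq[OF \<Omega>(1) su w _ _ x]) auto
    ultimately show False using lam e unfolding laplacian_diff[OF \<Omega>(1) s(2,1) x] by simp
  qed
  then show ?thesis using le[OF x] by simp
qed

lemma smooth_solution_cong:
  fixes c :: "real^'n => real^'n"
  assumes \<Omega>: "open \<Omega>" and eq: "!!x. x \<in> closure \<Omega> ==> u x = v x" and v: "smooth_solution \<Omega> c lam v"
  shows "smooth_solution \<Omega> c lam u"
proof -
  have e: "u x = v x" if "x \<in> \<Omega>" for x using eq that closure_subset by blast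
  have D: "Dd is u x = Dd is v x" if "x \<in> \<Omega>" for x "is" by (rule Dd_cong[OF \<Omega> e that])
  have "laplacian u x = laplacian v x" "gradient u x = gradient v x" if "x \<in> \<Omega>" for x
    using D[OF that, of "[_, _]"] D[OF that, of "[_]"] by (simp_all add: laplacian_def gradient_def)
  moreover have "smooth_on \<Omega> u" using smooth_on_cong[OF \<Omega>, of u v] e smooth_solutionD(1)[OF v] by blast
  moreover have "continuous_on (closure \<Omega>) u"
    using smooth_solutionD(2)[OF v] by (rule continuous_on_eq) (simp add: eq)
  moreover have "frontier \<Omega> \<subseteq> closure \<Omega>" by (simp add: frontier_def)
  ultimately show ?thesis
    using v e eq D unfolding smooth_solution_def smooth_on_closure_def by (auto simp: subset_iff)
qed

text \<open>The energy bound feeds \<open>gap_bound\<close> at a maximum point. The cases which that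
  theorem leaves out are a maximum on the frontier, where the solution is 0, and a maximum below
  7/8.\<close>

lemma uniform_gap:
  fixes c :: "real^'n => real^'n"
  assumes \<Omega>: "open \<Omega>" "bounded \<Omega>" "smooth_boundary \<Omega>" and c: "smooth_on_closure \<Omega> c" and n7: "CARD('n) <= 7"
    and ls: "0 < ls" and u: "!!lam. 0 < lam ==> lam < ls ==> minimal_solution \<Omega> c lam (u lam)"
  obtains d0 where "0 < d0" "!!lam x. ls / 2 <= lam ==> lam < ls ==> x \<in> closure \<Omega> ==> u lam x <= 1 - d0"
proof -
  obtain \<Gamma> where \<Gamma>: "!!x. x \<in> \<Omega> ==> norm (c x) <= \<Gamma>"
    using smooth_on_closure_bounded[OF \<Omega>(2) c, of "[]"] by auto
  obtain C where C: "!!lam lam' u u'. ls / 2 <= lam ==> lam < lam' ==> lam <= ls ==> smooth_solution \<Omega> c lam u ==>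
    smooth_solution \<Omega> c lam' u' ==> \<forall>x\<in>\<Omega>. u x < u' x ==> (\<integral>x. ext0 \<Omega> (%x. qq (u x) ^ 11) x \<partial>lborel) <= C"
    using energy_bound[of \<Omega> c \<Gamma> "ls / 2" ls, OF \<Omega>(1,2) \<Gamma> half_gt_zero[OF ls]] by metis
  have "\<exists>t0>0. \<forall>lam u x0 \<tau>. 0 <= lam --> lam <= ls --> smooth_solution \<Omega> c lam u --> x0 \<in> \<Omega> -->
    (\<forall>x\<in>\<Omega>. u x <= u x0) --> u x0 = 1 - \<tau>\<^sup>2 --> 0 < \<tau> --> \<tau>\<^sup>2 <= 1/8 -->
    (\<integral>x. ext0 \<Omega> (%x. qq (u x) ^ 11) x \<partial>lborel) <= C --> t0 <= \<tau>" (is "\<exists>t0>0. ?T t0")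
    by (rule gap_bound[OF \<Omega>(1,2) _ n7 less_imp_le[OF ls]]) (rule \<Gamma>)
  then obtain t0 where t0: "0 < t0" and T: "?T t0" by (elim exE conjE) rule
  define d0 where "d0 = min (1/8) (t0\<^sup>2)"
  have "u lam x <= 1 - d0" if lam: "ls / 2 <= lam" "lam < ls" and x: "x \<in> closure \<Omega>" for lam x
  proof -
    have l0: "0 < lam" using lam ls by linarith
    \<comment> \<open>Any parameter in between provides the second solution that the energy bound
      requires.\<close>
    define lam' where "lam' = (lam + ls) / 2"
    have l': "lam < lam'" "lam' < ls" "0 < lam'" using lam ls by (auto simp: lam'_def)
    have m: "minimal_solution \<Omega> c lam (u lam)" "smooth_solution \<Omega> c lam (u lam)" "smooth_solution \<Omega> c lam' (u lam')"
      using u[OF l0 lam(2)] u[OF l'(3,2)] by (auto simp: minimal_solution_def)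
    have mono: "\<forall>x\<in>\<Omega>. u lam x < u lam' x"
      using minimal_solution_mono[OF \<Omega> c less_imp_le[OF l0] l'(1) m(1,3)] by blast
    have E: "(\<integral>x. ext0 \<Omega> (%x. qq (u lam x) ^ 11) x \<partial>lborel) <= C"
      by (rule C[OF lam(1) l'(1) less_imp_le[OF lam(2)] m(2,3) mono])
    obtain z where z: "z \<in> closure \<Omega>" "!!y. y \<in> closure \<Omega> ==> u lam y <= u lam z"
      using attains_sup_closure[OF \<Omega>(2) smooth_solutionD(2)[OF m(2)] x] by blast
    have "u lam z <= 1 - d0"
    proof (cases "z \<in> \<Omega> & 1 - u lam z <= 1/8")
      case True
      define \<tau> where "\<tau> = sqrt (1 - u lam z)"
      have \<tau>: "0 < \<tau>" "\<tau>\<^sup>2 = 1 - u lam z" using smooth_solutionD(4)[OF m(2) z(1)] by (auto simp: \<tau>_def)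
      have "t0 <= \<tau>"
        by (rule T[rule_format, OF less_imp_le[OF l0] less_imp_le[OF lam(2)] m(2) _ _ _ \<tau>(1) _ E, of z])
           (use True \<tau> z(2) closure_subset in auto)
      then have "t0\<^sup>2 <= \<tau>\<^sup>2" using t0 by (intro power_mono) auto
      then show ?thesis using \<tau>(2) by (simp add: d0_def)
    next
      case False
      then consider "z \<in> frontier \<Omega>" | "1/8 < 1 - u lam z" using z(1) closure_Un_frontier by fastforce
      then show ?thesis
      proof cases
        case 1
        then show ?thesis using smooth_solutionD(5)[OF m(2) 1] by (simp add: d0_def)
      qed (simp add: d0_def)
    qed
    then show ?thesis using z(2)[OF x] by linarith
  qed
  then show ?thesis using that[of d0] t0 by (simp add: d0_def)
qed

text \<open>Once the gap is uniform, the right-hand sides are bounded, and a fixed multiple of one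
  solution dominates all of them. It vanishes on the frontier and so serves as the barrier at the
  boundary.\<close>

lemma uniform_barrier:
  fixes c :: "real^'n => real^'n"
  assumes \<Omega>: "open \<Omega>" "bounded \<Omega>" and lam0: "0 < lam0" and d0: "0 < d0" and w: "smooth_solution \<Omega> c lam0 w"
    and u: "smooth_solution \<Omega> c lam u" "lam <= ls" "!!x. x \<in> closure \<Omega> ==> u x <= 1 - d0" and ls: "0 < ls"
    and x: "x \<in> closure \<Omega>"
  shows "u x <= (ls / (d0\<^sup>2 * lam0) + 1) * w x"
proof -
  \<comment> \<open>The summand 1 makes the comparison strict, as the maximum principle
    requires.\<close>
  define K where "K = ls / (d0\<^sup>2 * lam0) + 1"
  note su = smooth_solutionD[OF u(1)] and sw = smooth_solutionD[OF w]
  have Kw: "smooth_on \<Omega> (%x. K * w x)" by (rule smooth_on_cmult[OF \<Omega>(1) sw(1)])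
  have "u x - K * w x <= 0"
  proof (rule weak_maximum_principle[OF \<Omega> smooth_on_diff[OF \<Omega>(1) su(1) Kw] _ _ _ x])
    show "continuous_on (closure \<Omega>) (%x. u x - K * w x)" by (intro continuous_intros su(2) sw(2))
    show "u z - K * w z <= 0" if "z \<in> frontier \<Omega>" for z using su(5)[OF that] sw(5)[OF that] by simp
    fix z assume z: "z \<in> \<Omega>"
    have zc: "z \<in> closure \<Omega>" using z closure_subset by blast
    have "pd i (%x. K * w x) z = K * pd i w z" "pd i (pd i (%x. K * w x)) z = K * pd i (pd i w) z" for i
      using Dd_cmult[OF \<Omega>(1) sw(1) z, of "[i]" K] Dd_cmult[OF \<Omega>(1) sw(1) z, of "[i, i]" K] by simp_all
    then have "laplacian (%x. K * w x) z = K * laplacian w z" "gradient (%x. K * w x) z = K *\<^sub>R gradient w z"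
      by (simp_all add: laplacian_def gradient_def sum_distrib_left vec_eq_iff)
    then have e: "laplacian (%x. u x - K * w x) z - c z \<bullet> gradient (%x. u x - K * w x) z
        = K * (lam0 / (1 - w z)\<^sup>2) - lam / (1 - u z)\<^sup>2"
    proof -
      have "laplacian u z = c z \<bullet> gradient u z - lam / (1 - u z)\<^sup>2" "laplacian w z = c z \<bullet> gradient w z - lam0 / (1 - w z)\<^sup>2"
        using su(6)[OF z] sw(6)[OF z] by linarith+
      with \<open>laplacian (%x. K * w x) z = _\<close> \<open>gradient (%x. K * w x) z = _\<close> show ?thesis
        unfolding laplacian_diff[OF \<Omega>(1) su(1) Kw z] by (simp add: inner_diff_right algebra_simps)
    qed
    have "lam / (1 - u z)\<^sup>2 <= ls / d0\<^sup>2"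
    proof -
      have "d0\<^sup>2 <= (1 - u z)\<^sup>2" using u(3)[OF zc] d0 by (intro power_mono) auto
      then have "ls / (1 - u z)\<^sup>2 <= ls / d0\<^sup>2" using ls d0 su(4)[OF zc] by (intro divide_left_mono) auto
      moreover have "lam / (1 - u z)\<^sup>2 <= ls / (1 - u z)\<^sup>2" using u(2) by (intro divide_right_mono) auto
      ultimately show ?thesis by linarith
    qed
    moreover have "ls / d0\<^sup>2 < K * lam0" using lam0 d0 by (simp add: K_def field_simps)
    moreover have "K * lam0 <= K * (lam0 / (1 - w z)\<^sup>2)"
    proof (rule mult_left_mono)
      have "0 < (1 - w z)\<^sup>2" "(1 - w z)\<^sup>2 <= 1" using sw(3,4)[OF zc] by (auto intro: power_le_one)
      then show "lam0 <= lam0 / (1 - w z)\<^sup>2" using lam0 by (simp add: pos_le_divide_eq mult_left_le)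
      show "0 <= K" using ls lam0 by (simp add: K_def)
    qed
    ultimately show "0 < laplacian (%x. u x - K * w x) z - c z \<bullet> gradient (%x. u x - K * w x) z"
      unfolding e by linarith
  qed
  then show ?thesis by (simp add: K_def)
qed

theorem theorem1:
  fixes \<Omega> :: "(real^'n) set"
    and c :: "real^'n \<Rightarrow> real^'n"
    and lamstar :: real
    and us :: "real^'n \<Rightarrow> real"
  assumes "smooth_bounded_domain \<Omega>"
    and "smooth_on_closure \<Omega> c"
    and "critical_parameter \<Omega> c lamstar"
    and "extremal_solution \<Omega> c lamstar us"
    and "1 \<le> CARD('n)" and "CARD('n) \<le> 7"
  shows "smooth_solution \<Omega> c lamstar us"
proof -
  have \<Omega>: "open \<Omega>" "bounded \<Omega>" "smooth_boundary \<Omega>" using assms(1) by (auto simp: smooth_bounded_domain_def)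
  note c = assms(2)
  have ls: "0 < lamstar" using assms(3) by (simp add: critical_parameter_def)
  obtain u where u: "!!lam. 0 < lam ==> lam < lamstar ==> minimal_solution \<Omega> c lam (u lam)"
    and lim: "!!x. x \<in> closure \<Omega> ==> ((%lam. u lam x) \<longlongrightarrow> us x) (at_left lamstar)"
    using assms(4) unfolding extremal_solution_def by blast
  have su: "smooth_solution \<Omega> c lam (u lam)" if "0 < lam" "lam < lamstar" for lam
    using u[OF that] by (simp add: minimal_solution_def)
  obtain d0 where d0: "0 < d0" and gap: "!!lam x. lamstar / 2 <= lam ==> lam < lamstar ==> x \<in> closure \<Omega> ==> u lam x <= 1 - d0"
    using uniform_gap[OF \<Omega> c assms(6) ls u] by metis
  define w where "w = u (lamstar / 2)"
  have half: "0 < lamstar / 2" "lamstar / 2 < lamstar" using ls by auto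
  have w: "smooth_solution \<Omega> c (lamstar / 2) w" unfolding w_def by (rule su[OF half])
  define K where "K = lamstar / (d0\<^sup>2 * (lamstar / 2)) + 1"
  \<comment> \<open>Starts at \<open>lamstar / 2\<close>, so that all members lie in the range
    covered by \<open>gap\<close>.\<close>
  define lm where "lm m = lamstar - lamstar / 2 * inverse (real (Suc m))" for m
  have lm: "lm \<longlonglongrightarrow> lamstar" "lamstar / 2 <= lm m" "lm m < lamstar" "lm m < lm (Suc m)" for m
  proof -
    have "lm \<longlonglongrightarrow> lamstar - lamstar / 2 * 0" unfolding lm_def[abs_def]
      by (intro tendsto_intros LIMSEQ_inverse_real_of_nat)
    then show "lm \<longlonglongrightarrow> lamstar" by simp
    have i: "inverse (real (Suc m)) <= 1" "inverse (real (Suc (Suc m))) < inverse (real (Suc m))" "0 < inverse (real (Suc m))"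
      by (auto simp: field_simps)
    show "lamstar / 2 <= lm m" using mult_left_mono[OF i(1), of "lamstar / 2"] ls by (simp add: lm_def)
    show "lm m < lamstar" using mult_strict_left_mono[OF i(3), of "lamstar / 2"] ls by (simp add: lm_def)
    show "lm m < lm (Suc m)" using mult_strict_left_mono[OF i(2), of "lamstar / 2"] ls by (simp add: lm_def)
  qed
  have lm0: "0 < lm m" for m using lm(2)[of m] half by linarith
  \<comment> \<open>The schemes for \<open>lm m\<close> lie below the minimal solution for
    \<open>lm (Suc m)\<close>; gap and barrier are uniform in \<open>m\<close>.\<close>
  obtain v where v: "smooth_solution \<Omega> c lamstar v" and vle: "!!x b. x \<in> \<Omega> ==> (!!m. u (lm (Suc m)) x <= b) ==> v x <= b"
  proof (rule existence_between[OF \<Omega> c d0 lm(1) less_imp_le[OF lm0] lm(4), of "%m. u (lm (Suc m))" "%x. K * w x"])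
    show "smooth_solution \<Omega> c (lm (Suc m)) (u (lm (Suc m)))" for m by (rule su[OF lm0 lm(3)])
    show "u (lm (Suc m)) x <= 1 - d0" if "x \<in> \<Omega>" for m x
      using gap[OF lm(2,3)] that closure_subset by blast
    show "continuous_on (closure \<Omega>) (%x. K * w x)" by (intro continuous_intros smooth_solutionD(2)[OF w])
    show "K * w x = 0" if "x \<in> frontier \<Omega>" for x using smooth_solutionD(5)[OF w that] by simp
    show "u (lm (Suc m)) x <= K * w x" if "x \<in> \<Omega>" for m x
      unfolding K_def
      by (rule uniform_barrier[OF \<Omega>(1,2) half(1) d0 w su[OF lm0 lm(3)] less_imp_le[OF lm(3)] gap[OF lm(2,3)] ls])
         (use that closure_subset in blast)+
    fix v assume "smooth_solution \<Omega> c lamstar v" "!!x b. x \<in> \<Omega> ==> (!!m. u (lm (Suc m)) x <= b) ==> v x <= b"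
    then show thesis by (rule that)
  qed
  have up: "u lam x <= us x" if lam: "0 < lam" "lam < lamstar" and x: "x \<in> \<Omega>" for lam x
  proof (rule tendsto_lowerbound[OF lim])
    show "x \<in> closure \<Omega>" using x closure_subset by blast
    have "\<forall>\<^sub>F t in at_left lamstar. t \<in> {lam<..<lamstar}" using lam(2) by (rule eventually_at_left_real)
    then show "\<forall>\<^sub>F t in at_left lamstar. u lam x <= u t x"
    proof eventually_elim
      case (elim t)
      then have t: "lam < t" "0 < t" "t < lamstar" using lam by auto
      show ?case using minimal_solution_mono[OF \<Omega> c less_imp_le[OF lam(1)] t(1) u[OF lam] su[OF t(2,3)] x] by simp
    qed
  qed (simp add: trivial_limit_at_left_real)
  \<comment> \<open>Minimal solutions lie below any solution for a larger parameter, hence below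
    \<open>v\<close>, and so does their limit.\<close>
  have low: "us x <= v x" if x: "x \<in> \<Omega>" for x
  proof (rule tendsto_upperbound[OF lim])
    show "x \<in> closure \<Omega>" using x closure_subset by blast
    have "\<forall>\<^sub>F t in at_left lamstar. t \<in> {0<..<lamstar}" using ls by (rule eventually_at_left_real)
    then show "\<forall>\<^sub>F t in at_left lamstar. u t x <= v x"
    proof eventually_elim
      case (elim t)
      then show ?case using minimal_solution_mono[OF \<Omega> c _ _ u v x, of t] by simp
    qed
  qed (simp add: trivial_limit_at_left_real)
  have "us x = v x" if "x \<in> closure \<Omega>" for x
  proof (cases "x \<in> \<Omega>")
    case True
    \<comment> \<open>\<open>v\<close> inherits every common upper bound of the approximating
      minimal solutions, and \<open>us x\<close> is one by monotonicity.\<close>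
    have "v x <= us x" by (rule vle[OF True]) (rule up[OF lm0 lm(3) True])
    then show ?thesis using low[OF True] by simp
  next
    case False
    then have f: "x \<in> frontier \<Omega>" using that closure_Un_frontier by blast
    have "\<forall>\<^sub>F t in at_left lamstar. t \<in> {0<..<lamstar}" using ls by (rule eventually_at_left_real)
    then have "\<forall>\<^sub>F t in at_left lamstar. u t x = 0"
      by eventually_elim (simp add: smooth_solutionD(5)[OF su f])
    then have "((%t. u t x) \<longlongrightarrow> 0) (at_left lamstar)" by (rule tendsto_eventually)
    then have "us x = 0" using lim[OF that] tendsto_unique trivial_limit_at_left_real by blast
    then show ?thesis using smooth_solutionD(5)[OF v f] by simp
  qed
  then show ?thesis by (rule smooth_solution_cong[OF \<Omega>(1) _ v])
qed

end
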